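(* Let $\mathbf A\in\mathbb R^{m\times\frac12n(n+1)}$ have linearly independent rows, and let $\tilde b\in\mathbb R^m$, $\tilde C\in\mathcal S^n$, $\tilde c=\operatorname{vec}_{\mathcal S}(\tilde C)$, $\epsilon>0$. Suppose that the centering assumption (A) holds with parameters $L,\delta,\chi_1$ and that the tangent space injectivity assumption (B) holds with parameter $\chi_2$ (see context). Given the scaling point $W\in\mathcal S^n_{++}$ of assumption (A), select an integer $r$ with $\operatorname{rank}(X^\star)\le r<n$, set $\tau=\frac12\lambda_{r+1}(W)$, and define $\mathbf E,\mathbf Q,\mathbf\Sigma$ as in the context. Let $$\begin{bmatrix} u_k \\ v_k \end{bmatrix}=\operatorname{MINRES}_k\left(\begin{bmatrix}\mathbf A\mathbf E\mathbf A^T&\mathbf A\mathbf Q \\ \mathbf Q^T\mathbf A^T&-\tau^2\mathbf\Sigma\end{bmatrix},\begin{bmatrix}\tilde b+\tau^2\mathbf A\mathbf E\tilde c \\ \tau^2\mathbf Q^T\tilde c\end{bmatrix},I,0\right)$$ and recover $\Delta y_k=\tau^{-2}u_k$ and $\Delta X_k\in\mathcal S^n$ from $\operatorname{vec}_{\mathcal S}(\Delta X_k)=\mathbf E(\mathbf A^Tu_k-\tau^2\tilde c)+\mathbf Qv_k$. Then the residual condition $$\left\|\begin{bmatrix}-(W\otimes_{\mathcal S}W)^{-1}&\mathbf A^T \\ \mathbf A&0\end{bmatrix}\begin{bmatrix}\operatorname{vec}_{\mathcal S}(\Delta X_k) \\ \Delta y_k\end{bmatrix}-\begin{bmatrix}\operatorname{vec}_{\mathcal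 S}(\tilde C) \\ \tilde b\end{bmatrix}\right\|\le\epsilon$$ is satisfied in at most $$k=O\left(\operatorname{cond}(\mathbf A\mathbf A^T)\cdot L^{20}\cdot(1-\delta)^{-19}\cdot\chi_1^2\cdot\chi_2^6\cdot\log\left(\frac{L^4}{\mu\cdot\epsilon\cdot(1-\delta)^4}\right)\right)$$ iterations for all $0<\mu\le1$, with a logarithmic dependence on $1/\mu$. Moreover, suppose that $X\mapsto\mathbf A\operatorname{vec}_{\mathcal S}(X)$ and $y\mapsto\mathbf A^Ty$ can be evaluated in at most $O(n^3)$ time and $O(n^2)$ storage for all $X\in\mathcal S^n$ and $y\in\mathbb R^m$. Then this algorithm can be implemented in $O(n^3k)$ time and $O(n^2)$ storage.
   Context: Notation. $\mathcal S^n\supseteq\mathcal S^n_+\supseteq\mathcal S^n_{++}$ are the real symmetric, positive semidefinite and positive definite $n\times n$ matrices; $A\succeq B$ means $A-B$ is positive semidefinite; $\lambda_1(W)\ge\dots\ge\lambda_n(W)$ are the ordered eigenvalues; $\|\cdot\|$ is the spectral norm of a matrix (Euclidean norm of a vector), $\|\cdot\|_F$ the Frobenius norm; $\operatorname{cond}(M)=\|M\|\|M^{-1}\|$. $\operatorname{vec}$ is column-stacking and $\otimes$ is the Kronecker product. $\Psi_n\in\mathbb R^{n^2\times n(n+1)/2}$ is the orthonormal basis matrix of $\operatorname{vec}(\mathcal S^n)$ such that $\operatorname{vec}_{\mathcal S}(X):=\Psi_n^T\operatorname{vec}(X)=[X_{11},\sqrt2X_{21},\dots,\sqrt2X_{n1},X_{22},\sqrt2X_{32},\dots,X_{nn}]^T$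 for $X\in\mathcal S^n$. For $A,B\in\mathbb R^{n\times r}$, $A\otimes_{\mathcal S}B:=\frac12\Psi_n^T(A\otimes B+B\otimes A)\Psi_r$. $\operatorname{diag}(\cdot,\cdot)$ of matrices is the block-diagonal matrix. Assumption (A). There exist absolute constants $L\ge0$ and $0\le\delta<1$ such that the iterates $X,S\in\mathcal S^n_{++}$, where $W=X^{1/2}(X^{1/2}SX^{1/2})^{-1/2}X^{1/2}$, satisfy $$\left\|\tfrac1\mu X^{1/2}SX^{1/2}-I\right\|\le\delta,\qquad\|X-X^\star\|\le L\mu,\qquad\|S-S^\star\|\le L,$$ with respect to $X^\star,S^\star\in\mathcal S^n_+$ that satisfy $X^\star S^\star=0$ and $\chi_1^{-1}I\preceq X^\star+S^\star\preceq I$. Here $\mu>0$ is the duality gap (accuracy) parameter, and $1\le\operatorname{rank}(X^\star)<n$. Assumption (B). Factor $X^\star=U^\star U^{\star T}$ with $U^\star\in\mathbb R^{n\times r^\star}$, $r^\star=\operatorname{rank}(X^\star)$. There exists a condition number $1\le\chi_2<\infty$ such that for all $V\in\mathbb R^{n\times r^\star}$, $$\|(\mathbf A\mathbf A^T)^{-1/2}\mathbf A\operatorname{vec}_{\mathcal S}(U^\star V^T+VU^{\star T})\|\ge\chi_2^{-1}\|U^\star V^T+VU^{\star T}\|_F.$$ Construction. Partition an orthonormal eigendecomposition $W=Q\Lambda Q^T+Q_\perp\Lambda_\perp Q_\perp^T$, where $\Lambda$ is the diagonal matrix of the top $r$ eigenvalues, $\Lambda_\perp$ that of the bottom $n-r$,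 $Q\in\mathbb R^{n\times r}$, and $[Q,Q_\perp]$ is orthogonal. Define $E=QQ^T+\tau^{-1}Q_\perp\Lambda_\perp Q_\perp^T$, $\mathbf E=E\otimes_{\mathcal S}E$, $\mathbf Q=[Q\otimes_{\mathcal S}Q,\ \sqrt2\,\Psi_n^T(Q\otimes Q_\perp)]$, $\mathbf\Sigma=\operatorname{diag}(\Lambda\otimes_{\mathcal S}\Lambda-\tau^2I,\ (\Lambda-\tau I)\otimes\Lambda_\perp)^{-1}$. MINRES. For a symmetric matrix $A$, a positive definite $P$ of the same size and vectors $b,x_0$, $\operatorname{MINRES}_k(A,b,P,x_0):=P^{1/2}y_k$, where $y_k=\arg\min_y\{\|\hat Ay-\hat b\|:y\in y_0+\operatorname{span}\{\hat b,\hat A\hat b,\dots,\hat A^{k-1}\hat b\}\}$ with $\hat A=P^{-1/2}AP^{-1/2}$, $\hat b=P^{-1/2}b$, $y_0=P^{-1/2}x_0$; here $P=I$ and $x_0=0$.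
   Formalization: The O-constant of the iteration bound may depend on bounds for ‖A‖, 1/‖A‖, ‖b̃‖, ‖c̃‖; L and the logarithm are read as max{1,L} and max{1,log}; in the time and storage claim (exact arithmetic, k≥1) the eigendecomposition of W is given as input. *)

theory Defs
  imports
    Complex_Main
    "HOL-Computational_Algebra.Polynomial"
    "Jordan_Normal_Form.Char_Poly"
    "Jordan_Normal_Form.DL_Rank"
    "Jordan_Normal_Form.Gauss_Jordan_Elimination"
begin

text \<open>Matrices and vectors have numeric dimensions, because the dimensions $n(n+1)/2$ and
  $r(r+1)/2 + r(n-r)$ occur and the constants have to be uniform in $n$, $m$ and $r$.
  Rows, columns and entries are counted from 0.\<close>

definition vnorm :: "real vec \<Rightarrow> real" where
  "vnorm x = sqrt (x \<bullet> x)"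

definition spec_norm :: "real mat \<Rightarrow> real" where
  "spec_norm M = Sup {vnorm (M *\<^sub>v x) | x. x \<in> carrier_vec (dim_col M) \<and> vnorm x \<le> 1}"

definition frob_norm :: "real mat \<Rightarrow> real" where
  "frob_norm M = sqrt (\<Sum>i<dim_row M. \<Sum>j<dim_col M. (M $$ (i, j))\<^sup>2)"

definition sym_mats :: "nat \<Rightarrow> real mat set" where
  "sym_mats n = {M \<in> carrier_mat n n. M\<^sup>T = M}"

definition psd_mats :: "nat \<Rightarrow> real mat set" where
  "psd_mats n = {M \<in> sym_mats n. \<forall>x \<in> carrier_vec n. 0 \<le> x \<bullet> (M *\<^sub>v x)}"

definition pd_mats :: "nat \<Rightarrow> real mat set" where
  "pd_mats n = {M \<in> sym_mats n. \<forall>x \<in> carrier_vec n. x \<noteq> 0\<^sub>v n \<longrightarrow> 0 < x \<bullet> (M *\<^sub>v x)}"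

definition minv :: "real mat \<Rightarrow> real mat" where
  "minv M = the (mat_inverse M)"

definition psd_sqrt :: "real mat \<Rightarrow> real mat" where
  "psd_sqrt M = (THE B. B \<in> psd_mats (dim_row M) \<and> B * B = M)"

definition cond :: "real mat \<Rightarrow> real" where
  "cond M = spec_norm M * spec_norm (minv M)"

text \<open>\<open>lam W i\<close> is the \<open>i\<close>-th largest eigenvalue of a symmetric \<open>W\<close>, counted with multiplicity
  and starting from \<open>i = 1\<close>.\<close>

definition lam :: "real mat \<Rightarrow> nat \<Rightarrow> real" where
  "lam W i = rev (sorted_list_of_multiset (proots (char_poly W))) ! (i - 1)"

definition lin_indpt_rows :: "real mat \<Rightarrow> bool" where
  "lin_indpt_rows M \<longleftrightarrow> distinct (rows M) \<and>
     module.lin_indpt class_ring (module_vec TYPE(real) (dim_col M)) (set (rows M))"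

abbreviation mrank :: "real mat \<Rightarrow> nat" where
  "mrank M \<equiv> vec_space.rank (dim_row M) M"

definition hcat :: "real mat \<Rightarrow> real mat \<Rightarrow> real mat" where
  "hcat M N = four_block_mat M N (0\<^sub>m 0 (dim_col M)) (0\<^sub>m 0 (dim_col N))"

definition kron :: "real mat \<Rightarrow> real mat \<Rightarrow> real mat" where
  "kron M N = mat (dim_row M * dim_row N) (dim_col M * dim_col N)
     (\<lambda>(i, j). M $$ (i div dim_row N, j div dim_col N) * N $$ (i mod dim_row N, j mod dim_col N))"

definition colvec :: "real mat \<Rightarrow> real vec" where
  "colvec M = vec (dim_row M * dim_col M) (\<lambda>p. M $$ (p mod dim_row M, p div dim_row M))"

definition tri :: "nat \<Rightarrow> nat" where
  "tri n = n * (n + 1) div 2"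

text \<open>The positions $(0,0),(1,0),\dots,(n-1,0),(1,1),(2,1),\dots$ of the lower triangle,
  column by column.\<close>

definition tri_positions :: "nat \<Rightarrow> (nat \<times> nat) list" where
  "tri_positions n = concat (map (\<lambda>j. map (\<lambda>i. (i, j)) [j..<n]) [0..<n])"

definition Psi :: "nat \<Rightarrow> real mat" where
  "Psi n = mat (n * n) (tri n) (\<lambda>(p, q). let (i, j) = tri_positions n ! q in
     if (p mod n, p div n) = (i, j) \<or> (p mod n, p div n) = (j, i)
     then (if i = j then 1 else 1 / sqrt 2) else 0)"

definition vecS :: "real mat \<Rightarrow> real vec" where
  "vecS X = (Psi (dim_row X))\<^sup>T *\<^sub>v colvec X"

definition matS :: "nat \<Rightarrow> real vec \<Rightarrow> real mat" where
  "matS n x = (THE X. X \<in> sym_mats n \<and> vecS X = x)"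

definition symkron :: "real mat \<Rightarrow> real mat \<Rightarrow> real mat" where
  "symkron M N =
     (1/2) \<cdot>\<^sub>m ((Psi (dim_row M))\<^sup>T * (kron M N + kron N M) * Psi (dim_col M))"

definition nt_scaling :: "real mat \<Rightarrow> real mat \<Rightarrow> real mat" where
  "nt_scaling X S =
     psd_sqrt X * minv (psd_sqrt (psd_sqrt X * S * psd_sqrt X)) * psd_sqrt X"

definition centering ::
  "nat \<Rightarrow> real \<Rightarrow> real \<Rightarrow> real \<Rightarrow> real \<Rightarrow> real mat \<Rightarrow> real mat \<Rightarrow> real mat \<Rightarrow> real mat \<Rightarrow> bool" where
  "centering n \<mu> L \<delta> \<chi>1 X S Xs Ss \<longleftrightarrow>
     0 < \<mu> \<and> 0 \<le> L \<and> 0 \<le> \<delta> \<and> \<delta> < 1 \<and> 0 < \<chi>1 \<and>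
     X \<in> pd_mats n \<and> S \<in> pd_mats n \<and> Xs \<in> psd_mats n \<and> Ss \<in> psd_mats n \<and>
     spec_norm ((1/\<mu>) \<cdot>\<^sub>m (psd_sqrt X * S * psd_sqrt X) - 1\<^sub>m n) \<le> \<delta> \<and>
     spec_norm (X - Xs) \<le> L * \<mu> \<and> spec_norm (S - Ss) \<le> L \<and>
     Xs * Ss = 0\<^sub>m n n \<and>
     Xs + Ss - (1/\<chi>1) \<cdot>\<^sub>m 1\<^sub>m n \<in> psd_mats n \<and> 1\<^sub>m n - (Xs + Ss) \<in> psd_mats n \<and>
     1 \<le> mrank Xs \<and> mrank Xs < n"

definition tangent_injective :: "nat \<Rightarrow> real mat \<Rightarrow> real \<Rightarrow> real mat \<Rightarrow> real mat \<Rightarrow> bool" where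
  "tangent_injective n A \<chi>2 Xs Us \<longleftrightarrow>
     1 \<le> \<chi>2 \<and> Us \<in> carrier_mat n (mrank Xs) \<and> Xs = Us * Us\<^sup>T \<and>
     (\<forall>V \<in> carrier_mat n (mrank Xs).
        vnorm ((minv (psd_sqrt (A * A\<^sup>T)) * A) *\<^sub>v vecS (Us * V\<^sup>T + V * Us\<^sup>T))
          \<ge> (1/\<chi>2) * frob_norm (Us * V\<^sup>T + V * Us\<^sup>T))"

definition Lam_top :: "real mat \<Rightarrow> nat \<Rightarrow> real mat" where
  "Lam_top W r = mat_diag r (\<lambda>i. lam W (i + 1))"

definition Lam_bot :: "real mat \<Rightarrow> nat \<Rightarrow> real mat" where
  "Lam_bot W r = mat_diag (dim_row W - r) (\<lambda>i. lam W (r + i + 1))"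

text \<open>A choice of bases \<open>Q\<close>, \<open>Qp\<close> (the latter is $Q_\perp$) in an orthonormal eigendecomposition
  that is partitioned after the top \<open>r\<close> eigenvalues.\<close>

definition eig_partition :: "nat \<Rightarrow> nat \<Rightarrow> real mat \<Rightarrow> real mat \<Rightarrow> real mat \<Rightarrow> bool" where
  "eig_partition n r W Q Qp \<longleftrightarrow>
     Q \<in> carrier_mat n r \<and> Qp \<in> carrier_mat n (n - r) \<and>
     (hcat Q Qp)\<^sup>T * hcat Q Qp = 1\<^sub>m n \<and>
     W = Q * Lam_top W r * Q\<^sup>T + Qp * Lam_bot W r * Qp\<^sup>T"

definition tau :: "real mat \<Rightarrow> nat \<Rightarrow> real" where
  "tau W r = lam W (r + 1) / 2"

definition bigE :: "real mat \<Rightarrow> nat \<Rightarrow> real mat \<Rightarrow> real mat \<Rightarrow> real mat" where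
  "bigE W r Q Qp =
     (let E = Q * Q\<^sup>T + (1 / tau W r) \<cdot>\<^sub>m (Qp * Lam_bot W r * Qp\<^sup>T) in symkron E E)"

definition bigQ :: "real mat \<Rightarrow> real mat \<Rightarrow> real mat" where
  "bigQ Q Qp = hcat (symkron Q Q) (sqrt 2 \<cdot>\<^sub>m ((Psi (dim_row Q))\<^sup>T * kron Q Qp))"

definition bigSigma :: "real mat \<Rightarrow> nat \<Rightarrow> real mat" where
  "bigSigma W r = minv (diag_block_mat
     [symkron (Lam_top W r) (Lam_top W r) - (tau W r)\<^sup>2 \<cdot>\<^sub>m 1\<^sub>m (tri r),
      kron (Lam_top W r - tau W r \<cdot>\<^sub>m 1\<^sub>m r) (Lam_bot W r)])"

definition aug_mat :: "real mat \<Rightarrow> real mat \<Rightarrow> nat \<Rightarrow> real mat \<Rightarrow> real mat \<Rightarrow> real mat" where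
  "aug_mat A W r Q Qp = four_block_mat
     (A * bigE W r Q Qp * A\<^sup>T)   (A * bigQ Q Qp)
     ((bigQ Q Qp)\<^sup>T * A\<^sup>T)       (- ((tau W r)\<^sup>2 \<cdot>\<^sub>m bigSigma W r))"

definition aug_rhs ::
  "real mat \<Rightarrow> real vec \<Rightarrow> real mat \<Rightarrow> real mat \<Rightarrow> nat \<Rightarrow> real mat \<Rightarrow> real mat \<Rightarrow> real vec" where
  "aug_rhs A b C W r Q Qp =
     (b + (tau W r)\<^sup>2 \<cdot>\<^sub>v ((A * bigE W r Q Qp) *\<^sub>v vecS C)) @\<^sub>v
     ((tau W r)\<^sup>2 \<cdot>\<^sub>v ((bigQ Q Qp)\<^sup>T *\<^sub>v vecS C))"

definition minres :: "nat \<Rightarrow> real mat \<Rightarrow> real vec \<Rightarrow> real mat \<Rightarrow> real vec \<Rightarrow> real vec" where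
  "minres k M b P x0 =
     (let P' = psd_sqrt P; M' = minv P' * M * minv P'; b' = minv P' *\<^sub>v b; y0 = minv P' *\<^sub>v x0;
          krylov = module.span class_ring (module_vec TYPE(real) (dim_vec b))
                     ((\<lambda>i. (M' ^\<^sub>m i) *\<^sub>v b') ` {..<k})
      in P' *\<^sub>v arg_min_on (\<lambda>y. vnorm (M' *\<^sub>v y - b')) ((\<lambda>z. y0 + z) ` krylov))"

definition aug_iterate ::
  "real mat \<Rightarrow> real vec \<Rightarrow> real mat \<Rightarrow> real mat \<Rightarrow> nat \<Rightarrow> real mat \<Rightarrow> real mat \<Rightarrow> nat \<Rightarrow> real vec" where
  "aug_iterate A b C W r Q Qp k =
     (let N = dim_row A + dim_col (bigQ Q Qp)
      in minres k (aug_mat A W r Q Qp) (aug_rhs A b C W r Q Qp) (1\<^sub>m N) (0\<^sub>v N))"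

definition iter_u ::
  "real mat \<Rightarrow> real vec \<Rightarrow> real mat \<Rightarrow> real mat \<Rightarrow> nat \<Rightarrow> real mat \<Rightarrow> real mat \<Rightarrow> nat \<Rightarrow> real vec" where
  "iter_u A b C W r Q Qp k = vec_first (aug_iterate A b C W r Q Qp k) (dim_row A)"

definition iter_v ::
  "real mat \<Rightarrow> real vec \<Rightarrow> real mat \<Rightarrow> real mat \<Rightarrow> nat \<Rightarrow> real mat \<Rightarrow> real mat \<Rightarrow> nat \<Rightarrow> real vec" where
  "iter_v A b C W r Q Qp k = vec_last (aug_iterate A b C W r Q Qp k) (dim_col (bigQ Q Qp))"

definition delta_y ::
  "real mat \<Rightarrow> real vec \<Rightarrow> real mat \<Rightarrow> real mat \<Rightarrow> nat \<Rightarrow> real mat \<Rightarrow> real mat \<Rightarrow> nat \<Rightarrow> real vec" where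
  "delta_y A b C W r Q Qp k = (1 / (tau W r)\<^sup>2) \<cdot>\<^sub>v iter_u A b C W r Q Qp k"

definition delta_X ::
  "real mat \<Rightarrow> real vec \<Rightarrow> real mat \<Rightarrow> real mat \<Rightarrow> nat \<Rightarrow> real mat \<Rightarrow> real mat \<Rightarrow> nat \<Rightarrow> real mat" where
  "delta_X A b C W r Q Qp k = matS (dim_row W)
     (bigE W r Q Qp *\<^sub>v (A\<^sup>T *\<^sub>v iter_u A b C W r Q Qp k - (tau W r)\<^sup>2 \<cdot>\<^sub>v vecS C)
        + bigQ Q Qp *\<^sub>v iter_v A b C W r Q Qp k)"

definition newton_residual ::
  "real mat \<Rightarrow> real vec \<Rightarrow> real mat \<Rightarrow> real mat \<Rightarrow> real mat \<Rightarrow> real vec \<Rightarrow> real" where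
  "newton_residual A b C W dX dy = vnorm
     (four_block_mat (- minv (symkron W W)) A\<^sup>T A (0\<^sub>m (dim_row A) (dim_row A)) *\<^sub>v (vecS dX @\<^sub>v dy)
        - (vecS C @\<^sub>v b))"

definition newton_setup ::
  "nat \<Rightarrow> nat \<Rightarrow> nat \<Rightarrow> real mat \<Rightarrow> real vec \<Rightarrow> real mat \<Rightarrow> real \<Rightarrow> real \<Rightarrow> real \<Rightarrow> real \<Rightarrow> real \<Rightarrow>
   real mat \<Rightarrow> real mat \<Rightarrow> real mat \<Rightarrow> real mat \<Rightarrow> real mat \<Rightarrow> real mat \<Rightarrow> real mat \<Rightarrow> real mat \<Rightarrow> bool" where
  "newton_setup n m r A b C \<mu> L \<delta> \<chi>1 \<chi>2 X S Xs Ss Us W Q Qp \<longleftrightarrow>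
     A \<in> carrier_mat m (tri n) \<and> lin_indpt_rows A \<and> b \<in> carrier_vec m \<and> C \<in> sym_mats n \<and>
     centering n \<mu> L \<delta> \<chi>1 X S Xs Ss \<and> tangent_injective n A \<chi>2 Xs Us \<and>
     W = nt_scaling X S \<and> mrank Xs \<le> r \<and> r < n \<and> eig_partition n r W Q Qp"

text \<open>Register programs over the reals at unit cost. A program never sees the entries of \<open>A\<close>: it can
  only call the two maps \<open>X \<mapsto> A vecS X\<close> and \<open>y \<mapsto> A\<^sup>T y\<close>, each call being charged a
  given time and workspace. In \<open>ApplyA d s\<close> the symmetric argument occupies, column by column, the
  \<open>n * n\<close> registers from \<open>s\<close>, only its lower triangle being read; the results of \<open>ApplyA d s\<close> and
  \<open>ApplyAT d s\<close> are written from register \<open>d\<close>. Since \<open>x / 0 = 0\<close>, \<open>Div\<close> is a division guarded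
  by a zero test.\<close>

datatype instr =
    Const nat real
  | Add nat nat nat
  | Sub nat nat nat
  | Mul nat nat nat
  | Div nat nat nat
  | Sqrt nat nat
  | ApplyA nat nat
  | ApplyAT nat nat

type_synonym regs = "nat \<Rightarrow> real"

definition store :: "nat \<Rightarrow> real vec \<Rightarrow> regs \<Rightarrow> regs" where
  "store d x R = (\<lambda>p. if d \<le> p \<and> p < d + dim_vec x then x $ (p - d) else R p)"

fun step :: "nat \<Rightarrow> real mat \<Rightarrow> instr \<Rightarrow> regs \<Rightarrow> regs" where
  "step n A (Const d a) R = R(d := a)"
| "step n A (Add d s t) R = R(d := R s + R t)"
| "step n A (Sub d s t) R = R(d := R s - R t)"
| "step n A (Mul d s t) R = R(d := R s * R t)"
| "step n A (Div d s t) R = R(d := R s / R t)"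
| "step n A (Sqrt d s) R = R(d := sqrt (R s))"
| "step n A (ApplyA d s) R =
     store d (A *\<^sub>v vecS (mat n n (\<lambda>(i, j). R (s + min i j * n + max i j)))) R"
| "step n A (ApplyAT d s) R = store d (A\<^sup>T *\<^sub>v vec (dim_row A) (\<lambda>i. R (s + i))) R"

text \<open>Runs a program with the input in registers \<open>0, 1, \<dots>\<close>, all other registers being 0, and reads
  \<open>l\<close> outputs from registers \<open>0, \<dots>, l - 1\<close>.\<close>

definition run :: "nat \<Rightarrow> real mat \<Rightarrow> instr list \<Rightarrow> real vec \<Rightarrow> nat \<Rightarrow> real vec" where
  "run n A prog x l = vec l (fold (step n A) prog (store 0 x (\<lambda>_. 0)))"

fun instr_time :: "nat \<Rightarrow> nat \<Rightarrow> instr \<Rightarrow> nat" where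
  "instr_time tA tAT (ApplyA d s) = tA"
| "instr_time tA tAT (ApplyAT d s) = tAT"
| "instr_time tA tAT _ = 1"

definition run_time :: "nat \<Rightarrow> nat \<Rightarrow> instr list \<Rightarrow> nat" where
  "run_time tA tAT prog = sum_list (map (instr_time tA tAT) prog)"

fun instr_regs :: "nat \<Rightarrow> nat \<Rightarrow> instr \<Rightarrow> nat set" where
  "instr_regs n m (Const d a) = {d}"
| "instr_regs n m (Add d s t) = {d, s, t}"
| "instr_regs n m (Sub d s t) = {d, s, t}"
| "instr_regs n m (Mul d s t) = {d, s, t}"
| "instr_regs n m (Div d s t) = {d, s, t}"
| "instr_regs n m (Sqrt d s) = {d, s}"
| "instr_regs n m (ApplyA d s) = {d..<d + m} \<union> {s..<s + n * n}"
| "instr_regs n m (ApplyAT d s) = {d..<d + tri n} \<union> {s..<s + m}"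

text \<open>All registers occupied by input, output and intermediate results, plus the workspace of the
  calls.\<close>

definition run_storage ::
  "nat \<Rightarrow> nat \<Rightarrow> nat \<Rightarrow> nat \<Rightarrow> instr list \<Rightarrow> nat \<Rightarrow> nat \<Rightarrow> nat" where
  "run_storage n m sA sAT prog inlen outlen =
     card ({..<inlen} \<union> {..<outlen} \<union> (\<Union>ins \<in> set prog. instr_regs n m ins)) + max sA sAT"

text \<open>The eigendecomposition of the scaling point is part of the input, since it is not computable
  by finitely many exact field operations and square roots.\<close>

definition alg_input :: "nat \<Rightarrow> real mat \<Rightarrow> real mat \<Rightarrow> real mat \<Rightarrow> real vec \<Rightarrow> real mat \<Rightarrow> real vec" where
  "alg_input n W Q Qp b C =
     colvec (hcat Q Qp) @\<^sub>v vec n (\<lambda>i. lam W (i + 1)) @\<^sub>v b @\<^sub>v colvec C"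

definition alg_output :: "real mat \<Rightarrow> real vec \<Rightarrow> real vec" where
  "alg_output dX dy = colvec dX @\<^sub>v dy"

end

theory Submission
  imports Defs "Jordan_Normal_Form.Spectral_Radius"
begin

text \<open>
\<^bold>\<open>Iteration bound.\<close> In the eigenbasis \<open>V = [Q, Q\<^sub>\<perp>]\<close> of the scaling point, a packed symmetric matrix becomes a
coordinate matrix on which \<open>W \<otimes> W\<close>, \<open>E \<otimes> E\<close>, \<open>Q\<close> and \<open>\<Sigma>\<close> all act entrywise. The augmented matrix \<open>M\<close> is
quasi-definite, with diagonal blocks \<open>A E A\<^sup>T\<close> and \<open>- \<tau>\<^sup>2 \<Sigma>\<close>. Its positive eigenvalues are bounded below through
the smallest eigenvalues of \<open>A A\<^sup>T\<close> and of \<open>W / \<tau>\<close>. For a negative eigenvalue \<open>- q\<close> with \<open>q\<close> below the smallest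
eigenvalue of \<open>A A\<^sup>T\<close> one eliminates the first block; what remains is
\<open>q |v|\<^sup>2 \<ge> v \<bullet> \<tau>\<^sup>2 \<Sigma> v + |P (Q v)|\<^sup>2 / 5\<close>, where \<open>P\<close> projects onto the row space of \<open>A\<close> (\<open>eigenvalue_bounds\<close>). Split
the matrix \<open>H\<close> packed in \<open>Q v\<close> into its compression \<open>Z\<close> to the kernel of \<open>X\<^sup>*\<close> and the rest. The rest lies in the
tangent space, so assumption (B) makes \<open>P\<close> see it; on the kernel \<open>W\<close> is of order \<open>sqrt \<mu>\<close>, like \<open>\<tau>\<close>, so
\<open>\<tau>\<^sup>2 \<Sigma> \<succeq> \<tau>\<^sup>2 (W \<otimes> W)\<^sup>-\<^sup>1\<close> sees \<open>Z\<close> (\<open>coupling\<close>). Centering bounds \<open>W\<close> from below and on that kernel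
(\<open>scaling_point_bounds\<close>), and \<open>\<mu>\<close> cancels in the quotient. Thus all eigenvalues of \<open>M\<close> have modulus in an interval
whose end points do not depend on \<open>\<mu>\<close> (\<open>setup_eigenvalues\<close>). A Chebyshev polynomial in the square of the
eigenvalue then shows that the minimal residual decays like \<open>exp (- k / \<kappa>)\<close> (\<open>minres_convergence\<close>), where \<open>\<kappa>\<close> is
the ratio of the end points. The Newton residual exceeds the residual of \<open>M\<close> by a factor of at most
\<open>max 1 (1 / \<tau>\<^sup>2)\<close>, of order \<open>1 / \<mu>\<close> (\<open>newton_residual_bound\<close>), which only enters the logarithm.

\<^bold>\<open>Arithmetic cost.\<close> The minimal residual iterates satisfy the three-term recurrence \<open>od_step\<close> of directions that are
orthogonal for \<open>x, y \<mapsto> M x \<bullet> M y\<close> (\<open>minres_eq\<close>). Breakdown is harmless: once the Krylov space is exhausted the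
direction is \<open>0\<close>, and \<open>0 / 0 = 0\<close> leaves the iterate unchanged. The recurrence is run on coordinate matrices, where a
product with \<open>M\<close> needs two congruences by \<open>V\<close>, entrywise products and one call each of the two constraint maps
(\<open>emb_M\<close>). The program is written with operations on blocks of registers and compiled to single instructions
(\<open>compile_correct\<close>); it has a fixed number of blocks of \<open>n\<^sup>2 + m\<close> registers, and a fixed number of block operations
per iteration, each taking $O(n^3)$ time.
\<close>

notation mult_mat_vec (infixl "*v" 70) and smult_vec (infixl "*s" 70)

section \<open>Inner products, norms and inverses\<close>

lemma scalar_prod_self_nonneg: "0 \<le> (x :: real vec) \<bullet> x"
 by (auto simp: scalar_prod_def intro!: sum_nonneg)

lemma scalar_prod_self_eq_0:
 assumes "(x :: real vec) \<in> carrier_vec n"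
 shows "x \<bullet> x = 0 \<longleftrightarrow> x = 0\<^sub>v n"
proof
 assume "x \<bullet> x = 0"
 then have "\<forall>i\<in>{0..<dim_vec x}. x $ i * x $ i = 0"
  unfolding scalar_prod_def by (subst (asm) sum_nonneg_eq_0_iff) auto
 then show "x = 0\<^sub>v n" using assms by (intro eq_vecI) auto
qed (use assms in auto)

lemma vnorm_nonneg [simp]: "0 \<le> vnorm x"
 by (simp add: vnorm_def scalar_prod_self_nonneg)

lemma vnorm_power2: "(vnorm x)\<^sup>2 = x \<bullet> x"
 by (simp add: vnorm_def scalar_prod_self_nonneg)

lemma vnorm_zero [simp]: "vnorm (0\<^sub>v n) = 0"
 by (simp add: vnorm_def)

lemma vnorm_le_iff: "0 \<le> c ==> vnorm x \<le> c \<longleftrightarrow> x \<bullet> x \<le> c\<^sup>2"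
 by (metis vnorm_nonneg vnorm_power2 abs_le_square_iff abs_of_nonneg)

lemma vnorm_smult: "vnorm (a *s x) = \<bar>a\<bar> * vnorm x"
proof -
 have "(a *s x) \<bullet> (a *s x) = a\<^sup>2 * (x \<bullet> x)"
  by (simp add: scalar_prod_def power2_eq_square sum_distrib_left algebra_simps)
 then show ?thesis by (simp add: vnorm_def real_sqrt_mult)
qed

lemma symmetric_scalar_prod:
 assumes "(M :: real mat) \<in> sym_mats n" "x \<in> carrier_vec n" "y \<in> carrier_vec n"
 shows "(M *v x) \<bullet> y = x \<bullet> (M *v y)"
 using transpose_vec_mult_scalar[of M n n y x] assms by (auto simp: sym_mats_def)

lemma discriminant_le:
 fixes a b c :: real
 assumes "\<And>t. 0 \<le> a + 2 * b * t + c * t\<^sup>2"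
 shows "b\<^sup>2 \<le> a * c"
proof (cases "c = 0")
 case True
 have "b = 0"
 proof (rule ccontr)
  assume "b \<noteq> 0"
  then show False using assms[of "- (a + 1) / (2 * b)"] True by (simp add: field_simps)
 qed
 then show ?thesis using True by simp
next
 case False
 have "0 < c"
 proof (rule ccontr)
  assume n: "\<not> 0 < c"
  have c: "c < 0" using n False by simp
  obtain t where t1: "1 \<le> t" and ct: "c * t = c - (\<bar>a\<bar> + 2 * \<bar>b\<bar>)"
  proof
   show "1 \<le> 1 + (\<bar>a\<bar> + 2 * \<bar>b\<bar>) / (- c)"
    using c divide_nonneg_pos[of "\<bar>a\<bar> + 2 * \<bar>b\<bar>" "- c"] by simp
   show "c * (1 + (\<bar>a\<bar> + 2 * \<bar>b\<bar>) / (- c)) = c - (\<bar>a\<bar> + 2 * \<bar>b\<bar>)"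
    using c by (simp add: field_simps)
  qed
  have "2 * (b * t) \<le> 2 * (\<bar>b\<bar> * t)" using t1 by (simp add: mult_right_mono)
  moreover have "a \<le> \<bar>a\<bar> * t" using mult_left_mono[OF t1, of "\<bar>a\<bar>"] by linarith
  moreover have "c * t\<^sup>2 = c * t - \<bar>a\<bar> * t - 2 * (\<bar>b\<bar> * t)"
   using arg_cong[OF ct, of "\<lambda>x. x * t"] by (simp add: power2_eq_square algebra_simps)
  ultimately have "a + 2 * b * t + c * t\<^sup>2 \<le> c * t" by simp
  also have "\<dots> < 0" using c t1 by (simp add: mult_neg_pos)
  finally show False using assms[of t] by simp
 qed
 then show ?thesis using assms[of "- b / c"] by (simp add: field_simps power2_eq_square)
qed

lemma psd_Cauchy_Schwarz:
 assumes M: "M \<in> psd_mats n" and x: "x \<in> carrier_vec n" and y: "y \<in> carrier_vec n"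
 shows "(x \<bullet> (M *v y))\<^sup>2 \<le> (x \<bullet> (M *v x)) * (y \<bullet> (M *v y))"
proof (rule discriminant_le)
 fix t
 have Mc: "M \<in> carrier_mat n n" and Ms: "M \<in> sym_mats n"
  using M by (auto simp: psd_mats_def sym_mats_def)
 have sw: "y \<bullet> (M *v x) = x \<bullet> (M *v y)"
  using symmetric_scalar_prod[OF Ms y x] comm_scalar_prod[of "M *v y" n x] Mc x y by simp
 have "(x + t *s y) \<bullet> (M *v (x + t *s y)) =
   x \<bullet> (M *v x) + 2 * (x \<bullet> (M *v y)) * t + (y \<bullet> (M *v y)) * t\<^sup>2"
  using Mc x y
  by (simp add: mult_add_distrib_mat_vec[of _ n n] mult_mat_vec[of _ n n]
    add_scalar_prod_distrib[of _ n] scalar_prod_add_distrib[of _ n] sw algebra_simps power2_eq_square)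
 moreover have "0 \<le> (x + t *s y) \<bullet> (M *v (x + t *s y))"
  using M x y by (auto simp: psd_mats_def)
 ultimately show "0 \<le> x \<bullet> (M *v x) + 2 * (x \<bullet> (M *v y)) * t + (y \<bullet> (M *v y)) * t\<^sup>2" by simp
qed

lemma one_psd: "1\<^sub>m n \<in> psd_mats n"
 by (auto simp: psd_mats_def sym_mats_def scalar_prod_self_nonneg)

lemma Cauchy_Schwarz_vnorm:
 assumes x: "x \<in> carrier_vec n" and y: "y \<in> carrier_vec n"
 shows "\<bar>x \<bullet> y\<bar> \<le> vnorm x * vnorm y"
proof -
 have "(x \<bullet> y)\<^sup>2 \<le> (x \<bullet> x) * (y \<bullet> y)"
  using psd_Cauchy_Schwarz[OF one_psd x y] x y by simp
 then have "\<bar>x \<bullet> y\<bar>\<^sup>2 \<le> (vnorm x * vnorm y)\<^sup>2" by (simp add: vnorm_power2 power_mult_distrib)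
 then show ?thesis by (rule power2_le_imp_le) simp
qed

lemma vnorm_triangle:
 assumes x: "x \<in> carrier_vec n" and y: "y \<in> carrier_vec n"
 shows "vnorm (x + y) \<le> vnorm x + vnorm y"
proof (rule power2_le_imp_le)
 have "(vnorm (x + y))\<^sup>2 = (vnorm x)\<^sup>2 + 2 * (x \<bullet> y) + (vnorm y)\<^sup>2"
  unfolding vnorm_power2 using x y comm_scalar_prod[OF x y]
  by (simp add: add_scalar_prod_distrib[of _ n] scalar_prod_add_distrib[of _ n])
 also have "\<dots> \<le> (vnorm x + vnorm y)\<^sup>2"
  using Cauchy_Schwarz_vnorm[OF x y] by (simp add: power2_sum)
 finally show "(vnorm (x + y))\<^sup>2 \<le> (vnorm x + vnorm y)\<^sup>2" .
qed simp

lemma vnorm_append: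
 "(vnorm (x @\<^sub>v y))\<^sup>2 = (vnorm x)\<^sup>2 + (vnorm y)\<^sup>2"
 unfolding vnorm_power2
 by (rule scalar_prod_append[of _ "dim_vec x" _ "dim_vec y"]) auto

lemma vnorm_mult_le_frob:
 assumes M: "M \<in> carrier_mat a c" and x: "x \<in> carrier_vec c"
 shows "vnorm (M *v x) \<le> frob_norm M * vnorm x"
proof (rule power2_le_imp_le)
 have "(vnorm (M *v x))\<^sup>2 = (\<Sum>i<a. (row M i \<bullet> x)\<^sup>2)"
  unfolding vnorm_power2 using M by (simp add: scalar_prod_def[of "M *v x"] power2_eq_square lessThan_atLeast0)
 also have "\<dots> \<le> (\<Sum>i<a. (row M i \<bullet> row M i) * (x \<bullet> x))"
 proof (rule sum_mono)
  fix i assume "i \<in> {..<a}"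
  then have r: "row M i \<in> carrier_vec c" using M by auto
  have "\<bar>row M i \<bullet> x\<bar>\<^sup>2 \<le> (vnorm (row M i) * vnorm x)\<^sup>2"
   by (rule power_mono[OF Cauchy_Schwarz_vnorm[OF r x]]) simp
  then show "(row M i \<bullet> x)\<^sup>2 \<le> (row M i \<bullet> row M i) * (x \<bullet> x)"
   by (simp add: power_mult_distrib vnorm_power2)
 qed
 also have "\<dots> = (frob_norm M)\<^sup>2 * (vnorm x)\<^sup>2"
 proof -
  have "(frob_norm M)\<^sup>2 = (\<Sum>i<a. row M i \<bullet> row M i)"
   using M by (auto simp: frob_norm_def scalar_prod_def sum_nonneg power2_eq_square lessThan_atLeast0
     intro!: sum.cong)
  then show ?thesis by (simp add: vnorm_power2 sum_distrib_right)
 qed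
 finally show "(vnorm (M *v x))\<^sup>2 \<le> (frob_norm M * vnorm x)\<^sup>2" by (simp add: power_mult_distrib)
 show "0 \<le> frob_norm M * vnorm x" by (simp add: frob_norm_def sum_nonneg)
qed

lemma spec_norm_bdd:
 "bdd_above {vnorm (M *v x) | x. x \<in> carrier_vec (dim_col M) \<and> vnorm x \<le> 1}"
proof (rule bdd_aboveI)
 fix y assume "y \<in> {vnorm (M *v x) | x. x \<in> carrier_vec (dim_col M) \<and> vnorm x \<le> 1}"
 then obtain x where x: "x \<in> carrier_vec (dim_col M)" "vnorm x \<le> 1" "y = vnorm (M *v x)" by auto
 have "y \<le> frob_norm M * vnorm x" using vnorm_mult_le_frob[of M _ _ x] x by auto
 also have "\<dots> \<le> frob_norm M * 1"
  by (rule mult_left_mono[OF x(2)]) (simp add: frob_norm_def sum_nonneg)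
 finally show "y \<le> frob_norm M" by simp
qed

lemma vnorm_mult_le:
 assumes M: "M \<in> carrier_mat a c" and x: "x \<in> carrier_vec c"
 shows "vnorm (M *v x) \<le> spec_norm M * vnorm x"
proof (cases "vnorm x = 0")
 case True
 then show ?thesis using M x vnorm_mult_le_frob[OF M x] by simp
next
 case False
 let ?y = "(1 / vnorm x) *s x"
 have p: "0 < vnorm x" using False by (simp add: less_le)
 have "vnorm (M *v ?y) \<le> spec_norm M"
  unfolding spec_norm_def
  by (rule cSup_upper[OF _ spec_norm_bdd]) (use M x p in \<open>auto simp: vnorm_smult intro!: exI[of _ ?y]\<close>)
 moreover have "vnorm (M *v ?y) = vnorm (M *v x) / vnorm x"
  using M x p by (simp add: mult_mat_vec[of _ a c] vnorm_smult)
 ultimately show ?thesis using p by (simp add: field_simps)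
qed

lemma spec_norm_nonneg: "0 \<le> spec_norm M"
proof -
 have "vnorm (M *v 0\<^sub>v (dim_col M)) \<le> spec_norm M"
  unfolding spec_norm_def by (rule cSup_upper[OF _ spec_norm_bdd]) auto
 then show ?thesis using vnorm_nonneg order_trans by blast
qed

lemma spec_norm_le:
 assumes M: "M \<in> carrier_mat a c" and c: "0 \<le> K"
  and le: "\<And>x. x \<in> carrier_vec c ==> vnorm (M *v x) \<le> K * vnorm x"
 shows "spec_norm M \<le> K"
 unfolding spec_norm_def
proof (rule cSup_least)
 show "{vnorm (M *v x) |x. x \<in> carrier_vec (dim_col M) \<and> vnorm x \<le> 1} \<noteq> {}"
  by (auto intro!: exI[of _ "0\<^sub>v (dim_col M)"])
next
 fix y assume "y \<in> {vnorm (M *v x) |x. x \<in> carrier_vec (dim_col M) \<and> vnorm x \<le> 1}"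
 then obtain x where x: "x \<in> carrier_vec c" "vnorm x \<le> 1" "y = vnorm (M *v x)" using M by auto
 have "y \<le> K * vnorm x" using le x by auto
 also have "\<dots> \<le> K * 1" by (rule mult_left_mono[OF x(2) c])
 finally show "y \<le> K" by simp
qed

lemma quadratic_form_le_spec_norm:
 assumes M: "M \<in> carrier_mat n n" and x: "x \<in> carrier_vec n"
 shows "\<bar>x \<bullet> (M *v x)\<bar> \<le> spec_norm M * (x \<bullet> x)"
proof -
 have "\<bar>x \<bullet> (M *v x)\<bar> \<le> vnorm x * vnorm (M *v x)"
  by (rule Cauchy_Schwarz_vnorm[OF x]) (use M x in auto)
 also have "\<dots> \<le> vnorm x * (spec_norm M * vnorm x)"
  by (rule mult_left_mono[OF vnorm_mult_le[OF M x]]) simp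
 finally show ?thesis by (simp add: vnorm_power2[symmetric] power2_eq_square algebra_simps)
qed

lemma minv_inverse:
 assumes M: "M \<in> carrier_mat n n"
  and inj: "\<And>x. x \<in> carrier_vec n ==> M *v x = 0\<^sub>v n ==> x = 0\<^sub>v n"
 shows "minv M \<in> carrier_mat n n" "M * minv M = 1\<^sub>m n" "minv M * M = 1\<^sub>m n"
proof -
 have "det M \<noteq> 0" using det_0_iff_vec_prod_zero[OF M] inj by auto
 then have "M \<in> Units (ring_mat TYPE(real) n ())" by (rule det_non_zero_imp_unit[OF M])
 then obtain B where "mat_inverse M = Some B"
  using mat_inverse(1)[OF M, of "()"] by (cases "mat_inverse M") auto
 then show "minv M \<in> carrier_mat n n" "M * minv M = 1\<^sub>m n" "minv M * M = 1\<^sub>m n"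
  using mat_inverse(2)[OF M] by (auto simp: minv_def)
qed

lemma minv_unique:
 assumes M: "M \<in> carrier_mat n n" and B: "B \<in> carrier_mat n n" and BM: "B * M = 1\<^sub>m n"
 shows "minv M = B"
proof -
 have inj: "x = 0\<^sub>v n" if x: "x \<in> carrier_vec n" and z: "M *v x = 0\<^sub>v n" for x
 proof -
  have "x = (B * M) *v x" using x BM by simp
  also have "\<dots> = 0\<^sub>v n" using assoc_mult_mat_vec[OF B M x] z B by (auto intro!: eq_vecI)
  finally show ?thesis .
 qed
 note mi = minv_inverse[OF M inj]
 have "minv M = (B * M) * minv M" using BM mi(1) by simp
 also have "\<dots> = B" using mi B by (simp add: assoc_mult_mat[OF B M mi(1)])
 finally show ?thesis .
qed

section \<open>Orthogonal diagonalisation of real symmetric matrices\<close>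

text \<open>A complex eigenvalue exists by the fundamental theorem of algebra and is real by symmetry; then the
 real and the imaginary part of the eigenvector are real eigenvectors, and one of them does not vanish.\<close>

lemma symmetric_eigenvector:
 assumes M: "(M :: real mat) \<in> sym_mats n" and n: "0 < n"
 obtains v e where "v \<in> carrier_vec n" "v \<bullet> v = 1" "M *v v = e *s v"
proof -
 let ?C = "map_mat complex_of_real M"
 have Mc: "M \<in> carrier_mat n n" using M by (auto simp: sym_mats_def)
 then have "?C \<in> carrier_mat n n" by auto
 from spectrum_non_empty[OF this n] obtain l z where z: "eigenvector ?C z l"
  unfolding spectrum_def eigenvalue_def by auto
 then have zc: "z \<in> carrier_vec n" and z0: "z \<noteq> 0\<^sub>v n" and ev: "?C *v z = l *s z"
  using Mc by (auto simp: eigenvector_def)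
 let ?x = "map_vec Re z" and ?y = "map_vec Im z"
 have xc: "?x \<in> carrier_vec n" and yc: "?y \<in> carrier_vec n" using zc by auto
 have comp: "(\<Sum>j<n. complex_of_real (M $$ (i, j)) * z $ j) = l * z $ i" if "i < n" for i
  using arg_cong[OF ev, of "\<lambda>w. w $ i"] that Mc zc
  by (simp add: scalar_prod_def lessThan_atLeast0)
 have Mx: "M *v ?x = Re l *s ?x - Im l *s ?y"
 proof (rule eq_vecI)
  fix i assume "i < dim_vec (Re l *s ?x - Im l *s ?y)"
  then have i: "i < n" using zc by simp
  have "(M *v ?x) $ i = Re (\<Sum>j<n. complex_of_real (M $$ (i, j)) * z $ j)"
   using i Mc zc by (simp add: scalar_prod_def lessThan_atLeast0)
  then show "(M *v ?x) $ i = (Re l *s ?x - Im l *s ?y) $ i" using i zc by (simp add: comp)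
 qed (use Mc zc in auto)
 have My: "M *v ?y = Im l *s ?x + Re l *s ?y"
 proof (rule eq_vecI)
  fix i assume "i < dim_vec (Im l *s ?x + Re l *s ?y)"
  then have i: "i < n" using zc by simp
  have "(M *v ?y) $ i = Im (\<Sum>j<n. complex_of_real (M $$ (i, j)) * z $ j)"
   using i Mc zc by (simp add: scalar_prod_def lessThan_atLeast0)
  then show "(M *v ?y) $ i = (Im l *s ?x + Re l *s ?y) $ i" using i zc by (simp add: comp)
 qed (use Mc zc in auto)
 have nz: "?x \<bullet> ?x + ?y \<bullet> ?y \<noteq> 0"
 proof
  assume "?x \<bullet> ?x + ?y \<bullet> ?y = 0"
  then have "?x \<bullet> ?x = 0" "?y \<bullet> ?y = 0"
   using scalar_prod_self_nonneg[of ?x] scalar_prod_self_nonneg[of ?y] by linarith+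
  then have "?x = 0\<^sub>v n" "?y = 0\<^sub>v n" using scalar_prod_self_eq_0 xc yc by blast+
  then have "Re (z $ i) = 0" "Im (z $ i) = 0" if "i < n" for i
   using that zc by (metis carrier_vecD index_map_vec(1) index_zero_vec(1))+
  then have "z = 0\<^sub>v n" using zc by (intro eq_vecI) (auto simp: complex_eq_iff)
  then show False using z0 by simp
 qed
 have "(M *v ?x) \<bullet> ?y = ?x \<bullet> (M *v ?y)" by (rule symmetric_scalar_prod[OF M xc yc])
 then have "Im l * (?x \<bullet> ?x + ?y \<bullet> ?y) = 0"
  unfolding Mx My using xc yc
  by (simp add: minus_scalar_prod_distrib[of _ n] scalar_prod_add_distrib[of _ n] algebra_simps)
 then have Im0: "Im l = 0" using nz by simp
 have ex: "\<exists>w. w \<in> carrier_vec n \<and> w \<bullet> w \<noteq> 0 \<and> M *v w = Re l *s w"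
 proof (cases "?x \<bullet> ?x = 0")
  case False
  have "M *v ?x = Re l *s ?x" unfolding Mx Im0 using xc yc by auto
  then show ?thesis using False xc by blast
 next
  case True
  have "M *v ?y = Re l *s ?y" unfolding My Im0 using xc yc by auto
  then show ?thesis using True nz yc by (intro exI[of _ ?y]) auto
 qed
 then obtain w where w: "w \<in> carrier_vec n" "w \<bullet> w \<noteq> 0" "M *v w = Re l *s w" by blast
 let ?v = "(1 / vnorm w) *s w"
 have p: "vnorm w \<noteq> 0" using w by (simp add: vnorm_def)
 have "?v \<bullet> ?v = 1" using w p vnorm_power2[of w] by (simp add: power2_eq_square field_simps)
 moreover have "M *v ?v = Re l *s ?v"
  using w Mc by (simp add: mult_mat_vec[of _ n n] smult_smult_assoc mult.commute)
 ultimately show ?thesis using w by (intro that[of ?v "Re l"]) auto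
qed

text \<open>Householder reflection: with \<open>w = v - e\<^sub>0\<close> the matrix \<open>I - (2 / w\<cdot>w) w w\<^sup>T\<close> is orthogonal,
 symmetric and swaps \<open>v\<close> and \<open>e\<^sub>0\<close>.  If \<open>v = e\<^sub>0\<close>, the convention \<open>x / 0 = 0\<close> makes it the identity.\<close>

lemma reflection_to_first_axis:
 assumes v: "(v :: real vec) \<in> carrier_vec (Suc n)" and v1: "v \<bullet> v = 1"
 obtains H where "H \<in> carrier_mat (Suc n) (Suc n)" "H\<^sup>T = H" "H * H = 1\<^sub>m (Suc n)" "col H 0 = v"
proof -
 define w where "w = v - unit_vec (Suc n) 0"
 define c where "c = 2 / (w \<bullet> w)"
 define H where "H = mat (Suc n) (Suc n) (\<lambda>(i, j). (if i = j then 1 else 0) - c * w $ i * w $ j)"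
 have wc: "w \<in> carrier_vec (Suc n)" using v by (simp add: w_def)
 have wi: "w $ i = v $ i - (if i = 0 then 1 else 0)" if "i < Suc n" for i
  using that v by (auto simp: w_def)
 have Hc: "H \<in> carrier_mat (Suc n) (Suc n)" by (simp add: H_def)
 have ww: "w \<bullet> w = - 2 * w $ 0"
 proof -
  have "w \<bullet> w = v \<bullet> v - 2 * (v $ 0) + 1"
   using v unfolding w_def
   by (simp add: minus_scalar_prod_distrib[of _ "Suc n"] scalar_prod_minus_distrib[of _ "Suc n"])
  then show ?thesis using v1 wi[of 0] by simp
 qed
 have cc: "c * c * (w \<bullet> w) = 2 * c" by (simp add: c_def)
 have HH: "H * H = 1\<^sub>m (Suc n)"
 proof (rule eq_matI)
  fix i j assume "i < dim_row (1\<^sub>m (Suc n) :: real mat)" "j < dim_col (1\<^sub>m (Suc n) :: real mat)"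
  then have i: "i < Suc n" and j: "j < Suc n" by auto
  have "(H * H) $$ (i, j) = (\<Sum>k<Suc n. H $$ (i, k) * H $$ (k, j))"
   using i j Hc by (simp add: scalar_prod_def lessThan_atLeast0)
  also have "\<dots> = (\<Sum>k<Suc n. (if i = k then (if k = j then 1 else 0) - c * w $ k * w $ j else 0)
     - (if k = j then c * w $ i * w $ k else 0) + c * c * w $ i * w $ j * (w $ k * w $ k))"
   using i j by (intro sum.cong) (auto simp: H_def algebra_simps)
  also have "\<dots> = ((if i = j then 1 else 0) - c * w $ i * w $ j) - c * w $ i * w $ j
     + c * c * w $ i * w $ j * (w \<bullet> w)"
   using i j wc by (simp add: sum.distrib sum_subtractf scalar_prod_def sum_distrib_left[symmetric]
     lessThan_atLeast0 del: sum.lessThan_Suc sum.op_ivl_Suc)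
  also have "\<dots> = (if i = j then 1 else 0) - 2 * c * w $ i * w $ j + (c * c * (w \<bullet> w)) * (w $ i * w $ j)"
   by (simp add: algebra_simps)
  also have "\<dots> = 1\<^sub>m (Suc n) $$ (i, j)" unfolding cc using i j by simp
  finally show "(H * H) $$ (i, j) = 1\<^sub>m (Suc n) $$ (i, j)" .
 qed (use Hc in auto)
 have cw: "w = 0\<^sub>v (Suc n) \<or> c * w $ 0 = - 1"
 proof (cases "w \<bullet> w = 0")
  case True
  then show ?thesis using scalar_prod_self_eq_0[OF wc] by simp
 next
  case False
  then show ?thesis using ww by (simp add: c_def field_simps)
 qed
 have "col H 0 = v"
 proof (rule eq_vecI)
  fix i assume "i < dim_vec v"
  then have i: "i < Suc n" using v by simp
  have h: "H $$ (i, 0) = (if i = 0 then 1 else 0) - (c * w $ 0) * w $ i"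
   using i by (simp add: H_def algebra_simps)
  have "H $$ (i, 0) = v $ i"
   using cw
  proof
   assume w0: "w = 0\<^sub>v (Suc n)"
   show ?thesis unfolding h using w0 i wi[OF i] by auto
  qed (simp add: h wi[OF i])
  then show "col H 0 $ i = v $ i" using i Hc by simp
 qed (use v Hc in auto)
 moreover have "H\<^sup>T = H" by (rule eq_matI) (auto simp: H_def)
 ultimately show ?thesis using Hc HH that by blast
qed

definition orth_mat :: "nat \<Rightarrow> real mat \<Rightarrow> bool" where
 "orth_mat n V \<longleftrightarrow> V \<in> carrier_mat n n \<and> V\<^sup>T * V = 1\<^sub>m n \<and> V * V\<^sup>T = 1\<^sub>m n"

lemma orth_matI:
 assumes "V \<in> carrier_mat n n" "V\<^sup>T * V = 1\<^sub>m n"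
 shows "orth_mat n V"
 using assms mat_mult_left_right_inverse[of "V\<^sup>T" n V] by (auto simp: orth_mat_def)

lemma mat_diag_dims [simp]: "dim_row (mat_diag n f) = n" "dim_col (mat_diag n f) = n"
 by (auto simp: mat_diag_def)

text \<open>Induction on the dimension: reflect a unit eigenvector to the first axis; the matrix then splits
 into the eigenvalue and a smaller symmetric block.\<close>

theorem symmetric_diagonalisation:
 assumes "M \<in> sym_mats n"
 obtains V d where "orth_mat n V" "M * V = V * mat_diag n d"
proof -
 have "\<exists>V d. orth_mat n V \<and> M * V = V * mat_diag n d"
  using assms
 proof (induction n arbitrary: M)
  case 0
  then show ?case
   by (intro exI[of _ "1\<^sub>m 0"] exI[of _ "\<lambda>_. 0"]) (auto simp: orth_mat_def sym_mats_def mat_diag_def intro!: eq_matI)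
 next
  case (Suc n)
  have Mc: "M \<in> carrier_mat (Suc n) (Suc n)" and Mt: "M\<^sup>T = M"
   using Suc.prems by (auto simp: sym_mats_def)
  obtain v e where v: "v \<in> carrier_vec (Suc n)" "v \<bullet> v = 1" "M *v v = e *s v"
   using symmetric_eigenvector[OF Suc.prems] by auto
  obtain H where H: "H \<in> carrier_mat (Suc n) (Suc n)" "H\<^sup>T = H" "H * H = 1\<^sub>m (Suc n)" "col H 0 = v"
   using reflection_to_first_axis[OF v(1,2)] by blast
  define B where "B = H * (M * H)"
  have Bc: "B \<in> carrier_mat (Suc n) (Suc n)" using H Mc by (simp add: B_def)
  have Bt: "B\<^sup>T = B"
   unfolding B_def using H Mc Mt
   by (simp add: transpose_mult[of _ "Suc n" "Suc n" _ "Suc n"] assoc_mult_mat[of _ "Suc n" "Suc n" _ "Suc n" _ "Suc n"])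
  have B0: "col B 0 = e *s unit_vec (Suc n) 0"
  proof -
   have "H *v v = col (H * H) 0" using H by (metis col_mult2 zero_less_Suc)
   then have Hv: "H *v v = unit_vec (Suc n) 0" using H(3) by simp
   have "col B 0 = H *v (M *v col H 0)"
    unfolding B_def using H Mc by (metis col_mult2 mult_carrier_mat zero_less_Suc)
   also have "\<dots> = e *s (H *v v)" using H v by (simp add: mult_mat_vec[of _ "Suc n" "Suc n"])
   finally show ?thesis using Hv by simp
  qed
  have Bi0: "B $$ (i, 0) = (if i = 0 then e else 0)" if "i < Suc n" for i
   using arg_cong[OF B0, of "\<lambda>x. x $ i"] that Bc by auto
  have B0i: "B $$ (0, i) = (if i = 0 then e else 0)" if "i < Suc n" for i
   using Bi0[OF that] arg_cong[OF Bt, of "\<lambda>x. x $$ (i, 0)"] that Bc by auto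
  define C where "C = mat n n (\<lambda>(i, j). B $$ (Suc i, Suc j))"
  have "C \<in> sym_mats n"
  proof -
   have "C\<^sup>T = C"
   proof (rule eq_matI)
    fix i j assume "i < dim_row C" "j < dim_col C"
    then show "C\<^sup>T $$ (i, j) = C $$ (i, j)"
     using arg_cong[OF Bt, of "\<lambda>x. x $$ (Suc i, Suc j)"] Bc by (auto simp: C_def)
   qed (auto simp: C_def)
   then show ?thesis by (auto simp: sym_mats_def C_def)
  qed
  from Suc.IH[OF this] obtain V d where V: "orth_mat n V" "C * V = V * mat_diag n d" by blast
  have Vc: "V \<in> carrier_mat n n" and VV: "V\<^sup>T * V = 1\<^sub>m n" using V by (auto simp: orth_mat_def)
  have Cc: "C \<in> carrier_mat n n" by (simp add: C_def)
  define U where "U = four_block_mat (1\<^sub>m 1) (0\<^sub>m 1 n) (0\<^sub>m n 1) V"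
  define g where "g = (\<lambda>i. if i = 0 then e else d (i - 1))"
  have Uc: "U \<in> carrier_mat (Suc n) (Suc n)" using Vc by (auto simp: U_def)
  have Beq: "B = four_block_mat (e \<cdot>\<^sub>m 1\<^sub>m 1) (0\<^sub>m 1 n) (0\<^sub>m n 1) C"
   by (rule eq_matI) (use Bc Bi0 B0i in \<open>auto simp: C_def split: if_splits\<close>)
  have Deq: "mat_diag (Suc n) g = four_block_mat (e \<cdot>\<^sub>m 1\<^sub>m 1) (0\<^sub>m 1 n) (0\<^sub>m n 1) (mat_diag n d)"
   by (rule eq_matI) (auto simp: mat_diag_def g_def)
  have BU: "B * U = U * mat_diag (Suc n) g"
   unfolding Beq U_def Deq using V(2) Vc Cc
   by (subst (1 2) mult_four_block_mat[of _ 1 1 _ n _ n _ _ 1 _ n]) (auto simp: mat_diag_dim)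
  have UU: "U\<^sup>T * U = 1\<^sub>m (Suc n)"
   unfolding U_def using Vc VV
   by (subst transpose_four_block_mat[of _ 1 1 _ n _ n], auto,
     subst mult_four_block_mat[of _ 1 1 _ n _ n _ _ 1 _ n], auto)
  have oHU: "orth_mat (Suc n) (H * U)"
  proof (rule orth_matI)
   have "(H * U)\<^sup>T * (H * U) = U\<^sup>T * ((H * H) * U)"
    using H(1,2) Uc by (simp add: transpose_mult[of _ "Suc n" "Suc n" _ "Suc n"] assoc_mult_mat[of _ "Suc n" "Suc n" _ "Suc n" _ "Suc n"])
   also have "\<dots> = 1\<^sub>m (Suc n)" unfolding H(3) using Uc UU by simp
   finally show "(H * U)\<^sup>T * (H * U) = 1\<^sub>m (Suc n)" .
  qed (use H Uc in auto)
  moreover have "M * (H * U) = (H * U) * mat_diag (Suc n) g"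
  proof -
   have "M * (H * U) = (H * H) * (M * (H * U))" unfolding H(3) using H(1) Mc Uc by simp
   also have "\<dots> = H * (B * U)"
    using H(1) Mc Uc by (simp add: B_def assoc_mult_mat[of _ "Suc n" "Suc n" _ "Suc n" _ "Suc n"])
   also have "\<dots> = (H * U) * mat_diag (Suc n) g"
    unfolding BU using H Uc mat_diag_dim[of "Suc n" g] by (metis assoc_mult_mat)
   finally show ?thesis .
  qed
  ultimately show ?case by blast
 qed
 then show ?thesis using that by blast
qed

section \<open>Matrix algebra with dimension conditions\<close>

text \<open>Carrier memberships leave the inner dimension of a product undetermined. Stated with the dimensions of
 the factors, the laws of matrix algebra can be used as rewrite rules.\<close>

lemma mult_carrier_iff: "A * B \<in> carrier_mat n m \<longleftrightarrow> dim_row A = n \<and> dim_col B = m"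
 unfolding carrier_mat_def by simp

lemma mult_vec_carrier_iff: "A *v x \<in> carrier_vec n \<longleftrightarrow> dim_row A = n"
 unfolding carrier_vec_def by simp

context
 fixes A B C :: "real mat"
begin

lemma assoc_mat_dim:
 "dim_col A = dim_row B ==> dim_col B = dim_row C ==> (A * B) * C = A * (B * C)"
 by (rule assoc_mult_mat[of _ "dim_row A" "dim_col A" _ "dim_col B" _ "dim_col C"]) (unfold carrier_mat_def carrier_vec_def, auto)

lemma assoc_vec_dim:
 "dim_col A = dim_row B ==> dim_col B = dim_vec x ==> (A * B) *v x = A *v (B *v x)"
 by (rule assoc_mult_mat_vec[of _ "dim_row A" "dim_col A" _ "dim_col B"]) (unfold carrier_mat_def carrier_vec_def, auto)

lemma transpose_mult_dim: "dim_col A = dim_row B ==> (A * B)\<^sup>T = B\<^sup>T * A\<^sup>T"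
 by (rule transpose_mult[of _ "dim_row A" "dim_col A" _ "dim_col B"]) (unfold carrier_mat_def carrier_vec_def, auto)

lemma mult_add_dim:
 "dim_row B = dim_row C ==> dim_col B = dim_col C ==> dim_col A = dim_row C ==> A * (B + C) = A * B + A * C"
 by (rule mult_add_distrib_mat[of _ "dim_row A" "dim_col A" _ "dim_col B"]) (unfold carrier_mat_def carrier_vec_def, auto)

lemma add_mult_dim:
 "dim_row A = dim_row B ==> dim_col A = dim_col B ==> dim_col B = dim_row C ==> (A + B) * C = A * C + B * C"
 by (rule add_mult_distrib_mat[of _ "dim_row A" "dim_col A" _ _ "dim_col C"]) (unfold carrier_mat_def carrier_vec_def, auto)

lemma mult_minus_dim:
 "dim_row B = dim_row C ==> dim_col B = dim_col C ==> dim_col A = dim_row C ==> A * (B - C) = A * B - A * C"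
 by (rule mult_minus_distrib_mat[of _ "dim_row A" "dim_col A" _ "dim_col B"]) (unfold carrier_mat_def carrier_vec_def, auto)

lemma minus_mult_dim:
 "dim_row A = dim_row B ==> dim_col A = dim_col B ==> dim_col B = dim_row C ==> (A - B) * C = A * C - B * C"
 by (rule minus_mult_distrib_mat[of _ "dim_row A" "dim_col A" _ _ "dim_col C"]) (unfold carrier_mat_def carrier_vec_def, auto)

lemma mult_smult_dim: "dim_col A = dim_row B ==> A * (c \<cdot>\<^sub>m B) = c \<cdot>\<^sub>m (A * B)"
 by (rule mult_smult_distrib[of _ "dim_row A" "dim_col A" _ "dim_col B"]) (unfold carrier_mat_def carrier_vec_def, auto)

lemma smult_mult_dim: "dim_col A = dim_row B ==> (c \<cdot>\<^sub>m A) * B = c \<cdot>\<^sub>m (A * B)"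
 by (rule mult_smult_assoc_mat[of _ "dim_row A" "dim_col A" _ "dim_col B"]) (unfold carrier_mat_def carrier_vec_def, auto)

lemma mult_vec_add_dim:
 "dim_vec x = dim_vec y ==> dim_col A = dim_vec y ==> A *v (x + y) = A *v x + A *v y"
 by (rule mult_add_distrib_mat_vec[of _ "dim_row A" "dim_col A"]) (unfold carrier_mat_def carrier_vec_def, auto)

lemma mult_vec_smult_dim: "dim_col A = dim_vec y ==> A *v (c *s y) = c *s (A *v y)"
 by (rule mult_mat_vec[of _ "dim_row A" "dim_col A"]) (unfold carrier_mat_def carrier_vec_def, auto)

end

lemmas mat_dims = mult_carrier_iff mult_vec_carrier_iff assoc_mat_dim assoc_vec_dim transpose_mult_dim

section \<open>Spectral calculus\<close>

definition spectral :: "real mat \<Rightarrow> (nat \<Rightarrow> real) \<Rightarrow> real mat" where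
 "spectral V f = V * (mat_diag (dim_row V) f * V\<^sup>T)"

lemma orth_matD:
 assumes "orth_mat n V"
 shows "V \<in> carrier_mat n n" "V\<^sup>T \<in> carrier_mat n n" "V\<^sup>T * V = 1\<^sub>m n" "V * V\<^sup>T = 1\<^sub>m n" "dim_row V = n"
  "dim_col V = n"
 using assms by (auto simp: orth_mat_def)

lemma orth_mat_cancel_vec:
 assumes "orth_mat n V" "x \<in> carrier_vec n"
 shows "V *v (V\<^sup>T *v x) = x" "V\<^sup>T *v (V *v x) = x"
 using assoc_vec_dim[of V "V\<^sup>T" x] assoc_vec_dim[of "V\<^sup>T" V x] orth_matD[OF assms(1)] assms(2)
 by auto

lemma orth_mat_isometry:
 assumes V: "orth_mat n V" and x: "x \<in> carrier_vec n"
 shows "(V\<^sup>T *v x) \<bullet> (V\<^sup>T *v x) = x \<bullet> x"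
 using transpose_vec_mult_scalar[OF orth_matD(1)[OF V], of "V\<^sup>T *v x" x] orth_matD[OF V] x
 by (simp add: orth_mat_cancel_vec[OF V x])

lemma mat_diag_mult_vec:
 assumes "y \<in> carrier_vec n"
 shows "mat_diag n f *v y = vec n (\<lambda>i. f i * y $ i)"
proof (rule eq_vecI)
 fix i assume "i < dim_vec (vec n (\<lambda>i. f i * y $ i))"
 then have i: "i < n" by simp
 have "(mat_diag n f *v y) $ i = (\<Sum>j\<in>{0..<n}. (if i = j then f j else 0) * y $ j)"
  using i assms by (simp add: mat_diag_def scalar_prod_def)
 also have "\<dots> = (\<Sum>j\<in>{0..<n}. if i = j then f j * y $ j else 0)" by (rule sum.cong) auto
 finally show "(mat_diag n f *v y) $ i = vec n (\<lambda>i. f i * y $ i) $ i" using i by simp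
qed (simp add: mat_diag_def)

lemma mat_diag_transpose [simp]: "(mat_diag n f)\<^sup>T = mat_diag n f"
 by (rule eq_matI) (auto simp: mat_diag_def)

lemma spectral_carrier [simp]: "orth_mat n V ==> spectral V f \<in> carrier_mat n n"
 using orth_matD[of n V] by (simp add: spectral_def mat_dims)

lemma spectral_sym: "orth_mat n V ==> spectral V f \<in> sym_mats n"
 using orth_matD[of n V]
 by (simp add: sym_mats_def spectral_def mat_dims)

lemma spectral_mult_vec:
 assumes V: "orth_mat n V" and x: "x \<in> carrier_vec n"
 shows "spectral V f *v x = V *v vec n (\<lambda>i. f i * (V\<^sup>T *v x) $ i)"
proof -
 note v = orth_matD[OF V]
 have "spectral V f *v x = V *v (mat_diag n f *v (V\<^sup>T *v x))"
  using v x by (simp add: spectral_def mat_dims)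
 then show ?thesis using mat_diag_mult_vec[of "V\<^sup>T *v x" n f] v x by simp
qed

lemma spectral_quadratic_form:
 assumes V: "orth_mat n V" and x: "x \<in> carrier_vec n"
 shows "x \<bullet> (spectral V f *v x) = (\<Sum>i<n. f i * ((V\<^sup>T *v x) $ i)\<^sup>2)"
proof -
 note v = orth_matD[OF V]
 have "x \<bullet> (spectral V f *v x) = (V\<^sup>T *v x) \<bullet> vec n (\<lambda>i. f i * (V\<^sup>T *v x) $ i)"
  unfolding spectral_mult_vec[OF V x] using transpose_vec_mult_scalar[OF v(1) _ x] v x by simp
 also have "\<dots> = (\<Sum>i<n. f i * ((V\<^sup>T *v x) $ i)\<^sup>2)"
  by (simp add: scalar_prod_def lessThan_atLeast0 power2_eq_square algebra_simps)
 finally show ?thesis .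
qed

lemma orth_mat_sum_squares:
 assumes V: "orth_mat n V" and x: "x \<in> carrier_vec n"
 shows "(\<Sum>i<n. ((V\<^sup>T *v x) $ i)\<^sup>2) = x \<bullet> x"
 unfolding orth_mat_isometry[OF V x, symmetric]
 using orth_matD[OF V] by (simp add: scalar_prod_def[of "V\<^sup>T *v x" "V\<^sup>T *v x"] lessThan_atLeast0 power2_eq_square)

lemma spectral_lower:
 assumes V: "orth_mat n V" and x: "x \<in> carrier_vec n" and f: "\<And>i. i < n ==> c \<le> f i"
 shows "c * (x \<bullet> x) \<le> x \<bullet> (spectral V f *v x)"
 unfolding spectral_quadratic_form[OF V x] orth_mat_sum_squares[OF V x, symmetric] sum_distrib_left
 by (rule sum_mono) (use f in \<open>auto intro: mult_right_mono\<close>)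

lemma spectral_upper:
 assumes V: "orth_mat n V" and x: "x \<in> carrier_vec n" and f: "\<And>i. i < n ==> f i \<le> c"
 shows "x \<bullet> (spectral V f *v x) \<le> c * (x \<bullet> x)"
 unfolding spectral_quadratic_form[OF V x] orth_mat_sum_squares[OF V x, symmetric] sum_distrib_left
 by (rule sum_mono) (use f in \<open>auto intro: mult_right_mono\<close>)

lemma spectral_mult:
 assumes V: "orth_mat n V"
 shows "spectral V f * spectral V g = spectral V (\<lambda>i. f i * g i)"
proof -
 note v = orth_matD[OF V]
 have "spectral V f * spectral V g = V * (mat_diag n f * ((V\<^sup>T * V) * (mat_diag n g * V\<^sup>T)))"
  using v(1) by (simp add: spectral_def mat_dims)
 also have "\<dots> = V * ((mat_diag n f * mat_diag n g) * V\<^sup>T)"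
  unfolding v(3) using v by (simp add: mat_dims del: mat_diag_diag)
 finally show ?thesis using v by (simp add: spectral_def)
qed

lemma orth_mat_col:
 assumes "orth_mat n V" "i < n" "j < n"
 shows "col V i \<bullet> col V j = (if i = j then 1 else 0)"
proof -
 have "(V\<^sup>T * V) $$ (i, j) = col V i \<bullet> col V j" using orth_matD(1)[OF assms(1)] assms by simp
 then show ?thesis using orth_matD(3)[OF assms(1)] assms by simp
qed

lemma spectral_one: "orth_mat n V ==> spectral V (\<lambda>_. 1) = 1\<^sub>m n"
proof -
 assume V: "orth_mat n V"
 note v = orth_matD[OF V]
 have "mat_diag n (\<lambda>_. 1 :: real) = 1\<^sub>m n" by (rule eq_matI) (auto simp: mat_diag_def)
 then show ?thesis using v by (simp add: spectral_def)
qed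

lemma spectral_cong:
 assumes "orth_mat n V" "\<And>i. i < n ==> f i = g i"
 shows "spectral V f = spectral V g"
proof -
 have "mat_diag n f = mat_diag n g" by (rule eq_matI) (auto simp: mat_diag_def assms(2))
 then show ?thesis using orth_matD[OF assms(1)] by (simp add: spectral_def)
qed

lemma spectral_eigenvector:
 assumes V: "orth_mat n V" and j: "j < n"
 shows "spectral V f *v col V j = f j *s col V j"
proof -
 note v = orth_matD[OF V]
 have u: "V\<^sup>T *v col V j = unit_vec n j"
 proof (rule eq_vecI)
  fix i assume "i < dim_vec (unit_vec n j :: real vec)"
  then show "(V\<^sup>T *v col V j) $ i = unit_vec n j $ i"
   using orth_mat_col[OF V, of i j] v(1) j by (simp add: unit_vec_def)
 qed (use v in simp)
 have "vec n (\<lambda>i. f i * unit_vec n j $ i) = f j *s unit_vec n j"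
  by (rule eq_vecI) (auto simp: unit_vec_def)
 moreover have "V *v unit_vec n j = col V j"
  using orth_mat_cancel_vec(1)[OF V, of "col V j"] v j u by simp
 moreover have "col V j \<in> carrier_vec n" using v j by auto
 ultimately show ?thesis
  using v by (simp add: spectral_mult_vec[OF V] u mult_mat_vec[of _ n n])
qed

theorem symmetric_spectral:
 assumes M: "M \<in> sym_mats n"
 obtains V d where "orth_mat n V" "M = spectral V d"
proof -
 obtain V d where V: "orth_mat n V" "M * V = V * mat_diag n d"
  using symmetric_diagonalisation[OF M] by blast
 note v = orth_matD[OF V(1)]
 have Mc: "M \<in> carrier_mat n n" using M by (simp add: sym_mats_def)
 have "M = (M * V) * V\<^sup>T" using v Mc by (simp add: mat_dims)
 also have "\<dots> = spectral V d"
  unfolding V(2) using v by (simp add: spectral_def mat_dims)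
 finally show ?thesis using V(1) that by blast
qed

lemma mat_eqI_vec:
 fixes A B :: "real mat"
 assumes A: "A \<in> carrier_mat m n" and B: "B \<in> carrier_mat m n"
  and eq: "\<And>x. x \<in> carrier_vec n ==> A *v x = B *v x"
 shows "A = B"
proof (rule eq_matI)
 fix i j assume "i < dim_row B" "j < dim_col B"
 then show "A $$ (i, j) = B $$ (i, j)"
  using arg_cong[OF eq[of "unit_vec n j"], of "\<lambda>v. v $ i"] A B by auto
qed (use A B in auto)

lemma psd_form_zero:
 assumes M: "M \<in> psd_mats n" and x: "x \<in> carrier_vec n" and z: "x \<bullet> (M *v x) = 0"
 shows "M *v x = 0\<^sub>v n"
proof -
 have Mc: "M \<in> carrier_mat n n" and Ms: "M \<in> sym_mats n"
  using M by (auto simp: psd_mats_def sym_mats_def)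
 have y: "M *v x \<in> carrier_vec n" using Mc x by simp
 have "(x \<bullet> (M *v (M *v x)))\<^sup>2 \<le> 0"
  using psd_Cauchy_Schwarz[OF M x y] z by simp
 then have "x \<bullet> (M *v (M *v x)) = 0" by simp
 then have "(M *v x) \<bullet> (M *v x) = 0" using symmetric_scalar_prod[OF Ms x y] by simp
 then show ?thesis using scalar_prod_self_eq_0[OF y] by simp
qed

section \<open>Square roots of positive semidefinite matrices\<close>

text \<open>On an eigenvector of \<open>C\<close> for the eigenvalue \<open>d\<close>, the matrix \<open>(B + d) (B - d) = C\<^sup>2 - d\<^sup>2\<close>
 vanishes; since \<open>B\<close> is semidefinite, already \<open>B - d\<close> vanishes there.\<close>

lemma psd_square_inj:
 assumes B: "B \<in> psd_mats n" and C: "C \<in> psd_mats n" and eq: "B * B = C * C"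
 shows "B = C"
proof -
 have Bc: "B \<in> carrier_mat n n" "B \<in> sym_mats n" and Cc: "C \<in> carrier_mat n n" "C \<in> sym_mats n"
  using B C by (auto simp: psd_mats_def sym_mats_def)
 obtain V d where V: "orth_mat n V" and Cd: "C = spectral V d"
  using symmetric_spectral[OF Cc(2)] by blast
 note v = orth_matD[OF V]
 have col: "B *v col V j = C *v col V j" if j: "j < n" for j
 proof -
  let ?v = "col V j"
  have vc: "?v \<in> carrier_vec n" using v j by auto
  have Cv: "C *v ?v = d j *s ?v" unfolding Cd by (rule spectral_eigenvector[OF V j])
  have vv: "?v \<bullet> ?v = 1"
   using orth_mat_col[OF V j j] by simp
  have d0: "0 \<le> d j"
   using C vc vv Cv by (auto simp: psd_mats_def dest!: bspec[of _ _ ?v])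
  define u where "u = B *v ?v - d j *s ?v"
  have uc: "u \<in> carrier_vec n" using Bc vc by (simp add: u_def)
  have BB: "B *v (B *v ?v) = (d j * d j) *s ?v"
  proof -
   have "B *v (B *v ?v) = C *v (C *v ?v)"
    using arg_cong[OF eq, of "\<lambda>A. A *v ?v"] Bc(1) Cc(1) vc by (simp add: mat_dims)
   then show ?thesis using Cv Cc vc by (simp add: mult_mat_vec[of _ n n] smult_smult_assoc)
  qed
  have Bu: "B *v u = - d j *s u"
  proof -
   have "B *v u = (d j * d j) *s ?v - d j *s (B *v ?v)"
    unfolding u_def using Bc vc BB by (simp add: mult_minus_distrib_mat_vec[of _ n n] mult_mat_vec[of _ n n])
   also have "\<dots> = - d j *s u" 
    unfolding u_def using Bc(1) vc v(5) by (intro eq_vecI) (auto simp: algebra_simps simp del: index_mult_mat_vec)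
   finally show ?thesis .
  qed
  have "u = 0\<^sub>v n"
  proof (cases "d j = 0")
   case True
   have "B *v (B *v ?v) = 0\<^sub>v n" unfolding BB using True vc v(1,5) by (intro eq_vecI) auto
   then have "(B *v ?v) \<bullet> (B *v ?v) = 0"
    using symmetric_scalar_prod[OF Bc(2) vc, of "B *v ?v"] Bc vc by simp
   then have "B *v ?v = 0\<^sub>v n" using scalar_prod_self_eq_0[of "B *v ?v" n] Bc vc by simp
   then show ?thesis unfolding u_def True using vc v(1,5) by (intro eq_vecI) auto
  next
   case False
   have "0 \<le> u \<bullet> (B *v u)" using B uc by (auto simp: psd_mats_def)
   then have "d j * (u \<bullet> u) \<le> 0" unfolding Bu using uc by simp
   then have "u \<bullet> u = 0" using d0 False scalar_prod_self_nonneg[of u]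
    by (simp add: mult_le_0_iff)
   then show ?thesis using scalar_prod_self_eq_0[OF uc] by simp
  qed
  then have "B *v ?v = d j *s ?v"
  proof (intro eq_vecI)
   fix i assume "i < dim_vec (d j *s ?v)"
   then have "i < n" using vc v(5) by simp
   then have "(B *v ?v) $ i - (d j *s ?v) $ i = 0"
    using arg_cong[OF \<open>u = 0\<^sub>v n\<close>, of "\<lambda>x. x $ i"] vc v(5) by (simp add: u_def del: index_mult_mat_vec)
   then show "(B *v ?v) $ i = (d j *s ?v) $ i" by linarith
  qed (use Bc(1) v(5) in simp)
  then show ?thesis using Cv by simp
 qed
 have "B * V = C * V"
 proof (rule eq_matI)
  fix i j assume "i < dim_row (C * V)" "j < dim_col (C * V)"
  then have ij: "i < n" "j < n" using v Cc by auto
  show "(B * V) $$ (i, j) = (C * V) $$ (i, j)"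
   using arg_cong[OF col[OF ij(2)], of "\<lambda>x. x $ i"] ij Bc Cc v by simp
 qed (use Bc Cc v in auto)
 then have "(B * V) * V\<^sup>T = (C * V) * V\<^sup>T" by simp
 then show ?thesis using Bc Cc v by (simp add: mat_dims)
qed

lemma psd_spectral:
 assumes "M \<in> psd_mats n" and V: "orth_mat n V" and M: "M = spectral V d" and i: "i < n"
 shows "0 \<le> d i"
proof -
 note v = orth_matD[OF V]
 have vc: "col V i \<in> carrier_vec n" using v i by auto
 have vv: "col V i \<bullet> col V i = 1"
  using orth_mat_col[OF V i i] by simp
 have "0 \<le> col V i \<bullet> (M *v col V i)" using assms(1) vc by (auto simp: psd_mats_def)
 then show ?thesis unfolding M spectral_eigenvector[OF V i] using vc vv by simp
qed

lemma spectral_psd: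
 assumes V: "orth_mat n V" and f: "\<And>i. i < n ==> 0 \<le> f i"
 shows "spectral V f \<in> psd_mats n"
 unfolding psd_mats_def using spectral_sym[OF V] spectral_lower[OF V _ f] by auto

lemma psd_sqrt_eqI:
 assumes B: "B \<in> psd_mats n" and M: "M \<in> carrier_mat n n" and BB: "B * B = M"
 shows "psd_sqrt M = B"
 unfolding psd_sqrt_def
proof (rule the_equality)
 show "B \<in> psd_mats (dim_row M) \<and> B * B = M" using B M BB by simp
 fix C assume "C \<in> psd_mats (dim_row M) \<and> C * C = M"
 then have "C \<in> psd_mats n" "C * C = B * B" using M BB by simp_all
 then show "C = B" using psd_square_inj B by blast
qed

lemma psd_sqrt_spectral:
 assumes V: "orth_mat n V" and f: "\<And>i. i < n ==> 0 \<le> f i"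
 shows "psd_sqrt (spectral V f) = spectral V (\<lambda>i. sqrt (f i))"
proof (rule psd_sqrt_eqI)
 show "spectral V (\<lambda>i. sqrt (f i)) * spectral V (\<lambda>i. sqrt (f i)) = spectral V f"
  unfolding spectral_mult[OF V] by (rule spectral_cong[OF V]) (use f in auto)
 show "spectral V (\<lambda>i. sqrt (f i)) \<in> psd_mats n" by (rule spectral_psd[OF V]) (use f in auto)
qed (rule spectral_carrier[OF V])

lemma psd_sqrt:
 assumes M: "M \<in> psd_mats n"
 shows "psd_sqrt M \<in> psd_mats n" "psd_sqrt M * psd_sqrt M = M"
proof -
 have "M \<in> sym_mats n" using M by (simp add: psd_mats_def)
 then obtain V d where V: "orth_mat n V" and Md: "M = spectral V d" by (rule symmetric_spectral)
 have d: "0 \<le> d i" if "i < n" for i by (rule psd_spectral[OF M V Md that])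
 have eq: "psd_sqrt M = spectral V (\<lambda>i. sqrt (d i))"
  unfolding Md by (rule psd_sqrt_spectral[OF V]) (rule d)
 show "psd_sqrt M \<in> psd_mats n"
  unfolding eq by (rule spectral_psd[OF V]) (use d in auto)
 have "spectral V (\<lambda>i. sqrt (d i) * sqrt (d i)) = spectral V d"
  by (rule spectral_cong[OF V]) (use d in auto)
 then show "psd_sqrt M * psd_sqrt M = M"
  unfolding eq spectral_mult[OF V] using Md by simp
qed

lemma psd_sqrt_one: "psd_sqrt (1\<^sub>m n) = 1\<^sub>m n"
 by (rule psd_sqrt_eqI[OF one_psd]) simp_all

lemma minv_one: "minv (1\<^sub>m n) = 1\<^sub>m n"
 by (rule minv_unique[of _ n]) simp_all

lemma pd_imp_psd:
 assumes "M \<in> pd_mats n"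
 shows "M \<in> psd_mats n"
proof -
 have "0 \<le> x \<bullet> (M *v x)" if x: "x \<in> carrier_vec n" for x
  using assms x by (cases "x = 0\<^sub>v n") (auto simp: pd_mats_def sym_mats_def less_imp_le)
 then show ?thesis using assms by (simp add: pd_mats_def psd_mats_def)
qed

lemma pd_inj:
 assumes "M \<in> pd_mats n" "x \<in> carrier_vec n" "M *v x = 0\<^sub>v n"
 shows "x = 0\<^sub>v n"
proof (rule ccontr)
 assume "x \<noteq> 0\<^sub>v n"
 then have "0 < x \<bullet> (M *v x)" using assms by (auto simp: pd_mats_def)
 then show False using assms by simp
qed

lemma psd_sqrt_pd:
 assumes M: "M \<in> pd_mats n"
 shows "psd_sqrt M \<in> pd_mats n"
proof -
 note s = psd_sqrt[OF pd_imp_psd[OF M]]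
 have sc: "psd_sqrt M \<in> carrier_mat n n" using s(1) by (auto simp: psd_mats_def sym_mats_def)
 have "0 < x \<bullet> (psd_sqrt M *v x)" if x: "x \<in> carrier_vec n" "x \<noteq> 0\<^sub>v n" for x
 proof (rule ccontr)
  assume "\<not> ?thesis"
  then have "x \<bullet> (psd_sqrt M *v x) = 0" using s(1) x by (auto simp: psd_mats_def intro: antisym)
  then have "psd_sqrt M *v x = 0\<^sub>v n" by (rule psd_form_zero[OF s(1) x(1)])
  then have "(psd_sqrt M * psd_sqrt M) *v x = 0\<^sub>v n"
   using sc x by (auto simp: mat_dims intro!: eq_vecI)
  then have "M *v x = 0\<^sub>v n" unfolding s(2) .
  then show False using pd_inj[OF M x(1)] x by simp
 qed
 then show ?thesis using s(1) by (auto simp: pd_mats_def psd_mats_def)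
qed

lemma pd_minv:
 assumes M: "M \<in> pd_mats n"
 shows "minv M \<in> carrier_mat n n" "M * minv M = 1\<^sub>m n" "minv M * M = 1\<^sub>m n"
 using minv_inverse[of M n] pd_inj[OF M] M by (auto simp: pd_mats_def sym_mats_def)

lemma inverse_cancel_vec:
 fixes A B :: "real mat"
 assumes "A \<in> carrier_mat n n" "B \<in> carrier_mat n n" "A * B = 1\<^sub>m n" "x \<in> carrier_vec n"
 shows "A *v (B *v x) = x"
 using assms assoc_vec_dim[of A B x] by simp

lemma minv_sym:
 assumes "M \<in> pd_mats n"
 shows "minv M \<in> sym_mats n"
proof -
 note i = pd_minv[OF assms]
 have M: "M \<in> carrier_mat n n" "M\<^sup>T = M" using assms by (auto simp: pd_mats_def sym_mats_def)
 have "minv M = (minv M)\<^sup>T"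
 proof (rule minv_unique[OF M(1)])
  show "(minv M)\<^sup>T * M = 1\<^sub>m n"
   using transpose_mult_dim[of M "minv M"] M i(1,2) by simp
 qed (use i in auto)
 then show ?thesis using i by (simp add: sym_mats_def)
qed

lemma minv_spectral:
 assumes V: "orth_mat n V" and f: "\<And>i. i < n ==> f i \<noteq> 0"
 shows "minv (spectral V f) = spectral V (\<lambda>i. 1 / f i)"
proof (rule minv_unique)
 have "spectral V (\<lambda>i. 1 / f i) * spectral V f = spectral V (\<lambda>_. 1)"
  unfolding spectral_mult[OF V] by (rule spectral_cong[OF V]) (use f in auto)
 then show "spectral V (\<lambda>i. 1 / f i) * spectral V f = 1\<^sub>m n" using spectral_one[OF V] by simp
qed (use V in auto)

lemma spectral_eigenvalue_bound:
 assumes V: "orth_mat n V" and i: "i < n"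
 obtains x where "x \<in> carrier_vec n" "x \<bullet> x = 1" "x \<bullet> (spectral V f *v x) = f i"
proof -
 note v = orth_matD[OF V]
 have vc: "col V i \<in> carrier_vec n" using v i by auto
 have vv: "col V i \<bullet> col V i = 1"
  using orth_mat_col[OF V i i] by simp
 show ?thesis
  using that[OF vc vv] spectral_eigenvector[OF V i, of f] vc vv by simp
qed

text \<open>The form of \<open>T\<^sup>-\<^sup>1\<^sup>/\<^sup>2\<close> when the spectrum of \<open>T\<close> lies in \<open>[a, b]\<close>.\<close>

lemma inverse_sqrt_bounds:
 assumes T: "T \<in> sym_mats n" and a: "0 < a"
  and lo: "\<And>x. x \<in> carrier_vec n ==> a * (x \<bullet> x) \<le> x \<bullet> (T *v x)"
  and hi: "\<And>x. x \<in> carrier_vec n ==> x \<bullet> (T *v x) \<le> b * (x \<bullet> x)"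
  and x: "x \<in> carrier_vec n"
 shows "minv (psd_sqrt T) \<in> sym_mats n"
  "(x \<bullet> x) / sqrt b \<le> x \<bullet> (minv (psd_sqrt T) *v x)"
  "x \<bullet> (minv (psd_sqrt T) *v x) \<le> (x \<bullet> x) / sqrt a"
proof -
 obtain V d where V: "orth_mat n V" and Td: "T = spectral V d" using symmetric_spectral[OF T] by blast
 have d: "a \<le> d i \<and> d i \<le> b" if i: "i < n" for i
 proof -
  obtain y where "y \<in> carrier_vec n" "y \<bullet> y = 1" "y \<bullet> (spectral V d *v y) = d i"
   using spectral_eigenvalue_bound[OF V i] by blast
  then show ?thesis using lo[of y] hi[of y] unfolding Td by simp
 qed
 have eq: "minv (psd_sqrt T) = spectral V (\<lambda>i. 1 / sqrt (d i))"
  unfolding Td using d a by (subst psd_sqrt_spectral[OF V], force, subst minv_spectral[OF V]) force+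
 show "minv (psd_sqrt T) \<in> sym_mats n" unfolding eq by (rule spectral_sym[OF V])
 have "(1 / sqrt b) * (x \<bullet> x) \<le> x \<bullet> (spectral V (\<lambda>i. 1 / sqrt (d i)) *v x)"
  by (rule spectral_lower[OF V x]) (use d a in \<open>force intro!: divide_left_mono mult_pos_pos\<close>)
 then show "(x \<bullet> x) / sqrt b \<le> x \<bullet> (minv (psd_sqrt T) *v x)" unfolding eq by simp
 have "x \<bullet> (spectral V (\<lambda>i. 1 / sqrt (d i)) *v x) \<le> (1 / sqrt a) * (x \<bullet> x)"
  by (rule spectral_upper[OF V x]) (use d a in \<open>force intro!: divide_left_mono mult_pos_pos\<close>)
 then show "x \<bullet> (minv (psd_sqrt T) *v x) \<le> (x \<bullet> x) / sqrt a" unfolding eq by simp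
qed

section \<open>Ordered eigenvalues\<close>

text \<open>The roots of the characteristic polynomial of \<open>V diag f V\<^sup>T\<close> are the values of \<open>f\<close>, so sorting them
 recovers any decreasing \<open>f\<close>, whatever eigenbasis was chosen.\<close>

lemma size_eigenvalues_spectral:
 assumes V: "orth_mat n V"
 shows "size (proots (char_poly (spectral V d))) = n"
proof -
 note v = orth_matD[OF V]
 have "similar_mat (spectral V d) (mat_diag n d)"
  by (rule similar_matI[of _ _ V "V\<^sup>T" n])
   (use v in \<open>auto simp: spectral_def mat_dims\<close>)
 then have "char_poly (spectral V d) = char_poly (mat_diag n d)" by (rule char_poly_similar)
 also have "\<dots> = (\<Prod>a\<leftarrow>diag_mat (mat_diag n d). [:- a, 1:])"
  by (rule char_poly_upper_triangular[OF mat_diag_dim]) (auto simp: mat_diag_def)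
 also have "size (proots \<dots>) = length (diag_mat (mat_diag n d))"
 proof -
  have "size (proots (\<Prod>a\<leftarrow>xs. [:- a, 1:])) = length xs" for xs :: "real list"
  proof (induction xs)
   case (Cons a xs)
   have "(\<Prod>a\<leftarrow>xs. [:- a, 1:]) \<noteq> 0" by (auto simp: prod_list_zero_iff)
   then have "proots ([:- a, 1:] * (\<Prod>a\<leftarrow>xs. [:- a, 1:])) = {#a#} + proots (\<Prod>a\<leftarrow>xs. [:- a, 1:])"
    by (subst proots_mult) auto
   then show ?case using Cons by simp
  qed simp
  then show ?thesis by blast
 qed
 also have "\<dots> = n" by (simp add: diag_mat_def)
 finally show ?thesis by simp
qed

lemma lam_antimono:
 assumes V: "orth_mat n V" and W: "W = spectral V d" and ij: "i \<le> j" "j < n"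
 shows "lam W (j + 1) \<le> lam W (i + 1)"
proof -
 let ?l = "sorted_list_of_multiset (proots (char_poly W))"
 have len: "length ?l = n"
  using size_eigenvalues_spectral[OF V, of d] W by (metis mset_sorted_list_of_multiset size_mset)
 have "sorted ?l" by simp
 then have "rev ?l ! j \<le> rev ?l ! i"
  using ij len by (simp add: rev_nth sorted_nth_mono)
 then show ?thesis by (simp add: lam_def)
qed

section \<open>Vectorisation and Kronecker products\<close>

lemma div_mod_bound:
 assumes "p < a * (b :: nat)"
 shows "p mod a < a" "p div a < b" "0 < a"
proof -
 show "0 < a" using assms by (cases a) auto
 then show "p mod a < a" by simp
 show "p div a < b" using assms by (metis less_mult_imp_div_less mult.commute)
qed

lemma sum_div_mod: "(\<Sum>p<n * k. f (p mod n) (p div (n :: nat))) = (\<Sum>j<k. \<Sum>i<n. (f i j :: real))"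
proof -
 have "(\<Sum>j<k. \<Sum>i<n. f i j) = (\<Sum>(j, i)\<in>{..<k} \<times> {..<n}. f i j)"
  by (simp add: sum.cartesian_product)
 also have "\<dots> = (\<Sum>p<n * k. f (p mod n) (p div n))"
 proof (rule sum.reindex_bij_witness[of _ "\<lambda>p. (p div n, p mod n)" "\<lambda>(j, i). i + n * j"])
  fix a assume "a \<in> {..<k} \<times> {..<n}"
  then obtain j i where a: "a = (j, i)" "j < k" "i < n" by auto
  have "i + n * j < n * (j + 1)" using a by simp
  also have "\<dots> \<le> n * k" using a by (intro mult_le_mono2) simp
  finally show "(case a of (j, i) \<Rightarrow> i + n * j) \<in> {..<n * k}" using a by simp
 qed (auto dest: div_mod_bound)
 finally show ?thesis by simp
qed

lemma colvec_carrier: "X \<in> carrier_mat a b ==> colvec X \<in> carrier_vec (a * b)"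
 by (simp add: colvec_def carrier_dim_vec)

lemma dim_colvec [simp]: "dim_vec (colvec X) = dim_row X * dim_col X"
 by (simp add: colvec_def)

lemma index_colvec: "p < dim_row X * dim_col X ==> colvec X $ p = X $$ (p mod dim_row X, p div dim_row X)"
 by (simp add: colvec_def)

lemma colvec_add:
 assumes "X \<in> carrier_mat a b" "Y \<in> carrier_mat a b"
 shows "colvec (X + Y) = colvec X + colvec Y"
 by (rule eq_vecI) (use assms div_mod_bound in \<open>auto simp: index_colvec\<close>)

lemma colvec_smult: "colvec (c \<cdot>\<^sub>m X) = c *s colvec X"
 by (rule eq_vecI) (use div_mod_bound in \<open>auto simp: index_colvec\<close>)

lemma colvec_index_pair:
 assumes X: "X \<in> carrier_mat a b" and i: "i < a" and j: "j < b"
 shows "colvec X $ (i + a * j) = X $$ (i, j)" "i + a * j < a * b"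
proof -
 have "i + a * j < a * (j + 1)" using i by simp
 also have "\<dots> \<le> a * b" using j by (intro mult_le_mono2) simp
 finally show "i + a * j < a * b" .
 then show "colvec X $ (i + a * j) = X $$ (i, j)" using X i by (simp add: index_colvec)
qed

lemma colvec_inj:
 assumes X: "X \<in> carrier_mat a b" and Y: "Y \<in> carrier_mat a b" and eq: "colvec X = colvec Y"
 shows "X = Y"
proof (rule eq_matI)
 fix i j assume "i < dim_row Y" "j < dim_col Y"
 then have "i < a" "j < b" using Y by auto
 then show "X $$ (i, j) = Y $$ (i, j)"
  using colvec_index_pair(1)[OF X, of i j] colvec_index_pair(1)[OF Y, of i j] eq by simp
qed (use X Y in auto)

lemma colvec_scalar_prod:
 assumes X: "X \<in> carrier_mat a b" and Y: "Y \<in> carrier_mat a b"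
 shows "colvec X \<bullet> colvec Y = (\<Sum>j<b. \<Sum>i<a. X $$ (i, j) * Y $$ (i, j))"
proof -
 have "colvec X \<bullet> colvec Y = (\<Sum>p<a * b. X $$ (p mod a, p div a) * Y $$ (p mod a, p div a))"
  using X Y by (simp add: scalar_prod_def lessThan_atLeast0 index_colvec)
 also have "\<dots> = (\<Sum>j<b. \<Sum>i<a. X $$ (i, j) * Y $$ (i, j))"
  by (rule sum_div_mod[of "\<lambda>i j. X $$ (i, j) * Y $$ (i, j)"])
 finally show ?thesis .
qed

lemma colvec_scalar_prod_self:
 assumes X: "X \<in> carrier_mat a b"
 shows "colvec X \<bullet> colvec X = (\<Sum>j<b. col X j \<bullet> col X j)"
 unfolding colvec_scalar_prod[OF X X] using X
 by (simp add: scalar_prod_def lessThan_atLeast0)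

lemma frob_norm_colvec: "frob_norm X = vnorm (colvec X)"
proof -
 have "X \<in> carrier_mat (dim_row X) (dim_col X)" by simp
 then show ?thesis
  unfolding frob_norm_def vnorm_def
  by (subst colvec_scalar_prod) (auto simp: power2_eq_square sum.swap[of _ "{..<dim_col X}"])
qed

lemma mult_entry:
 assumes "A \<in> carrier_mat a b" "B \<in> carrier_mat b c" "i < a" "j < c"
 shows "(A * B) $$ (i, j) = (\<Sum>k<b. A $$ (i, k) * B $$ (k, j))"
 using assms by (simp add: scalar_prod_def lessThan_atLeast0)

text \<open>The characteristic property of the Kronecker product with column stacking.\<close>

lemma kron_mult_colvec:
 assumes M: "M \<in> carrier_mat a c" and N: "N \<in> carrier_mat b d" and Z: "Z \<in> carrier_mat d c"
 shows "kron M N *v colvec Z = colvec (N * Z * M\<^sup>T)"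
proof (rule eq_vecI)
 fix i assume "i < dim_vec (colvec (N * Z * M\<^sup>T))"
 then have i: "i < b * a" using M N by simp
 note ib = div_mod_bound[OF i]
 have "(kron M N *v colvec Z) $ i = (\<Sum>p<d * c. M $$ (i div b, p div d) * N $$ (i mod b, p mod d) * Z $$ (p mod d, p div d))"
  using M N Z i by (simp add: kron_def scalar_prod_def lessThan_atLeast0 index_colvec mult.commute)
 also have "\<dots> = (\<Sum>k<c. \<Sum>l<d. M $$ (i div b, k) * N $$ (i mod b, l) * Z $$ (l, k))"
  by (rule sum_div_mod[of "\<lambda>l k. M $$ (i div b, k) * N $$ (i mod b, l) * Z $$ (l, k)"])
 also have "\<dots> = (\<Sum>k<c. (N * Z) $$ (i mod b, k) * M\<^sup>T $$ (k, i div b))"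
  using ib M by (intro sum.cong refl) (simp add: mult_entry[OF N Z] sum_distrib_left sum_distrib_right algebra_simps)
 also have "\<dots> = (N * Z * M\<^sup>T) $$ (i mod b, i div b)"
  using ib M N Z by (subst mult_entry[of _ b c _ a]) (auto simp: mat_dims)
 also have "\<dots> = colvec (N * Z * M\<^sup>T) $ i" using i M N by (simp add: index_colvec)
 finally show "(kron M N *v colvec Z) $ i = colvec (N * Z * M\<^sup>T) $ i" .
qed (use M N in \<open>simp add: kron_def\<close>)

lemma kron_dims [simp]:
 "dim_row (kron M N) = dim_row M * dim_row N" "dim_col (kron M N) = dim_col M * dim_col N"
 by (auto simp: kron_def)

lemma kron_transpose: "(kron M N)\<^sup>T = kron M\<^sup>T N\<^sup>T"
proof (rule eq_matI)
 fix i j assume "i < dim_row (kron M\<^sup>T N\<^sup>T)" "j < dim_col (kron M\<^sup>T N\<^sup>T)"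
 then have i: "i < dim_col N * dim_col M" and j: "j < dim_row N * dim_row M"
  by (auto simp: mult.commute)
 show "(kron M N)\<^sup>T $$ (i, j) = kron M\<^sup>T N\<^sup>T $$ (i, j)"
  using i j div_mod_bound[OF i] div_mod_bound[OF j] by (simp add: kron_def mult.commute)
qed auto

subsection \<open>The packed lower triangle\<close>

lemma set_tri_positions: "set (tri_positions n) = {(i, j). j \<le> i \<and> i < n}"
 by (force simp: tri_positions_def image_iff)

lemma distinct_tri_positions: "distinct (tri_positions n)"
proof -
 have "distinct (concat (map (\<lambda>j. map (\<lambda>i. (i, j)) [j..<n]) js))" if "distinct js" for js
  using that
 proof (induction js)
  case (Cons j js)
  have "distinct (map (\<lambda>i. (i, j)) [j..<n])" by (simp add: distinct_map inj_on_def)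
  then show ?case using Cons by auto
 qed simp
 then show ?thesis by (simp add: tri_positions_def)
qed

lemma length_tri_positions: "length (tri_positions n) = tri n"
proof -
 have "length (tri_positions n) = (\<Sum>j<n. n - j)"
  by (simp add: tri_positions_def length_concat comp_def interv_sum_list_conv_sum_set_nat lessThan_atLeast0)
 also have "\<dots> = (\<Sum>j<n. Suc j)"
  by (rule sum.reindex_bij_witness[of _ "\<lambda>j. n - Suc j" "\<lambda>j. n - Suc j"]) auto
 also have "\<dots> = tri n"
 proof (induction n)
  case (Suc n)
  have "Suc n * (Suc n + 1) = n * (n + 1) + 2 * Suc n" by simp
  then show ?case using Suc unfolding tri_def by simp
 qed (simp add: tri_def)
 finally show ?thesis .
qed

definition tri_pos :: "nat \<Rightarrow> nat \<Rightarrow> nat \<Rightarrow> nat" where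
 "tri_pos n i j = (THE q. q < tri n \<and> tri_positions n ! q = (max i j, min i j))"

lemma tri_pos:
 assumes "i < n" "j < n"
 shows "tri_pos n i j < tri n" "tri_positions n ! tri_pos n i j = (max i j, min i j)"
proof -
 have "(max i j, min i j) \<in> set (tri_positions n)" using assms by (auto simp: set_tri_positions)
 then have "\<exists>!q. q < tri n \<and> tri_positions n ! q = (max i j, min i j)"
  using distinct_Ex1[OF distinct_tri_positions] length_tri_positions by metis
 from theI'[OF this] show "tri_pos n i j < tri n" "tri_positions n ! tri_pos n i j = (max i j, min i j)"
  unfolding tri_pos_def by auto
qed

lemma tri_pos_unique:
 assumes q: "q < tri n" and ij: "tri_positions n ! q = (i, j)"
 shows "j \<le> i" "i < n" "tri_pos n i j = q"
proof -
 have "(i, j) \<in> set (tri_positions n)" using q ij length_tri_positions by (metis nth_mem)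
 then show b: "j \<le> i" "i < n" by (auto simp: set_tri_positions)
 have "j < n" using b by simp
 note t = tri_pos[OF b(2) this]
 show "tri_pos n i j = q"
  using t q ij b(1) nth_eq_iff_index_eq[OF distinct_tri_positions] length_tri_positions
  by (metis max.absorb1 min.absorb2)
qed

lemma tri_pos_eq_iff:
 assumes ab: "a < n" "b < n" and q: "q < tri n" and ij: "tri_positions n ! q = (i, j)"
 shows "(a, b) = (i, j) \<or> (a, b) = (j, i) \<longleftrightarrow> q = tri_pos n a b"
proof -
 note t = tri_pos_unique[OF q ij]
 have "q = tri_pos n a b \<longleftrightarrow> (max a b, min a b) = (i, j)"
 proof
  assume "(max a b, min a b) = (i, j)"
  then have "tri_pos n i j = tri_pos n a b" using t(1) by (auto simp: tri_pos_def max.absorb1 min.absorb2)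
  then show "q = tri_pos n a b" using t(3) by simp
 qed (use tri_pos(2)[OF ab] ij in simp)
 then show ?thesis using t(1) by (cases "a \<le> b") auto
qed

lemma tri_pos_commute: "tri_pos n i j = tri_pos n j i"
 by (simp add: tri_pos_def max.commute min.commute)

lemma Psi_carrier [simp]: "Psi n \<in> carrier_mat (n * n) (tri n)"
 by (simp add: Psi_def)

lemma Psi_dims [simp]: "dim_row (Psi n) = n * n" "dim_col (Psi n) = tri n"
 by (simp_all add: Psi_def)

lemma Psi_entry:
 assumes "a < n" "b < n" "q < tri n"
 shows "Psi n $$ (a + n * b, q) = (if q = tri_pos n a b then if a = b then 1 else 1 / sqrt 2 else 0)"
proof -
 obtain i j where ij: "tri_positions n ! q = (i, j)" by fastforce
 note t = tri_pos_unique[OF assms(3) ij]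
 have "a + n * b < n * (b + 1)" using assms by simp
 also have "\<dots> \<le> n * n" using assms by (intro mult_le_mono2) simp
 finally have lt: "a + n * b < n * n" .
 have iff: "(a, b) = (i, j) \<or> (a, b) = (j, i) \<longleftrightarrow> q = tri_pos n a b"
  by (rule tri_pos_eq_iff[OF assms ij])
 have "Psi n $$ (a + n * b, q) =
   (if (a, b) = (i, j) \<or> (a, b) = (j, i) then if i = j then 1 else 1 / sqrt 2 else 0)"
  using lt assms by (simp add: Psi_def Let_def ij)
 also have "\<dots> = (if q = tri_pos n a b then if a = b then 1 else 1 / sqrt 2 else 0)"
  using iff by auto
 finally show ?thesis .
qed

text \<open>\<open>smat n\<close> unpacks a vector to a symmetric matrix; it is the inverse of \<open>vecS\<close> on symmetric
 matrices, so it computes \<open>matS\<close>.\<close>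

definition smat :: "nat \<Rightarrow> real vec \<Rightarrow> real mat" where
 "smat n x = mat n n (\<lambda>(i, j). (if i = j then 1 else 1 / sqrt 2) * x $ tri_pos n i j)"

lemma smat_sym: "smat n x \<in> sym_mats n"
 unfolding sym_mats_def smat_def by (auto intro!: eq_matI simp: tri_pos_commute)

lemma smat_carrier [simp]: "smat n x \<in> carrier_mat n n"
 by (simp add: smat_def)

lemma smat_dims [simp]: "dim_row (smat n x) = n" "dim_col (smat n x) = n"
 by (simp_all add: smat_def)

lemma Psi_mult_vec:
 assumes x: "x \<in> carrier_vec (tri n)"
 shows "Psi n *v x = colvec (smat n x)"
proof (rule eq_vecI)
 fix p assume "p < dim_vec (colvec (smat n x))"
 then have p: "p < n * n" by simp
 note pb = div_mod_bound[OF p]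
 have "(Psi n *v x) $ p = (\<Sum>q<tri n. Psi n $$ (p mod n + n * (p div n), q) * x $ q)"
  using p x by (simp add: scalar_prod_def lessThan_atLeast0)
 also have "\<dots> = (\<Sum>q<tri n. if q = tri_pos n (p mod n) (p div n)
   then (if p mod n = p div n then 1 else 1 / sqrt 2) * x $ q else 0)"
  by (rule sum.cong) (simp_all only: Psi_entry[OF pb(1,2)] lessThan_iff if_distrib[of "\<lambda>c. c * _"] mult_zero_left)
 also have "\<dots> = (if p mod n = p div n then 1 else 1 / sqrt 2) * x $ tri_pos n (p mod n) (p div n)"
  using tri_pos(1)[OF pb(1,2)] by simp
 finally show "(Psi n *v x) $ p = colvec (smat n x) $ p"
  using p pb by (simp add: index_colvec smat_def)
qed simp

lemma vecS_carrier [simp]: "vecS X \<in> carrier_vec (tri (dim_row X))"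
 unfolding vecS_def carrier_vec_def by simp

lemma dim_vecS [simp]: "dim_vec (vecS X) = tri (dim_row X)"
 by (simp add: vecS_def)

lemma index_vecS:
 assumes X: "X \<in> carrier_mat n n" and q: "q < tri n" and ij: "tri_positions n ! q = (i, j)"
 shows "vecS X $ q = (if i = j then X $$ (i, i) else (X $$ (i, j) + X $$ (j, i)) / sqrt 2)"
proof -
 note t = tri_pos_unique[OF q ij]
 then have jn: "j < n" by simp
 have "vecS X $ q = (\<Sum>p<n * n. Psi n $$ (p mod n + n * (p div n), q) * X $$ (p mod n, p div n))"
  using X q unfolding vecS_def by (simp add: scalar_prod_def lessThan_atLeast0 index_colvec)
 also have "\<dots> = (\<Sum>b<n. \<Sum>a<n. Psi n $$ (a + n * b, q) * X $$ (a, b))"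
  by (rule sum_div_mod[of "\<lambda>a b. Psi n $$ (a + n * b, q) * X $$ (a, b)"])
 also have "\<dots> = (\<Sum>b<n. \<Sum>a<n. if (a, b) = (i, j) \<or> (a, b) = (j, i)
   then (if i = j then 1 else 1 / sqrt 2) * X $$ (a, b) else 0)"
 proof (intro sum.cong refl)
  fix a b assume "b \<in> {..<n}" "a \<in> {..<n}"
  then have ab: "a < n" "b < n" by auto
  have "(a, b) = (i, j) \<or> (a, b) = (j, i) \<longleftrightarrow> q = tri_pos n a b"
   by (rule tri_pos_eq_iff[OF ab q ij])
  then show "Psi n $$ (a + n * b, q) * X $$ (a, b) = (if (a, b) = (i, j) \<or> (a, b) = (j, i)
   then (if i = j then 1 else 1 / sqrt 2) * X $$ (a, b) else 0)"
   using Psi_entry[OF ab q] by auto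
 qed
 also have "\<dots> = (if i = j then X $$ (i, i) else (X $$ (i, j) + X $$ (j, i)) / sqrt 2)"
 proof (cases "i = j")
  case True
  have "(\<Sum>b<n. \<Sum>a<n. if (a, b) = (i, j) \<or> (a, b) = (j, i)
   then (if i = j then 1 else 1 / sqrt 2) * X $$ (a, b) else 0)
   = (\<Sum>b<n. if b = i then (\<Sum>a<n. if a = i then X $$ (a, b) else 0) else 0)"
   using True by (intro sum.cong) auto
  then show ?thesis using True t by simp
 next
  case False
  have "(\<Sum>b<n. \<Sum>a<n. if (a, b) = (i, j) \<or> (a, b) = (j, i)
   then (if i = j then 1 else 1 / sqrt 2) * X $$ (a, b) else 0)
   = (\<Sum>b<n. (if b = j then (\<Sum>a<n. if a = i then 1 / sqrt 2 * X $$ (a, b) else 0) else 0)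
     + (if b = i then (\<Sum>a<n. if a = j then 1 / sqrt 2 * X $$ (a, b) else 0) else 0))"
   using False by (intro sum.cong) (auto intro!: sum.cong)
  then show ?thesis using False t jn by (simp add: sum.distrib add_divide_distrib)
 qed
 finally show ?thesis .
qed

lemma vecS_smat:
 assumes x: "x \<in> carrier_vec (tri n)"
 shows "vecS (smat n x) = x"
proof (rule eq_vecI)
 fix q assume "q < dim_vec x"
 then have q: "q < tri n" using x by simp
 obtain i j where ij: "tri_positions n ! q = (i, j)" by fastforce
 note t = tri_pos_unique[OF q ij]
 have "sqrt 2 * sqrt 2 = (2 :: real)" by simp
 then have "(y / sqrt 2 + y / sqrt 2) / sqrt 2 = y" for y :: real by (simp add: field_simps)
 then show "vecS (smat n x) $ q = x $ q"
  unfolding index_vecS[OF smat_carrier q ij] using t by (auto simp: smat_def tri_pos_commute[of n j i])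
qed (use x in simp)

lemma sym_matsD: "X \<in> sym_mats n ==> X \<in> carrier_mat n n" "X \<in> sym_mats n ==> dim_row X = n"
 "X \<in> sym_mats n ==> dim_col X = n" "X \<in> sym_mats n ==> X\<^sup>T = X"
 unfolding sym_mats_def by auto

lemma smat_vecS:
 assumes X: "X \<in> sym_mats n"
 shows "smat n (vecS X) = X"
proof (rule eq_matI)
 note Xc = sym_matsD(1)[OF X] and Xt = sym_matsD(4)[OF X]
 fix i j assume "i < dim_row X" "j < dim_col X"
 then have ij: "i < n" "j < n" using Xc by auto
 note t = tri_pos[OF ij]
 have sw: "X $$ (j, i) = X $$ (i, j)" using arg_cong[OF Xt, of "\<lambda>A. A $$ (i, j)"] ij Xc by simp
 have s2: "sqrt 2 * sqrt 2 = (2 :: real)" by simp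
 have "X $$ (max i j, min i j) = X $$ (i, j)" "X $$ (min i j, max i j) = X $$ (i, j)"
  using sw by (simp_all add: max_def min_def)
 then show "smat n (vecS X) $$ (i, j) = X $$ (i, j)"
  using ij s2 by (auto simp: smat_def index_vecS[OF Xc t(1) t(2)] field_simps max_def min_def split: if_splits)
qed (use X in \<open>auto simp: sym_mats_def\<close>)

lemma matS_eq_smat:
 assumes x: "x \<in> carrier_vec (tri n)"
 shows "matS n x = smat n x"
 unfolding matS_def
proof (rule the_equality)
 show "smat n x \<in> sym_mats n \<and> vecS (smat n x) = x" using smat_sym vecS_smat[OF x] by simp
 fix X assume "X \<in> sym_mats n \<and> vecS X = x"
 then show "X = smat n x" using smat_vecS[of X n] by auto
qed

lemma Psi_mult_vecS:
 assumes X: "X \<in> sym_mats n"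
 shows "Psi n *v vecS X = colvec X"
 using Psi_mult_vec[of "vecS X" n] smat_vecS[OF X] sym_matsD[OF X] by (simp add: carrier_dim_vec)

lemma vecS_scalar_prod:
 assumes X: "X \<in> carrier_mat n n" and Y: "Y \<in> sym_mats n"
 shows "vecS X \<bullet> vecS Y = colvec X \<bullet> colvec Y"
proof -
 have "vecS X \<bullet> vecS Y = colvec X \<bullet> (Psi n *v vecS Y)"
  unfolding vecS_def[of X] using X sym_matsD[OF Y]
  by (subst transpose_vec_mult_scalar[of _ "n * n" "tri n"]) (auto simp: carrier_dim_vec)
 then show ?thesis using Psi_mult_vecS[OF Y] by simp
qed

lemma vnorm_vecS: "X \<in> sym_mats n ==> vnorm (vecS X) = frob_norm X"
 using vecS_scalar_prod[of X n X] sym_matsD[of X n] by (simp add: vnorm_def frob_norm_colvec)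

lemma vecS_add:
 assumes "X \<in> carrier_mat n n" "Y \<in> carrier_mat n n"
 shows "vecS (X + Y) = vecS X + vecS Y"
 using assms unfolding vecS_def by (simp add: colvec_add[OF assms] mult_vec_add_dim)

lemma vecS_smult:
 assumes "X \<in> carrier_mat n n"
 shows "vecS (c \<cdot>\<^sub>m X) = c *s vecS X"
 using assms unfolding vecS_def by (simp add: colvec_smult mult_vec_smult_dim)

lemma vecS_minus:
 assumes X: "X \<in> carrier_mat n n" and Y: "Y \<in> carrier_mat n n"
 shows "vecS (X - Y) = vecS X - vecS Y"
proof -
 have "X - Y = X + (- 1) \<cdot>\<^sub>m Y" by (rule eq_matI) (use X Y in auto)
 then have "vecS (X - Y) = vecS X + (- 1) *s vecS Y"
  using vecS_add[OF X, of "(- 1) \<cdot>\<^sub>m Y"] vecS_smult[OF Y, of "- 1"] Y by simp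
 then show ?thesis using X Y by (intro eq_vecI) auto
qed

lemma vecS_inj:
 assumes "X \<in> sym_mats n" "Y \<in> sym_mats n" "vecS X = vecS Y"
 shows "X = Y"
 by (metis assms smat_vecS)

lemma symkron_dims [simp]: "dim_row (symkron M N) = tri (dim_row M)" "dim_col (symkron M N) = tri (dim_col M)"
 by (simp_all add: symkron_def)

lemma smult_smult_half: "(1 / 2) \<cdot>\<^sub>m (2 \<cdot>\<^sub>m M) = (M :: real mat)"
 by (rule eq_matI) simp_all

lemma symkron_self: "symkron M M = (Psi (dim_row M))\<^sup>T * (kron M M * Psi (dim_col M))"
proof -
 have "kron M M + kron M M = 2 \<cdot>\<^sub>m kron M M" by (rule eq_matI) auto
 then show ?thesis unfolding symkron_def
  by (simp add: mult_smult_dim smult_mult_dim mat_dims smult_smult_half)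
qed

lemma symkron_mult_vecS:
 assumes M: "M \<in> carrier_mat a c" and X: "X \<in> sym_mats c"
 shows "symkron M M *v vecS X = vecS (M * X * M\<^sup>T)"
proof -
 have "symkron M M *v vecS X = (Psi a)\<^sup>T *v (kron M M *v (Psi c *v vecS X))"
  using M sym_matsD[OF X] unfolding symkron_self by (simp add: mat_dims)
 also have "\<dots> = vecS (M * X * M\<^sup>T)"
  unfolding Psi_mult_vecS[OF X] kron_mult_colvec[OF M M sym_matsD(1)[OF X]]
  using M by (simp add: vecS_def)
 finally show ?thesis .
qed

lemma symkron_transpose: "(symkron M M)\<^sup>T = symkron M\<^sup>T M\<^sup>T"
 unfolding symkron_self by (simp add: mat_dims kron_transpose)

lemma conj_sym:
 assumes M: "M \<in> carrier_mat a c" and X: "X \<in> sym_mats c"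
 shows "M * X * M\<^sup>T \<in> sym_mats a"
 using M sym_matsD[OF X] unfolding sym_mats_def by (simp add: mat_dims)

section \<open>Coordinates in the eigenbasis of the scaling point\<close>

definition had :: "(nat \<Rightarrow> nat \<Rightarrow> real) \<Rightarrow> real mat \<Rightarrow> real mat" where
 "had f T = mat (dim_row T) (dim_col T) (\<lambda>(i, j). f i j * T $$ (i, j))"

lemma had_dims [simp]: "dim_row (had f T) = dim_row T" "dim_col (had f T) = dim_col T"
 by (simp_all add: had_def)

lemma had_index [simp]: "i < dim_row T ==> j < dim_col T ==> had f T $$ (i, j) = f i j * T $$ (i, j)"
 by (simp add: had_def)

lemma sym_index:
 assumes "T \<in> sym_mats n" "i < n" "j < n"
 shows "T $$ (i, j) = T $$ (j, i)"
 using arg_cong[OF sym_matsD(4)[OF assms(1)], of "\<lambda>A. A $$ (i, j)"] assms sym_matsD(2,3)[OF assms(1)] by simp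

lemma had_sym:
 assumes T: "T \<in> sym_mats n" and f: "\<And>i j. i < n ==> j < n ==> f i j = f j i"
 shows "had f T \<in> sym_mats n"
proof -
 note t = sym_matsD[OF T]
 have "(had f T)\<^sup>T = had f T"
 proof (rule eq_matI)
  fix i j assume "i < dim_row (had f T)" "j < dim_col (had f T)"
  then have ij: "i < n" "j < n" using t by auto
  have "T $$ (j, i) = T $$ (i, j)" by (rule sym_index[OF T ij(2,1)])
  then show "(had f T)\<^sup>T $$ (i, j) = had f T $$ (i, j)" using ij t f[OF ij] by simp
 qed (use t in auto)
 then show ?thesis unfolding sym_mats_def using t by auto
qed

lemma mult_diag_transpose_entry:
 assumes "A \<in> carrier_mat a k" "B \<in> carrier_mat b k" "i < a" "j < b"
 shows "(A * mat_diag k f * B\<^sup>T) $$ (i, j) = (\<Sum>q<k. A $$ (i, q) * f q * B $$ (j, q))"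
proof -
 have "A * mat_diag k f = mat a k (\<lambda>(i, j). A $$ (i, j) * f j)"
  by (rule mat_diag_mult_right[OF assms(1)])
 then show ?thesis using assms by (subst mult_entry[of _ a k _ b]) auto
qed

lemma sum_split: "(\<Sum>q<r + (s :: nat). g q) = (\<Sum>q<r. g q) + (\<Sum>q<s. (g (r + q) :: real))"
 by (induction s) (simp_all add: add.assoc)

lemma hcat_index:
 assumes "Q \<in> carrier_mat n r" "P \<in> carrier_mat n s" "i < n" "j < r + s"
 shows "hcat Q P $$ (i, j) = (if j < r then Q $$ (i, j) else P $$ (i, j - r))"
 using assms by (simp add: hcat_def)

lemma hcat_carrier: "Q \<in> carrier_mat n r ==> P \<in> carrier_mat n s ==> hcat Q P \<in> carrier_mat n (r + s)"
 by (auto simp: hcat_def)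

lemma transpose_mult_mult_entry:
 fixes A B H :: "real mat"
 assumes "A \<in> carrier_mat n a" "B \<in> carrier_mat n b" "H \<in> carrier_mat n n" "i < a" "j < b"
 shows "(A\<^sup>T * H * B) $$ (i, j) = col A i \<bullet> (H *v col B j)"
proof -
 have "(A\<^sup>T * H * B) $$ (i, j) = (A\<^sup>T * (H * B)) $$ (i, j)" using assms by (simp add: mat_dims)
 also have "\<dots> = col A i \<bullet> col (H * B) j" using assms by simp
 also have "col (H * B) j = H *v col B j" by (rule col_mult2[OF assms(3,2,5)])
 finally show ?thesis .
qed

lemma diag_block_mat_pair:
 "diag_block_mat [A, B] = four_block_mat A (0\<^sub>m (dim_row A) (dim_col B)) (0\<^sub>m (dim_row B) (dim_col A)) (B :: real mat)"
proof -
 have "diag_block_mat [B] = B" by (rule diag_block_mat_singleton)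
 then show ?thesis by (simp only: diag_block_mat.simps Let_def)
qed

lemma smult_one_mult_vec: "x \<in> carrier_vec k ==> (c \<cdot>\<^sub>m 1\<^sub>m k) *v x = c *s (x :: real vec)"
 by (rule eq_vecI) (auto simp: scalar_prod_smult_left)

lemma zero_mat_mult_vec: "x \<in> carrier_vec b ==> 0\<^sub>m a b *v x = (0\<^sub>v a :: real vec)"
 by (rule eq_vecI) (auto simp: scalar_prod_def)

lemma diag_block_mult_vec:
 assumes A: "A \<in> carrier_mat a a'" and B: "B \<in> carrier_mat b b'"
  and x: "x \<in> carrier_vec a'" and y: "y \<in> carrier_vec (b' :: nat)"
 shows "four_block_mat A (0\<^sub>m a b') (0\<^sub>m b a') B *v (x @\<^sub>v y) = (A *v x) @\<^sub>v (B *v y :: real vec)"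
proof -
 have "four_block_mat A (0\<^sub>m a b') (0\<^sub>m b a') B *v (x @\<^sub>v y) =
   (A *v x + 0\<^sub>m a b' *v y) @\<^sub>v (0\<^sub>m b a' *v x + B *v y)"
  by (rule four_block_mat_mult_vec[OF A _ _ B x y]) simp_all
 moreover have "A *v x \<in> carrier_vec a" "B *v y \<in> carrier_vec b" using A B x y by auto
 ultimately show ?thesis by (simp add: zero_mat_mult_vec[OF x] zero_mat_mult_vec[OF y])
qed

definition ip :: "real mat \<Rightarrow> real mat \<Rightarrow> real" where
 "ip S T = colvec S \<bullet> colvec T"

lemma ip_eq: "S \<in> carrier_mat n n ==> T \<in> carrier_mat n n ==> ip S T = (\<Sum>j<n. \<Sum>i<n. S $$ (i, j) * T $$ (i, j))"
 unfolding ip_def by (rule colvec_scalar_prod)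

lemma ip_had:
 assumes "S \<in> carrier_mat n n" "T \<in> carrier_mat n n"
 shows "ip S (had f T) = (\<Sum>j<n. \<Sum>i<n. f i j * (S $$ (i, j) * T $$ (i, j)))"
proof -
 have "had f T \<in> carrier_mat n n" by (rule carrier_matI) (use assms in auto)
 from ip_eq[OF assms(1) this] show ?thesis using assms(2) by (simp add: algebra_simps)
qed

text \<open>The setting: \<open>W\<close> is positive definite and \<open>[Q, Q\<^sub>\<perp>]\<close> is an orthonormal eigenbasis, split after
 the top \<open>r\<close> eigenvalues.  A packed symmetric matrix is described by its coordinate matrix \<open>T\<close>
 through \<open>up T\<close>, the packing of \<open>V T V\<^sup>T\<close>; all operators of the algorithm act entrywise on \<open>T\<close>.\<close>

locale eigenbasis =
 fixes n r :: nat and W Q Qp :: "real mat"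
 assumes part: "eig_partition n r W Q Qp" and rn: "r < n" and Wpd: "W \<in> pd_mats n"
begin

definition V where "V = hcat Q Qp"
definition ev where "ev i = lam W (i + 1)"
abbreviation t where "t \<equiv> tau W r"
definition ec where "ec i = (if i < r then 1 else ev i / t)"
definition up where "up T = vecS (V * T * V\<^sup>T)"
definition dn where "dn x = V\<^sup>T * smat n x * V"

lemma Q: "Q \<in> carrier_mat n r" and Qp: "Qp \<in> carrier_mat n (n - r)"
 using part by (auto simp: eig_partition_def)

lemma V: "orth_mat n V"
 using part hcat_carrier[OF Q Qp] rn by (intro orth_matI) (auto simp: V_def eig_partition_def)

lemmas VD = orth_matD[OF V]

lemma V_index: "i < n ==> j < n ==> V $$ (i, j) = (if j < r then Q $$ (i, j) else Qp $$ (i, j - r))"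
 using hcat_index[OF Q Qp] rn by (simp add: V_def)

lemma col_V: "j < r ==> col V j = col Q j" "j < n - r ==> col V (r + j) = col Qp j"
 using Q Qp VD rn by (auto intro!: eq_vecI simp: V_index)

lemma spectral_V_split:
 "spectral V f = Q * mat_diag r f * Q\<^sup>T + Qp * mat_diag (n - r) (\<lambda>i. f (r + i)) * Qp\<^sup>T"
proof (rule eq_matI)
 let ?R = "Q * mat_diag r f * Q\<^sup>T + Qp * mat_diag (n - r) (\<lambda>i. f (r + i)) * Qp\<^sup>T"
 fix i j assume "i < dim_row ?R" "j < dim_col ?R"
 then have ij: "i < n" "j < n" using Qp by auto
 have "spectral V f $$ (i, j) = (V * mat_diag n f * V\<^sup>T) $$ (i, j)"
  using VD by (simp add: spectral_def mat_dims)
 also have "\<dots> = (\<Sum>q<r + (n - r). V $$ (i, q) * f q * V $$ (j, q))"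
  using mult_diag_transpose_entry[OF VD(1) VD(1) ij] rn by simp
 also have "\<dots> = ?R $$ (i, j)"
  unfolding sum_split using ij rn Q Qp
  by (simp add: mult_diag_transpose_entry[OF Q Q] mult_diag_transpose_entry[OF Qp Qp] V_index
    del: index_mult_mat(1))
 finally show "spectral V f $$ (i, j) = ?R $$ (i, j)" .
qed (use Q Qp spectral_carrier[OF V, of f] in auto)

lemma W_spectral: "W = spectral V ev"
proof -
 have "dim_row W = n" using Wpd by (auto simp: pd_mats_def sym_mats_def)
 moreover have "ev = (\<lambda>i. lam W (i + 1))" by (auto simp: ev_def)
 ultimately show ?thesis
  using part unfolding spectral_V_split
  by (simp add: eig_partition_def Lam_top_def Lam_bot_def add.assoc)
qed

lemma dimW: "dim_row W = n" "dim_col W = n"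
 using Wpd by (auto simp: pd_mats_def sym_mats_def)

lemma ev_pos: "i < n ==> 0 < ev i"
proof -
 assume i: "i < n"
 obtain x where x: "x \<in> carrier_vec n" "x \<bullet> x = 1" "x \<bullet> (spectral V ev *v x) = ev i"
  using spectral_eigenvalue_bound[OF V i] by blast
 have "x \<noteq> 0\<^sub>v n" using x(2) by auto
 then have "0 < x \<bullet> (W *v x)" using Wpd x(1) by (auto simp: pd_mats_def)
 then show ?thesis using x(3) W_spectral by simp
qed

lemma ev_antimono: "i \<le> j ==> j < n ==> ev j \<le> ev i"
 unfolding ev_def by (rule lam_antimono[OF V W_spectral])

lemma tau_ev: "t = ev r / 2"
 by (simp add: tau_def ev_def)

lemma tau_pos: "0 < t"
 using ev_pos[OF rn] by (simp add: tau_ev)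

lemma ev_top: "i < r ==> 2 * t \<le> ev i"
 using ev_antimono[of i r] rn by (simp add: tau_ev)

lemma ev_bot: "r \<le> i ==> i < n ==> ev i \<le> 2 * t"
 using ev_antimono[of r i] by (simp add: tau_ev)

lemma E_spectral: "Q * Q\<^sup>T + (1 / t) \<cdot>\<^sub>m (Qp * Lam_bot W r * Qp\<^sup>T) = spectral V ec"
proof -
 have o: "mat_diag r ec = 1\<^sub>m r" by (rule eq_matI) (auto simp: mat_diag_def ec_def)
 have b: "mat_diag (n - r) (\<lambda>i. ec (r + i)) = (1 / t) \<cdot>\<^sub>m Lam_bot W r"
  unfolding Lam_bot_def by (rule eq_matI) (auto simp: mat_diag_def ec_def ev_def dimW)
 have "dim_row (Lam_bot W r) = n - r" "dim_col (Lam_bot W r) = n - r" by (simp_all add: Lam_bot_def dimW)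
 then show ?thesis
  unfolding spectral_V_split o b using Q Qp by (simp add: mult_smult_dim smult_mult_dim)
qed

subsection \<open>The coordinate map\<close>

lemma conj_V_sym: "T \<in> sym_mats n ==> V * T * V\<^sup>T \<in> sym_mats n"
 by (rule conj_sym[OF VD(1)])

lemma up_carrier: "up T \<in> carrier_vec (tri n)"
 using vecS_carrier[of "V * T * V\<^sup>T"] VD by (simp add: up_def)

lemma dn_sym: "dn x \<in> sym_mats n"
 using conj_sym[of "V\<^sup>T" n n "smat n x"] VD smat_sym by (simp add: dn_def)

lemma conj_V_cancel: "T \<in> carrier_mat n n ==> V\<^sup>T * (V * T * V\<^sup>T) * V = T"
proof -
 assume T: "T \<in> carrier_mat n n"
 have "V\<^sup>T * (V * T * V\<^sup>T) * V = (V\<^sup>T * V) * T * (V\<^sup>T * V)" using VD(1) T by (simp add: mat_dims)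
 then show ?thesis unfolding VD(3) using T by simp
qed

lemma conj_V_cancel': "T \<in> carrier_mat n n ==> V * (V\<^sup>T * T * V) * V\<^sup>T = T"
proof -
 assume T: "T \<in> carrier_mat n n"
 have "V * (V\<^sup>T * T * V) * V\<^sup>T = (V * V\<^sup>T) * T * (V * V\<^sup>T)" using VD(1) T by (simp add: mat_dims)
 then show ?thesis unfolding VD(4) using T by simp
qed

lemma up_dn: "x \<in> carrier_vec (tri n) ==> up (dn x) = x"
 unfolding up_def dn_def by (simp add: conj_V_cancel' vecS_smat)

lemma conj_V_isometry:
 assumes T: "S \<in> carrier_mat n n" "T \<in> carrier_mat n n"
 shows "ip (V * S * V\<^sup>T) (V * T * V\<^sup>T) = ip S T"
proof -
 let ?K = "kron V V"
 have c: "colvec (V * S * V\<^sup>T) = ?K *v colvec S" if "S \<in> carrier_mat n n" for S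
  using kron_mult_colvec[OF VD(1) VD(1) that] by simp
 have K: "?K \<in> carrier_mat (n * n) (n * n)" using VD by (metis carrier_matI kron_dims)
 have "?K\<^sup>T *v (?K *v colvec S) = colvec S"
  unfolding c[OF T(1), symmetric] kron_transpose
  using kron_mult_colvec[of "V\<^sup>T" n n "V\<^sup>T" n n "V * S * V\<^sup>T"] VD(1,2) conj_V_cancel[OF T(1)] T
  by (simp add: mat_dims)
 then show ?thesis
  unfolding ip_def c[OF T(1)] c[OF T(2)]
  using transpose_vec_mult_scalar[OF K, of "colvec T" "?K *v colvec S"] K T
   colvec_carrier[OF T(1)] colvec_carrier[OF T(2)] by simp
qed

lemma up_scalar_prod:
 assumes "S \<in> sym_mats n" "T \<in> sym_mats n"
 shows "up S \<bullet> up T = ip S T"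
 unfolding up_def
 using vecS_scalar_prod[OF sym_matsD(1)[OF conj_V_sym[OF assms(1)]] conj_V_sym[OF assms(2)]]
  conj_V_isometry[of S T] assms sym_matsD(1) by (simp add: ip_def)

lemma up_eqI:
 assumes x: "x \<in> carrier_vec (tri n)" and T: "T \<in> sym_mats n"
  and eq: "\<And>S. S \<in> sym_mats n ==> x \<bullet> up S = ip T S"
 shows "x = up T"
proof -
 have "dn x = T"
 proof (rule eq_matI)
  fix i j assume "i < dim_row T" "j < dim_col T"
  then have ij: "i < n" "j < n" using sym_matsD[OF T] by auto
  note d = dn_sym[of x]
  define S where "S = mat n n (\<lambda>(a, b). if (a, b) = (i, j) \<or> (a, b) = (j, i) then 1 else 0 :: real)"
  have S: "S \<in> sym_mats n" unfolding sym_mats_def S_def by (auto intro!: eq_matI)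
  have ipS: "ip U S = (if i = j then U $$ (i, j) else 2 * U $$ (i, j))" if U: "U \<in> sym_mats n" for U
  proof -
   have "ip U S = (\<Sum>b<n. \<Sum>a<n. if (a, b) = (i, j) \<or> (a, b) = (j, i) then U $$ (a, b) else 0)"
    using sym_matsD[OF U] unfolding ip_eq[OF sym_matsD(1)[OF U] sym_matsD(1)[OF S]]
    by (intro sum.cong refl) (auto simp: S_def)
   also have "\<dots> = (if i = j then U $$ (i, j) else U $$ (i, j) + U $$ (j, i))"
   proof (cases "i = j")
    case True
    have "(\<Sum>b<n. \<Sum>a<n. if (a, b) = (i, j) \<or> (a, b) = (j, i) then U $$ (a, b) else 0)
     = (\<Sum>b<n. if b = i then (\<Sum>a<n. if a = i then U $$ (a, b) else 0) else 0)"
     using True by (intro sum.cong) auto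
    then show ?thesis using True ij by simp
   next
    case False
    have "(\<Sum>b<n. \<Sum>a<n. if (a, b) = (i, j) \<or> (a, b) = (j, i) then U $$ (a, b) else 0)
     = (\<Sum>b<n. (if b = j then (\<Sum>a<n. if a = i then U $$ (a, b) else 0) else 0)
       + (if b = i then (\<Sum>a<n. if a = j then U $$ (a, b) else 0) else 0))"
     using False by (intro sum.cong) (auto intro!: sum.cong)
    then show ?thesis using False ij by (simp add: sum.distrib)
   qed
   finally show ?thesis using sym_index[OF U ij] by simp
  qed
  have "ip (dn x) S = ip T S"
   using up_scalar_prod[OF d S] up_dn[OF x] eq[OF S] by simp
  then show "dn x $$ (i, j) = T $$ (i, j)" unfolding ipS[OF d] ipS[OF T] by (simp split: if_splits)
 qed (use sym_matsD[OF T] sym_matsD[OF dn_sym] in auto)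
 then show ?thesis using up_dn[OF x] by simp
qed

lemma spectral_conj:
 assumes T: "T \<in> sym_mats n"
 shows "spectral V f * (V * T * V\<^sup>T) * (spectral V f)\<^sup>T = V * had (\<lambda>i j. f i * f j) T * V\<^sup>T"
proof -
 note Tc = sym_matsD[OF T]
 have "spectral V f * (V * T * V\<^sup>T) * (spectral V f)\<^sup>T =
   V * (mat_diag n f * ((V\<^sup>T * V) * T * (V\<^sup>T * V)) * mat_diag n f) * V\<^sup>T"
  using VD(1) Tc by (simp add: spectral_def mat_dims)
 also have "\<dots> = V * (mat_diag n f * T * mat_diag n f) * V\<^sup>T" unfolding VD(3) using Tc by simp
 also have "mat_diag n f * T = mat n n (\<lambda>(i, j). f i * T $$ (i, j))"
  by (rule mat_diag_mult_left[OF Tc(1)])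
 also have "\<dots> * mat_diag n f = had (\<lambda>i j. f i * f j) T"
  using Tc by (subst mat_diag_mult_right[of _ n n]) (auto intro!: eq_matI simp: had_def)
 finally show ?thesis .
qed

lemma symkron_spectral_up:
 assumes T: "T \<in> sym_mats n"
 shows "symkron (spectral V f) (spectral V f) *v up T = up (had (\<lambda>i j. f i * f j) T)"
 unfolding up_def symkron_mult_vecS[OF spectral_carrier[OF V] conj_V_sym[OF T]] spectral_conj[OF T] ..

definition ee where "ee i j = ec i * ec j"

lemma bigE_up: "T \<in> sym_mats n ==> bigE W r Q Qp *v up T = up (had ee T)"
 unfolding bigE_def Let_def E_spectral ee_def by (rule symkron_spectral_up)

lemma WW_up: "T \<in> sym_mats n ==> symkron W W *v up T = up (had (\<lambda>i j. ev i * ev j) T)"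
 using symkron_spectral_up[of T ev] W_spectral by simp

subsection \<open>The low-rank block\<close>

text \<open>Vectors \<open>v\<close> multiplied by \<open>bigQ\<close> correspond to the coordinate matrices whose lower right
 \<open>(n - r) \<times> (n - r)\<close> block vanishes; \<open>pack\<close> reads such a vector off, the factor \<open>sqrt 2\<close> accounting for
 the off-diagonal block that is stored once.\<close>

definition tblk where "tblk T = mat r r (\<lambda>(i, j). T $$ (i, j) :: real)"
definition lblk where "lblk T = mat (n - r) r (\<lambda>(i, j). T $$ (r + i, j) :: real)"
definition pack where "pack T = vecS (tblk T) @\<^sub>v (sqrt 2 *s colvec (lblk T))"
definition msk :: "nat \<Rightarrow> nat \<Rightarrow> real" where "msk i j = (if i < r \<or> j < r then 1 else 0)"
definition d where "d = tri r + r * (n - r)"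

lemma top_sym: "T \<in> sym_mats n ==> tblk T \<in> sym_mats r"
 using sym_index[of T n] rn unfolding sym_mats_def[of r] by (auto simp: tblk_def intro!: eq_matI)

lemma low_carrier: "lblk T \<in> carrier_mat (n - r) r"
 by (simp add: lblk_def)

lemma pack_carrier: "pack T \<in> carrier_vec d"
 by (simp add: pack_def d_def carrier_dim_vec tblk_def lblk_def mult.commute)

lemma bigQ_dims: "dim_row (bigQ Q Qp) = tri n" "dim_col (bigQ Q Qp) = d"
 using Q Qp by (simp_all add: bigQ_def hcat_def d_def)

lemma bigQ_carrier: "bigQ Q Qp \<in> carrier_mat (tri n) d"
 by (rule carrier_matI) (use bigQ_dims in auto)

lemma hcat_transpose_mult_vec:
 assumes M: "M \<in> carrier_mat a b" and N: "N \<in> carrier_mat a c" and x: "x \<in> carrier_vec a"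
 shows "(hcat M N)\<^sup>T *v x = (M\<^sup>T *v x) @\<^sub>v (N\<^sup>T *v x)"
proof (rule eq_vecI)
 have h: "hcat M N \<in> carrier_mat a (b + c)" by (rule hcat_carrier[OF M N])
 fix i assume "i < dim_vec ((M\<^sup>T *v x) @\<^sub>v (N\<^sup>T *v x))"
 then have i: "i < b + c" using M N by simp
 have "col (hcat M N) i = (if i < b then col M i else col N (i - b))"
  using i M N h by (intro eq_vecI) (auto simp: hcat_index[OF M N])
 then show "((hcat M N)\<^sup>T *v x) $ i = ((M\<^sup>T *v x) @\<^sub>v (N\<^sup>T *v x)) $ i"
  using i M N h by auto
qed (use M N hcat_carrier[OF M N] in auto)

lemma top_conj:
 assumes T: "T \<in> sym_mats n"
 shows "Q\<^sup>T * (V * T * V\<^sup>T) * Q = tblk T"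
proof (rule eq_matI)
 note h = sym_matsD[OF conj_V_sym[OF T]]
 fix i j assume "i < dim_row (tblk T)" "j < dim_col (tblk T)"
 then have ij: "i < r" "j < r" by (auto simp: tblk_def)
 have "(Q\<^sup>T * (V * T * V\<^sup>T) * Q) $$ (i, j) = (V\<^sup>T * (V * T * V\<^sup>T) * V) $$ (i, j)"
  using ij rn by (simp add: transpose_mult_mult_entry[OF Q Q h(1)] transpose_mult_mult_entry[OF VD(1) VD(1) h(1)]
    col_V del: index_mult_mat)
 then show "(Q\<^sup>T * (V * T * V\<^sup>T) * Q) $$ (i, j) = tblk T $$ (i, j)"
  using ij by (simp add: conj_V_cancel[OF sym_matsD(1)[OF T]] tblk_def)
qed (use Q in \<open>auto simp: tblk_def\<close>)

lemma low_conj: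
 assumes T: "T \<in> sym_mats n"
 shows "Qp\<^sup>T * (V * T * V\<^sup>T) * Q = lblk T"
proof (rule eq_matI)
 note h = sym_matsD[OF conj_V_sym[OF T]]
 fix i j assume "i < dim_row (lblk T)" "j < dim_col (lblk T)"
 then have ij: "i < n - r" "j < r" by (auto simp: lblk_def)
 have "(Qp\<^sup>T * (V * T * V\<^sup>T) * Q) $$ (i, j) = (V\<^sup>T * (V * T * V\<^sup>T) * V) $$ (r + i, j)"
  using ij rn by (simp add: transpose_mult_mult_entry[OF Qp Q h(1)] transpose_mult_mult_entry[OF VD(1) VD(1) h(1)]
    col_V del: index_mult_mat)
 then show "(Qp\<^sup>T * (V * T * V\<^sup>T) * Q) $$ (i, j) = lblk T $$ (i, j)"
  using ij by (simp add: conj_V_cancel[OF sym_matsD(1)[OF T]] lblk_def)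
qed (use Q Qp in \<open>auto simp: lblk_def\<close>)

lemma bigQT_up:
 assumes T: "T \<in> sym_mats n"
 shows "(bigQ Q Qp)\<^sup>T *v up T = pack T"
proof -
 let ?H = "V * T * V\<^sup>T"
 note H = conj_V_sym[OF T]
 let ?N = "sqrt 2 \<cdot>\<^sub>m ((Psi (dim_row Q))\<^sup>T * kron Q Qp)"
 have s: "symkron Q Q \<in> carrier_mat (tri n) (tri r)" using Q by auto
 have N: "?N \<in> carrier_mat (tri n) (r * (n - r))" using Q Qp by auto
 have 1: "(symkron Q Q)\<^sup>T *v vecS ?H = vecS (tblk T)"
  unfolding symkron_transpose
  using symkron_mult_vecS[of "Q\<^sup>T" r n ?H] Q H top_conj[OF T] by simp
 have "?N\<^sup>T = sqrt 2 \<cdot>\<^sub>m (kron Q\<^sup>T Qp\<^sup>T * Psi n)"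
 proof -
  have "?N\<^sup>T = sqrt 2 \<cdot>\<^sub>m ((Psi n)\<^sup>T * kron Q Qp)\<^sup>T" using Q by (intro eq_matI) auto
  also have "((Psi n)\<^sup>T * kron Q Qp)\<^sup>T = kron Q\<^sup>T Qp\<^sup>T * Psi n"
   using Q Qp by (subst transpose_mult_dim) (auto simp: kron_transpose)
  finally show ?thesis .
 qed
 also have "\<dots> *v vecS ?H = sqrt 2 *s ((kron Q\<^sup>T Qp\<^sup>T * Psi n) *v vecS ?H)"
  by (intro eq_vecI) (use VD Q Qp in \<open>auto simp: carrier_dim_vec\<close>)
 also have "(kron Q\<^sup>T Qp\<^sup>T * Psi n) *v vecS ?H = kron Q\<^sup>T Qp\<^sup>T *v colvec ?H"
  using Q Qp VD Psi_mult_vecS[OF H] by (simp add: mat_dims)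
 also have "\<dots> = colvec (lblk T)"
  using kron_mult_colvec[of "Q\<^sup>T" r n "Qp\<^sup>T" "n - r" n ?H] Q Qp sym_matsD(1)[OF H] low_conj[OF T]
  by simp
 finally show ?thesis
  unfolding bigQ_def up_def pack_def
  using hcat_transpose_mult_vec[OF s N, of "vecS ?H"] 1 sym_matsD(2)[OF H] by (simp add: carrier_dim_vec)
qed

lemma pack_scalar_prod:
 assumes S: "S \<in> sym_mats n" and T: "T \<in> sym_mats n"
 shows "pack S \<bullet> pack T = ip S (had msk T)"
proof -
 let ?g = "\<lambda>i j. S $$ (i, j) * T $$ (i, j)"
 have g: "?g i j = ?g j i" if "i < n" "j < n" for i j
  using sym_index[OF S that] sym_index[OF T that] by simp
 have "pack S \<bullet> pack T = vecS (tblk S) \<bullet> vecS (tblk T) + (sqrt 2 *s colvec (lblk S)) \<bullet> (sqrt 2 *s colvec (lblk T))"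
  unfolding pack_def by (rule scalar_prod_append[of _ "tri r" _ "(n - r) * r"])
   (auto simp: carrier_dim_vec tblk_def lblk_def)
 also have "vecS (tblk S) \<bullet> vecS (tblk T) = (\<Sum>j<r. \<Sum>i<r. ?g i j)"
  using vecS_scalar_prod[OF sym_matsD(1)[OF top_sym[OF S]] top_sym[OF T]]
   colvec_scalar_prod[OF sym_matsD(1)[OF top_sym[OF S]] sym_matsD(1)[OF top_sym[OF T]]]
  by (simp add: tblk_def)
 also have "(sqrt 2 *s colvec (lblk S)) \<bullet> (sqrt 2 *s colvec (lblk T)) = 2 * (\<Sum>j<r. \<Sum>i<n - r. ?g (r + i) j)"
  using colvec_scalar_prod[OF low_carrier low_carrier, of S T] colvec_carrier[OF low_carrier]
  by (simp add: lblk_def[of S] lblk_def[of T])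
 also have "(\<Sum>j<r. \<Sum>i<r. ?g i j) + 2 * (\<Sum>j<r. \<Sum>i<n - r. ?g (r + i) j) =
  (\<Sum>j<r. (\<Sum>i<r. ?g i j) + (\<Sum>i<n - r. ?g (r + i) j)) + (\<Sum>i<n - r. \<Sum>j<r. ?g j (r + i))"
 proof -
  have "(\<Sum>i<n - r. \<Sum>j<r. ?g j (r + i)) = (\<Sum>j<r. \<Sum>i<n - r. ?g (r + i) j)"
   using g by (subst sum.swap) (auto intro!: sum.cong)
  then show ?thesis by (simp add: sum.distrib)
 qed
 also have "\<dots> = (\<Sum>j<r + (n - r). \<Sum>i<r + (n - r). msk i j * ?g i j)"
  unfolding sum_split by (simp add: msk_def)
 also have "\<dots> = ip S (had msk T)"
  using rn by (simp add: ip_had[OF sym_matsD(1)[OF S] sym_matsD(1)[OF T]])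
 finally show ?thesis .
qed

definition unpack where "unpack v = mat n n (\<lambda>(i, j).
 if i < r \<and> j < r then smat r (vec_first v (tri r)) $$ (i, j)
 else if j < r then v $ (tri r + ((i - r) + (n - r) * j)) / sqrt 2
 else if i < r then v $ (tri r + ((j - r) + (n - r) * i)) / sqrt 2 else 0)"

lemma unpack_sym: "unpack v \<in> sym_mats n"
 using sym_index[OF smat_sym] unfolding sym_mats_def by (auto simp: unpack_def intro!: eq_matI)

lemma unpack_dims [simp]: "dim_row (unpack v) = n" "dim_col (unpack v) = n"
 by (simp_all add: unpack_def)

lemma unpack_bot: "r \<le> i ==> r \<le> j ==> i < n ==> j < n ==> unpack v $$ (i, j) = 0"
 by (simp add: unpack_def)

lemma had_msk_unpack: "had msk (unpack v) = unpack v"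
 by (rule eq_matI) (auto simp: msk_def unpack_bot)

lemma pack_unpack:
 assumes v: "v \<in> carrier_vec d"
 shows "pack (unpack v) = v"
proof -
 have t: "tblk (unpack v) = smat r (vec_first v (tri r))"
  by (rule eq_matI) (use rn in \<open>auto simp: tblk_def unpack_def\<close>)
 have l: "sqrt 2 *s colvec (lblk (unpack v)) = vec_last v ((n - r) * r)"
 proof (rule eq_vecI)
  fix p assume "p < dim_vec (vec_last v ((n - r) * r))"
  then have p: "p < (n - r) * r" by simp
  note b = div_mod_bound[OF p]
  have "r + p mod (n - r) < n" "p div (n - r) < n" using b rn by linarith+
  then have "(sqrt 2 *s colvec (lblk (unpack v))) $ p = v $ (tri r + p)"
   using p b by (simp add: index_colvec lblk_def unpack_def)
  then show "(sqrt 2 *s colvec (lblk (unpack v))) $ p = vec_last v ((n - r) * r) $ p"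
   using p v by (simp add: vec_last_def d_def mult.commute)
 qed (simp add: lblk_def)
 show ?thesis unfolding pack_def t l
  using vec_first_last_append[of v "tri r" "(n - r) * r"] v
  by (simp add: vecS_smat d_def mult.commute)
qed

lemma msk_sym: "msk i j = msk j i" by (auto simp: msk_def)

lemma ip_had_swap:
 assumes "S \<in> carrier_mat n n" "T \<in> carrier_mat n n"
 shows "ip S (had f T) = ip (had f S) T"
proof -
 have "had f S \<in> carrier_mat n n" by (rule carrier_matI) (use assms in auto)
 from ip_eq[OF this assms(2)] show ?thesis unfolding ip_had[OF assms] using assms(1) by (simp add: algebra_simps)
qed

lemma bigQ_up:
 assumes v: "v \<in> carrier_vec d"
 shows "bigQ Q Qp *v v = up (unpack v)"
proof (rule up_eqI)
 show "bigQ Q Qp *v v \<in> carrier_vec (tri n)" using bigQ_carrier v by simp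
 fix S assume S: "S \<in> sym_mats n"
 note c = sym_matsD(1)[OF S] sym_matsD(1)[OF unpack_sym[of v]]
 have "(bigQ Q Qp *v v) \<bullet> up S = up S \<bullet> (bigQ Q Qp *v v)"
  by (rule comm_scalar_prod[of _ "tri n"]) (use bigQ_carrier v up_carrier in auto)
 also have "\<dots> = ((bigQ Q Qp)\<^sup>T *v up S) \<bullet> v"
  using transpose_vec_mult_scalar[OF bigQ_carrier v up_carrier] by simp
 also have "\<dots> = pack S \<bullet> pack (unpack v)" unfolding bigQT_up[OF S] pack_unpack[OF v] ..
 also have "\<dots> = ip S (unpack v)" unfolding pack_scalar_prod[OF S unpack_sym] had_msk_unpack ..
 also have "\<dots> = ip (unpack v) S"
  unfolding ip_eq[OF c] ip_eq[OF c(2,1)] by (simp add: mult.commute)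
 finally show "(bigQ Q Qp *v v) \<bullet> up S = ip (unpack v) S" .
qed (rule unpack_sym)

lemma unpack_scalar_prod:
 assumes "v \<in> carrier_vec d" "w \<in> carrier_vec d"
 shows "ip (unpack v) (unpack w) = v \<bullet> w"
 using pack_scalar_prod[OF unpack_sym unpack_sym, of v w] by (simp add: had_msk_unpack pack_unpack assms)

text \<open>The diagonal of \<open>\<Sigma>\<^sup>-\<^sup>1\<close>, which is also that of \<open>W \<otimes> W - \<tau>\<^sup>2 E \<otimes> E\<close>; it vanishes on the
 lower right block.\<close>

definition sg where "sg i j = ev i * ev j - t\<^sup>2 * ee i j"

lemma sg_sym: "sg i j = sg j i" by (simp add: sg_def ee_def mult.commute)

lemma sg_bot: "r \<le> i ==> r \<le> j ==> sg i j = 0"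
 using tau_pos by (simp add: sg_def ee_def ec_def power2_eq_square)

lemma sg_top: "i < r ==> j < r ==> sg i j = ev i * ev j - t\<^sup>2"
 by (simp add: sg_def ee_def ec_def)

lemma sg_low: "r \<le> i ==> j < r ==> sg i j = ev i * (ev j - t)"
 using tau_pos by (simp add: sg_def ee_def ec_def power2_eq_square field_simps)

lemma sg_pos:
 assumes "msk i j \<noteq> 0" "i < n" "j < n"
 shows "0 < sg i j"
proof -
 have low: "0 < sg a b" if "r \<le> a" "b < r" "a < n" for a b
  using ev_pos[OF that(3)] ev_top[OF that(2)] tau_pos by (simp add: sg_low that)
 have topp: "0 < sg a b" if "a < r" "b < r" for a b
 proof -
  have "t * t < (2 * t) * (2 * t)" using tau_pos by simp
  also have "\<dots> \<le> ev a * ev b" using ev_top[OF that(1)] ev_top[OF that(2)] tau_pos by (intro mult_mono) auto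
  finally show ?thesis using that by (simp add: sg_top power2_eq_square)
 qed
 show ?thesis
  using assms low[of i j] low[of j i] topp[of i j] sg_sym[of i j] by (cases "i < r"; cases "j < r") (auto simp: msk_def)
qed

definition Sinv where "Sinv = diag_block_mat
  [symkron (Lam_top W r) (Lam_top W r) - t\<^sup>2 \<cdot>\<^sub>m 1\<^sub>m (tri r),
   kron (Lam_top W r - t \<cdot>\<^sub>m 1\<^sub>m r) (Lam_bot W r)]"

lemma Lam_dims: "Lam_top W r \<in> carrier_mat r r" "Lam_bot W r \<in> carrier_mat (n - r) (n - r)"
 by (simp_all add: Lam_top_def Lam_bot_def dimW)

lemma Sinv_carrier: "Sinv \<in> carrier_mat d d"
 using Lam_dims by (auto simp: Sinv_def d_def Let_def)

lemma Sinv_pack: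
 assumes T: "T \<in> sym_mats n"
 shows "Sinv *v pack T = pack (had sg T)"
proof -
 let ?A = "symkron (Lam_top W r) (Lam_top W r) - t\<^sup>2 \<cdot>\<^sub>m 1\<^sub>m (tri r)"
 let ?B = "kron (Lam_top W r - t \<cdot>\<^sub>m 1\<^sub>m r) (Lam_bot W r)"
 note Td = sym_matsD[OF T] and tt = sym_matsD[OF top_sym[OF T]]
 have A: "?A \<in> carrier_mat (tri r) (tri r)" using Lam_dims by auto
 have B: "?B \<in> carrier_mat (r * (n - r)) (r * (n - r))" using Lam_dims by auto
 have S: "Sinv = four_block_mat ?A (0\<^sub>m (tri r) (r * (n - r))) (0\<^sub>m (r * (n - r)) (tri r)) ?B"
  unfolding Sinv_def diag_block_mat_pair using A B Lam_dims by auto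
 have x: "vecS (tblk T) \<in> carrier_vec (tri r)" using tt by (simp add: carrier_dim_vec)
 have y: "sqrt 2 *s colvec (lblk T) \<in> carrier_vec (r * (n - r))"
  using colvec_carrier[OF low_carrier, of T] by (simp add: mult.commute)
 have 1: "?A *v vecS (tblk T) = vecS (tblk (had sg T))"
 proof -
  have "?A *v vecS (tblk T) = symkron (Lam_top W r) (Lam_top W r) *v vecS (tblk T) - t\<^sup>2 *s vecS (tblk T)"
  proof -
   have "(t\<^sup>2 \<cdot>\<^sub>m 1\<^sub>m (tri r)) *v vecS (tblk T) = t\<^sup>2 *s vecS (tblk T)"
    by (rule smult_one_mult_vec[OF x])
   then show ?thesis using x Lam_dims by (subst minus_mult_distrib_mat_vec[of _ "tri r" "tri r"]) auto
  qed
  also have "\<dots> = vecS (Lam_top W r * tblk T * (Lam_top W r)\<^sup>T - t\<^sup>2 \<cdot>\<^sub>m tblk T)"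
   using symkron_mult_vecS[OF Lam_dims(1) top_sym[OF T]] vecS_smult[OF tt(1)] Lam_dims tt
   by (subst vecS_minus[of _ r]) auto
  also have "Lam_top W r * tblk T * (Lam_top W r)\<^sup>T - t\<^sup>2 \<cdot>\<^sub>m tblk T = tblk (had sg T)"
  proof (rule eq_matI)
   fix i j assume "i < dim_row (tblk (had sg T))" "j < dim_col (tblk (had sg T))"
   then have ij: "i < r" "j < r" by (auto simp: tblk_def)
   have "(Lam_top W r * tblk T * (Lam_top W r)\<^sup>T) $$ (i, j) = ev i * tblk T $$ (i, j) * ev j"
    unfolding Lam_top_def using ij tt
    by (simp add: mat_diag_mult_left[OF tt(1)] mat_diag_mult_right[of _ r r] ev_def del: index_mult_mat(1))
   then show "(Lam_top W r * tblk T * (Lam_top W r)\<^sup>T - t\<^sup>2 \<cdot>\<^sub>m tblk T) $$ (i, j) = tblk (had sg T) $$ (i, j)"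
    using ij tt Td rn by (simp add: tblk_def sg_top algebra_simps del: index_mult_mat(1))
  qed (use Lam_dims in \<open>auto simp: tblk_def\<close>)
  finally show ?thesis .
 qed
 have 2: "?B *v (sqrt 2 *s colvec (lblk T)) = sqrt 2 *s colvec (lblk (had sg T))"
 proof -
  have D: "Lam_top W r - t \<cdot>\<^sub>m 1\<^sub>m r = mat_diag r (\<lambda>i. ev i - t)"
   by (rule eq_matI) (auto simp: Lam_top_def mat_diag_def ev_def)
  have D': "Lam_bot W r = mat_diag (n - r) (\<lambda>i. ev (r + i))"
   by (simp add: Lam_bot_def dimW ev_def)
  have "?B *v (sqrt 2 *s colvec (lblk T)) = sqrt 2 *s (?B *v colvec (lblk T))"
   using Lam_dims by (intro mult_vec_smult_dim) (auto simp: lblk_def)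
  also have "?B *v colvec (lblk T) = colvec (Lam_bot W r * lblk T * (Lam_top W r - t \<cdot>\<^sub>m 1\<^sub>m r)\<^sup>T)"
   by (rule kron_mult_colvec[OF _ Lam_dims(2) low_carrier]) (use Lam_dims in auto)
  also have "Lam_bot W r * lblk T * (Lam_top W r - t \<cdot>\<^sub>m 1\<^sub>m r)\<^sup>T = lblk (had sg T)"
   unfolding D D'
  proof (rule eq_matI)
   fix i j assume "i < dim_row (lblk (had sg T))" "j < dim_col (lblk (had sg T))"
   then have ij: "i < n - r" "j < r" by (auto simp: lblk_def)
   show "(mat_diag (n - r) (\<lambda>i. ev (r + i)) * lblk T * (mat_diag r (\<lambda>i. ev i - t))\<^sup>T) $$ (i, j) =
     lblk (had sg T) $$ (i, j)"
    using ij Td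
    by (simp add: mat_diag_mult_left[OF low_carrier] mat_diag_mult_right[of _ "n - r" r] del: index_mult_mat(1))
     (simp add: lblk_def sg_low)
  qed (auto simp: lblk_def)
  finally show ?thesis .
 qed
 show ?thesis
  unfolding S pack_def[of T] pack_def[of "had sg T"] 1[symmetric] 2[symmetric]
  by (rule diag_block_mult_vec[OF A B x y])
qed

lemma Sinv_inj:
 assumes v: "v \<in> carrier_vec d" and z: "Sinv *v v = 0\<^sub>v d"
 shows "v = 0\<^sub>v d"
proof -
 let ?U = "had sg (unpack v)"
 have U: "?U \<in> sym_mats n" by (rule had_sym[OF unpack_sym sg_sym])
 have mU: "had msk ?U = ?U" by (rule eq_matI) (auto simp: msk_def unpack_bot)
 have "pack ?U = 0\<^sub>v d" using Sinv_pack[OF unpack_sym, of v] pack_unpack[OF v] z by simp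
 then have "ip ?U ?U = 0" using pack_scalar_prod[OF U U] mU by simp
 then have "colvec ?U \<bullet> colvec ?U = 0" by (simp add: ip_def)
 then have c0: "colvec ?U = 0\<^sub>v (n * n)"
  using scalar_prod_self_eq_0[OF colvec_carrier[OF sym_matsD(1)[OF U]]] by simp
 have "unpack v $$ (i, j) = 0" if ij: "i < n" "j < n" for i j
 proof -
  have "?U $$ (i, j) = 0"
   using colvec_index_pair[OF sym_matsD(1)[OF U] ij] c0 by simp
  then have "sg i j * unpack v $$ (i, j) = 0" using ij by simp
  then show ?thesis using sg_pos[OF _ ij] unpack_bot[of i j v] ij by (cases "msk i j = 0") (auto simp: msk_def split: if_splits)
 qed
 then have "ip (unpack v) (unpack v) = 0"
  by (subst ip_eq[of _ n]) (auto simp: sym_matsD(1)[OF unpack_sym])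
 then show ?thesis using unpack_scalar_prod[OF v v] scalar_prod_self_eq_0[OF v] by simp
qed

text \<open>\<open>\<Sigma>\<close> is defined as the inverse of a matrix that multiplies entrywise by \<open>sg\<close>, which is positive on the
 entries that \<open>pack\<close> keeps.\<close>

lemma bigSigma_mult:
 assumes v: "v \<in> carrier_vec d"
 shows "bigSigma W r *v v = pack (had (\<lambda>i j. 1 / sg i j) (unpack v))"
proof -
 let ?w = "pack (had (\<lambda>i j. 1 / sg i j) (unpack v))"
 have bs: "bigSigma W r = minv Sinv" by (simp add: bigSigma_def Sinv_def)
 note i = minv_inverse[OF Sinv_carrier Sinv_inj]
 have sy: "had (\<lambda>i j. 1 / sg i j) (unpack v) \<in> sym_mats n"
  by (rule had_sym[OF unpack_sym]) (simp add: sg_sym)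
 have "had sg (had (\<lambda>i j. 1 / sg i j) (unpack v)) = unpack v"
 proof (rule eq_matI)
  fix i j assume "i < dim_row (unpack v)" "j < dim_col (unpack v)"
  then have ij: "i < n" "j < n" by auto
  show "had sg (had (\<lambda>i j. 1 / sg i j) (unpack v)) $$ (i, j) = unpack v $$ (i, j)"
   using ij sg_pos[OF _ ij] unpack_bot[of i j v] by (cases "msk i j = 0") (auto simp: msk_def split: if_splits)
 qed auto
 then have "Sinv *v ?w = v" using Sinv_pack[OF sy] pack_unpack[OF v] by simp
 then have "minv Sinv *v v = minv Sinv *v (Sinv *v ?w)" by simp
 also have "\<dots> = ?w" by (rule inverse_cancel_vec[OF i(1) Sinv_carrier i(3) pack_carrier])
 finally show ?thesis unfolding bs .
qed

lemma bigSigma_carrier: "bigSigma W r \<in> carrier_mat d d"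
 using minv_inverse(1)[OF Sinv_carrier Sinv_inj] by (simp add: bigSigma_def Sinv_def)

end

section \<open>The scaling point of a centered pair\<close>

lemma form_le_of_psd:
 assumes D: "N - M \<in> psd_mats n" and N: "N \<in> carrier_mat n n" and M: "M \<in> carrier_mat n n" and x: "x \<in> carrier_vec n"
 shows "x \<bullet> (M *v x) \<le> x \<bullet> (N *v x)"
proof -
 have "0 \<le> x \<bullet> ((N - M) *v x)" using D x by (auto simp: psd_mats_def)
 also have "(N - M) *v x = N *v x - M *v x" by (rule minus_mult_distrib_mat_vec[OF N M x])
 also have "x \<bullet> \<dots> = x \<bullet> (N *v x) - x \<bullet> (M *v x)"
  using N M x by (intro scalar_prod_minus_distrib[of _ n]) auto
 finally show ?thesis by simp
qed

lemma form_minus: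
 fixes N M :: "real mat"
 assumes N: "N \<in> carrier_mat n n" and M: "M \<in> carrier_mat n n" and x: "x \<in> carrier_vec n"
 shows "x \<bullet> ((N - M) *v x) = x \<bullet> (N *v x) - x \<bullet> (M *v x)"
proof -
 have "(N - M) *v x = N *v x - M *v x" by (rule minus_mult_distrib_mat_vec[OF N M x])
 also have "x \<bullet> \<dots> = x \<bullet> (N *v x) - x \<bullet> (M *v x)"
  using N M x by (intro scalar_prod_minus_distrib[of _ n]) auto
 finally show ?thesis .
qed

lemma form_add:
 fixes N M :: "real mat"
 assumes N: "N \<in> carrier_mat n n" and M: "M \<in> carrier_mat n n" and x: "x \<in> carrier_vec n"
 shows "x \<bullet> ((N + M) *v x) = x \<bullet> (N *v x) + x \<bullet> (M *v x)"
proof -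
 have "(N + M) *v x = N *v x + M *v x" by (rule add_mult_distrib_mat_vec[OF N M x])
 also have "x \<bullet> \<dots> = x \<bullet> (N *v x) + x \<bullet> (M *v x)"
  using N M x by (intro scalar_prod_add_distrib[of _ n]) auto
 finally show ?thesis .
qed

lemma form_smult:
 fixes N :: "real mat"
 assumes N: "N \<in> carrier_mat n n" and x: "x \<in> carrier_vec n"
 shows "x \<bullet> ((c \<cdot>\<^sub>m N) *v x) = c * (x \<bullet> (N *v x))"
proof -
 have "(c \<cdot>\<^sub>m N) *v x = c *s (N *v x)" using N x by (intro eq_vecI) auto
 then show ?thesis using N x by simp
qed

lemma sandwich_form:
 fixes R N :: "real mat"
 assumes R: "R \<in> sym_mats n" and N: "N \<in> carrier_mat n n" and x: "x \<in> carrier_vec n"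
 shows "x \<bullet> ((R * N * R) *v x) = (R *v x) \<bullet> (N *v (R *v x))"
proof -
 note Rc = sym_matsD[OF R]
 have "(R * N * R) *v x = R *v (N *v (R *v x))" using Rc N x by (simp add: mat_dims)
 then show ?thesis using symmetric_scalar_prod[OF R x, of "N *v (R *v x)"] Rc N x by simp
qed

lemma sandwich_sym:
 fixes R N :: "real mat"
 assumes R: "R \<in> sym_mats n" and N: "N \<in> sym_mats n"
 shows "R * N * R \<in> sym_mats n"
 using conj_sym[OF sym_matsD(1)[OF R] N] sym_matsD(4)[OF R] by simp

lemma nonzero_vec_exists: "0 < n ==> \<exists>x \<in> carrier_vec n. x \<bullet> x = (1 :: real)"
 by (rule bexI[of _ "unit_vec n 0"]) auto

text \<open>With \<open>T = X\<^sup>1\<^sup>/\<^sup>2 S X\<^sup>1\<^sup>/\<^sup>2\<close> the scaling point is \<open>X\<^sup>1\<^sup>/\<^sup>2 T\<^sup>-\<^sup>1\<^sup>/\<^sup>2 X\<^sup>1\<^sup>/\<^sup>2\<close>, and centering puts the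
 spectrum of \<open>T\<close> between \<open>(1 - \<delta>) \<mu>\<close> and \<open>(1 + \<delta>) \<mu>\<close>. Hence \<open>W\<close> is comparable to \<open>X / sqrt \<mu>\<close>. From below,
 \<open>S \<preceq> (1 + L) I\<close> forces \<open>X\<close> to be at least a multiple of \<open>\<mu> / (1 + L)\<close>; on the kernel of \<open>X\<^sup>*\<close> the form of \<open>X\<close>
 is that of \<open>X - X\<^sup>*\<close>, which is at most \<open>L \<mu>\<close>.\<close>

lemma scaling_point_bounds:
 assumes c: "centering n \<mu> L \<delta> \<chi>1 X S Xs Ss" and W: "W = nt_scaling X S"
 shows "W \<in> pd_mats n"
  and "x \<in> carrier_vec n ==> (1 - \<delta>) * \<mu> / ((1 + L) * sqrt (2 * \<mu>)) * (x \<bullet> x) \<le> x \<bullet> (W *v x)"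
  and "x \<in> carrier_vec n ==> Xs *v x = 0\<^sub>v n ==> x \<bullet> (W *v x) \<le> L * \<mu> / sqrt ((1 - \<delta>) * \<mu>) * (x \<bullet> x)"
  and "1 \<le> \<chi>1" and "0 < n"
proof -
 have mu: "0 < \<mu>" and L: "0 \<le> L" and de: "0 \<le> \<delta>" "\<delta> < 1" and chi: "0 < \<chi>1"
  and X: "X \<in> pd_mats n" and S: "S \<in> pd_mats n" and Xs: "Xs \<in> psd_mats n" and Ss: "Ss \<in> psd_mats n"
  and cen: "spec_norm ((1/\<mu>) \<cdot>\<^sub>m (psd_sqrt X * S * psd_sqrt X) - 1\<^sub>m n) \<le> \<delta>"
  and dX: "spec_norm (X - Xs) \<le> L * \<mu>" and dS: "spec_norm (S - Ss) \<le> L"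
  and lo: "Xs + Ss - (1/\<chi>1) \<cdot>\<^sub>m 1\<^sub>m n \<in> psd_mats n" and hi: "1\<^sub>m n - (Xs + Ss) \<in> psd_mats n"
  and rk: "mrank Xs < n"
  using c by (auto simp: centering_def)
 show n: "0 < n" using rk by simp
 have carr: "X \<in> carrier_mat n n" "S \<in> carrier_mat n n" "Xs \<in> carrier_mat n n" "Ss \<in> carrier_mat n n"
  and Ssym: "S \<in> sym_mats n"
  using X S Xs Ss by (simp_all add: pd_mats_def psd_mats_def sym_mats_def)
 define R where "R = psd_sqrt X"
 have Rpd: "R \<in> pd_mats n" unfolding R_def by (rule psd_sqrt_pd[OF X])
 have RR: "R * R = X" unfolding R_def by (rule psd_sqrt(2)[OF pd_imp_psd[OF X]])
 have Rs: "R \<in> sym_mats n" using Rpd by (simp add: pd_mats_def)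
 note Rc = sym_matsD[OF Rs]
 define T where "T = R * S * R"
 have Ts: "T \<in> sym_mats n" unfolding T_def by (rule sandwich_sym[OF Rs Ssym])
 note Tc = sym_matsD[OF Ts]
 have Rx: "(R *v x) \<bullet> (R *v x) = x \<bullet> (X *v x)" if x: "x \<in> carrier_vec n" for x
  using symmetric_scalar_prod[OF Rs x, of "R *v x"] Rc x RR assoc_vec_dim[of R R x] by simp
 have Tb: "\<bar>x \<bullet> (T *v x) - \<mu> * (x \<bullet> x)\<bar> \<le> \<delta> * \<mu> * (x \<bullet> x)" if x: "x \<in> carrier_vec n" for x
 proof -
  have mc: "(1/\<mu>) \<cdot>\<^sub>m T - 1\<^sub>m n \<in> carrier_mat n n" by (rule carrier_matI) (simp_all)
  have "\<bar>x \<bullet> (((1/\<mu>) \<cdot>\<^sub>m T - 1\<^sub>m n) *v x)\<bar> \<le> spec_norm ((1/\<mu>) \<cdot>\<^sub>m T - 1\<^sub>m n) * (x \<bullet> x)"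
   by (rule quadratic_form_le_spec_norm[OF mc x])
  also have "\<dots> \<le> \<delta> * (x \<bullet> x)"
   using cen scalar_prod_self_nonneg[of x] by (intro mult_right_mono) (simp_all add: T_def R_def)
  also have "x \<bullet> (((1/\<mu>) \<cdot>\<^sub>m T - 1\<^sub>m n) *v x) = (1/\<mu>) * (x \<bullet> (T *v x)) - x \<bullet> x"
   using x Tc by (subst form_minus[of _ n]) (simp_all add: form_smult[OF Tc(1) x])
  finally have "\<mu> * \<bar>(1/\<mu>) * (x \<bullet> (T *v x)) - x \<bullet> x\<bar> \<le> \<mu> * (\<delta> * (x \<bullet> x))"
   using mu by (intro mult_left_mono) auto
  moreover have "\<mu> * \<bar>(1/\<mu>) * (x \<bullet> (T *v x)) - x \<bullet> x\<bar> = \<bar>x \<bullet> (T *v x) - \<mu> * (x \<bullet> x)\<bar>"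
   using mu abs_mult[of \<mu> "(1/\<mu>) * (x \<bullet> (T *v x)) - x \<bullet> x"] by (simp add: algebra_simps)
  ultimately show ?thesis by (simp add: algebra_simps)
 qed
 have Tlo: "(1 - \<delta>) * \<mu> * (x \<bullet> x) \<le> x \<bullet> (T *v x)" if "x \<in> carrier_vec n" for x
  using Tb[OF that] by (simp add: algebra_simps abs_le_iff)
 have Thi: "x \<bullet> (T *v x) \<le> (1 + \<delta>) * \<mu> * (x \<bullet> x)" if "x \<in> carrier_vec n" for x
  using Tb[OF that] by (simp add: algebra_simps abs_le_iff)
 have pos: "0 < (1 - \<delta>) * \<mu>" using de mu by simp
 define N where "N = minv (psd_sqrt T)"
 note b = inverse_sqrt_bounds[OF Ts pos Tlo Thi, folded N_def]
 have Ns: "N \<in> sym_mats n" using b(1)[of "0\<^sub>v n"] by simp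
 note Nc = sym_matsD[OF Ns]
 have WR: "W = R * N * R" unfolding W nt_scaling_def N_def T_def R_def ..
 have Ws: "W \<in> sym_mats n" unfolding WR by (rule sandwich_sym[OF Rs Ns])
 have Wx: "x \<bullet> (W *v x) = (R *v x) \<bullet> (N *v (R *v x))" if "x \<in> carrier_vec n" for x
  unfolding WR by (rule sandwich_form[OF Rs Nc(1) that])
 have Wlo: "(x \<bullet> (X *v x)) / sqrt ((1 + \<delta>) * \<mu>) \<le> x \<bullet> (W *v x)" if x: "x \<in> carrier_vec n" for x
  using b(2)[of "R *v x"] Rx[OF x] Wx[OF x] Rc x by simp
 have Whi: "x \<bullet> (W *v x) \<le> (x \<bullet> (X *v x)) / sqrt ((1 - \<delta>) * \<mu>)" if x: "x \<in> carrier_vec n" for x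
  using b(3)[of "R *v x"] Rx[OF x] Wx[OF x] Rc x by simp
 have XSc: "Xs + Ss \<in> carrier_mat n n" using carr by simp
 have sumhi: "x \<bullet> ((Xs + Ss) *v x) \<le> x \<bullet> x" if x: "x \<in> carrier_vec n" for x
  using form_le_of_psd[OF hi _ XSc x] x by simp
 have Shi: "x \<bullet> (S *v x) \<le> (1 + L) * (x \<bullet> x)" if x: "x \<in> carrier_vec n" for x
 proof -
  have "x \<bullet> (S *v x) = x \<bullet> ((S - Ss) *v x) + x \<bullet> (Ss *v x)"
   using form_minus[OF carr(2,4) x] by simp
  also have "x \<bullet> ((S - Ss) *v x) \<le> L * (x \<bullet> x)"
  proof -
   have "S - Ss \<in> carrier_mat n n" by (rule minus_carrier_mat[OF carr(4)])
   then have "x \<bullet> ((S - Ss) *v x) \<le> spec_norm (S - Ss) * (x \<bullet> x)"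
    using quadratic_form_le_spec_norm[OF _ x] abs_le_D1 by blast
   also have "\<dots> \<le> L * (x \<bullet> x)" by (rule mult_right_mono[OF dS scalar_prod_self_nonneg])
   finally show ?thesis .
  qed
  also have "x \<bullet> (Ss *v x) \<le> x \<bullet> x"
  proof -
   have "0 \<le> x \<bullet> (Xs *v x)" using Xs x by (simp add: psd_mats_def)
   then show ?thesis using sumhi[OF x] form_add[OF carr(3,4) x] by simp
  qed
  finally show ?thesis by (simp add: algebra_simps)
 qed
 \<comment> \<open>\<open>X\<close> is bounded below because \<open>X\<^sup>1\<^sup>/\<^sup>2 S X\<^sup>1\<^sup>/\<^sup>2 \<ge> (1 - \<delta>) \<mu>\<close> and \<open>S\<close> is bounded above.\<close>
 have Xlo: "(1 - \<delta>) * \<mu> / (1 + L) * (x \<bullet> x) \<le> x \<bullet> (X *v x)" if x: "x \<in> carrier_vec n" for x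
 proof -
  have Rxc: "R *v x \<in> carrier_vec n" using Rc x by simp
  have "(1 - \<delta>) * \<mu> * (x \<bullet> x) \<le> (R *v x) \<bullet> (S *v (R *v x))"
   using Tlo[OF x] sandwich_form[OF Rs carr(2) x] by (simp add: T_def)
  also have "\<dots> \<le> (1 + L) * (x \<bullet> (X *v x))" using Shi[OF Rxc] Rx[OF x] by simp
  finally have "(1 - \<delta>) * \<mu> * (x \<bullet> x) \<le> (1 + L) * (x \<bullet> (X *v x))" .
  then show ?thesis using L by (simp add: field_simps)
 qed
 have low: "(1 - \<delta>) * \<mu> / ((1 + L) * sqrt (2 * \<mu>)) * (x \<bullet> x) \<le> x \<bullet> (W *v x)" if x: "x \<in> carrier_vec n" for x
 proof -
  have s: "sqrt ((1 + \<delta>) * \<mu>) \<le> sqrt (2 * \<mu>)" using de mu by simp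
  have sp: "0 < sqrt ((1 + \<delta>) * \<mu>)" using de mu by simp
  have xx: "0 \<le> (1 - \<delta>) * \<mu> / (1 + L) * (x \<bullet> x)" using de mu L scalar_prod_self_nonneg[of x] by simp
  have "(1 - \<delta>) * \<mu> / ((1 + L) * sqrt (2 * \<mu>)) * (x \<bullet> x) = ((1 - \<delta>) * \<mu> / (1 + L) * (x \<bullet> x)) / sqrt (2 * \<mu>)"
   by simp
  also have "\<dots> \<le> ((1 - \<delta>) * \<mu> / (1 + L) * (x \<bullet> x)) / sqrt ((1 + \<delta>) * \<mu>)"
   using s sp xx by (intro divide_left_mono) auto
  also have "\<dots> \<le> (x \<bullet> (X *v x)) / sqrt ((1 + \<delta>) * \<mu>)"
   by (rule divide_right_mono[OF Xlo[OF x]]) (use sp in simp)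
  also have "\<dots> \<le> x \<bullet> (W *v x)" by (rule Wlo[OF x])
  finally show ?thesis .
 qed
 then show "x \<in> carrier_vec n ==> (1 - \<delta>) * \<mu> / ((1 + L) * sqrt (2 * \<mu>)) * (x \<bullet> x) \<le> x \<bullet> (W *v x)" .
 show "W \<in> pd_mats n"
 proof -
  have "0 < x \<bullet> (W *v x)" if x: "x \<in> carrier_vec n" "x \<noteq> 0\<^sub>v n" for x
  proof -
   have "0 < x \<bullet> x" using scalar_prod_self_nonneg[of x] scalar_prod_self_eq_0[OF x(1)] x(2) by linarith
   then have "0 < (1 - \<delta>) * \<mu> / ((1 + L) * sqrt (2 * \<mu>)) * (x \<bullet> x)" using de mu L by simp
   then show ?thesis using low[OF x(1)] by linarith
  qed
  then show ?thesis using Ws by (simp add: pd_mats_def)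
 qed
 show "x \<bullet> (W *v x) \<le> L * \<mu> / sqrt ((1 - \<delta>) * \<mu>) * (x \<bullet> x)"
  if x: "x \<in> carrier_vec n" and ker: "Xs *v x = 0\<^sub>v n" for x
 proof -
  have "x \<bullet> (X *v x) = x \<bullet> ((X - Xs) *v x)"
   using form_minus[OF carr(1,3) x] ker x by simp
  also have "\<dots> \<le> spec_norm (X - Xs) * (x \<bullet> x)"
  proof -
   have "X - Xs \<in> carrier_mat n n" by (rule minus_carrier_mat[OF carr(3)])
   then show ?thesis using quadratic_form_le_spec_norm[OF _ x] abs_le_D1 by blast
  qed
  also have "\<dots> \<le> L * \<mu> * (x \<bullet> x)" by (rule mult_right_mono[OF dX scalar_prod_self_nonneg])
  finally have "(x \<bullet> (X *v x)) / sqrt ((1 - \<delta>) * \<mu>) \<le> L * \<mu> * (x \<bullet> x) / sqrt ((1 - \<delta>) * \<mu>)"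
   using pos by (intro divide_right_mono) auto
  then show ?thesis using Whi[OF x] by simp
 qed
 show "1 \<le> \<chi>1"
 proof -
  obtain x :: "real vec" where x: "x \<in> carrier_vec n" "x \<bullet> x = 1" using nonzero_vec_exists[OF n] by blast
  have c1: "(1/\<chi>1) \<cdot>\<^sub>m 1\<^sub>m n \<in> carrier_mat n n" by simp
  have "x \<bullet> (((1/\<chi>1) \<cdot>\<^sub>m 1\<^sub>m n) *v x) \<le> x \<bullet> ((Xs + Ss) *v x)"
   by (rule form_le_of_psd[OF lo XSc c1 x(1)])
  also have "\<dots> \<le> 1" using sumhi[OF x(1)] x by simp
  also have "x \<bullet> (((1/\<chi>1) \<cdot>\<^sub>m 1\<^sub>m n) *v x) = 1/\<chi>1" using x by (simp add: form_smult[of _ n])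
  finally show ?thesis using chi by simp
 qed
qed

section \<open>Inner products of matrices\<close>

lemma ip_commute:
 assumes "S \<in> carrier_mat a b" "T \<in> carrier_mat a b"
 shows "ip S T = ip T S"
 unfolding ip_def colvec_scalar_prod[OF assms] colvec_scalar_prod[OF assms(2,1)] by (simp add: mult.commute)

lemma ip_transpose:
 assumes S: "S \<in> carrier_mat a b" and T: "T \<in> carrier_mat a b"
 shows "ip S\<^sup>T T\<^sup>T = ip S T"
proof -
 have St: "S\<^sup>T \<in> carrier_mat b a" "T\<^sup>T \<in> carrier_mat b a" using S T by simp_all
 have "ip S\<^sup>T T\<^sup>T = (\<Sum>j<a. \<Sum>i<b. S $$ (j, i) * T $$ (j, i))"
  unfolding ip_def colvec_scalar_prod[OF St] using S T by simp
 also have "\<dots> = ip S T" unfolding ip_def colvec_scalar_prod[OF S T] by (rule sum.swap)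
 finally show ?thesis .
qed

lemma ip_self_nonneg: "0 \<le> ip S S"
 by (simp add: ip_def scalar_prod_self_nonneg)

lemma ip_conj:
 assumes M: "M \<in> carrier_mat n n" and S: "S \<in> carrier_mat n n" and T: "T \<in> carrier_mat n n"
 shows "ip (M * S * M\<^sup>T) T = ip S (M\<^sup>T * T * M)"
proof -
 let ?K = "kron M M"
 have K: "?K \<in> carrier_mat (n * n) (n * n)" by (rule carrier_matI) (use M in simp_all)
 have "ip (M * S * M\<^sup>T) T = (?K *v colvec S) \<bullet> colvec T"
  unfolding ip_def kron_mult_colvec[OF M M S] ..
 also have "\<dots> = colvec T \<bullet> (?K *v colvec S)"
  using K colvec_carrier[OF T] colvec_carrier[OF S] by (intro comm_scalar_prod[of _ "n * n"]) auto
 also have "\<dots> = (?K\<^sup>T *v colvec T) \<bullet> colvec S"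
  using transpose_vec_mult_scalar[OF K colvec_carrier[OF S] colvec_carrier[OF T]] by simp
 also have "?K\<^sup>T *v colvec T = colvec (M\<^sup>T * T * M)"
  unfolding kron_transpose using kron_mult_colvec[of "M\<^sup>T" n n "M\<^sup>T" n n T] M T by simp
 also have "colvec (M\<^sup>T * T * M) \<bullet> colvec S = ip (M\<^sup>T * T * M) S" by (simp add: ip_def)
 also have "\<dots> = ip S (M\<^sup>T * T * M)" by (rule ip_commute[of _ n n]) (use M S T in \<open>simp_all add: mat_dims\<close>)
 finally show ?thesis .
qed

lemma ip_mult_bound:
 fixes R Y :: "real mat"
 assumes R: "R \<in> sym_mats n" and Y: "Y \<in> carrier_mat n n"
  and b: "\<And>j. j < n ==> col Y j \<bullet> ((R * R) *v col Y j) \<le> l * (col Y j \<bullet> col Y j)"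
 shows "ip (R * Y) (R * Y) \<le> l * ip Y Y"
proof -
 note Rc = sym_matsD[OF R]
 have RY: "R * Y \<in> carrier_mat n n" using Rc Y by simp
 have "ip (R * Y) (R * Y) = (\<Sum>j<n. col (R * Y) j \<bullet> col (R * Y) j)"
  unfolding ip_def by (rule colvec_scalar_prod_self[OF RY])
 also have "\<dots> \<le> (\<Sum>j<n. l * (col Y j \<bullet> col Y j))"
 proof (rule sum_mono)
  fix j assume "j \<in> {..<n}"
  then have j: "j < n" by simp
  then have yc: "col Y j \<in> carrier_vec n" using Y by simp
  have "col (R * Y) j = R *v col Y j" by (rule col_mult2[OF Rc(1) Y j])
  then have "col (R * Y) j \<bullet> col (R * Y) j = col Y j \<bullet> (R *v (R *v col Y j))"
   using symmetric_scalar_prod[OF R yc, of "R *v col Y j"] Rc yc by simp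
  also have "R *v (R *v col Y j) = (R * R) *v col Y j"
   by (rule assoc_mult_mat_vec[OF Rc(1) Rc(1) yc, symmetric])
  finally show "col (R * Y) j \<bullet> col (R * Y) j \<le> l * (col Y j \<bullet> col Y j)" using b[OF j] by simp
 qed
 also have "\<dots> = l * ip Y Y" unfolding ip_def colvec_scalar_prod_self[OF Y] by (simp add: sum_distrib_left)
 finally show ?thesis .
qed

text \<open>If \<open>W\<close> is bounded by \<open>l\<close> on the range of the symmetric matrix \<open>Z\<close>, then
 \<open>tr (Z W Z W) \<le> l\<^sup>2 tr (Z Z)\<close>: write \<open>W = R\<^sup>2\<close> and bound the two outer factors one after the other.\<close>

lemma weighted_trace_bound:
 assumes W: "W \<in> psd_mats n" and Z: "Z \<in> sym_mats n" and l: "0 \<le> l"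
  and b: "\<And>x. x \<in> carrier_vec n ==> (Z *v x) \<bullet> (W *v (Z *v x)) \<le> l * ((Z *v x) \<bullet> (Z *v x))"
 shows "ip Z (W * Z * W) \<le> l\<^sup>2 * ip Z Z"
proof -
 define R where "R = psd_sqrt W"
 have Rs: "R \<in> sym_mats n" and RR: "R * R = W"
  using psd_sqrt[OF W] by (simp_all add: R_def psd_mats_def)
 note Rc = sym_matsD[OF Rs] and Zc = sym_matsD[OF Z]
 have cb: "col (Z * Y) j \<bullet> ((R * R) *v col (Z * Y) j) \<le> l * (col (Z * Y) j \<bullet> col (Z * Y) j)"
  if Y: "Y \<in> carrier_mat n n" and j: "j < n" for Y j
 proof -
  have "col (Z * Y) j = Z *v col Y j" by (rule col_mult2[OF Zc(1) Y j])
  then show ?thesis using b[of "col Y j"] Y j RR by simp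
 qed
 have ZR: "Z * R \<in> carrier_mat n n" "R * Z \<in> carrier_mat n n" using Zc Rc by simp_all
 have WZW: "W * Z * W = R * (R * Z * R) * R\<^sup>T"
  unfolding RR[symmetric] using Rc Zc by (simp add: mat_dims)
 have "ip Z (W * Z * W) = ip (R * (R * Z * R) * R\<^sup>T) Z"
  unfolding WZW using Rc Zc by (intro ip_commute[of _ n n]) (simp_all add: mat_dims)
 also have "\<dots> = ip (R * Z * R) (R\<^sup>T * Z * R)"
  using Rc Zc by (intro ip_conj) (simp_all add: mat_dims)
 also have "\<dots> = ip (R * (Z * R)) (R * (Z * R))" using Rc Zc by (simp add: mat_dims)
 also have "\<dots> \<le> l * ip (Z * R) (Z * R)"
  by (rule ip_mult_bound[OF Rs ZR(1)]) (rule cb[OF Rc(1)])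
 also have "ip (Z * R) (Z * R) = ip (R * Z) (R * Z)"
  using ip_transpose[OF ZR(2) ZR(2)] Rc Zc by (simp add: mat_dims)
 also have "l * ip (R * Z) (R * Z) \<le> l * (l * ip Z Z)"
 proof (rule mult_left_mono[OF _ l], rule ip_mult_bound[OF Rs Zc(1)])
  fix j assume j: "j < n"
  show "col Z j \<bullet> ((R * R) *v col Z j) \<le> l * (col Z j \<bullet> col Z j)"
   using cb[of "1\<^sub>m n" j] j Zc by simp
 qed
 finally show ?thesis by (simp add: power2_eq_square)
qed

lemma ip_weighted_Cauchy_Schwarz:
 assumes S: "S \<in> carrier_mat n n" and T: "T \<in> carrier_mat n n"
  and w: "\<And>i j. i < n ==> j < n ==> 0 < w i j"
 shows "(ip S T)\<^sup>2 \<le> ip S (had w S) * ip T (had (\<lambda>i j. 1 / w i j) T)"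
proof -
 let ?S = "had (\<lambda>i j. sqrt (w i j)) S" and ?T = "had (\<lambda>i j. 1 / sqrt (w i j)) T"
 have c: "?S \<in> carrier_mat n n" "?T \<in> carrier_mat n n"
  using S T by (auto intro!: carrier_matI)
 have "ip ?S ?T = ip S T"
  unfolding ip_eq[OF c] ip_eq[OF S T]
 proof (intro sum.cong refl)
  fix i j assume "j \<in> {..<n}" "i \<in> {..<n}"
  then have ij: "i < n" "j < n" by auto
  then show "?S $$ (i, j) * ?T $$ (i, j) = S $$ (i, j) * T $$ (i, j)"
   using S T w[OF ij] by simp
 qed
 moreover have "ip ?S ?S = ip S (had w S)"
  unfolding ip_eq[OF c(1) c(1)] ip_had[OF S S]
 proof (intro sum.cong refl)
  fix i j assume "j \<in> {..<n}" "i \<in> {..<n}"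
  then have ij: "i < n" "j < n" by auto
  have "sqrt (w i j) * sqrt (w i j) = w i j" using w[OF ij] by simp
  then show "?S $$ (i, j) * ?S $$ (i, j) = w i j * (S $$ (i, j) * S $$ (i, j))"
   using S ij by (simp add: algebra_simps)
 qed
 moreover have "ip ?T ?T = ip T (had (\<lambda>i j. 1 / w i j) T)"
  unfolding ip_eq[OF c(2) c(2)] ip_had[OF T T]
 proof (intro sum.cong refl)
  fix i j assume "j \<in> {..<n}" "i \<in> {..<n}"
  then have ij: "i < n" "j < n" by auto
  have "sqrt (w i j) * sqrt (w i j) = w i j" using w[OF ij] by simp
  then show "?T $$ (i, j) * ?T $$ (i, j) = 1 / w i j * (T $$ (i, j) * T $$ (i, j))"
   using T ij by (simp add: algebra_simps)
 qed
 moreover have "\<bar>ip ?S ?T\<bar>\<^sup>2 \<le> (vnorm (colvec ?S) * vnorm (colvec ?T))\<^sup>2"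
  unfolding ip_def
  by (rule power_mono[OF Cauchy_Schwarz_vnorm[of _ "n * n"]]) (use colvec_carrier[OF c(1)] colvec_carrier[OF c(2)] in auto)
 ultimately show ?thesis by (simp add: power_mult_distrib vnorm_power2 ip_def[symmetric])
qed

lemma mult_zero_vec: "B \<in> carrier_mat a b ==> B *v 0\<^sub>v b = (0\<^sub>v a :: real vec)"
 by (rule eq_vecI) auto

section \<open>Matrices with linearly independent rows\<close>

lemma lin_indpt_rows_inj:
 assumes A: "A \<in> carrier_mat m k" and li: "lin_indpt_rows A"
 shows "w \<in> carrier_vec m ==> A\<^sup>T *v w = 0\<^sub>v k ==> w = 0\<^sub>v m" and "m \<le> k"
proof -
 interpret vec_space "TYPE(real)" k .
 have cr: "cols A\<^sup>T = rows A" by (rule cols_transpose)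
 have d: "distinct (rows A)" and l: "lin_indpt (set (rows A))"
  using li A by (auto simp: lin_indpt_rows_def)
 show "w = 0\<^sub>v m" if "w \<in> carrier_vec m" "A\<^sup>T *v w = 0\<^sub>v k"
  using lin_depI[of "A\<^sup>T" m w] that A d l by (auto simp: cr)
 have "set (rows A) \<subseteq> carrier_vec k" using A rows_carrier[of A] by auto
 then have "card (set (rows A)) \<le> dim" using li_le_dim(2)[OF fin_dim _ l] by simp
 then show "m \<le> k" using A d by (simp add: distinct_card dim_is_n)
qed

lemma gram_pd:
 fixes A :: "real mat"
 assumes A: "A \<in> carrier_mat m k" and inj: "\<And>w. w \<in> carrier_vec m ==> A\<^sup>T *v w = 0\<^sub>v k ==> w = 0\<^sub>v m"
 shows "A * A\<^sup>T \<in> pd_mats m"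
  and "w \<in> carrier_vec m ==> w \<bullet> ((A * A\<^sup>T) *v w) = (A\<^sup>T *v w) \<bullet> (A\<^sup>T *v w)"
proof -
 have f: "w \<bullet> ((A * A\<^sup>T) *v w) = (A\<^sup>T *v w) \<bullet> (A\<^sup>T *v w)" if w: "w \<in> carrier_vec m" for w
  using transpose_vec_mult_scalar[OF A _ w, of "A\<^sup>T *v w"] A w by (simp add: mat_dims)
 then show "w \<in> carrier_vec m ==> w \<bullet> ((A * A\<^sup>T) *v w) = (A\<^sup>T *v w) \<bullet> (A\<^sup>T *v w)" .
 have "A * A\<^sup>T \<in> sym_mats m" using A by (simp add: sym_mats_def mat_dims)
 moreover have "0 < w \<bullet> ((A * A\<^sup>T) *v w)" if w: "w \<in> carrier_vec m" "w \<noteq> 0\<^sub>v m" for w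
 proof -
  have "A\<^sup>T *v w \<noteq> 0\<^sub>v k" using inj w by blast
  then have "(A\<^sup>T *v w) \<bullet> (A\<^sup>T *v w) \<noteq> 0" using scalar_prod_self_eq_0[of "A\<^sup>T *v w" k] A w by simp
  then show ?thesis using f[OF w(1)] scalar_prod_self_nonneg[of "A\<^sup>T *v w"] by simp
 qed
 ultimately show "A * A\<^sup>T \<in> pd_mats m" by (simp add: pd_mats_def)
qed

text \<open>A homogeneous system with more unknowns than equations has a nontrivial solution: pad it with
 zero rows to a singular square system.\<close>

lemma underdetermined_solution:
 fixes K :: "real mat"
 assumes K: "K \<in> carrier_mat a c" and ac: "a < c"
 obtains x where "x \<in> carrier_vec c" "x \<noteq> 0\<^sub>v c" "K *v x = 0\<^sub>v a"
proof -
 define B where "B = mat c c (\<lambda>(i, j). if i < a then K $$ (i, j) else 0)"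
 have Bc: "B \<in> carrier_mat c c" by (simp add: B_def)
 have "det B\<^sup>T = 0"
 proof (rule iffD2[OF det_0_iff_vec_prod_zero[of _ c]])
  show "\<exists>v. v \<in> carrier_vec c \<and> v \<noteq> 0\<^sub>v c \<and> B\<^sup>T *v v = 0\<^sub>v c"
  proof (intro exI conjI)
   show "unit_vec c (c - 1) \<noteq> (0\<^sub>v c :: real vec)" using ac by simp
   show "B\<^sup>T *v unit_vec c (c - 1) = 0\<^sub>v c"
    using ac Bc by (intro eq_vecI) (auto simp: B_def)
  qed simp
 qed (use Bc in simp)
 then have "det B = 0" using det_transpose[OF Bc] by simp
 then obtain x where x: "x \<in> carrier_vec c" "x \<noteq> 0\<^sub>v c" "B *v x = 0\<^sub>v c"
  using det_0_iff_vec_prod_zero[OF Bc] by blast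
 have "K *v x = 0\<^sub>v a"
 proof (rule eq_vecI)
  fix i assume "i < dim_vec (0\<^sub>v a :: real vec)"
  then have i: "i < a" by simp
  have "row B i = row K i" using i ac K by (intro eq_vecI) (auto simp: B_def)
  then have "(K *v x) $ i = (B *v x) $ i" using i ac K Bc by simp
  then show "(K *v x) $ i = 0\<^sub>v a $ i" using x(3) i ac by simp
 qed (use K in simp)
 then show ?thesis using x that by blast
qed

section \<open>The augmented matrix in coordinates\<close>

lemma vec_first_index: "i < k ==> vec_first v k $ i = v $ i"
 by (simp add: vec_first_def)

context eigenbasis
begin

text \<open>Each entry of the coordinate matrix is a fixed multiple of a single entry of the packed vector, and
 linearity follows entrywise.\<close>

lemma unpack_entry:
 obtains c k where "\<And>i j. i < n ==> j < n ==> c i j = 0 \<or> k i j < d"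
  and "\<And>v i j. i < n ==> j < n ==> unpack v $$ (i, j) = c i j * v $ k i j"
proof -
 define k where "k i j = (if i < r \<and> j < r then tri_pos r i j
  else if j < r then tri r + ((i - r) + (n - r) * j) else tri r + ((j - r) + (n - r) * i))" for i j
 define c where "c i j = (if i < r \<and> j < r then (if i = j then 1 else 1 / sqrt 2)
  else if i < r \<or> j < r then 1 / sqrt 2 else (0 :: real))" for i j
 have low: "tri r + ((i - r) + (n - r) * j) < d" if "i < n" "\<not> i < r" "j < r" for i j
 proof -
  have "i - r < n - r" using that by linarith
  then have "(i - r) + (n - r) * j < (n - r) * r"
   by (rule colvec_index_pair(2)[OF zero_carrier_mat _ that(3)])
  then show ?thesis by (simp only: d_def add_less_cancel_left mult.commute[of r "n - r"])
 qed
 have 1: "c i j = 0 \<or> k i j < d" if ij: "i < n" "j < n" for i j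
 proof (cases "i < r \<and> j < r")
  case True
  then show ?thesis using tri_pos(1)[of i r j] by (simp add: k_def d_def)
 next
  case False
  then show ?thesis using low[of i j] low[of j i] ij unfolding c_def k_def by auto
 qed
 have 2: "unpack v $$ (i, j) = c i j * v $ k i j" if "i < n" "j < n" for v i j
  using that tri_pos(1)[of i r j] by (auto simp: unpack_def c_def k_def smat_def vec_first_index)
 show thesis by (rule that[OF 1 2])
qed

lemma unpack_linear:
 assumes x: "x \<in> carrier_vec d" and y: "y \<in> carrier_vec d"
 shows "unpack (x + y) = unpack x + unpack y" and "unpack (c *s x) = c \<cdot>\<^sub>m unpack x"
  and "unpack (x - y) = unpack x - unpack y"
proof -
 obtain a k where k: "\<And>i j. i < n ==> j < n ==> a i j = 0 \<or> k i j < d"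
  and e: "\<And>v i j. i < n ==> j < n ==> unpack v $$ (i, j) = a i j * v $ k i j"
  using unpack_entry by blast
 have dims: "dim_vec x = d" "dim_vec y = d" using x y by auto
 show "unpack (x + y) = unpack x + unpack y"
 proof (rule eq_matI)
  fix i j assume "i < dim_row (unpack x + unpack y)" "j < dim_col (unpack x + unpack y)"
  then have ij: "i < n" "j < n" by auto
  show "unpack (x + y) $$ (i, j) = (unpack x + unpack y) $$ (i, j)"
   using k[OF ij] ij by (auto simp: e dims distrib_left)
 qed auto
 show "unpack (c *s x) = c \<cdot>\<^sub>m unpack x"
 proof (rule eq_matI)
  fix i j assume "i < dim_row (c \<cdot>\<^sub>m unpack x)" "j < dim_col (c \<cdot>\<^sub>m unpack x)"
  then have ij: "i < n" "j < n" by auto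
  show "unpack (c *s x) $$ (i, j) = (c \<cdot>\<^sub>m unpack x) $$ (i, j)"
   using k[OF ij] ij by (auto simp: e dims)
 qed auto
 show "unpack (x - y) = unpack x - unpack y"
 proof (rule eq_matI)
  fix i j assume "i < dim_row (unpack x - unpack y)" "j < dim_col (unpack x - unpack y)"
  then have ij: "i < n" "j < n" by auto
  show "unpack (x - y) $$ (i, j) = (unpack x - unpack y) $$ (i, j)"
   using k[OF ij] ij by (auto simp: e dims right_diff_distrib)
 qed auto
qed

lemma pack_inj:
 assumes S: "S \<in> sym_mats n" and T: "T \<in> sym_mats n" and eq: "pack S = pack T"
 shows "had msk S = had msk T"
proof -
 have tt: "tblk S = tblk T" and ll: "lblk S = lblk T"
 proof -
  note ap = append_vec_eq[of "vecS (tblk S)" "tri r" "vecS (tblk T)"]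
  have vc: "vecS (tblk S) \<in> carrier_vec (tri r)" "vecS (tblk T) \<in> carrier_vec (tri r)"
   using vecS_carrier[of "tblk S"] vecS_carrier[of "tblk T"] by (simp_all add: tblk_def)
  from ap[OF this] eq have v: "vecS (tblk S) = vecS (tblk T)" and w: "sqrt 2 *s colvec (lblk S) = sqrt 2 *s colvec (lblk T)"
   unfolding pack_def by auto
  show "tblk S = tblk T" by (rule vecS_inj[OF top_sym[OF S] top_sym[OF T] v])
  have "colvec (lblk S) = colvec (lblk T)"
  proof (rule eq_vecI)
   fix i assume "i < dim_vec (colvec (lblk T))"
   then show "colvec (lblk S) $ i = colvec (lblk T) $ i"
    using arg_cong[OF w, of "\<lambda>v. v $ i"] low_carrier by (auto simp: lblk_def)
  qed (simp add: lblk_def)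
  then show "lblk S = lblk T" by (rule colvec_inj[OF low_carrier low_carrier])
 qed
 show ?thesis
 proof (rule eq_matI)
  fix i j assume "i < dim_row (had msk T)" "j < dim_col (had msk T)"
  then have ij: "i < n" "j < n" using sym_matsD(1)[OF T] by auto
  have low: "S $$ (i, j) = T $$ (i, j)" if "r \<le> i" "j < r" "i < n" for i j
   using arg_cong[OF ll, of "\<lambda>X. X $$ (i - r, j)"] that by (simp add: lblk_def)
  have top: "S $$ (i, j) = T $$ (i, j)" if "i < r" "j < r" for i j
   using arg_cong[OF tt, of "\<lambda>X. X $$ (i, j)"] that by (simp add: tblk_def)
  have "msk i j * S $$ (i, j) = msk i j * T $$ (i, j)"
   using top[of i j] low[of i j] low[of j i] sym_index[OF S ij] sym_index[OF T ij] ij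
   by (cases "i < r"; cases "j < r"; simp add: msk_def)
  then show "had msk S $$ (i, j) = had msk T $$ (i, j)"
   using ij sym_matsD(1)[OF S] sym_matsD(1)[OF T] by auto
 qed (use sym_matsD(1)[OF S] sym_matsD(1)[OF T] in auto)
qed

lemma unpack_pack:
 assumes T: "T \<in> sym_mats n"
 shows "unpack (pack T) = had msk T"
 using pack_inj[OF unpack_sym T pack_unpack[OF pack_carrier]] had_msk_unpack by simp

end

locale augmented = eigenbasis n r W Q Qp for n r W Q Qp +
 fixes m :: nat and A :: "real mat"
 assumes A: "A \<in> carrier_mat m (tri n)" and li: "lin_indpt_rows A"
begin

lemma AT: "A\<^sup>T \<in> carrier_mat (tri n) m" using A by simp

lemmas AT_inj = lin_indpt_rows_inj(1)[OF A li]
lemmas m_le = lin_indpt_rows_inj(2)[OF A li]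

lemma AAT_pd: "A * A\<^sup>T \<in> pd_mats m"
 using gram_pd(1)[OF A] AT_inj by blast

lemma AAT_form: "w \<in> carrier_vec m ==> w \<bullet> ((A * A\<^sup>T) *v w) = (A\<^sup>T *v w) \<bullet> (A\<^sup>T *v w)"
 using gram_pd(2)[OF A] AT_inj by blast

abbreviation EE where "EE \<equiv> bigE W r Q Qp"
abbreviation QQ where "QQ \<equiv> bigQ Q Qp"
abbreviation M where "M \<equiv> aug_mat A W r Q Qp"

lemma EE_carrier: "EE \<in> carrier_mat (tri n) (tri n)"
 unfolding bigE_def Let_def E_spectral
 by (rule carrier_matI) (simp_all add: carrier_matD[OF spectral_carrier[OF V]])

lemma EE_sym: "EE\<^sup>T = EE"
 unfolding bigE_def Let_def E_spectral symkron_transpose using sym_matsD(4)[OF spectral_sym[OF V]] by simp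

lemma EE_mult: "x \<in> carrier_vec (tri n) ==> EE *v x = up (had ee (dn x))"
 using bigE_up[OF dn_sym, of x] up_dn by simp

lemma QQT_mult: "x \<in> carrier_vec (tri n) ==> QQ\<^sup>T *v x = pack (dn x)"
 using bigQT_up[OF dn_sym, of x] up_dn by simp

lemma M_carrier: "M \<in> carrier_mat (m + d) (m + d)"
 using A EE_carrier bigQ_carrier bigSigma_carrier by (auto simp: aug_mat_def)

lemma M_sym: "M \<in> sym_mats (m + d)"
proof -
 have bs: "(bigSigma W r)\<^sup>T = bigSigma W r"
 proof (rule mat_eqI_vec[of _ d d])
  show "(bigSigma W r)\<^sup>T \<in> carrier_mat d d" using bigSigma_carrier by simp
  fix x :: "real vec" assume x: "x \<in> carrier_vec d"
  let ?f = "\<lambda>i j. 1 / sg i j"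
  have sy: "had ?f (unpack y) \<in> sym_mats n" for y
   by (rule had_sym[OF unpack_sym]) (simp add: sg_sym)
  have mk: "had msk (had ?f (unpack y)) = had ?f (unpack y)" for y
   by (rule eq_matI) (auto simp: msk_def unpack_bot)
  have un: "unpack (pack (had ?f (unpack y))) = had ?f (unpack y)" if "y \<in> carrier_vec d" for y
   unfolding unpack_pack[OF sy] by (rule mk)
  have s: "(bigSigma W r *v a) \<bullet> b = a \<bullet> (bigSigma W r *v b)" if "a \<in> carrier_vec d" "b \<in> carrier_vec d" for a b
  proof -
   have c: "had ?f (unpack a) \<in> carrier_mat n n" "had ?f (unpack b) \<in> carrier_mat n n" "unpack a \<in> carrier_mat n n"
    "unpack b \<in> carrier_mat n n"
    using sym_matsD(1)[OF sy] sym_matsD(1)[OF unpack_sym] by auto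
   have "(bigSigma W r *v a) \<bullet> b = ip (unpack (bigSigma W r *v a)) (unpack b)"
    using unpack_scalar_prod[of "bigSigma W r *v a" b] that bigSigma_carrier by simp
   also have "\<dots> = ip (had ?f (unpack a)) (unpack b)" unfolding bigSigma_mult[OF that(1)] un[OF that(1)] ..
   also have "\<dots> = ip (unpack a) (had ?f (unpack b))" by (rule ip_had_swap[OF c(3,4), symmetric])
   also have "\<dots> = ip (unpack a) (unpack (bigSigma W r *v b))" unfolding bigSigma_mult[OF that(2)] un[OF that(2)] ..
   also have "\<dots> = a \<bullet> (bigSigma W r *v b)"
    using unpack_scalar_prod[of a "bigSigma W r *v b"] that bigSigma_carrier by simp
   finally show ?thesis .
  qed
  show "(bigSigma W r)\<^sup>T *v x = bigSigma W r *v x"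
  proof (rule eq_vecI)
   fix i assume "i < dim_vec (bigSigma W r *v x)"
   then have i: "i < d" using bigSigma_carrier by simp
   let ?e = "unit_vec d i :: real vec"
   let ?Sx = "bigSigma W r *v x" and ?Tx = "(bigSigma W r)\<^sup>T *v x"
   have cc: "?Sx \<in> carrier_vec d" "?Tx \<in> carrier_vec d" using bigSigma_carrier x by simp_all
   have "?Tx \<bullet> ?e = x \<bullet> (bigSigma W r *v ?e)"
    using transpose_vec_mult_scalar[OF bigSigma_carrier _ x, of ?e] by simp
   also have "\<dots> = ?Sx \<bullet> ?e" using s[OF x, of ?e] by simp
   finally show "?Tx $ i = ?Sx $ i" using cc i by (simp del: index_mult_mat_vec)
  qed (use bigSigma_carrier in simp)
 qed (rule bigSigma_carrier)
 have "M\<^sup>T = M"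
 proof -
  have "M\<^sup>T = four_block_mat (A * EE * A\<^sup>T)\<^sup>T (QQ\<^sup>T * A\<^sup>T)\<^sup>T (A * QQ)\<^sup>T (- (t\<^sup>2 \<cdot>\<^sub>m bigSigma W r))\<^sup>T"
   unfolding aug_mat_def
   by (rule transpose_four_block_mat[of _ m m _ d _ d]) (use A EE_carrier bigQ_carrier bigSigma_carrier in auto)
  also have "(A * EE * A\<^sup>T)\<^sup>T = A * EE * A\<^sup>T" using A EE_carrier EE_sym by (simp add: mat_dims)
  also have "(QQ\<^sup>T * A\<^sup>T)\<^sup>T = A * QQ" using A bigQ_carrier by (simp add: mat_dims)
  also have "(A * QQ)\<^sup>T = QQ\<^sup>T * A\<^sup>T" using A bigQ_carrier by (simp add: mat_dims)
  also have "(- (t\<^sup>2 \<cdot>\<^sub>m bigSigma W r))\<^sup>T = - (t\<^sup>2 \<cdot>\<^sub>m (bigSigma W r)\<^sup>T)" by (rule eq_matI) auto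
  finally show ?thesis unfolding bs aug_mat_def .
 qed
 then show ?thesis using M_carrier by (simp add: sym_mats_def)
qed

text \<open>The coefficients of \<open>\<tau>\<^sup>2 \<Sigma>\<close>.\<close>

definition dd where "dd i j = t\<^sup>2 / sg i j"

lemma dd_sym: "dd i j = dd j i" by (simp add: dd_def sg_sym)

lemma D_mult:
 assumes v: "v \<in> carrier_vec d"
 shows "t\<^sup>2 *s (bigSigma W r *v v) = pack (had dd (unpack v))"
proof -
 have c: "had (\<lambda>i j. 1 / sg i j) (unpack v) \<in> carrier_mat n n" by (rule carrier_matI) simp_all
 have "had dd (unpack v) = t\<^sup>2 \<cdot>\<^sub>m had (\<lambda>i j. 1 / sg i j) (unpack v)"
  by (rule eq_matI) (auto simp: dd_def)
 moreover have "pack (c \<cdot>\<^sub>m T) = c *s pack T" if "T \<in> carrier_mat n n" for T c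
 proof -
  have 1: "tblk (c \<cdot>\<^sub>m T) = c \<cdot>\<^sub>m tblk T" by (rule eq_matI) (use that rn in \<open>auto simp: tblk_def\<close>)
  have 2: "lblk (c \<cdot>\<^sub>m T) = c \<cdot>\<^sub>m lblk T" by (rule eq_matI) (use that rn in \<open>auto simp: lblk_def\<close>)
  have 3: "vecS (c \<cdot>\<^sub>m tblk T) = c *s vecS (tblk T)" by (rule vecS_smult[of _ r]) (simp add: tblk_def)
  show ?thesis unfolding pack_def 1 2 3 colvec_smult by (rule eq_vecI) auto
 qed
 ultimately show ?thesis using bigSigma_mult[OF v] c by simp
qed

lemma M_mult:
 assumes u: "u \<in> carrier_vec m" and v: "v \<in> carrier_vec d"
 shows "M *v (u @\<^sub>v v) = (A *v (EE *v (A\<^sup>T *v u)) + A *v (QQ *v v)) @\<^sub>v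
  (QQ\<^sup>T *v (A\<^sup>T *v u) - t\<^sup>2 *s (bigSigma W r *v v))"
proof -
 note c = A EE_carrier bigQ_carrier bigSigma_carrier
 have "M *v (u @\<^sub>v v) = (A * EE * A\<^sup>T *v u + A * QQ *v v) @\<^sub>v
   (QQ\<^sup>T * A\<^sup>T *v u + - (t\<^sup>2 \<cdot>\<^sub>m bigSigma W r) *v v)"
  unfolding aug_mat_def
  by (rule four_block_mat_mult_vec[of _ m m _ d _ d]) (use c u v in auto)
 moreover have "A * EE * A\<^sup>T *v u = A *v (EE *v (A\<^sup>T *v u))" using c u by (simp add: mat_dims)
 moreover have "A * QQ *v v = A *v (QQ *v v)" using c v by (simp add: mat_dims)
 moreover have "QQ\<^sup>T * A\<^sup>T *v u = QQ\<^sup>T *v (A\<^sup>T *v u)" using c u by (simp add: mat_dims)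
 moreover have "QQ\<^sup>T *v (A\<^sup>T *v u) + - (t\<^sup>2 \<cdot>\<^sub>m bigSigma W r) *v v =
   QQ\<^sup>T *v (A\<^sup>T *v u) - t\<^sup>2 *s (bigSigma W r *v v)"
  using c u v by (intro eq_vecI) auto
 ultimately show ?thesis by simp
qed

subsection \<open>Quadratic forms of the blocks\<close>

definition gform where "gform u = u \<bullet> (A *v (EE *v (A\<^sup>T *v u)))"
definition dform where "dform v = ip (unpack v) (had dd (unpack v))"

lemma D_form:
 assumes v: "v \<in> carrier_vec d"
 shows "v \<bullet> (t\<^sup>2 *s (bigSigma W r *v v)) = dform v"
proof -
 have s: "had dd (unpack v) \<in> sym_mats n" by (rule had_sym[OF unpack_sym dd_sym])
 have "v \<bullet> (t\<^sup>2 *s (bigSigma W r *v v)) = pack (unpack v) \<bullet> pack (had dd (unpack v))"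
  unfolding D_mult[OF v] pack_unpack[OF v] ..
 also have "\<dots> = ip (unpack v) (had msk (had dd (unpack v)))" by (rule pack_scalar_prod[OF unpack_sym s])
 also have "had msk (had dd (unpack v)) = had dd (unpack v)" by (rule eq_matI) (auto simp: msk_def unpack_bot)
 finally show ?thesis by (simp add: dform_def)
qed

lemma E_form:
 assumes x: "x \<in> carrier_vec (tri n)" and y: "y \<in> carrier_vec (tri n)"
 shows "x \<bullet> (EE *v y) = ip (dn x) (had ee (dn y))"
proof -
 have s: "had ee (dn y) \<in> sym_mats n" by (rule had_sym[OF dn_sym]) (simp add: ee_def mult.commute)
 have "x \<bullet> (EE *v y) = up (dn x) \<bullet> up (had ee (dn y))" unfolding EE_mult[OF y] up_dn[OF x] ..
 also have "\<dots> = ip (dn x) (had ee (dn y))" by (rule up_scalar_prod[OF dn_sym s])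
 finally show ?thesis .
qed

lemma dn_norm: "x \<in> carrier_vec (tri n) ==> ip (dn x) (dn x) = x \<bullet> x"
 using up_scalar_prod[OF dn_sym dn_sym, of x x] up_dn[of x] by simp

lemma ip_had_bounds:
 assumes T: "T \<in> carrier_mat n n"
 shows "(\<And>i j. i < n ==> j < n ==> T $$ (i, j) \<noteq> 0 ==> c \<le> f i j) ==> c * ip T T \<le> ip T (had f T)"
  and "(\<And>i j. i < n ==> j < n ==> T $$ (i, j) \<noteq> 0 ==> f i j \<le> c) ==> ip T (had f T) \<le> c * ip T T"
proof -
 show "c * ip T T \<le> ip T (had f T)" if b: "\<And>i j. i < n ==> j < n ==> T $$ (i, j) \<noteq> 0 ==> c \<le> f i j"
  unfolding ip_eq[OF T T] ip_had[OF T T] sum_distrib_left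
 proof (intro sum_mono)
  fix i j assume "j \<in> {..<n}" "i \<in> {..<n}"
  then show "c * (T $$ (i, j) * T $$ (i, j)) \<le> f i j * (T $$ (i, j) * T $$ (i, j))"
   using b[of i j] by (cases "T $$ (i, j) = 0") (auto intro: mult_right_mono)
 qed
 show "ip T (had f T) \<le> c * ip T T" if b: "\<And>i j. i < n ==> j < n ==> T $$ (i, j) \<noteq> 0 ==> f i j \<le> c"
  unfolding ip_eq[OF T T] ip_had[OF T T] sum_distrib_left
 proof (intro sum_mono)
  fix i j assume "j \<in> {..<n}" "i \<in> {..<n}"
  then show "f i j * (T $$ (i, j) * T $$ (i, j)) \<le> c * (T $$ (i, j) * T $$ (i, j))"
   using b[of i j] by (cases "T $$ (i, j) = 0") (auto intro: mult_right_mono)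
 qed
qed

lemma E_bounds:
 assumes x: "x \<in> carrier_vec (tri n)" and w: "0 < w" "\<And>i. i < n ==> w \<le> ev i"
 shows "(w / (2 * t))\<^sup>2 * (x \<bullet> x) \<le> x \<bullet> (EE *v x)" and "x \<bullet> (EE *v x) \<le> 4 * (x \<bullet> x)"
proof -
 have w2: "w \<le> 2 * t" using w(2)[OF rn] by (simp add: tau_ev)
 have lo: "w / (2 * t) \<le> ec i" if "i < n" for i
 proof (cases "i < r")
  case True
  then show ?thesis using w2 tau_pos by (simp add: ec_def)
 next
  case False
  have "w / (2 * t) \<le> w / t" using w(1) tau_pos by (simp add: field_simps)
  also have "\<dots> \<le> ev i / t" using w(2)[OF that] tau_pos by (simp add: divide_right_mono)
  finally show ?thesis using False by (simp add: ec_def)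
 qed
 have hi: "ec i \<le> 2" if "i < n" for i
  using ev_bot[of i] that tau_pos by (auto simp: ec_def field_simps)
 have p: "0 \<le> w / (2 * t)" using w(1) tau_pos by simp
 note dc = sym_matsD(1)[OF dn_sym[of x]]
 have "(w / (2 * t))\<^sup>2 * ip (dn x) (dn x) \<le> ip (dn x) (had ee (dn x))"
 proof (rule ip_had_bounds(1)[OF dc])
  fix i j assume ij: "i < n" "j < n"
  have "w / (2 * t) * (w / (2 * t)) \<le> ec i * ec j"
   by (rule mult_mono[OF lo[OF ij(1)] lo[OF ij(2)]]) (use p lo[OF ij(1)] in linarith)+
  then show "(w / (2 * t))\<^sup>2 \<le> ee i j" by (simp only: ee_def power2_eq_square)
 qed
 then show "(w / (2 * t))\<^sup>2 * (x \<bullet> x) \<le> x \<bullet> (EE *v x)" by (simp add: dn_norm[OF x] E_form[OF x x])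
 have "ip (dn x) (had ee (dn x)) \<le> 4 * ip (dn x) (dn x)"
 proof (rule ip_had_bounds(2)[OF dc])
  fix i j assume ij: "i < n" "j < n"
  have "ec i * ec j \<le> 2 * 2" using hi[OF ij(1)] hi[OF ij(2)] p lo[OF ij(2)] by (intro mult_mono) auto
  then show "ee i j \<le> 4" by (simp add: ee_def)
 qed
 then show "x \<bullet> (EE *v x) \<le> 4 * (x \<bullet> x)" by (simp add: dn_norm[OF x] E_form[OF x x])
qed

lemma unpack_nonzero_msk: "i < n ==> j < n ==> unpack v $$ (i, j) \<noteq> 0 ==> msk i j \<noteq> 0"
 using unpack_bot[of i j v] by (cases "i < r"; cases "j < r") (auto simp: msk_def)

lemma D_bounds:
 assumes v: "v \<in> carrier_vec d" and w: "0 < w" "\<And>i. i < n ==> w \<le> ev i"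
 shows "0 \<le> dform v" and "dform v \<le> t / w * (v \<bullet> v)"
proof -
 note uc = sym_matsD(1)[OF unpack_sym[of v]]
 have "0 * ip (unpack v) (unpack v) \<le> ip (unpack v) (had dd (unpack v))"
 proof (rule ip_had_bounds(1)[OF uc])
  fix i j assume "i < n" "j < n" "unpack v $$ (i, j) \<noteq> 0"
  then show "0 \<le> dd i j" using sg_pos[of i j] unpack_nonzero_msk[of i j v] by (auto simp: dd_def)
 qed
 then show "0 \<le> dform v" by (simp add: dform_def)
 have w2: "w \<le> 2 * t" using w(2)[OF rn] by (simp add: tau_ev)
 have low: "dd i j \<le> t / w" if "r \<le> i" "j < r" "i < n" for i j
 proof -
  have "w * t \<le> ev i * (ev j - t)" using w(1) w(2)[OF that(3)] ev_top[OF that(2)] tau_pos by (intro mult_mono) auto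
  moreover have wt: "0 < w * t" using w(1) tau_pos by simp
  ultimately have "t\<^sup>2 / sg i j \<le> t\<^sup>2 / (w * t)"
   unfolding sg_low[OF that(1,2)] using wt
   by (intro divide_left_mono mult_pos_pos[of "ev i * (ev j - t)" "w * t"]) auto
  then show ?thesis using tau_pos by (simp add: dd_def power2_eq_square)
 qed
 have tp: "dd i j \<le> t / w" if "i < r" "j < r" for i j
 proof -
  have "(2 * t) * (2 * t) \<le> ev i * ev j" using ev_top[OF that(1)] ev_top[OF that(2)] tau_pos by (intro mult_mono) auto
  then have "3 * t\<^sup>2 \<le> sg i j" unfolding sg_top[OF that] by (simp add: power2_eq_square)
  moreover have t2: "0 < t\<^sup>2" using tau_pos by simp
  moreover have "0 < sg i j" using calculation by linarith
  ultimately have "t\<^sup>2 / sg i j \<le> t\<^sup>2 / (3 * t\<^sup>2)" by (intro divide_left_mono mult_pos_pos) auto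
  also have "\<dots> \<le> 1 / 2" using t2 by simp
  also have "1 / 2 \<le> t / w" using w2 w(1) by (simp add: field_simps)
  finally show ?thesis by (simp add: dd_def)
 qed
 have "ip (unpack v) (had dd (unpack v)) \<le> t / w * ip (unpack v) (unpack v)"
 proof (rule ip_had_bounds(2)[OF uc])
  fix i j assume ij: "i < n" "j < n" "unpack v $$ (i, j) \<noteq> 0"
  then show "dd i j \<le> t / w"
   using low[of i j] low[of j i] tp[of i j] dd_sym[of i j] unpack_nonzero_msk[OF ij]
   by (cases "i < r"; cases "j < r") (auto simp: msk_def)
 qed
 then show "dform v \<le> t / w * (v \<bullet> v)" by (simp add: dform_def unpack_scalar_prod[OF v v])
qed

lemma Q_isometry:
 assumes v: "v \<in> carrier_vec d"
 shows "(QQ *v v) \<bullet> (QQ *v v) = v \<bullet> v"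
 unfolding bigQ_up[OF v] up_scalar_prod[OF unpack_sym unpack_sym] unpack_scalar_prod[OF v v] ..

text \<open>\<open>piq h\<close> is the squared norm of the orthogonal projection of \<open>h\<close> onto the row space of \<open>A\<close>.\<close>

definition pw where "pw h = minv (A * A\<^sup>T) *v (A *v h)"
definition piq where "piq h = (A\<^sup>T *v pw h) \<bullet> (A\<^sup>T *v pw h)"

lemma pw_carrier: "h \<in> carrier_vec (tri n) ==> pw h \<in> carrier_vec m"
 using pd_minv(1)[OF AAT_pd] by (simp add: pw_def mat_dims)

lemma piq_eq:
 assumes h: "h \<in> carrier_vec (tri n)"
 shows "pw h \<bullet> (A *v h) = piq h" "(A\<^sup>T *v pw h) \<bullet> h = piq h"
proof -
 note i = pd_minv[OF AAT_pd]
 have Nc: "A * A\<^sup>T \<in> carrier_mat m m" using A by simp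
 have "(A * A\<^sup>T) *v pw h = A *v h"
  unfolding pw_def by (rule inverse_cancel_vec[OF Nc i(1) i(2) mult_mat_vec_carrier[OF A h]])
 then show 1: "pw h \<bullet> (A *v h) = piq h" using AAT_form[OF pw_carrier[OF h]] by (simp add: piq_def)
 show "(A\<^sup>T *v pw h) \<bullet> h = piq h"
  using transpose_vec_mult_scalar[OF A h pw_carrier[OF h]] 1 by simp
qed

lemma piq_nonneg: "0 \<le> piq h" by (simp add: piq_def scalar_prod_self_nonneg)

lemma piq_le:
 assumes h: "h \<in> carrier_vec (tri n)"
 shows "sqrt (piq h) \<le> vnorm h"
proof (cases "piq h = 0")
 case False
 then have p: "0 < sqrt (piq h)" using piq_nonneg[of h] by simp
 have "piq h \<le> vnorm (A\<^sup>T *v pw h) * vnorm h"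
  using Cauchy_Schwarz_vnorm[of "A\<^sup>T *v pw h" "tri n" h] piq_eq(2)[OF h] h A pw_carrier[OF h] by simp
 also have "vnorm (A\<^sup>T *v pw h) = sqrt (piq h)" by (simp add: vnorm_def piq_def)
 finally have "sqrt (piq h) * sqrt (piq h) \<le> sqrt (piq h) * vnorm h" using piq_nonneg[of h] by simp
 then show ?thesis by (rule mult_left_le_imp_le[OF _ p])
qed simp

text \<open>The matrix is quasi-definite.  For a negative eigenvalue \<open>- q\<close> the first block row reads
 \<open>(G + q) u = - A h\<close> with \<open>h = Q v\<close>, and eliminating \<open>u\<close> leaves
 \<open>q |v|\<^sup>2 = v\<cdot>D v + u\<cdot>(G + q) u\<close>; the last term is bounded below by testing with
 \<open>(A A\<^sup>T)\<^sup>-\<^sup>1 A h\<close>.\<close>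

lemma eigenvalue_bounds:
 assumes z: "z \<in> carrier_vec (m + d)" "z \<noteq> 0\<^sub>v (m + d)" and ev: "M *v z = \<theta> *s z"
  and a: "0 < a" "\<And>w. w \<in> carrier_vec m ==> a * (w \<bullet> w) \<le> (A\<^sup>T *v w) \<bullet> (A\<^sup>T *v w)"
  and B: "0 \<le> B" "\<And>w. w \<in> carrier_vec m ==> vnorm (A\<^sup>T *v w) \<le> B * vnorm w"
  and w: "0 < w" "\<And>i. i < n ==> w \<le> ev i"
  and s: "0 < s" "\<And>v. v \<in> carrier_vec d ==> s * (v \<bullet> v) \<le> dform v + piq (QQ *v v) / 5"
  and c: "c \<le> a" "c \<le> a * (w / (2 * t))\<^sup>2" "c \<le> s"
 shows "c \<le> \<bar>\<theta>\<bar>" and "\<bar>\<theta>\<bar> \<le> 4 * B\<^sup>2 + B + t / w"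
proof -
 define u v where "u = vec_first z m" and "v = vec_last z d"
 have u: "u \<in> carrier_vec m" and v: "v \<in> carrier_vec d" by (simp_all add: u_def v_def)
 have zuv: "z = u @\<^sub>v v" unfolding u_def v_def using vec_first_last_append[OF z(1)] by simp
 define h where "h = QQ *v v"
 define G where "G = A *v (EE *v (A\<^sup>T *v u))"
 define Bv where "Bv = A *v h"
 define Bu where "Bu = QQ\<^sup>T *v (A\<^sup>T *v u)"
 define Dv where "Dv = t\<^sup>2 *s (bigSigma W r *v v)"
 note cr = A EE_carrier bigQ_carrier bigSigma_carrier
 have h: "h \<in> carrier_vec (tri n)" using cr v by (simp add: h_def)
 have au: "A\<^sup>T *v u \<in> carrier_vec (tri n)" using A u by simp
 have cc: "G \<in> carrier_vec m" "Bv \<in> carrier_vec m" "Bu \<in> carrier_vec d" "Dv \<in> carrier_vec d"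
  unfolding G_def Bv_def Bu_def Dv_def h_def using cr u v by (simp_all add: mat_dims)
 have "(G + Bv) @\<^sub>v (Bu - Dv) = (\<theta> *s u) @\<^sub>v (\<theta> *s v)"
 proof -
  have "\<theta> *s z = (\<theta> *s u) @\<^sub>v (\<theta> *s v)" unfolding zuv by (rule eq_vecI) auto
  then show ?thesis using ev M_mult[OF u v] unfolding zuv G_def Bv_def Bu_def Dv_def h_def by simp
 qed
 then have e1: "G + Bv = \<theta> *s u" and e2: "Bu - Dv = \<theta> *s v"
  using append_vec_eq[of "G + Bv" m "\<theta> *s u"] cc u by simp_all
 define uG uB vD where "uG = u \<bullet> G" and "uB = u \<bullet> Bv" and "vD = v \<bullet> Dv"
 have vB: "v \<bullet> Bu = uB"
 proof -
  have "v \<bullet> Bu = (QQ *v v) \<bullet> (A\<^sup>T *v u)"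
   unfolding Bu_def using transpose_vec_mult_scalar[OF bigQ_carrier v au]
    comm_scalar_prod[of v d "QQ\<^sup>T *v (A\<^sup>T *v u)"] comm_scalar_prod[of "QQ *v v" "tri n" "A\<^sup>T *v u"] cc v au h
   by (simp add: Bu_def h_def)
  also have "\<dots> = uB"
   unfolding uB_def Bv_def using transpose_vec_mult_scalar[OF A h u] comm_scalar_prod[OF h au] by (simp add: h_def)
  finally show ?thesis .
 qed
 have f1: "uG + uB = \<theta> * (u \<bullet> u)"
  using arg_cong[OF e1, of "\<lambda>x. u \<bullet> x"] cc u by (simp add: uG_def uB_def scalar_prod_add_distrib[of _ m])
 have f2: "uB - vD = \<theta> * (v \<bullet> v)"
  using arg_cong[OF e2, of "\<lambda>x. v \<bullet> x"] cc v vB by (simp add: vD_def scalar_prod_minus_distrib[of _ d])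
 have vDd: "vD = dform v" unfolding vD_def Dv_def by (rule D_form[OF v])
 have vD0: "0 \<le> vD" and vD1: "vD \<le> t / w * (v \<bullet> v)" unfolding vDd using D_bounds[OF v w] by simp_all
 have Gx: "x \<bullet> (A *v (EE *v (A\<^sup>T *v y))) = (A\<^sup>T *v x) \<bullet> (EE *v (A\<^sup>T *v y))"
  if "x \<in> carrier_vec m" "y \<in> carrier_vec m" for x y
  using transpose_vec_mult_scalar[OF A _ that(1), of "EE *v (A\<^sup>T *v y)"] EE_carrier A that by (simp add: mat_dims)
 have uG1: "(w / (2 * t))\<^sup>2 * ((A\<^sup>T *v u) \<bullet> (A\<^sup>T *v u)) \<le> uG" and uG2: "uG \<le> 4 * ((A\<^sup>T *v u) \<bullet> (A\<^sup>T *v u))"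
  unfolding uG_def G_def Gx[OF u u] using E_bounds[OF au w] by blast+
 have uu: "0 \<le> u \<bullet> u" and vv: "0 \<le> v \<bullet> v" by (rule scalar_prod_self_nonneg)+
 have zz: "0 < u \<bullet> u + v \<bullet> v"
 proof -
  have "z \<bullet> z = u \<bullet> u + v \<bullet> v" unfolding zuv by (rule scalar_prod_append[OF u v u v])
  then show ?thesis using scalar_prod_self_eq_0[OF z(1)] z(2) uu vv by linarith
 qed
 have uG3: "a * (w / (2 * t))\<^sup>2 * (u \<bullet> u) \<le> uG"
 proof -
  have "(w / (2 * t))\<^sup>2 * (a * (u \<bullet> u)) \<le> (w / (2 * t))\<^sup>2 * ((A\<^sup>T *v u) \<bullet> (A\<^sup>T *v u))"
   by (rule mult_left_mono[OF a(2)[OF u]]) simp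
  then show ?thesis using uG1 by (simp add: algebra_simps)
 qed
 have uG0: "0 \<le> uG" using uG3 uu a(1) by (meson mult_nonneg_nonneg order_trans less_imp_le zero_le_power2)
 show "c \<le> \<bar>\<theta>\<bar>"
 proof (cases "0 \<le> \<theta>")
  case True
  have "uG + vD = \<theta> * (u \<bullet> u) - \<theta> * (v \<bullet> v)" using f1 f2 by linarith
  then have le: "uG \<le> \<theta> * (u \<bullet> u)" using vD0 True vv mult_nonneg_nonneg[of \<theta> "v \<bullet> v"] by linarith
  have "u \<bullet> u \<noteq> 0"
  proof
   assume u0: "u \<bullet> u = 0"
   then have "u = 0\<^sub>v m" using scalar_prod_self_eq_0[OF u] by simp
   then have G0: "G = 0\<^sub>v m" unfolding G_def
    using mult_zero_vec[OF AT] mult_zero_vec[OF EE_carrier] mult_zero_vec[OF A] by simp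
   then have Bv0: "Bv = 0\<^sub>v m" using e1 \<open>u = 0\<^sub>v m\<close> cc by (auto intro!: eq_vecI dest: arg_cong[of _ _ "\<lambda>x. x $ _"])
   have "piq h = 0" using piq_eq(1)[OF h] Bv0 pw_carrier[OF h] by (simp add: Bv_def)
   then have "s * (v \<bullet> v) \<le> vD" using s(2)[OF v] vDd by (simp add: h_def)
   moreover have "vD = - \<theta> * (v \<bullet> v)" using f2 Bv0 u by (simp add: uB_def)
   moreover have "0 < v \<bullet> v" using zz u0 by simp
   moreover have "- \<theta> * (v \<bullet> v) \<le> 0" using True vv by simp
   ultimately show False using s(1) by (metis mult_pos_pos not_less order_trans)
  qed
  then have up: "0 < u \<bullet> u" using uu by simp
  have "c * (u \<bullet> u) \<le> a * (w / (2 * t))\<^sup>2 * (u \<bullet> u)" by (rule mult_right_mono[OF c(2) uu])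
  then have "c * (u \<bullet> u) \<le> \<theta> * (u \<bullet> u)" using uG3 le by linarith
  then show ?thesis using up True by simp
 next
  case False
  define q where "q = - \<theta>"
  have q: "0 < q" using False by (simp add: q_def)
  show ?thesis
  proof (cases "a \<le> q")
   case True
   then show ?thesis using c(1) q by (simp add: q_def)
  next
   case False
   define K where "K x y = x \<bullet> (A *v (EE *v (A\<^sup>T *v y))) + q * (x \<bullet> y)" for x y
   let ?p = "pw h"
   note pc = pw_carrier[OF h]
   have atp: "A\<^sup>T *v ?p \<in> carrier_vec (tri n)" using A pc by simp
   have CS: "(K ?p u)\<^sup>2 \<le> K ?p ?p * K u u"
   proof (rule discriminant_le)
    fix y :: real
    let ?x = "?p + y *s u"
    have xc: "?x \<in> carrier_vec m" using pc u by simp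
    have Esw: "(A\<^sup>T *v u) \<bullet> (EE *v (A\<^sup>T *v ?p)) = (A\<^sup>T *v ?p) \<bullet> (EE *v (A\<^sup>T *v u))"
    proof -
     have "(EE *v (A\<^sup>T *v u)) \<bullet> (A\<^sup>T *v ?p) = (A\<^sup>T *v u) \<bullet> (EE *v (A\<^sup>T *v ?p))"
      using transpose_vec_mult_scalar[OF EE_carrier atp au] EE_sym by simp
     then show ?thesis using comm_scalar_prod[of "EE *v (A\<^sup>T *v u)" "tri n" "A\<^sup>T *v ?p"] EE_carrier au atp by simp
    qed
    have ax: "A\<^sup>T *v ?x = A\<^sup>T *v ?p + y *s (A\<^sup>T *v u)"
     using A pc u by (simp add: mult_vec_add_dim mult_vec_smult_dim)
    have ex: "EE *v (A\<^sup>T *v ?x) = EE *v (A\<^sup>T *v ?p) + y *s (EE *v (A\<^sup>T *v u))"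
     unfolding ax using mult_add_distrib_mat_vec[OF EE_carrier atp, of "y *s (A\<^sup>T *v u)"]
      mult_mat_vec[OF EE_carrier au, of y] au by simp
    have ecs: "EE *v (A\<^sup>T *v ?p) \<in> carrier_vec (tri n)" "EE *v (A\<^sup>T *v u) \<in> carrier_vec (tri n)"
     using EE_carrier atp au by simp_all
    have "K ?x ?x = K ?p ?p + 2 * K ?p u * y + K u u * y\<^sup>2"
     unfolding K_def Gx[OF xc xc] Gx[OF pc pc] Gx[OF pc u] Gx[OF u u] unfolding ex unfolding ax
     using atp au ecs pc u comm_scalar_prod[OF u pc]
     by (simp add: add_scalar_prod_distrib[of _ "tri n"] scalar_prod_add_distrib[of _ "tri n"]
       add_scalar_prod_distrib[of _ m] scalar_prod_add_distrib[of _ m] Esw algebra_simps power2_eq_square)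
    moreover have "0 \<le> K ?x ?x"
    proof -
     have axc: "A\<^sup>T *v ?x \<in> carrier_vec (tri n)" using A xc by simp
     have "0 \<le> (w / (2 * t))\<^sup>2 * ((A\<^sup>T *v ?x) \<bullet> (A\<^sup>T *v ?x))"
      by (intro mult_nonneg_nonneg scalar_prod_self_nonneg) simp
     then show ?thesis unfolding K_def Gx[OF xc xc]
      using E_bounds(1)[OF axc w] q scalar_prod_self_nonneg[of ?x] by (simp add: add_nonneg_nonneg)
    qed
    ultimately show "0 \<le> K ?p ?p + 2 * K ?p u * y + K u u * y\<^sup>2" by simp
   qed
   have Kpp: "K ?p ?p \<le> 5 * piq h"
   proof -
    have "K ?p ?p \<le> 4 * piq h + q * (?p \<bullet> ?p)"
     unfolding K_def Gx[OF pc pc] using E_bounds(2)[OF atp w] by (simp add: piq_def)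
    also have "q * (?p \<bullet> ?p) \<le> a * (?p \<bullet> ?p)"
     using False scalar_prod_self_nonneg[of ?p] by (intro mult_right_mono) auto
    also have "a * (?p \<bullet> ?p) \<le> piq h" using a(2)[OF pc] by (simp add: piq_def)
    finally show ?thesis by simp
   qed
   have Kpu: "K ?p u = - piq h"
   proof -
    have "G + Bv = - q *s u" using e1 by (simp add: q_def)
    then have "?p \<bullet> (G + Bv) = - q * (?p \<bullet> u)" using pc u by simp
    then have "?p \<bullet> G + ?p \<bullet> Bv = - q * (?p \<bullet> u)" using pc cc by (simp add: scalar_prod_add_distrib[of _ m])
    then show ?thesis using piq_eq(1)[OF h] by (simp add: K_def G_def Bv_def)
   qed
   have Kuu: "K u u = - uB" using f1 by (simp add: K_def uG_def G_def q_def)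
   have Kuu0: "0 \<le> K u u" using uG0 q uu by (simp add: K_def uG_def G_def)
   have le: "piq h / 5 \<le> K u u"
   proof (cases "piq h = 0")
    case False
    then have pp: "0 < piq h" using piq_nonneg[of h] by simp
    have "piq h * piq h \<le> K ?p ?p * K u u" using CS Kpu by (simp add: power2_eq_square)
    also have "\<dots> \<le> 5 * piq h * K u u" by (rule mult_right_mono[OF Kpp Kuu0])
    finally have "piq h * piq h \<le> piq h * (5 * K u u)" by (simp add: algebra_simps)
    then show ?thesis using pp by simp
   qed (use Kuu0 in simp)
   have qv: "q * (v \<bullet> v) = vD + K u u" using f2 Kuu by (simp add: q_def)
   have "v \<bullet> v \<noteq> 0"
   proof
    assume v0: "v \<bullet> v = 0"
    then have "v = 0\<^sub>v d" using scalar_prod_self_eq_0[OF v] by simp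
    then have "K u u = 0" using qv vD0 Kuu0 v0 by simp
    then have "q * (u \<bullet> u) = 0" using uG0 q uu by (simp add: K_def uG_def G_def add_nonneg_eq_0_iff)
    then show False using zz v0 q by simp
   qed
   then have vp: "0 < v \<bullet> v" using vv by simp
   have "s * (v \<bullet> v) \<le> q * (v \<bullet> v)" using s(2)[OF v] le qv vDd by (simp add: h_def)
   then have "s \<le> q" using vp by simp
   then show ?thesis using c(3) q by (simp add: q_def)
  qed
 qed
 show "\<bar>\<theta>\<bar> \<le> 4 * B\<^sup>2 + B + t / w"
 proof -
  define nu nv where "nu = vnorm u" and "nv = vnorm v"
  have nn: "u \<bullet> u = nu\<^sup>2" "v \<bullet> v = nv\<^sup>2" by (simp_all add: nu_def nv_def vnorm_power2)
  have n0: "0 \<le> nu" "0 \<le> nv" by (simp_all add: nu_def nv_def)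
  have Au: "vnorm (A\<^sup>T *v u) \<le> B * nu" using B(2)[OF u] by (simp add: nu_def)
  have "(A\<^sup>T *v u) \<bullet> (A\<^sup>T *v u) \<le> (B * nu)\<^sup>2"
   using Au by (subst vnorm_le_iff[symmetric]) (auto simp: B(1) n0)
  then have g: "uG \<le> 4 * (B\<^sup>2 * nu\<^sup>2)" using uG2 by (simp add: power_mult_distrib)
  have "uB = (A\<^sup>T *v u) \<bullet> h" unfolding uB_def Bv_def using transpose_vec_mult_scalar[OF A h u] by simp
  then have "\<bar>uB\<bar> \<le> vnorm (A\<^sup>T *v u) * vnorm h" using Cauchy_Schwarz_vnorm[OF au h] by simp
  also have "vnorm h = nv" using Q_isometry[OF v] by (simp add: h_def nv_def vnorm_def)
  also have "vnorm (A\<^sup>T *v u) * nv \<le> B * nu * nv" by (rule mult_right_mono[OF Au n0(2)])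
  finally have b: "\<bar>uB\<bar> \<le> B * (nu * nv)" by (simp add: algebra_simps)
  have "0 \<le> (nu - nv)\<^sup>2" by simp
  then have "2 * (nu * nv) \<le> nu\<^sup>2 + nv\<^sup>2" by (simp add: power2_diff)
  then have b2: "2 * \<bar>uB\<bar> \<le> B * (nu\<^sup>2 + nv\<^sup>2)"
   using b mult_left_mono[of "2 * (nu * nv)" "nu\<^sup>2 + nv\<^sup>2" B] B(1) by linarith
  have dv: "vD \<le> t / w * nv\<^sup>2" using vD1 nn by simp
  have tw: "0 \<le> t / w" using tau_pos w(1) by simp
  have "\<theta> * (nu\<^sup>2 + nv\<^sup>2) = uG + 2 * uB - vD" using f1 f2 nn by (simp add: algebra_simps)
  then have "\<bar>\<theta>\<bar> * (nu\<^sup>2 + nv\<^sup>2) = \<bar>uG + 2 * uB - vD\<bar>"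
   by (metis abs_mult abs_of_nonneg add_nonneg_nonneg zero_le_power2)
  also have "\<dots> \<le> uG + 2 * \<bar>uB\<bar> + vD" using uG0 vD0 by linarith
  also have "\<dots> \<le> 4 * (B\<^sup>2 * nu\<^sup>2) + B * (nu\<^sup>2 + nv\<^sup>2) + t / w * nv\<^sup>2" using g b2 dv by linarith
  also have "\<dots> \<le> (4 * B\<^sup>2 + B + t / w) * (nu\<^sup>2 + nv\<^sup>2)"
   using mult_nonneg_nonneg[OF tw zero_le_power2[of nu]] by (simp add: algebra_simps add_nonneg_nonneg)
  finally show ?thesis using zz nn by simp
 qed
qed

end

lemma append_vec_minus:
 "dim_vec a = dim_vec c ==> dim_vec b = dim_vec d ==> (a @\<^sub>v b) - (c @\<^sub>v d) = (a - c) @\<^sub>v (b - d :: real vec)"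
 by (rule eq_vecI) auto

lemma add_vec_minus_assoc:
 "a \<in> carrier_vec k ==> b \<in> carrier_vec k ==> c \<in> carrier_vec k ==> a + b - c = a + (b - c :: real vec)"
 by (rule eq_vecI) auto

lemma smult_minus_factor:
 assumes "y \<in> carrier_vec k" "c \<in> carrier_vec k" "s \<noteq> 0"
 shows "(1 / s) *s y - c = (1 / s) *s (y - s *s (c :: real vec))"
 by (rule eq_vecI) (use assms in \<open>auto simp: field_simps\<close>)

section \<open>Tangent space injectivity and the low-rank block\<close>

context augmented
begin

text \<open>An \<open>(r + 1)\<close>-dimensional eigenspace of \<open>W\<close> meets the kernel of \<open>X\<^sup>* = U U\<^sup>T\<close>, because \<open>U\<close> has at
 most \<open>r\<close> columns.\<close>

lemma threshold_le_kernel_bound: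
 assumes Us: "Us \<in> carrier_mat n k" "k \<le> r" and Xs: "Xs = Us * Us\<^sup>T"
  and ker: "\<And>x. x \<in> carrier_vec n ==> Xs *v x = 0\<^sub>v n ==> x \<bullet> (W *v x) \<le> l * (x \<bullet> x)"
 shows "2 * t \<le> l"
proof -
 define N where "N = Us\<^sup>T * V"
 define K where "K = mat k (r + 1) (\<lambda>(i, j). N $$ (i, j))"
 have Nc: "N \<in> carrier_mat k n" using Us VD by (simp add: N_def)
 have Kc: "K \<in> carrier_mat k (r + 1)" by (simp add: K_def)
 obtain x where x: "x \<in> carrier_vec (r + 1)" "x \<noteq> 0\<^sub>v (r + 1)" "K *v x = 0\<^sub>v k"
  using underdetermined_solution[OF Kc] Us(2) by auto
 define c where "c = vec n (\<lambda>i. if i < r + 1 then x $ i else 0)"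
 have cc: "c \<in> carrier_vec n" by (simp add: c_def)
 have n: "(r + 1) + (n - (r + 1)) = n" using rn by simp
 have Nc0: "N *v c = 0\<^sub>v k"
 proof (rule eq_vecI)
  fix i assume "i < dim_vec (0\<^sub>v k :: real vec)"
  then have i: "i < k" by simp
  have "(N *v c) $ i = (\<Sum>j<(r + 1) + (n - (r + 1)). N $$ (i, j) * c $ j)"
   unfolding n using i Nc cc by (simp add: scalar_prod_def lessThan_atLeast0)
  also have "\<dots> = (\<Sum>j<r + 1. N $$ (i, j) * x $ j)"
   unfolding sum_split using rn by (simp add: c_def)
  also have "\<dots> = (K *v x) $ i"
   using i x(1) by (simp add: K_def scalar_prod_def lessThan_atLeast0)
  finally show "(N *v c) $ i = 0\<^sub>v k $ i" using x(3) by simp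
 qed (use Nc in simp)
 let ?y = "V *v c"
 have yc: "?y \<in> carrier_vec n" using VD cc by simp
 have "Us\<^sup>T *v ?y = 0\<^sub>v k"
  using Nc0 assoc_mult_mat_vec[of "Us\<^sup>T" k n V n c] Us VD cc by (simp add: N_def)
 then have "Xs *v ?y = 0\<^sub>v n"
  using assoc_mult_mat_vec[of Us n k "Us\<^sup>T" n ?y] Us yc Xs mult_zero_vec[OF Us(1)] by simp
 then have le: "?y \<bullet> (W *v ?y) \<le> l * (?y \<bullet> ?y)" by (rule ker[OF yc])
 have Vy: "V\<^sup>T *v ?y = c" by (rule orth_mat_cancel_vec(2)[OF V cc])
 have Wy: "?y \<bullet> (W *v ?y) = (\<Sum>i<n. ev i * (c $ i)\<^sup>2)"
  using spectral_quadratic_form[OF V yc, of ev] unfolding W_spectral[symmetric] Vy .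
 have yy: "?y \<bullet> ?y = (\<Sum>i<n. (c $ i)\<^sup>2)"
  using orth_mat_sum_squares[OF V yc] unfolding Vy by simp
 have "2 * t * (?y \<bullet> ?y) \<le> ?y \<bullet> (W *v ?y)"
  unfolding Wy yy sum_distrib_left
 proof (rule sum_mono)
  fix i assume "i \<in> {..<n}"
  then show "2 * t * (c $ i)\<^sup>2 \<le> ev i * (c $ i)\<^sup>2"
   using ev_antimono[of i r] rn by (auto simp: c_def tau_ev intro!: mult_right_mono)
 qed
 then have "2 * t * (?y \<bullet> ?y) \<le> l * (?y \<bullet> ?y)" using le by simp
 moreover have "0 < ?y \<bullet> ?y"
 proof -
  have "?y \<noteq> 0\<^sub>v n"
  proof
   assume y0: "?y = 0\<^sub>v n"
   then have c0: "c = 0\<^sub>v n" using Vy mult_zero_vec[OF VD(2)] by simp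
   have "x = 0\<^sub>v (r + 1)"
   proof (rule eq_vecI)
    fix i assume i: "i < dim_vec (0\<^sub>v (r + 1) :: real vec)"
    then have "c $ i = x $ i" using rn by (simp add: c_def)
    then show "x $ i = 0\<^sub>v (r + 1) $ i" using c0 i rn by simp
   qed (use x in simp)
   then show False using x(2) by simp
  qed
  then show ?thesis using scalar_prod_self_eq_0[OF yc] scalar_prod_self_nonneg[of ?y] by linarith
 qed
 ultimately show ?thesis by simp
qed

definition sn where "sn x = vnorm ((minv (psd_sqrt (A * A\<^sup>T)) * A) *v x)"

lemma sn_eq:
 assumes x: "x \<in> carrier_vec (tri n)"
 shows "sn x = sqrt (piq x)"
proof -
 define N R where "N = A * A\<^sup>T" and "R = psd_sqrt N"
 have Npd: "N \<in> pd_mats m" unfolding N_def by (rule AAT_pd)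
 have Rpd: "R \<in> pd_mats m" unfolding R_def by (rule psd_sqrt_pd[OF Npd])
 note i = pd_minv[OF Rpd]
 have Rc: "R \<in> carrier_mat m m" using Rpd by (simp add: pd_mats_def sym_mats_def)
 have RR: "R * R = N" unfolding R_def by (rule psd_sqrt(2)[OF pd_imp_psd[OF Npd]])
 let ?B = "minv R"
 have Nc: "N \<in> carrier_mat m m" using A by (simp add: N_def)
 have BB: "minv N = ?B * ?B"
 proof (rule minv_unique[OF Nc])
  show "?B * ?B \<in> carrier_mat m m" using i(1) by simp
  have "?B * ?B * N = ?B * ((?B * R) * R)"
   unfolding RR[symmetric] using i(1) Rc by (simp add: mat_dims)
  also have "\<dots> = 1\<^sub>m m" unfolding i(3) using i(3) Rc by simp
  finally show "?B * ?B * N = 1\<^sub>m m" .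
 qed
 define g where "g = A *v x"
 have g: "g \<in> carrier_vec m" unfolding g_def by (rule mult_mat_vec_carrier[OF A x])
 have bg: "?B *v g \<in> carrier_vec m" by (rule mult_mat_vec_carrier[OF i(1) g])
 have "(?B * A) *v x = ?B *v g" unfolding g_def by (rule assoc_mult_mat_vec[OF i(1) A x])
 moreover have "(?B *v g) \<bullet> (?B *v g) = g \<bullet> (?B *v (?B *v g))"
  by (rule symmetric_scalar_prod[OF minv_sym[OF Rpd] g bg])
 moreover have "?B *v (?B *v g) = pw x"
  unfolding pw_def N_def[symmetric] BB g_def[symmetric] by (rule assoc_mult_mat_vec[OF i(1) i(1) g, symmetric])
 moreover have "g \<bullet> pw x = piq x"
  using piq_eq(1)[OF x] comm_scalar_prod[OF g pw_carrier[OF x]] by (simp add: g_def)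
 ultimately show ?thesis by (simp add: sn_def vnorm_def N_def[symmetric] R_def[symmetric])
qed

lemma sn_triangle:
 assumes x: "x \<in> carrier_vec (tri n)" and y: "y \<in> carrier_vec (tri n)"
 shows "sn (x - y) \<le> sn x + sn y"
proof -
 let ?B = "minv (psd_sqrt (A * A\<^sup>T)) * A"
 have Bc: "?B \<in> carrier_mat m (tri n)" using pd_minv(1)[OF psd_sqrt_pd[OF AAT_pd]] A by simp
 have "?B *v (x - y) = ?B *v x - ?B *v y" by (rule mult_minus_distrib_mat_vec[OF Bc x y])
 also have "\<dots> = ?B *v x + (- 1) *s (?B *v y)" using Bc x y by (intro eq_vecI) auto
 finally have "sn (x - y) \<le> vnorm (?B *v x) + vnorm ((- 1) *s (?B *v y))"
  unfolding sn_def using vnorm_triangle[of "?B *v x" m "(- 1) *s (?B *v y)"] Bc x y by (simp add: mat_dims)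
 then show ?thesis by (simp add: sn_def vnorm_smult)
qed

text \<open>Let \<open>H\<close> be the matrix with packing \<open>Q v\<close> and \<open>Z\<close> its compression to the kernel of \<open>X\<^sup>*\<close>.  Then
 \<open>H - Z\<close> is tangential, so the projection onto the row space of \<open>A\<close> controls it, and \<open>Z\<close> is
 controlled by the block \<open>\<tau>\<^sup>2 \<Sigma>\<close>, which dominates \<open>\<tau>\<^sup>2 (W \<otimes> W)\<^sup>-\<^sup>1\<close>, because \<open>W\<close> is small on that
 kernel.\<close>

lemma coupling:
 assumes Xs: "Xs \<in> psd_mats n" and ti: "tangent_injective n A \<chi>2 Xs Us" and rk: "mrank Xs \<le> r"
  and l: "0 \<le> l"
  and ker: "\<And>x. x \<in> carrier_vec n ==> Xs *v x = 0\<^sub>v n ==> x \<bullet> (W *v x) \<le> l * (x \<bullet> x)"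
  and v: "v \<in> carrier_vec d"
 shows "1 / (9 * \<chi>2\<^sup>2 * (l / t)\<^sup>2) * (v \<bullet> v) \<le> dform v + piq (QQ *v v) / 5"
proof -
 have chi: "1 \<le> \<chi>2" and Us: "Us \<in> carrier_mat n (mrank Xs)" and XsU: "Xs = Us * Us\<^sup>T"
  and inj: "\<And>Y. Y \<in> carrier_mat n (mrank Xs) ==>
    (1/\<chi>2) * frob_norm (Us * Y\<^sup>T + Y * Us\<^sup>T) \<le> sn (vecS (Us * Y\<^sup>T + Y * Us\<^sup>T))"
  using ti by (auto simp: tangent_injective_def sn_def)
 have lt: "2 * t \<le> l" by (rule threshold_le_kernel_bound[OF Us rk XsU ker])
 have Xss: "Xs \<in> sym_mats n" using Xs by (simp add: psd_mats_def)
 note Xsc = sym_matsD[OF Xss]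
 obtain U f where U: "orth_mat n U" and Xf: "Xs = spectral U f" using symmetric_spectral[OF Xss] by blast
 define P where "P = spectral U (\<lambda>i. if f i = 0 then 0 else 1)"
 define Pk where "Pk = spectral U (\<lambda>i. if f i = 0 then 1 else 0)"
 \<comment> \<open>the projector onto the range of \<open>X\<^sup>*\<close> factors through \<open>Us\<close>, which makes \<open>H - Z\<close> a tangent vector\<close>
 define Y where "Y = Us\<^sup>T * spectral U (\<lambda>i. if f i = 0 then 0 else 1 / f i)"
 have Ps: "P \<in> sym_mats n" and Os: "Pk \<in> sym_mats n" unfolding P_def Pk_def by (rule spectral_sym[OF U])+
 note Pc = sym_matsD[OF Ps] and Oc = sym_matsD[OF Os]
 have OO: "Pk * Pk = Pk" unfolding Pk_def spectral_mult[OF U] by (rule spectral_cong[OF U]) auto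
 have PO: "P + Pk = 1\<^sub>m n"
 proof -
  have "P + Pk = spectral U (\<lambda>_. 1)"
  proof (rule mat_eqI_vec[of _ n n])
   fix x :: "real vec" assume x: "x \<in> carrier_vec n"
   let ?c = "U\<^sup>T *v x"
   have cc: "?c \<in> carrier_vec n" using orth_matD[OF U] x by simp
   have "(P + Pk) *v x = P *v x + Pk *v x" by (rule add_mult_distrib_mat_vec[OF Pc(1) Oc(1) x])
   also have "\<dots> = U *v (vec n (\<lambda>i. (if f i = 0 then 0 else 1) * ?c $ i) + vec n (\<lambda>i. (if f i = 0 then 1 else 0) * ?c $ i))"
    unfolding P_def Pk_def spectral_mult_vec[OF U x]
    by (rule mult_add_distrib_mat_vec[OF orth_matD(1)[OF U], symmetric]) auto
   also have "vec n (\<lambda>i. (if f i = 0 then 0 else 1) * ?c $ i) + vec n (\<lambda>i. (if f i = 0 then 1 else 0) * ?c $ i)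
     = vec n (\<lambda>i. 1 * ?c $ i)" by (rule eq_vecI) auto
   also have "U *v \<dots> = spectral U (\<lambda>_. 1) *v x" unfolding spectral_mult_vec[OF U x] ..
   finally show "(P + Pk) *v x = spectral U (\<lambda>_. 1) *v x" .
  qed (use Pc Oc spectral_carrier[OF U] in auto)
  then show ?thesis using spectral_one[OF U] by simp
 qed
 have XO: "Xs * Pk = 0\<^sub>m n n"
 proof -
  have "Xs * Pk = spectral U (\<lambda>_. 0)"
   unfolding Xf Pk_def spectral_mult[OF U] by (rule spectral_cong[OF U]) auto
  also have "\<dots> = 0\<^sub>m n n"
  proof -
   have "mat_diag n (\<lambda>_. 0 :: real) = 0\<^sub>m n n" by (rule eq_matI) (auto simp: mat_diag_def)
   then show ?thesis using orth_matD[OF U] by (simp add: spectral_def)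
  qed
  finally show ?thesis .
 qed
 have PY: "P = Us * Y"
 proof -
  have "Us * Y = Xs * spectral U (\<lambda>i. if f i = 0 then 0 else 1 / f i)"
   unfolding Y_def XsU using Us carrier_matD[OF spectral_carrier[OF U]] by (simp add: mat_dims)
  also have "\<dots> = P" unfolding Xf P_def spectral_mult[OF U] by (rule spectral_cong[OF U]) auto
  finally show ?thesis by simp
 qed
 define Zc where "Zc = unpack v"
 define H where "H = V * Zc * V\<^sup>T"
 have Zs: "Zc \<in> sym_mats n" unfolding Zc_def by (rule unpack_sym)
 have Hs: "H \<in> sym_mats n" unfolding H_def by (rule conj_V_sym[OF Zs])
 note Hc = sym_matsD[OF Hs]
 have h: "QQ *v v = vecS H" unfolding bigQ_up[OF v] up_def H_def Zc_def ..
 define Z where "Z = Pk * H * Pk"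
 have ZS: "Z \<in> sym_mats n" unfolding Z_def by (rule sandwich_sym[OF Os Hs])
 note Zd = sym_matsD[OF ZS]
 define T where "T = P * H - (1/2) \<cdot>\<^sub>m (P * H * P)"
 have Td: "dim_row T = n" "dim_col T = n" using Pc Hc by (simp_all add: T_def)
 have Tt: "T\<^sup>T = H * P - (1/2) \<cdot>\<^sub>m (P * H * P)"
 proof -
  have "(P * H)\<^sup>T = H * P" "(P * H * P)\<^sup>T = P * H * P" using Pc Hc by (simp_all add: mat_dims)
  moreover have "T\<^sup>T = (P * H)\<^sup>T - (1/2) \<cdot>\<^sub>m (P * H * P)\<^sup>T"
   unfolding T_def by (rule eq_matI) (use Pc Hc in \<open>auto simp del: index_mult_mat(1)\<close>)
  ultimately show ?thesis by simp
 qed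
 have HZ: "H - Z = T + T\<^sup>T"
 proof -
  have Oe: "Pk = 1\<^sub>m n - P"
  proof (rule eq_matI)
   fix i j assume "i < dim_row (1\<^sub>m n - P)" "j < dim_col (1\<^sub>m n - P)"
   then have ij: "i < n" "j < n" using Pc by auto
   then have "P $$ (i, j) + Pk $$ (i, j) = 1\<^sub>m n $$ (i, j)"
    using arg_cong[OF PO, of "\<lambda>X. X $$ (i, j)"] Pc Oc by simp
   then show "Pk $$ (i, j) = (1\<^sub>m n - P) $$ (i, j)" using ij Pc by simp
  qed (use Pc Oc in auto)
  have "Z = H - P * H - H * P + P * H * P"
  proof -
   have "Z = (H - P * H) * (1\<^sub>m n - P)"
    unfolding Z_def Oe using Pc Hc by (simp add: minus_mult_dim)
   also have "\<dots> = (H - P * H) - (H * P - P * H * P)"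
    using Pc Hc by (simp add: mult_minus_dim minus_mult_dim)
   also have "\<dots> = H - P * H - H * P + P * H * P"
    by (rule eq_matI) (use Pc Hc in \<open>auto simp del: index_mult_mat(1)\<close>)
   finally show ?thesis .
  qed
  then show ?thesis unfolding Tt unfolding T_def
   by (intro eq_matI) (use Pc Hc in \<open>auto simp del: index_mult_mat(1)\<close>)
 qed
 have Yc: "Y \<in> carrier_mat (mrank Xs) n" unfolding Y_def using Us carrier_matD[OF spectral_carrier[OF U]]
  by (intro carrier_matI) auto
 define Y' where "Y' = (Y * H - (1/2) \<cdot>\<^sub>m (Y * H * P))\<^sup>T"
 have Y'c: "Y' \<in> carrier_mat n (mrank Xs)" using Yc Hc Pc by (intro carrier_matI) (simp_all add: Y'_def)
 have UY: "Us * Y'\<^sup>T = T"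
 proof -
  have "Us * Y'\<^sup>T = Us * (Y * H) - (1/2) \<cdot>\<^sub>m (Us * (Y * H * P))"
   unfolding Y'_def using Us Yc Hc Pc by (simp add: mult_minus_dim mult_smult_dim)
  also have "Us * (Y * H) = P * H" unfolding PY using Us Yc Hc by (simp add: mat_dims)
  also have "Us * (Y * H * P) = P * H * P"
  proof -
   have "Us * (Y * H * P) = (Us * Y) * H * P" using Us Yc Hc Pc by (simp add: mat_dims)
   then show ?thesis unfolding PY[symmetric] .
  qed
  finally show ?thesis by (simp add: T_def)
 qed
 have UY': "Y' * Us\<^sup>T = T\<^sup>T"
 proof -
  have "(Us * Y'\<^sup>T)\<^sup>T = Y' * Us\<^sup>T" using Us Y'c by (simp add: transpose_mult_dim)
  then show ?thesis unfolding UY by simp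
 qed
 have tang: "(1/\<chi>2) * frob_norm (H - Z) \<le> sn (vecS (H - Z))"
  using inj[OF Y'c] unfolding UY UY' HZ .
 have HZs: "H - Z \<in> sym_mats n"
  unfolding sym_mats_def using minus_carrier_mat[OF Zd(1), of H] Hc Zd transpose_minus[OF Hc(1) Zd(1)] by auto
 define p dq z nu where "p = sqrt (piq (QQ *v v))" and "dq = sqrt (dform v)" and "z = vnorm (vecS Z)" and "nu = vnorm v"
 have vZ: "vecS (H - Z) = vecS H - vecS Z" by (rule vecS_minus[OF Hc(1) Zd(1)])
 have hc: "vecS H \<in> carrier_vec (tri n)" "vecS Z \<in> carrier_vec (tri n)"
  using vecS_carrier[of H] vecS_carrier[of Z] Hc Zd by simp_all
 have nuH: "vnorm (vecS H) = nu" using Q_isometry[OF v] by (simp add: h nu_def vnorm_def)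
 have t1: "vnorm (vecS H - vecS Z) \<le> \<chi>2 * (p + z)"
 proof -
  have "(1/\<chi>2) * vnorm (vecS H - vecS Z) \<le> sn (vecS H - vecS Z)"
   using tang vnorm_vecS[OF HZs] vZ by simp
  also have "\<dots> \<le> sn (vecS H) + sn (vecS Z)" by (rule sn_triangle[OF hc])
  also have "\<dots> \<le> p + z" using sn_eq[OF hc(1)] sn_eq[OF hc(2)] piq_le[OF hc(2)] by (simp add: p_def z_def h)
  finally show ?thesis using chi by (simp add: field_simps)
 qed
 have t2: "nu \<le> vnorm (vecS H - vecS Z) + z"
 proof -
  have "vecS H = (vecS H - vecS Z) + vecS Z" using Hc Zd by (intro eq_vecI) auto
  then have "nu = vnorm ((vecS H - vecS Z) + vecS Z)" using nuH by simp
  also have "\<dots> \<le> vnorm (vecS H - vecS Z) + z"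
   unfolding z_def by (rule vnorm_triangle[of _ "tri n"]) (use hc in auto)
  finally show ?thesis .
 qed
 have d0: "0 \<le> dform v"
  using D_bounds(1)[OF v, of "ev (n - 1)"] ev_pos[of "n - 1"] ev_antimono[of _ "n - 1"] rn by simp
 have zz: "z\<^sup>2 = ip Z Z"
  unfolding z_def vnorm_power2 using vecS_scalar_prod[OF Zd(1) ZS] by (simp add: ip_def)
 have zd: "z \<le> (l / t) * dq"
 proof (cases "z = 0")
  case True
  then show ?thesis using l tau_pos d0 by (simp add: dq_def)
 next
  case False
  then have zp: "0 < z" by (simp add: z_def less_le)
  define Zh where "Zh = V\<^sup>T * Z * V"
  have Zhs: "Zh \<in> sym_mats n" unfolding Zh_def using conj_sym[of "V\<^sup>T" n n Z] VD ZS by simp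
  note Zhc = sym_matsD[OF Zhs]
  have ZVh: "Z = V * Zh * V\<^sup>T" unfolding Zh_def by (rule conj_V_cancel'[OF Zd(1), symmetric])
  have OZO: "Pk * Z * Pk = Z"
  proof -
   have "Pk * Z * Pk = (Pk * Pk) * H * (Pk * Pk)" unfolding Z_def using Oc Hc by (simp add: mat_dims)
   then show ?thesis unfolding OO Z_def .
  qed
  have "ip Z Z = ip (Pk * H * Pk\<^sup>T) Z" using Oc by (simp add: Z_def)
  also have "\<dots> = ip H (Pk\<^sup>T * Z * Pk)" by (rule ip_conj[OF Oc(1) Hc(1) Zd(1)])
  also have "\<dots> = ip H Z" using OZO Oc by simp
  also have "\<dots> = ip Zc Zh" unfolding H_def by (subst ZVh) (rule conj_V_isometry[OF sym_matsD(1)[OF Zs] Zhc(1)])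
  finally have "ip Z Z = ip Zh Zc" using ip_commute[OF sym_matsD(1)[OF Zs] Zhc(1)] by simp
  then have cs: "(ip Z Z)\<^sup>2 \<le> ip Zh (had (\<lambda>i j. ev i * ev j) Zh) * ip Zc (had (\<lambda>i j. 1 / (ev i * ev j)) Zc)"
   using ip_weighted_Cauchy_Schwarz[OF Zhc(1) sym_matsD(1)[OF Zs], of "\<lambda>i j. ev i * ev j"] ev_pos by simp
  have wf: "ip Zh (had (\<lambda>i j. ev i * ev j) Zh) = ip Z (W * Z * W)"
  proof -
   have hs: "had (\<lambda>i j. ev i * ev j) Zh \<in> carrier_mat n n" by (rule carrier_matI) (use Zhc in auto)
   have Wt: "W\<^sup>T = W" using Wpd by (simp add: pd_mats_def sym_mats_def)
   have "W * Z * W = spectral V ev * (V * Zh * V\<^sup>T) * (spectral V ev)\<^sup>T"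
    unfolding W_spectral[symmetric] Wt ZVh[symmetric] ..
   also have "\<dots> = V * had (\<lambda>i j. ev i * ev j) Zh * V\<^sup>T" by (rule spectral_conj[OF Zhs])
   finally have e: "W * Z * W = V * had (\<lambda>i j. ev i * ev j) Zh * V\<^sup>T" .
   show ?thesis unfolding e by (subst ZVh) (rule conj_V_isometry[OF Zhc(1) hs, symmetric])
  qed
  have wt: "ip Z (W * Z * W) \<le> l\<^sup>2 * ip Z Z"
  proof (rule weighted_trace_bound[OF pd_imp_psd[OF Wpd] ZS l])
   fix x :: "real vec" assume x: "x \<in> carrier_vec n"
   have zx: "Z *v x \<in> carrier_vec n" by (rule mult_mat_vec_carrier[OF Zd(1) x])
   have hox: "H *v (Pk *v x) \<in> carrier_vec n" using Hc Oc x by simp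
   have "Z *v x = Pk *v (H *v (Pk *v x))" unfolding Z_def using Oc Hc x by (simp add: mat_dims)
   then have "Xs *v (Z *v x) = (Xs * Pk) *v (H *v (Pk *v x))"
    using assoc_mult_mat_vec[OF Xsc(1) Oc(1) hox] by simp
   then have "Xs *v (Z *v x) = 0\<^sub>v n" unfolding XO using zero_mat_mult_vec[OF hox] by simp
   then show "(Z *v x) \<bullet> (W *v (Z *v x)) \<le> l * ((Z *v x) \<bullet> (Z *v x))" by (rule ker[OF zx])
  qed
  have df: "ip Zc (had (\<lambda>i j. 1 / (ev i * ev j)) Zc) \<le> dform v / t\<^sup>2"
  proof -
   note zc = sym_matsD(1)[OF Zs]
   have "dform v / t\<^sup>2 = ip Zc (had (\<lambda>i j. dd i j / t\<^sup>2) Zc)"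
    unfolding dform_def Zc_def[symmetric] ip_had[OF zc zc] by (simp add: sum_divide_distrib)
   moreover have "ip Zc (had (\<lambda>i j. 1 / (ev i * ev j)) Zc) \<le> \<dots>"
    unfolding ip_had[OF zc zc]
   proof (intro sum_mono)
    fix i j assume "j \<in> {..<n}" "i \<in> {..<n}"
    then have ij: "i < n" "j < n" by auto
    show "1 / (ev i * ev j) * (Zc $$ (i, j) * Zc $$ (i, j)) \<le> dd i j / t\<^sup>2 * (Zc $$ (i, j) * Zc $$ (i, j))"
    proof (cases "Zc $$ (i, j) = 0")
     case False
     have sp: "0 < sg i j" using sg_pos[OF unpack_nonzero_msk[OF ij] ij] False by (simp add: Zc_def)
     have "0 \<le> ee i j"
      unfolding ee_def ec_def using ev_pos[OF ij(1)] ev_pos[OF ij(2)] tau_pos by (simp add: mult_nonneg_nonneg)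
     then have "sg i j \<le> ev i * ev j" by (simp add: sg_def)
     then have "1 / (ev i * ev j) \<le> 1 / sg i j"
      using sp ev_pos[OF ij(1)] ev_pos[OF ij(2)] by (intro divide_left_mono mult_pos_pos) auto
     also have "\<dots> = dd i j / t\<^sup>2" using tau_pos by (simp add: dd_def)
     finally show ?thesis by (intro mult_right_mono) auto
    qed simp
   qed
   ultimately show ?thesis by simp
  qed
  have "0 * ip Zc Zc \<le> ip Zc (had (\<lambda>i j. 1 / (ev i * ev j)) Zc)"
   by (rule ip_had_bounds(1)[OF sym_matsD(1)[OF Zs]]) (use ev_pos in \<open>simp add: less_imp_le\<close>)
  then have "ip Zh (had (\<lambda>i j. ev i * ev j) Zh) * ip Zc (had (\<lambda>i j. 1 / (ev i * ev j)) Zc)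
    \<le> l\<^sup>2 * ip Z Z * (dform v / t\<^sup>2)"
   using wt df ip_self_nonneg[of Z] unfolding wf by (intro mult_mono) auto
  then have "(ip Z Z)\<^sup>2 \<le> l\<^sup>2 * ip Z Z * (dform v / t\<^sup>2)" using cs by linarith
  then have "z\<^sup>2 * z\<^sup>2 \<le> z\<^sup>2 * ((l / t) * dq)\<^sup>2"
   using d0 unfolding zz[symmetric] by (simp add: power2_eq_square dq_def power_mult_distrib algebra_simps)
  then have "z\<^sup>2 \<le> ((l / t) * dq)\<^sup>2" by (rule mult_left_le_imp_le) (use zp in simp)
  then show ?thesis by (rule power2_le_imp_le) (use l tau_pos d0 in \<open>simp add: dq_def\<close>)
 qed
 have p0: "0 \<le> p" and dq0: "0 \<le> dq" using piq_nonneg d0 by (simp_all add: p_def dq_def)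
 define c where "c = l / t"
 have c2: "2 \<le> c" using lt tau_pos by (simp add: c_def field_simps)
 have "nu \<le> \<chi>2 * (p + z) + z" using t1 t2 by linarith
 also have "\<dots> \<le> \<chi>2 * p + \<chi>2 * (2 * z)"
  using mult_right_mono[OF chi, of z] by (simp add: z_def algebra_simps)
 also have "\<dots> \<le> \<chi>2 * p + \<chi>2 * (2 * (c * dq))"
  using zd chi unfolding c_def by (intro add_left_mono mult_left_mono) auto
 also have "\<dots> \<le> \<chi>2 * (c * p) + \<chi>2 * (2 * (c * dq))"
  using c2 p0 chi mult_right_mono[of 1 c p] by simp
 finally have nu1: "nu \<le> \<chi>2 * c * (p + 2 * dq)" by (simp add: algebra_simps)
 have "nu\<^sup>2 \<le> (\<chi>2 * c * (p + 2 * dq))\<^sup>2" by (rule power_mono[OF nu1]) (simp add: nu_def)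
 also have "\<dots> = (\<chi>2 * c)\<^sup>2 * (p + 2 * dq)\<^sup>2" by (simp add: power_mult_distrib)
 also have "\<dots> \<le> (\<chi>2 * c)\<^sup>2 * (9 * (dq\<^sup>2 + p\<^sup>2 / 5))"
 proof (rule mult_left_mono)
  \<comment> \<open>\<open>(p + 2 q)\<^sup>2 \<le> (5 + 4) (p\<^sup>2 / 5 + q\<^sup>2)\<close> by Cauchy-Schwarz; the square is the defect\<close>
  have "0 \<le> (2 * p - 5 * (2 * dq / 2))\<^sup>2" by simp
  then have "0 \<le> 4 * p\<^sup>2 - 20 * (p * dq) + 25 * dq\<^sup>2" by (simp add: power2_eq_square algebra_simps)
  then show "(p + 2 * dq)\<^sup>2 \<le> 9 * (dq\<^sup>2 + p\<^sup>2 / 5)" by (simp add: power2_eq_square algebra_simps)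
 qed simp
 finally have fin: "nu\<^sup>2 \<le> 9 * \<chi>2\<^sup>2 * c\<^sup>2 * (dq\<^sup>2 + p\<^sup>2 / 5)" by (simp add: power_mult_distrib algebra_simps)
 have "0 < 9 * \<chi>2\<^sup>2 * c\<^sup>2" using chi c2 by simp
 then have "1 / (9 * \<chi>2\<^sup>2 * c\<^sup>2) * nu\<^sup>2 \<le> dq\<^sup>2 + p\<^sup>2 / 5" using fin by (simp add: field_simps)
 moreover have "dq\<^sup>2 = dform v" "p\<^sup>2 = piq (QQ *v v)" "nu\<^sup>2 = v \<bullet> v"
  using d0 piq_nonneg by (simp_all add: dq_def p_def nu_def vnorm_power2)
 ultimately show ?thesis by (simp add: c_def)
qed

section \<open>From the augmented residual to the Newton residual\<close>

lemma WW_inverse_up: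
 assumes T: "T \<in> sym_mats n"
 shows "minv (symkron W W) *v up T = up (had (\<lambda>i j. 1 / ev i * (1 / ev j)) T)"
  and "minv (symkron W W) \<in> carrier_mat (tri n) (tri n)"
proof -
 let ?B = "symkron (spectral V (\<lambda>i. 1 / ev i)) (spectral V (\<lambda>i. 1 / ev i))"
 have Bc: "?B \<in> carrier_mat (tri n) (tri n)" "symkron W W \<in> carrier_mat (tri n) (tri n)"
  by (rule carrier_matI; simp add: carrier_matD[OF spectral_carrier[OF V]] dimW)+
 have "minv (symkron W W) = ?B"
 proof (rule minv_unique[OF Bc(2,1)], rule mat_eqI_vec[of _ "tri n" "tri n"])
  fix x :: "real vec" assume x: "x \<in> carrier_vec (tri n)"
  have hs: "had (\<lambda>i j. ev i * ev j) (dn x) \<in> sym_mats n" by (rule had_sym[OF dn_sym]) simp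
  have "?B * symkron W W *v x = ?B *v (symkron W W *v up (dn x))"
   using assoc_mult_mat_vec[OF Bc x] up_dn[OF x] by simp
  also have "\<dots> = up (had (\<lambda>i j. 1 / ev i * (1 / ev j)) (had (\<lambda>i j. ev i * ev j) (dn x)))"
   unfolding WW_up[OF dn_sym] by (rule symkron_spectral_up[OF hs])
  also have "had (\<lambda>i j. 1 / ev i * (1 / ev j)) (had (\<lambda>i j. ev i * ev j) (dn x)) = dn x"
  proof (rule eq_matI)
   fix i j assume "i < dim_row (dn x)" "j < dim_col (dn x)"
   then have "i < n" "j < n" using sym_matsD[OF dn_sym] by auto
   then show "had (\<lambda>i j. 1 / ev i * (1 / ev j)) (had (\<lambda>i j. ev i * ev j) (dn x)) $$ (i, j) = dn x $$ (i, j)"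
    using ev_pos[of i] ev_pos[of j] sym_matsD[OF dn_sym[of x]] by simp
  qed auto
  finally show "?B * symkron W W *v x = 1\<^sub>m (tri n) *v x" using up_dn[OF x] x by simp
 qed (use Bc in auto)
 then show "minv (symkron W W) *v up T = up (had (\<lambda>i j. 1 / ev i * (1 / ev j)) T)"
  "minv (symkron W W) \<in> carrier_mat (tri n) (tri n)"
  using symkron_spectral_up[OF T] Bc by simp_all
qed

lemma up_add: "S \<in> carrier_mat n n ==> T \<in> carrier_mat n n ==> up (S + T) = up S + up T"
 unfolding up_def using VD by (simp add: mult_add_dim add_mult_dim vecS_add[of _ n])

lemma up_smult: "T \<in> carrier_mat n n ==> up (c \<cdot>\<^sub>m T) = c *s up T"
 unfolding up_def using VD by (simp add: mult_smult_dim smult_mult_dim vecS_smult[of _ n])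

text \<open>The right-hand side is chosen such that \<open>\<tau>\<^sup>2 c\<close> and \<open>A\<^sup>T u\<close> enter the residual through their difference \<open>w\<close> only.\<close>

lemma aug_rhs_residual:
 assumes b: "b \<in> carrier_vec m" and C: "C \<in> sym_mats n" and u: "u \<in> carrier_vec m" and v: "v \<in> carrier_vec d"
 defines "w \<equiv> A\<^sup>T *v u - t\<^sup>2 *s vecS C"
 shows "M *v (u @\<^sub>v v) - aug_rhs A b C W r Q Qp =
  (A *v (EE *v w + QQ *v v) - b) @\<^sub>v (QQ\<^sup>T *v w - t\<^sup>2 *s (bigSigma W r *v v))"
proof -
 note cr = EE_carrier bigQ_carrier bigSigma_carrier
 have cc: "vecS C \<in> carrier_vec (tri n)" using vecS_carrier[of C] sym_matsD[OF C] by simp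
 have tc: "t\<^sup>2 *s vecS C \<in> carrier_vec (tri n)" using cc by simp
 have au: "A\<^sup>T *v u \<in> carrier_vec (tri n)" by (rule mult_mat_vec_carrier[OF AT u])
 have Ew: "EE *v w = EE *v (A\<^sup>T *v u) - t\<^sup>2 *s (EE *v vecS C)"
  unfolding w_def using mult_minus_distrib_mat_vec[OF cr(1) au tc] mult_mat_vec[OF cr(1) cc] by simp
 have QT: "QQ\<^sup>T \<in> carrier_mat d (tri n)" using cr by simp
 have Qw: "QQ\<^sup>T *v w = QQ\<^sup>T *v (A\<^sup>T *v u) - t\<^sup>2 *s (QQ\<^sup>T *v vecS C)"
  unfolding w_def using mult_minus_distrib_mat_vec[OF QT au tc] mult_mat_vec[OF QT cc] by simp
 define e1 e2 e3 q1 q2 q3 where "e1 = EE *v (A\<^sup>T *v u)" and "e2 = EE *v vecS C" and "e3 = QQ *v v"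
  and "q1 = QQ\<^sup>T *v (A\<^sup>T *v u)" and "q2 = QQ\<^sup>T *v vecS C" and "q3 = t\<^sup>2 *s (bigSigma W r *v v)"
 have ec: "e1 \<in> carrier_vec (tri n)" "e2 \<in> carrier_vec (tri n)" "e3 \<in> carrier_vec (tri n)"
  "q1 \<in> carrier_vec d" "q2 \<in> carrier_vec d" "q3 \<in> carrier_vec d"
  unfolding e1_def e2_def e3_def q1_def q2_def q3_def
  using mult_mat_vec_carrier[OF cr(1) au] mult_mat_vec_carrier[OF cr(1) cc] mult_mat_vec_carrier[OF cr(2) v]
   mult_mat_vec_carrier[OF QT au] mult_mat_vec_carrier[OF QT cc] mult_mat_vec_carrier[OF cr(3) v] by simp_all
 have Ae: "A *v (e1 - t\<^sup>2 *s e2 + e3) = A *v e1 - t\<^sup>2 *s (A *v e2) + A *v e3"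
 proof -
  have m1: "e1 - t\<^sup>2 *s e2 \<in> carrier_vec (tri n)" "t\<^sup>2 *s e2 \<in> carrier_vec (tri n)" using ec by simp_all
  show ?thesis
   using mult_add_distrib_mat_vec[OF A m1(1) ec(3)] mult_minus_distrib_mat_vec[OF A ec(1) m1(2)]
    mult_mat_vec[OF A ec(2)] by simp
 qed
 have AE: "A * EE *v vecS C = A *v e2" unfolding e2_def by (rule assoc_mult_mat_vec[OF A cr(1) cc])
 have ac: "A *v e1 \<in> carrier_vec m" "A *v e2 \<in> carrier_vec m" "A *v e3 \<in> carrier_vec m"
  using mult_mat_vec_carrier[OF A] ec by simp_all
 have l: "M *v (u @\<^sub>v v) = (A *v e1 + A *v e3) @\<^sub>v (q1 - q3)"
  using M_mult[OF u v] by (simp add: e1_def e3_def q1_def q3_def)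
 have rh: "aug_rhs A b C W r Q Qp = (b + t\<^sup>2 *s (A *v e2)) @\<^sub>v (t\<^sup>2 *s q2)"
  by (simp add: aug_rhs_def AE q2_def)
 have Qw': "QQ\<^sup>T *v w = q1 - t\<^sup>2 *s q2" using Qw by (simp add: q1_def q2_def)
 have Ew': "EE *v w + QQ *v v = e1 - t\<^sup>2 *s e2 + e3" using Ew by (simp add: e1_def e2_def e3_def)
 define a1 a2 a3 where "a1 = A *v e1" and "a2 = A *v e2" and "a3 = A *v e3"
 have "(a1 + a3) - (b + t\<^sup>2 *s a2) = a1 - t\<^sup>2 *s a2 + a3 - b"
  using ac b unfolding a1_def[symmetric] a2_def[symmetric] a3_def[symmetric] by (intro eq_vecI) auto
 moreover have "(q1 - q3) - t\<^sup>2 *s q2 = q1 - t\<^sup>2 *s q2 - q3"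
  using ec by (intro eq_vecI) auto
 ultimately show ?thesis
  unfolding l rh Qw' Ew' Ae q3_def[symmetric] a1_def[symmetric] a2_def[symmetric] a3_def[symmetric]
  using ac ec b unfolding a1_def[symmetric] a2_def[symmetric] a3_def[symmetric]
  by (subst append_vec_minus) auto
qed

text \<open>The recovered step satisfies the second Newton equation up to the first component of the augmented
 residual. In the first equation the coordinates of the defect are those of the second component times
 \<open>sg i j / (\<tau>\<^sup>2 lam\<^sub>i lam\<^sub>j)\<close>, because \<open>W \<otimes> W = \<tau>\<^sup>2 E \<otimes> E + Q \<Sigma>\<^sup>-\<^sup>1 Q\<^sup>T\<close>. Since \<open>0 \<le> sg i j \<le> lam\<^sub>i lam\<^sub>j\<close>, only the
 factor \<open>1 / \<tau>\<^sup>2\<close> is lost.\<close>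

lemma newton_residual_bound:
 assumes b: "b \<in> carrier_vec m" and C: "C \<in> sym_mats n" and u: "u \<in> carrier_vec m" and v: "v \<in> carrier_vec d"
 defines "w \<equiv> A\<^sup>T *v u - t\<^sup>2 *s vecS C"
 shows "newton_residual A b C W (matS n (EE *v w + QQ *v v)) ((1 / t\<^sup>2) *s u)
  \<le> max 1 (1 / t\<^sup>2) * vnorm (M *v (u @\<^sub>v v) - aug_rhs A b C W r Q Qp)"
proof -
 have cc: "vecS C \<in> carrier_vec (tri n)" using vecS_carrier[of C] sym_matsD[OF C] by simp
 have au: "A\<^sup>T *v u \<in> carrier_vec (tri n)" by (rule mult_mat_vec_carrier[OF AT u])
 have wc: "w \<in> carrier_vec (tri n)" unfolding w_def using au cc by simp
 define T where "T = dn w"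
 define Z where "Z = unpack v"
 have Ts: "T \<in> sym_mats n" and Zs: "Z \<in> sym_mats n" unfolding T_def Z_def by (rule dn_sym, rule unpack_sym)
 note Tc = sym_matsD[OF Ts] and Zc = sym_matsD[OF Zs]
 have eT: "had ee T \<in> sym_mats n" by (rule had_sym[OF Ts]) (simp add: ee_def mult.commute)
 define x where "x = EE *v w + QQ *v v"
 have xc: "x \<in> carrier_vec (tri n)" unfolding x_def
  using mult_mat_vec_carrier[OF EE_carrier wc] mult_mat_vec_carrier[OF bigQ_carrier v] by simp
 have xs: "x = up (had ee T + Z)"
  unfolding x_def EE_mult[OF wc] bigQ_up[OF v] T_def[symmetric] Z_def[symmetric]
  using up_add[OF sym_matsD(1)[OF eT] Zc(1)] by simp
 have Ss: "had ee T + Z \<in> sym_mats n"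
  unfolding sym_mats_def using sym_matsD[OF eT] Zc transpose_add[of "had ee T" n n Z] by simp
 have vx: "vecS (matS n x) = x" unfolding matS_eq_smat[OF xc] by (rule vecS_smat[OF xc])
 let ?I = "minv (symkron W W)"
 note Ic = WW_inverse_up(2)[OF Ts]
 let ?dy = "(1 / t\<^sup>2) *s u"
 define F where "F = had (\<lambda>i j. sg i j / (t\<^sup>2 * (ev i * ev j))) (had msk (T + (- 1) \<cdot>\<^sub>m had dd Z))"
 have first: "(- ?I) *v x + A\<^sup>T *v ?dy - vecS C = up F"
 proof -
  have wt: "A\<^sup>T *v ?dy - vecS C = (1 / t\<^sup>2) *s w"
   unfolding w_def mult_mat_vec[OF AT u] by (rule smult_minus_factor[OF au cc]) (use tau_pos in simp)
  let ?X = "had (\<lambda>i j. 1 / ev i * (1 / ev j)) (had ee T + Z)"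
  have Xc: "?X \<in> carrier_mat n n" by (rule carrier_matI) (use Zc in auto)
  have ix: "(- ?I) *v x = (- 1) *s up ?X"
  proof -
   have "(- ?I) *v x = - (?I *v x)" using Ic xc by (intro uminus_mult_mat_vec) auto
   also have "\<dots> = (- 1) *s (?I *v x)" by (rule eq_vecI) auto
   also have "?I *v x = up ?X" unfolding xs by (rule WW_inverse_up(1)[OF Ss])
   finally show ?thesis .
  qed
  have c1: "(- ?I) *v x \<in> carrier_vec (tri n)" "A\<^sup>T *v ?dy \<in> carrier_vec (tri n)"
   unfolding ix using up_carrier[of ?X] mult_mat_vec_carrier[OF AT, of ?dy] u by simp_all
  have "(- ?I) *v x + A\<^sup>T *v ?dy - vecS C = (- ?I) *v x + (A\<^sup>T *v ?dy - vecS C)"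
   by (rule add_vec_minus_assoc[OF c1 cc])
  also have "\<dots> = (- 1) *s up ?X + (1 / t\<^sup>2) *s up T" unfolding ix wt T_def up_dn[OF wc] ..
  also have "\<dots> = up ((- 1) \<cdot>\<^sub>m ?X + (1 / t\<^sup>2) \<cdot>\<^sub>m T)"
   using up_add[of "(- 1) \<cdot>\<^sub>m ?X" "(1 / t\<^sup>2) \<cdot>\<^sub>m T"] up_smult[OF Xc, of "- 1"] up_smult[OF Tc(1), of "1 / t\<^sup>2"] Xc Tc by simp
  also have "(- 1) \<cdot>\<^sub>m ?X + (1 / t\<^sup>2) \<cdot>\<^sub>m T = F"
  proof (rule eq_matI)
   fix i j assume "i < dim_row F" "j < dim_col F"
   then have ij: "i < n" "j < n" using Zc by (auto simp: F_def)
   define a where "a = ev i * ev j"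
   have a: "a \<noteq> 0" using ev_pos[OF ij(1)] ev_pos[OF ij(2)] by (simp add: a_def)
   have t0: "t \<noteq> 0" using tau_pos by simp
   have L: "((- 1) \<cdot>\<^sub>m ?X + (1 / t\<^sup>2) \<cdot>\<^sub>m T) $$ (i, j) = - (ee i j * T $$ (i, j) + Z $$ (i, j)) / a + T $$ (i, j) / t\<^sup>2"
    using ij Tc Zc by (simp add: a_def)
   have sge: "sg i j = a - t\<^sup>2 * ee i j" by (simp add: sg_def a_def)
   show "((- 1) \<cdot>\<^sub>m ?X + (1 / t\<^sup>2) \<cdot>\<^sub>m T) $$ (i, j) = F $$ (i, j)"
   proof (cases "msk i j = 0")
    case True
    then have "r \<le> i" "r \<le> j" by (auto simp: msk_def split: if_splits)
    then have "sg i j = 0" "Z $$ (i, j) = 0" using sg_bot unpack_bot ij by (simp_all add: Z_def)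
    then have "a = t\<^sup>2 * ee i j" using sge by simp
    then have "ee i j = a / t\<^sup>2" using t0 by simp
    then show ?thesis unfolding L using ij Tc Zc True \<open>Z $$ (i, j) = 0\<close> a t0 by (simp add: F_def)
   next
    case False
    then have m1: "msk i j = 1" by (auto simp: msk_def split: if_splits)
    have s0: "sg i j \<noteq> 0" using sg_pos[OF False ij] by simp
    have "F $$ (i, j) = sg i j / (t\<^sup>2 * a) * (T $$ (i, j) - t\<^sup>2 / sg i j * Z $$ (i, j))"
     using ij Tc Zc m1 by (simp add: F_def a_def dd_def)
    also have "\<dots> = (sg i j * T $$ (i, j) - t\<^sup>2 * Z $$ (i, j)) / (t\<^sup>2 * a)"
     using s0 a t0 by (simp add: field_simps)
    also have "\<dots> = - (ee i j * T $$ (i, j) + Z $$ (i, j)) / a + T $$ (i, j) / t\<^sup>2"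
     unfolding sge using a t0 by (simp add: field_simps)
    finally show ?thesis using L by simp
   qed
  qed (use Tc Zc in \<open>simp_all add: F_def\<close>)
  finally show ?thesis .
 qed
 let ?rho = "M *v (u @\<^sub>v v) - aug_rhs A b C W r Q Qp"
 have rho: "?rho = (A *v x - b) @\<^sub>v (pack T - pack (had dd Z))"
  using aug_rhs_residual[OF b C u v] QQT_mult[OF wc] D_mult[OF v]
  by (simp add: w_def[symmetric] x_def T_def Z_def)
 define S where "S = T + (- 1) \<cdot>\<^sub>m had dd Z"
 have ddZ: "had dd Z \<in> sym_mats n" by (rule had_sym[OF Zs]) (rule dd_sym)
 have Ssy: "S \<in> sym_mats n"
 proof -
  have "S\<^sup>T = T\<^sup>T + ((- 1) \<cdot>\<^sub>m had dd Z)\<^sup>T" unfolding S_def by (rule transpose_add[of _ n n]) (use Tc Zc in auto)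
  also have "((- 1) \<cdot>\<^sub>m had dd Z)\<^sup>T = (- 1) \<cdot>\<^sub>m (had dd Z)\<^sup>T" by (rule eq_matI) auto
  finally show ?thesis unfolding sym_mats_def using Tc sym_matsD[OF ddZ] by (simp add: S_def)
 qed
 note Sc = sym_matsD[OF Ssy]
 have pS: "pack T - pack (had dd Z) = pack S"
 proof -
  have "QQ\<^sup>T *v (up T + (- 1) *s up (had dd Z)) = QQ\<^sup>T *v up S"
   unfolding S_def using up_add[OF Tc(1), of "(- 1) \<cdot>\<^sub>m had dd Z"] up_smult[OF sym_matsD(1)[OF ddZ], of "- 1"]
    sym_matsD(1)[OF ddZ] by simp
  moreover have "QQ\<^sup>T *v (up T + (- 1) *s up (had dd Z)) = pack T + (- 1) *s pack (had dd Z)"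
  proof -
   have QT: "QQ\<^sup>T \<in> carrier_mat d (tri n)" using bigQ_carrier by simp
   show ?thesis
    using mult_add_distrib_mat_vec[OF QT up_carrier, of "(- 1) *s up (had dd Z)"] up_carrier[of "had dd Z"]
     mult_mat_vec[OF QT up_carrier] bigQT_up[OF Ts] bigQT_up[OF ddZ] by simp
  qed
  ultimately have "pack S = pack T + (- 1) *s pack (had dd Z)" using bigQT_up[OF Ssy] by simp
  then show ?thesis using pack_carrier[of T] pack_carrier[of "had dd Z"] by (intro eq_vecI) auto
 qed
 have mS: "had msk S \<in> sym_mats n" by (rule had_sym[OF Ssy]) (rule msk_sym)
 have Fs: "F \<in> sym_mats n"
  unfolding F_def S_def[symmetric] by (rule had_sym[OF mS]) (simp add: sg_sym mult.commute)
 have t2: "0 < t\<^sup>2" using tau_pos by simp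
 have Fb: "up F \<bullet> up F \<le> (1 / t\<^sup>2)\<^sup>2 * (pack S \<bullet> pack S)"
 proof -
  note Fc = sym_matsD(1)[OF Fs]
  have "ip F F \<le> (1 / t\<^sup>2)\<^sup>2 * ip S (had msk S)"
   unfolding ip_eq[OF Fc Fc] ip_had[OF Sc(1) Sc(1)] sum_distrib_left
  proof (intro sum_mono)
   fix i j assume "j \<in> {..<n}" "i \<in> {..<n}"
   then have ij: "i < n" "j < n" by auto
   define g where "g = sg i j / (ev i * ev j)"
   have Fij: "F $$ (i, j) = g / t\<^sup>2 * (msk i j * S $$ (i, j))"
    using ij Sc by (simp add: F_def S_def[symmetric] g_def)
   have g01: "0 \<le> g \<and> g \<le> 1" if "msk i j \<noteq> 0"
   proof -
    have ep: "0 < ev i * ev j" using ev_pos[OF ij(1)] ev_pos[OF ij(2)] by simp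
    have "0 \<le> ee i j"
     unfolding ee_def ec_def using ev_pos[OF ij(1)] ev_pos[OF ij(2)] tau_pos by (simp add: mult_nonneg_nonneg)
    then have "sg i j \<le> ev i * ev j" by (simp add: sg_def)
    then show ?thesis using sg_pos[OF that ij] ep by (simp add: g_def)
   qed
   show "F $$ (i, j) * F $$ (i, j) \<le> (1 / t\<^sup>2)\<^sup>2 * (msk i j * (S $$ (i, j) * S $$ (i, j)))"
   proof (cases "msk i j = 0")
    case False
    then have m1: "msk i j = 1" by (auto simp: msk_def split: if_splits)
    have "g * g \<le> 1" using g01[OF False] mult_mono[of g 1 g 1] by simp
    then have "(g * g) * ((1 / t\<^sup>2)\<^sup>2 * (S $$ (i, j) * S $$ (i, j))) \<le> 1 * ((1 / t\<^sup>2)\<^sup>2 * (S $$ (i, j) * S $$ (i, j)))"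
     by (rule mult_right_mono) simp
    then show ?thesis unfolding Fij m1 by (simp add: power2_eq_square algebra_simps)
   qed (simp add: Fij)
  qed
  then show ?thesis unfolding up_scalar_prod[OF Fs Fs] pack_scalar_prod[OF Ssy Ssy] .
 qed
 define mx where "mx = max 1 (1 / t\<^sup>2)"
 have mx: "1 \<le> mx" "1 / t\<^sup>2 \<le> mx" by (simp_all add: mx_def)
 have "newton_residual A b C W (matS n x) ?dy = vnorm (up F @\<^sub>v (A *v x - b))"
 proof -
  have dyc: "?dy \<in> carrier_vec m" using u by simp
  have Axc: "A *v x \<in> carrier_vec m" by (rule mult_mat_vec_carrier[OF A xc])
  have "four_block_mat (- ?I) A\<^sup>T A (0\<^sub>m m m) *v (x @\<^sub>v ?dy) =
   ((- ?I) *v x + A\<^sup>T *v ?dy) @\<^sub>v (A *v x + 0\<^sub>m m m *v ?dy)"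
   by (rule four_block_mat_mult_vec[OF _ AT A _ xc dyc]) (use Ic in auto)
  also have "A *v x + 0\<^sub>m m m *v ?dy = A *v x" using zero_mat_mult_vec[OF dyc, of m] Axc by simp
  finally have "four_block_mat (- ?I) A\<^sup>T A (0\<^sub>m m m) *v (x @\<^sub>v ?dy) - (vecS C @\<^sub>v b) =
    (((- ?I) *v x + A\<^sup>T *v ?dy) @\<^sub>v (A *v x)) - (vecS C @\<^sub>v b)" by simp
  also have "\<dots> = ((- ?I) *v x + A\<^sup>T *v ?dy - vecS C) @\<^sub>v (A *v x - b)"
  proof (rule append_vec_minus)
   show "dim_vec ((- ?I) *v x + A\<^sup>T *v ?dy) = dim_vec (vecS C)" using A sym_matsD[OF C] by simp
  qed (use A b in simp)
  finally have e: "four_block_mat (- ?I) A\<^sup>T A (0\<^sub>m m m) *v (x @\<^sub>v ?dy) - (vecS C @\<^sub>v b) =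
    ((- ?I) *v x + A\<^sup>T *v ?dy - vecS C) @\<^sub>v (A *v x - b)" .
  then show ?thesis
   unfolding newton_residual_def vx using e A first by simp
 qed
 also have "\<dots> \<le> mx * vnorm ?rho"
 proof (rule power2_le_imp_le)
  have "(1 / t\<^sup>2)\<^sup>2 \<le> mx\<^sup>2" "1 \<le> mx\<^sup>2" using mx t2 by (auto intro!: power_mono one_le_power)
  then have "(1 / t\<^sup>2)\<^sup>2 * (pack S \<bullet> pack S) + (vnorm (A *v x - b))\<^sup>2 \<le> mx\<^sup>2 * (pack S \<bullet> pack S) + mx\<^sup>2 * (vnorm (A *v x - b))\<^sup>2"
   using scalar_prod_self_nonneg[of "pack S"] mult_right_mono[of 1 "mx\<^sup>2" "(vnorm (A *v x - b))\<^sup>2"]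
   by (intro add_mono mult_right_mono) auto
  then show "(vnorm (up F @\<^sub>v (A *v x - b)))\<^sup>2 \<le> (mx * vnorm ?rho)\<^sup>2"
   using Fb unfolding rho pS power_mult_distrib vnorm_append
   by (simp add: vnorm_power2 algebra_simps)
 qed (use mx in simp)
 finally show ?thesis by (simp add: mx_def x_def)
qed

end

section \<open>Chebyshev polynomials\<close>

fun cheb :: "nat \<Rightarrow> real poly" where
 "cheb 0 = 1"
| "cheb (Suc 0) = [:0, 1:]"
| "cheb (Suc (Suc n)) = [:0, 2:] * cheb (Suc n) - cheb n"

lemma degree_cheb: "degree (cheb n) \<le> n"
proof (induction n rule: cheb.induct)
 case (3 n)
 have "degree ([:0, 2:] * cheb (Suc n)) \<le> Suc (Suc n)"
  using degree_mult_le[of "[:0, 2:]" "cheb (Suc n)"] 3 by (simp del: mult_pCons_left)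
 moreover have "degree (cheb n) \<le> Suc (Suc n)" using 3 by simp
 ultimately show ?case by (simp add: degree_diff_le del: mult_pCons_left)
qed auto

lemma cheb_cos: "poly (cheb n) (cos x) = cos (real n * x)"
proof (induction n rule: cheb.induct)
 case (3 n)
 have "cos (real (Suc (Suc n)) * x) + cos (real n * x) = 2 * cos x * cos (real (Suc n) * x)"
  using cos_plus_cos[of "real (Suc (Suc n)) * x" "real n * x"] by (simp add: algebra_simps add_divide_distrib)
 then show ?case using 3 by (simp add: algebra_simps)
qed auto

lemma cheb_bounded:
 assumes "\<bar>x\<bar> \<le> 1"
 shows "\<bar>poly (cheb n) x\<bar> \<le> 1"
proof -
 have "cos (arccos x) = x" using assms by (simp add: cos_arccos_abs)
 then have "poly (cheb n) x = cos (real n * arccos x)" using cheb_cos[of n "arccos x"] by simp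
 then show ?thesis by simp
qed

lemma cheb_growth:
 assumes "0 < z"
 shows "poly (cheb n) ((z + 1 / z) / 2) = (z ^ n + 1 / z ^ n) / 2"
proof (induction n rule: cheb.induct)
 case (3 n)
 have "poly (cheb (Suc (Suc n))) x = 2 * x * poly (cheb (Suc n)) x - poly (cheb n) x" for x by simp
 then have "poly (cheb (Suc (Suc n))) ((z + 1 / z) / 2) =
   2 * ((z + 1 / z) / 2) * ((z ^ Suc n + 1 / z ^ Suc n) / 2) - (z ^ n + 1 / z ^ n) / 2"
  by (simp only: 3)
 also have "\<dots> = (z ^ Suc (Suc n) + 1 / z ^ Suc (Suc n)) / 2"
  using assms by (simp add: field_simps)
 finally show ?case .
qed auto

text \<open>The Chebyshev polynomial transplanted to \<open>[a\<^sup>2, b\<^sup>2]\<close> and normalised at \<open>0\<close>, evaluated at \<open>x\<^sup>2\<close>,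
 so that both signs of an indefinite spectrum are treated at once.\<close>

lemma small_polynomial:
 assumes a: "0 < a" "a < b"
 obtains p :: "real poly" where "degree p \<le> 2 * k" "poly p 0 = 1"
  "\<And>x. a \<le> \<bar>x\<bar> ==> \<bar>x\<bar> \<le> b ==> \<bar>poly p x\<bar> \<le> 2 * exp (- real k * a / b)"
proof -
 define z where "z = (b + a) / (b - a)"
 define L where "L = [:(b\<^sup>2 + a\<^sup>2) / (b\<^sup>2 - a\<^sup>2), 0, - 2 / (b\<^sup>2 - a\<^sup>2):]"
 have z: "1 < z" using a by (simp add: z_def)
 have ab: "0 < b\<^sup>2 - a\<^sup>2" using a by (simp add: power_strict_mono)
 have L0: "(b\<^sup>2 + a\<^sup>2) / (b\<^sup>2 - a\<^sup>2) = (z + 1 / z) / 2"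
 proof -
  have "b - a \<noteq> 0" "b + a \<noteq> 0" using a by auto
  moreover have "b\<^sup>2 - a\<^sup>2 = (b - a) * (b + a)" by (simp add: power2_eq_square algebra_simps)
  ultimately show ?thesis by (simp add: z_def divide_simps) (simp add: power2_eq_square algebra_simps)
 qed
 define c where "c = poly (cheb k) ((z + 1 / z) / 2)"
 have c: "z ^ k / 2 \<le> c" using z by (simp add: c_def cheb_growth)
 have zk: "0 < z ^ k" using z by simp
 have c0: "0 < c" using c zk by linarith
 define p where "p = Polynomial.smult (1 / c) (pcompose (cheb k) L)"
 show ?thesis
 proof
  have "degree L \<le> 2" by (simp add: L_def)
  then have "degree (cheb k) * degree L \<le> k * 2" using degree_cheb[of k] by (intro mult_mono) auto
  then have "degree (pcompose (cheb k) L) \<le> 2 * k" by simp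
  then show "degree p \<le> 2 * k" unfolding p_def using degree_smult_le order_trans by blast
  show "poly p 0 = 1" using c0 by (simp add: p_def poly_pcompose L_def L0 c_def)
 next
  fix x assume x: "a \<le> \<bar>x\<bar>" "\<bar>x\<bar> \<le> b"
  have x2: "a\<^sup>2 \<le> x\<^sup>2" "x\<^sup>2 \<le> b\<^sup>2"
   using power_mono[OF x(1), of 2] power_mono[OF x(2), of 2] a by simp_all
  have "poly L x = (b\<^sup>2 + a\<^sup>2 - 2 * x\<^sup>2) / (b\<^sup>2 - a\<^sup>2)"
  proof -
   define D where "D = b\<^sup>2 - a\<^sup>2"
   have "poly L x = (b\<^sup>2 + a\<^sup>2) / D - 2 * x\<^sup>2 / D"
    unfolding L_def D_def[symmetric] by (simp add: power2_eq_square)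
   then show ?thesis by (simp add: D_def diff_divide_distrib)
  qed
  moreover have "\<bar>b\<^sup>2 + a\<^sup>2 - 2 * x\<^sup>2\<bar> \<le> b\<^sup>2 - a\<^sup>2" using x2 by (simp add: abs_le_iff)
  ultimately have "\<bar>poly L x\<bar> \<le> 1" using ab by simp
  then have "\<bar>poly (cheb k) (poly L x)\<bar> \<le> 1" by (rule cheb_bounded)
  then have "\<bar>poly p x\<bar> \<le> 1 / c" using c0 by (simp add: p_def poly_pcompose abs_mult divide_right_mono)
  also have "\<dots> \<le> 1 / (z ^ k / 2)" using c zk by (intro divide_left_mono mult_pos_pos) (auto simp: c0)
  also have "\<dots> = 2 * (1 / z) ^ k" by (simp add: power_divide)
  also have "\<dots> \<le> 2 * exp (- a / b) ^ k"
  proof -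
   have "1 / z = 1 + (- 2 * a / (b + a))" using a by (simp add: z_def field_simps)
   also have "\<dots> \<le> 1 + (- a / b)" using a by (simp add: field_simps)
   also have "\<dots> \<le> exp (- a / b)" by (rule exp_ge_add_one_self)
   finally have "1 / z \<le> exp (- a / b)" .
   then show ?thesis using z by (simp add: power_mono)
  qed
  also have "exp (- a / b) ^ k = exp (- real k * a / b)" by (simp add: exp_of_nat_mult[symmetric])
  finally show "\<bar>poly p x\<bar> \<le> 2 * exp (- real k * a / b)" .
 qed
qed

section \<open>Spans of finite sequences of vectors\<close>

definition seq_span :: "nat \<Rightarrow> (nat \<Rightarrow> real vec) \<Rightarrow> nat \<Rightarrow> real vec set" where
 "seq_span N f k = module.span class_ring (module_vec TYPE(real) N) (f ` {..<k})"

context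
 fixes N :: nat and f :: "nat \<Rightarrow> real vec" and k :: nat
 assumes f: "\<And>i. i < k ==> f i \<in> carrier_vec N"
begin

interpretation vec_space "TYPE(real)" N .

lemma gens_sub: "f ` {..<k} \<subseteq> carrier_vec N" using f by auto

lemma seq_span_carrier: "x \<in> seq_span N f k ==> x \<in> carrier_vec N"
 using span_is_subset2[of "f ` {..<k}"] gens_sub by (auto simp: seq_span_def)

lemma seq_span_gen: "i < k ==> f i \<in> seq_span N f k"
 using in_own_span[of "f ` {..<k}"] gens_sub by (auto simp: seq_span_def)

lemma seq_span_sub: "submodule class_ring (seq_span N f k) (module_vec TYPE(real) N)"
 unfolding seq_span_def by (rule span_is_submodule) (use gens_sub in simp)

lemma seq_span_add: "x \<in> seq_span N f k ==> y \<in> seq_span N f k ==> x + y \<in> seq_span N f k"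
 using submodule.m_closed[OF seq_span_sub] by (simp add: module_vec_simps)

lemma seq_span_zero: "0\<^sub>v N \<in> seq_span N f k"
 using submodule.zero_closed[OF seq_span_sub] by (simp add: module_vec_simps)

lemma seq_span_smult: "x \<in> seq_span N f k ==> c *s x \<in> seq_span N f k"
 using submodule.smult_closed[OF seq_span_sub, of c] by (simp add: module_vec_simps class_ring_simps)

lemma seq_span_minus: "x \<in> seq_span N f k ==> y \<in> seq_span N f k ==> x - y \<in> seq_span N f k"
proof -
 assume a: "x \<in> seq_span N f k" "y \<in> seq_span N f k"
 have "x - y = x + (- 1) *s y" using seq_span_carrier a by (intro eq_vecI) auto
 then show ?thesis using a seq_span_add seq_span_smult by simp
qed

lemma seq_span_least:
 assumes sub: "U \<subseteq> carrier_vec N" and gen: "\<And>i. i < k ==> f i \<in> U" and z: "0\<^sub>v N \<in> U"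
  and add: "\<And>x y. x \<in> U ==> y \<in> U ==> x + y \<in> U" and sm: "\<And>c x. x \<in> U ==> c *s x \<in> U"
 shows "seq_span N f k \<subseteq> U"
 unfolding seq_span_def
proof (rule span_is_subset)
 show "f ` {..<k} \<subseteq> U" using gen by auto
 show "submodule class_ring U V"
  by unfold_locales (use sub z add sm in \<open>auto simp: module_vec_simps class_ring_simps\<close>)
qed

end

lemma seq_span_mono:
 assumes "\<And>i. i < l ==> f i \<in> carrier_vec N" "k \<le> l"
 shows "seq_span N f k \<subseteq> seq_span N f l"
proof -
 interpret vec_space "TYPE(real)" N .
 show ?thesis unfolding seq_span_def by (rule span_is_monotone) (use assms(2) in auto)
qed

lemma vec_minus_minus_add:
 "x \<in> carrier_vec k ==> y \<in> carrier_vec k ==> z \<in> carrier_vec k ==> x - y - z + (y + z) = (x :: real vec)"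
 by (rule eq_vecI) auto

lemma vec_minus_swap:
 "x \<in> carrier_vec k ==> y \<in> carrier_vec k ==> y - x = (- 1) *s (x - y :: real vec)"
 by (rule eq_vecI) auto

lemma vec_minus_telescope:
 "x \<in> carrier_vec k ==> y \<in> carrier_vec k ==> z \<in> carrier_vec k ==> x - y + (z - x) = (z - y :: real vec)"
 by (rule eq_vecI) auto

lemma vec_neg_minus:
 "x \<in> carrier_vec k ==> y \<in> carrier_vec k ==> (- 1) *s x - y = (- 1) *s (y + 1 *s x :: real vec)"
 by (rule eq_vecI) auto

section \<open>Minimal residuals by conjugate directions\<close>

text \<open>The vectors \<open>p\<close> below are the Lanczos vectors for the inner product \<open>x, y \<mapsto> M x \<cdot> M y\<close>, in which \<open>M\<close> is
 still self-adjoint; hence the three-term recurrence, and the iterate is a sum of projections.  When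
 the Krylov space is exhausted, \<open>p\<close> vanishes and all later quotients are \<open>0 / 0 = 0\<close>.\<close>

record odir =
 od_p :: "real vec"
 od_o :: "real vec"
 od_n :: real
 od_y :: "real vec"

definition od_step :: "(real vec \<Rightarrow> real vec) \<Rightarrow> real vec \<Rightarrow> odir \<Rightarrow> odir" where
 "od_step F b s = (let p = od_p s; q = F p; nn = q \<bullet> q in
  \<lparr>od_p = (q - ((F q \<bullet> q) / nn) *s p) - (nn / od_n s) *s od_o s, od_o = p, od_n = nn,
   od_y = od_y s + ((q \<bullet> b) / nn) *s p\<rparr>)"

text \<open>The value \<open>0\<close> of \<open>od_n\<close> switches off the term of the missing predecessor in the first step, again by
 \<open>x / 0 = 0\<close>.\<close>

definition od_init :: "nat \<Rightarrow> real vec \<Rightarrow> odir" where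
 "od_init N b = \<lparr>od_p = b, od_o = 0\<^sub>v N, od_n = 0, od_y = 0\<^sub>v N\<rparr>"

definition od_state :: "nat \<Rightarrow> (real vec \<Rightarrow> real vec) \<Rightarrow> real vec \<Rightarrow> nat \<Rightarrow> odir" where
 "od_state N F b k = (od_step F b ^^ k) (od_init N b)"

locale regular_system =
 fixes N :: nat and M :: "real mat" and b :: "real vec"
 assumes M: "M \<in> sym_mats N" and inj: "\<And>x. x \<in> carrier_vec N ==> M *v x = 0\<^sub>v N ==> x = 0\<^sub>v N"
  and b: "b \<in> carrier_vec N"
begin

abbreviation st where "st \<equiv> od_state N (\<lambda>x. M *v x) b"
definition P where "P j = od_p (st j)"
definition y where "y j = od_y (st j)"
definition ipm where "ipm u v = (M *v u) \<bullet> (M *v v)"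
definition al where "al j = ipm (M *v P j) (P j) / ipm (P j) (P j)"
definition be where "be j = (if j = 0 then 0 else ipm (P j) (P j) / ipm (P (j - 1)) (P (j - 1)))"

lemmas Mc = sym_matsD[OF M]

lemma Mx: "x \<in> carrier_vec N ==> M *v x \<in> carrier_vec N"
 using Mc by simp

lemma st_Suc: "st (Suc j) = od_step (\<lambda>x. M *v x) b (st j)"
 by (simp add: od_state_def)

lemma st_0: "st 0 = od_init N b" by (simp add: od_state_def)

lemma od_o_st: "od_o (st (Suc j)) = P j"
 by (simp add: st_Suc od_step_def Let_def P_def)

lemma od_n_st: "od_n (st (Suc j)) = ipm (P j) (P j)"
 by (simp add: st_Suc od_step_def Let_def P_def ipm_def)

lemma P_0: "P 0 = b" by (simp add: P_def st_0 od_init_def)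

lemma y_0: "y 0 = 0\<^sub>v N" by (simp add: y_def st_0 od_init_def)

lemma P_Suc: "P (Suc j) = (M *v P j - al j *s P j) - be j *s (if j = 0 then 0\<^sub>v N else P (j - 1))"
proof (cases j)
 case 0
 have z: "c *s 0\<^sub>v N = (0\<^sub>v N :: real vec)" for c by (rule eq_vecI) auto
 show ?thesis
  unfolding 0 by (simp add: P_def[of "Suc 0"] st_Suc od_step_def Let_def P_def[symmetric] al_def ipm_def be_def)
   (simp add: st_0 od_init_def z)
next
 case (Suc i)
 have "P (Suc j) = (M *v P j - al j *s P j) - (ipm (P j) (P j) / od_n (st j)) *s od_o (st j)"
  by (simp add: P_def[of "Suc j"] st_Suc[of j] od_step_def Let_def P_def[symmetric] al_def ipm_def)
 then show ?thesis unfolding Suc od_n_st od_o_st by (simp add: be_def)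
qed

lemma P_carrier: "P j \<in> carrier_vec N"
proof (induction j rule: less_induct)
 case (less j)
 show ?case
 proof (cases j)
  case 0
  then show ?thesis using b P_0 by simp
 next
  case (Suc i)
  then show ?thesis using less[of i] less[of "i - 1"] Mx unfolding Suc P_Suc by auto
 qed
qed

lemma y_Suc: "y (Suc j) = y j + (((M *v P j) \<bullet> b) / ipm (P j) (P j)) *s P j"
 by (simp add: y_def st_Suc od_step_def Let_def P_def ipm_def)

lemma y_carrier: "y j \<in> carrier_vec N"
 by (induction j) (use y_0 y_Suc P_carrier in auto)

lemma ipm_commute: "u \<in> carrier_vec N ==> v \<in> carrier_vec N ==> ipm u v = ipm v u"
 unfolding ipm_def using Mx by (intro comm_scalar_prod[of _ N]) auto

lemma ipm_self_adjoint: "u \<in> carrier_vec N ==> v \<in> carrier_vec N ==> ipm (M *v u) v = ipm u (M *v v)"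
 unfolding ipm_def using symmetric_scalar_prod[OF M Mx Mx] by simp

lemma ipm_add:
 assumes u: "u \<in> carrier_vec N" and v: "v \<in> carrier_vec N" and w: "w \<in> carrier_vec N"
 shows "ipm u (v + w) = ipm u v + ipm u w"
 unfolding ipm_def mult_add_distrib_mat_vec[OF Mc(1) v w]
 by (rule scalar_prod_add_distrib[OF Mx[OF u] Mx[OF v] Mx[OF w]])

lemma ipm_minus:
 assumes u: "u \<in> carrier_vec N" and v: "v \<in> carrier_vec N" and w: "w \<in> carrier_vec N"
 shows "ipm u (v - w) = ipm u v - ipm u w"
 unfolding ipm_def mult_minus_distrib_mat_vec[OF Mc(1) v w]
 by (rule scalar_prod_minus_distrib[OF Mx[OF u] Mx[OF v] Mx[OF w]])

lemma ipm_smult: "u \<in> carrier_vec N ==> v \<in> carrier_vec N ==> ipm u (c *s v) = c * ipm u v"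
 unfolding ipm_def using Mx mult_mat_vec[OF Mc(1)] by simp

lemma ipm_zero: "u \<in> carrier_vec N ==> ipm u (0\<^sub>v N) = 0"
 unfolding ipm_def using Mx mult_zero_vec[OF Mc(1)] by simp

lemma ipm_self_0: "u \<in> carrier_vec N ==> ipm u u = 0 ==> u = 0\<^sub>v N"
 unfolding ipm_def using scalar_prod_self_eq_0[OF Mx] inj by simp

lemma M_P: "M *v P j = P (Suc j) + (al j *s P j + be j *s (if j = 0 then 0\<^sub>v N else P (j - 1)))"
proof -
 have c: "al j *s P j \<in> carrier_vec N" "be j *s (if j = 0 then 0\<^sub>v N else P (j - 1)) \<in> carrier_vec N"
  using P_carrier[of j] P_carrier[of "j - 1"] by auto
 show ?thesis unfolding P_Suc by (rule vec_minus_minus_add[OF Mx[OF P_carrier] c, symmetric])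
qed

lemma be_times: "1 \<le> j ==> be j * ipm (P (j - 1)) (P (j - 1)) = ipm (P j) (P j)"
proof (cases "ipm (P (j - 1)) (P (j - 1)) = 0")
 case True
 assume j: "1 \<le> j"
 then obtain i where i: "j = Suc i" by (cases j) auto
 have p0: "P i = 0\<^sub>v N" using ipm_self_0[OF P_carrier] True i by simp
 have z: "c *s 0\<^sub>v N = (0\<^sub>v N :: real vec)" for c by (rule eq_vecI) auto
 have "be i *s (if i = 0 then 0\<^sub>v N else P (i - 1)) = 0\<^sub>v N"
 proof (cases "i = 0")
  case False
  have "be i = 0" using True i False by (simp add: be_def)
  then show ?thesis using False P_carrier[of "i - 1"] by (intro eq_vecI) auto
 qed (use z in simp)
 then have "P j = 0\<^sub>v N" unfolding i P_Suc p0 using mult_zero_vec[OF Mc(1)] z by simp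
 then show ?thesis using ipm_zero[of "0\<^sub>v N"] True by simp
qed (simp add: be_def)

lemma al_times: "al j * ipm (P j) (P j) = ipm (M *v P j) (P j)"
proof (cases "ipm (P j) (P j) = 0")
 case True
 then have "P j = 0\<^sub>v N" using ipm_self_0[OF P_carrier] by simp
 then show ?thesis using True ipm_zero Mx[OF P_carrier[of j]] by simp
qed (simp add: al_def)

text \<open>Self-adjointness moves \<open>M\<close> onto \<open>P i\<close>, which is a combination of \<open>P (i + 1)\<close>, \<open>P i\<close> and \<open>P (i - 1)\<close>; only for
 the last two indices below \<open>j\<close> does the recurrence have to cancel something.\<close>

lemma P_orthogonal: "i < j ==> ipm (P i) (P j) = 0"
proof (induction j arbitrary: i rule: less_induct)
 case (less j)
 obtain k where j: "j = Suc k" using less.prems by (cases j) auto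
 define pr where "pr l = (if l = 0 then 0\<^sub>v N else P (l - 1))" for l
 have prc: "pr l \<in> carrier_vec N" for l by (simp add: pr_def P_carrier)
 have orth: "ipm (P a) (P c) = 0" if "a \<le> k" "c \<le> k" "a \<noteq> c" for a c
  using less.IH[of c a] less.IH[of a c] that j ipm_commute[OF P_carrier P_carrier, of a c] by (cases "a < c") auto
 have exp: "ipm (P i) (P j) = ipm (P i) (M *v P k) - al k * ipm (P i) (P k) - be k * ipm (P i) (pr k)"
  unfolding j P_Suc pr_def[symmetric] using P_carrier[of i] P_carrier[of k] Mx[OF P_carrier[of k]] prc[of k]
  by (simp add: ipm_minus ipm_smult)
 have swap: "ipm (P i) (M *v P k) = ipm (P k) (P (Suc i)) + al i * ipm (P k) (P i) + be i * ipm (P k) (pr i)"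
 proof -
  have "ipm (P i) (M *v P k) = ipm (M *v P i) (P k)" using ipm_self_adjoint[OF P_carrier P_carrier] by simp
  also have "\<dots> = ipm (P k) (M *v P i)" by (rule ipm_commute[OF Mx[OF P_carrier] P_carrier])
  also have "\<dots> = ipm (P k) (P (Suc i) + (al i *s P i + be i *s pr i))" unfolding M_P pr_def ..
  also have "\<dots> = ipm (P k) (P (Suc i)) + al i * ipm (P k) (P i) + be i * ipm (P k) (pr i)"
   using P_carrier prc by (simp add: ipm_add ipm_smult)
  finally show ?thesis .
 qed
 have ik: "i \<le> k" using less.prems j by simp
 show ?case
 proof (cases "i = k")
  case True
  have "ipm (P k) (pr k) = 0" using orth[of k "k - 1"] ipm_zero[OF P_carrier] by (cases "k = 0") (auto simp: pr_def)
  then show ?thesis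
   using exp al_times[of k] ipm_commute[OF Mx[OF P_carrier] P_carrier, of k k] unfolding True by simp
 next
  case False
  then have i: "i < k" using ik by simp
  have 1: "ipm (P k) (P i) = 0" "ipm (P i) (P k) = 0" using orth i by auto
  have 2: "ipm (P k) (pr i) = 0" using orth[of k "i - 1"] i ipm_zero[OF P_carrier] by (cases "i = 0") (auto simp: pr_def)
  show ?thesis
  proof (cases "Suc i = k")
   case True
   have "pr k = P i" using True by (auto simp: pr_def)
   then show ?thesis unfolding exp swap using 1 2 True be_times[of k] by auto
  next
   case False
   then have s: "Suc i < k" using i by simp
   have "ipm (P i) (pr k) = 0" using orth[of i "k - 1"] s by (auto simp: pr_def)
   then show ?thesis unfolding exp swap using 1 2 orth[of k "Suc i"] s by simp
  qed
 qed
qed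

lemma residual_orthogonal: "i < k ==> (b - M *v y k) \<bullet> (M *v P i) = 0"
proof -
 have yip: "ipm (y k) (P i) = (if i < k then (M *v P i) \<bullet> b else 0)" for k i
 proof (induction k)
  case 0
  show ?case using y_0 ipm_commute[of "0\<^sub>v N" "P i"] ipm_zero[OF P_carrier] P_carrier by simp
 next
  case (Suc k)
  define g where "g = ((M *v P k) \<bullet> b) / ipm (P k) (P k)"
  have "ipm (y (Suc k)) (P i) = ipm (P i) (y (Suc k))" by (rule ipm_commute[OF y_carrier P_carrier])
  also have "\<dots> = ipm (P i) (y k) + g * ipm (P i) (P k)"
   unfolding y_Suc g_def[symmetric] using P_carrier y_carrier by (simp add: ipm_add ipm_smult)
  also have "ipm (P i) (y k) = ipm (y k) (P i)" by (rule ipm_commute[OF P_carrier y_carrier])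
  finally have e: "ipm (y (Suc k)) (P i) = (if i < k then (M *v P i) \<bullet> b else 0) + g * ipm (P i) (P k)"
   unfolding Suc .
  consider "i < k" | "i = k" | "k < i" by linarith
  then show ?case
  proof cases
   case 2
   have "g * ipm (P k) (P k) = (M *v P k) \<bullet> b"
   proof (cases "ipm (P k) (P k) = 0")
    case True
    then have "P k = 0\<^sub>v N" using ipm_self_0[OF P_carrier] by simp
    then show ?thesis using True b mult_zero_vec[OF Mc(1)] by simp
   qed (simp add: g_def)
   then show ?thesis using e 2 by simp
  qed (use e P_orthogonal ipm_commute[OF P_carrier P_carrier, of i k] in auto)
 qed
 assume "i < k"
 then have "(M *v y k) \<bullet> (M *v P i) = (M *v P i) \<bullet> b" using yip[of k i] by (simp add: ipm_def)
 then show ?thesis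
  using minus_scalar_prod_distrib[OF b Mx[OF y_carrier] Mx[OF P_carrier], of k i]
   comm_scalar_prod[OF b Mx[OF P_carrier], of i] by simp
qed

definition kry where "kry i = (M ^\<^sub>m i) *v b"

lemma kry_carrier: "kry i \<in> carrier_vec N"
 unfolding kry_def by (rule mult_mat_vec_carrier[OF pow_carrier_mat[OF Mc(1)] b])

lemma pow_commute: "M * M ^\<^sub>m i = M ^\<^sub>m i * M"
proof (induction i)
 case (Suc i)
 have c: "M ^\<^sub>m i \<in> carrier_mat N N" by (rule pow_carrier_mat[OF Mc(1)])
 have "M * M ^\<^sub>m Suc i = (M * M ^\<^sub>m i) * M" using assoc_mult_mat[OF Mc(1) c Mc(1)] by simp
 then show ?case unfolding Suc by simp
qed (use Mc in simp)

lemma kry_Suc: "kry (Suc i) = M *v kry i"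
proof -
 have c: "M ^\<^sub>m i \<in> carrier_mat N N" by (rule pow_carrier_mat[OF Mc(1)])
 have "kry (Suc i) = (M * M ^\<^sub>m i) *v b" unfolding pow_commute by (simp add: kry_def)
 then show ?thesis using assoc_mult_mat_vec[OF Mc(1) c b] by (simp add: kry_def)
qed

lemma kry_0: "kry 0 = b" using b Mc by (simp add: kry_def)

lemma seq_span_image:
 assumes f: "\<And>i. f i \<in> carrier_vec N" and step: "\<And>i. i < k ==> M *v f i \<in> seq_span N f (Suc k)"
  and x: "x \<in> seq_span N f k"
 shows "M *v x \<in> seq_span N f (Suc k)"
proof -
 let ?U = "{x \<in> carrier_vec N. M *v x \<in> seq_span N f (Suc k)}"
 have "seq_span N f k \<subseteq> ?U"
 proof (rule seq_span_least)
  show "0\<^sub>v N \<in> ?U" using mult_zero_vec[OF Mc(1)] seq_span_zero[of "Suc k" f N] f by simp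
 next
  fix u v assume "u \<in> ?U" "v \<in> ?U"
  then show "u + v \<in> ?U" using mult_add_distrib_mat_vec[OF Mc(1), of u v] seq_span_add[of "Suc k" f N] f by auto
 next
  fix c u assume "u \<in> ?U"
  then show "c *s u \<in> ?U" using mult_mat_vec[OF Mc(1), of u c] seq_span_smult[of "Suc k" f N] f by auto
 qed (use f step in auto)
 then show ?thesis using x by auto
qed

lemma P_in_krylov: "P j \<in> seq_span N kry (Suc j)"
proof (induction j rule: less_induct)
 case (less j)
 show ?case
 proof (cases j)
  case 0
  then show ?thesis using seq_span_gen[of 1 kry N 0] kry_carrier P_0 kry_0 b by simp
 next
  case (Suc i)
  have st: "M *v kry l \<in> seq_span N kry (Suc (Suc i))" if "l < Suc i" for l
   using seq_span_gen[of "Suc (Suc i)" kry N "Suc l"] kry_carrier that by (simp add: kry_Suc)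
  have mo: "seq_span N kry l \<subseteq> seq_span N kry (Suc (Suc i))" if "l \<le> Suc (Suc i)" for l
   by (rule seq_span_mono) (use kry_carrier that in auto)
  have a: "M *v P i \<in> seq_span N kry (Suc (Suc i))"
   by (rule seq_span_image[OF kry_carrier st]) (use less[of i] Suc in auto)
  have c: "P i \<in> seq_span N kry (Suc (Suc i))" using less[of i] mo[of "Suc i"] Suc by auto
  have d: "(if i = 0 then 0\<^sub>v N else P (i - 1)) \<in> seq_span N kry (Suc (Suc i))"
  proof (cases "i = 0")
   case False
   then show ?thesis using less[of "i - 1"] mo[of "Suc (i - 1)"] Suc by auto
  qed (use seq_span_zero[of "Suc (Suc i)" kry N] kry_carrier in simp)
  show ?thesis
   unfolding Suc P_Suc by (intro seq_span_minus seq_span_smult a c d kry_carrier)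
 qed
qed

lemma krylov_in_P: "kry i \<in> seq_span N P (Suc i)"
proof (induction i)
 case 0
 show ?case using seq_span_gen[of 1 P N 0] P_carrier P_0 kry_0 b by simp
next
 case (Suc i)
 have st: "M *v P l \<in> seq_span N P (Suc (Suc i))" if l: "l < Suc i" for l
 proof -
  have g: "P a \<in> seq_span N P (Suc (Suc i))" if "a < Suc (Suc i)" for a
   by (rule seq_span_gen) (use P_carrier that in auto)
  have d: "(if l = 0 then 0\<^sub>v N else P (l - 1)) \<in> seq_span N P (Suc (Suc i))"
   using g[of "l - 1"] l seq_span_zero[of "Suc (Suc i)" P N] P_carrier by auto
  show ?thesis unfolding M_P by (intro seq_span_add seq_span_smult g d P_carrier) (use l in auto)
 qed
 show ?case unfolding kry_Suc by (rule seq_span_image[OF P_carrier st Suc])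
qed

lemma y_in_krylov: "y k \<in> seq_span N kry k"
proof (induction k)
 case 0
 show ?case using seq_span_zero[of 0 kry N] y_0 by simp
next
 case (Suc k)
 have "y k \<in> seq_span N kry (Suc k)"
  using Suc seq_span_mono[of "Suc k" kry N k] kry_carrier by auto
 then show ?case unfolding y_Suc by (intro seq_span_add seq_span_smult P_in_krylov kry_carrier)
qed

lemma residual_orthogonal_krylov:
 assumes "x \<in> seq_span N kry k"
 shows "(b - M *v y k) \<bullet> (M *v x) = 0"
proof -
 let ?r = "b - M *v y k"
 have rc: "?r \<in> carrier_vec N" using b Mx[OF y_carrier] by simp
 let ?U = "{x \<in> carrier_vec N. ?r \<bullet> (M *v x) = 0}"
 have add: "u + v \<in> ?U" if "u \<in> ?U" "v \<in> ?U" for u v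
  using that mult_add_distrib_mat_vec[OF Mc(1), of u v] scalar_prod_add_distrib[OF rc Mx Mx, of u v] by auto
 have sm: "c *s u \<in> ?U" if "u \<in> ?U" for c u
  using that mult_mat_vec[OF Mc(1), of u c] Mx[of u] rc by auto
 have z: "0\<^sub>v N \<in> ?U" using mult_zero_vec[OF Mc(1)] rc by simp
 have "seq_span N P k \<subseteq> ?U"
  by (rule seq_span_least) (use P_carrier residual_orthogonal add sm z in auto)
 moreover have "kry i \<in> seq_span N P k" if "i < k" for i
  using krylov_in_P[of i] seq_span_mono[of k P N "Suc i"] P_carrier that by auto
 ultimately have "kry i \<in> ?U" if "i < k" for i using that by auto
 then have "seq_span N kry k \<subseteq> ?U"
  by (intro seq_span_least) (use kry_carrier add sm z in auto)
 then show ?thesis using assms by auto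
qed

text \<open>Orthogonality of the residual to \<open>M\<close> times the Krylov space is Pythagoras for every competitor, which
 gives minimality and, \<open>M\<close> being injective, uniqueness of the minimiser.\<close>

lemma krylov_residual_split:
 assumes x: "x \<in> seq_span N kry k"
 shows "(vnorm (M *v x - b))\<^sup>2 = (vnorm (M *v y k - b))\<^sup>2 + ipm (x - y k) (x - y k)"
proof -
 have xc: "x \<in> carrier_vec N" using seq_span_carrier[OF _ x] kry_carrier by auto
 have yc: "y k \<in> carrier_vec N" by (rule y_carrier)
 define R D where "R = M *v y k - b" and "D = M *v (x - y k)"
 have Rc: "R \<in> carrier_vec N" and Dc: "D \<in> carrier_vec N"
  unfolding R_def D_def using Mx xc yc b by auto
 have "x - y k \<in> seq_span N kry k" by (rule seq_span_minus[OF kry_carrier x y_in_krylov])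
 from residual_orthogonal_krylov[OF this] have o: "(b - M *v y k) \<bullet> D = 0" by (simp add: D_def)
 have "b - M *v y k = (- 1) *s R" unfolding R_def by (rule vec_minus_swap[OF Mx[OF yc] b])
 then have RD: "R \<bullet> D = 0" using o Rc Dc by simp
 have "M *v x - b = R + D"
  unfolding R_def D_def mult_minus_distrib_mat_vec[OF Mc(1) xc yc]
  by (rule vec_minus_telescope[OF Mx[OF yc] b Mx[OF xc], symmetric])
 then have "(vnorm (M *v x - b))\<^sup>2 = R \<bullet> R + D \<bullet> D"
  unfolding vnorm_power2 using Rc Dc RD comm_scalar_prod[OF Rc Dc]
  by (simp add: add_scalar_prod_distrib[of _ N] scalar_prod_add_distrib[of _ N])
 then show ?thesis by (simp add: vnorm_power2 R_def D_def ipm_def)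
qed

lemma y_minimal:
 assumes "x \<in> seq_span N kry k"
 shows "vnorm (M *v y k - b) \<le> vnorm (M *v x - b)"
 by (rule power2_le_imp_le) (use krylov_residual_split[OF assms] scalar_prod_self_nonneg in \<open>simp_all add: ipm_def\<close>)

theorem minres_eq: "minres k M b (1\<^sub>m N) (0\<^sub>v N) = y k"
proof -
 have one: "1\<^sub>m N * M * 1\<^sub>m N = M" "1\<^sub>m N *v b = b" "1\<^sub>m N *v 0\<^sub>v N = (0\<^sub>v N :: real vec)"
  using Mc b by simp_all
 have db: "dim_vec b = N" using b by simp
 have img: "(\<lambda>i. (M ^\<^sub>m i) *v b) = kry" by (auto simp: kry_def)
 have "(\<lambda>z. 0\<^sub>v N + z) ` seq_span N kry k = seq_span N kry k"
 proof -
  have "0\<^sub>v N + z = z" if "z \<in> seq_span N kry k" for z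
   using seq_span_carrier[OF _ that] kry_carrier by auto
  then show ?thesis by (simp cong: image_cong)
 qed
 then have "minres k M b (1\<^sub>m N) (0\<^sub>v N) =
   1\<^sub>m N *v arg_min_on (\<lambda>x. vnorm (M *v x - b)) (seq_span N kry k)"
  unfolding minres_def Let_def psd_sqrt_one minv_one one db img seq_span_def by simp
 moreover have "arg_min_on (\<lambda>x. vnorm (M *v x - b)) (seq_span N kry k) = y k"
  unfolding arg_min_on_def arg_min_def
 proof (rule some_equality)
  show "is_arg_min (\<lambda>x. vnorm (M *v x - b)) (\<lambda>x. x \<in> seq_span N kry k) (y k)"
   unfolding is_arg_min_def using y_in_krylov y_minimal by (auto simp: not_less)
 next
  fix x assume "is_arg_min (\<lambda>x. vnorm (M *v x - b)) (\<lambda>x. x \<in> seq_span N kry k) x"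
  then have x: "x \<in> seq_span N kry k" and le: "vnorm (M *v x - b) \<le> vnorm (M *v y k - b)"
   using y_in_krylov by (auto simp: is_arg_min_def not_less)
  have "(vnorm (M *v x - b))\<^sup>2 \<le> (vnorm (M *v y k - b))\<^sup>2" by (rule power_mono[OF le]) simp
  then have "ipm (x - y k) (x - y k) = 0"
   using krylov_residual_split[OF x] scalar_prod_self_nonneg[of "M *v (x - y k)"] by (simp add: ipm_def)
  moreover have xc: "x \<in> carrier_vec N" using seq_span_carrier[OF _ x] kry_carrier by auto
  ultimately have z: "x - y k = 0\<^sub>v N" using ipm_self_0[of "x - y k"] y_carrier[of k] by simp
  show "x = y k"
  proof (rule eq_vecI)
   fix i assume "i < dim_vec (y k)"
   then have "i < N" using y_carrier[of k] by simp
   then show "x $ i = y k $ i" using arg_cong[OF z, of "\<lambda>v. v $ i"] y_carrier[of k] by simp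
  qed (use xc y_carrier[of k] in simp)
 qed
 ultimately show ?thesis using y_carrier by simp
qed

text \<open>Every polynomial \<open>p\<close> with \<open>p 0 = 1\<close> is the residual polynomial of a Krylov vector.\<close>

theorem minres_convergence:
 assumes a: "0 < a" "a < c"
  and eig: "\<And>z \<theta>. z \<in> carrier_vec N ==> z \<noteq> 0\<^sub>v N ==> M *v z = \<theta> *s z ==> a \<le> \<bar>\<theta>\<bar> \<and> \<bar>\<theta>\<bar> \<le> c"
 shows "vnorm (M *v y (2 * k) - b) \<le> 2 * exp (- real k * a / c) * vnorm b"
proof -
 obtain V f where V: "orth_mat N V" and Mf: "M = spectral V f" using symmetric_spectral[OF M] by blast
 have fb: "a \<le> \<bar>f i\<bar> \<and> \<bar>f i\<bar> \<le> c" if i: "i < N" for i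
 proof (rule eig)
  show cc: "col V i \<in> carrier_vec N" using orth_matD[OF V] i by simp
  show "col V i \<noteq> 0\<^sub>v N" using orth_mat_col[OF V i i] by auto
  show "M *v col V i = f i *s col V i" unfolding Mf by (rule spectral_eigenvector[OF V i])
 qed
 obtain p where p: "degree p \<le> 2 * k" "poly p 0 = 1"
   "\<And>x. a \<le> \<bar>x\<bar> ==> \<bar>x\<bar> \<le> c ==> \<bar>poly p x\<bar> \<le> 2 * exp (- real k * a / c)"
  using small_polynomial[OF a] by blast
 have kryf: "kry i = spectral V (\<lambda>j. f j ^ i) *v b" for i
 proof (induction i)
  case 0
  show ?case using spectral_one[OF V] kry_0 b by simp
 next
  case (Suc i)
  have "kry (Suc i) = (spectral V f * spectral V (\<lambda>j. f j ^ i)) *v b"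
   unfolding kry_Suc Suc Mf[symmetric]
   by (rule assoc_mult_mat_vec[OF Mc(1) spectral_carrier[OF V] b, symmetric])
  then show ?case unfolding spectral_mult[OF V] by simp
 qed
 have lin: "spectral V (\<lambda>j. g j + e * h j) *v b = spectral V g *v b + e *s (spectral V h *v b)" for g h e
 proof -
  let ?c = "V\<^sup>T *v b"
  have vc: "vec N (\<lambda>i. g i * ?c $ i) \<in> carrier_vec N" "vec N (\<lambda>i. h i * ?c $ i) \<in> carrier_vec N" by simp_all
  have "vec N (\<lambda>i. (g i + e * h i) * ?c $ i) = vec N (\<lambda>i. g i * ?c $ i) + e *s vec N (\<lambda>i. h i * ?c $ i)"
   by (rule eq_vecI) (auto simp: algebra_simps)
  then show ?thesis
   unfolding spectral_mult_vec[OF V b]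
   using mult_add_distrib_mat_vec[OF orth_matD(1)[OF V] vc(1), of "e *s vec N (\<lambda>i. h i * ?c $ i)"]
    mult_mat_vec[OF orth_matD(1)[OF V] vc(2), of e] by simp
 qed
 define G where "G l j = (\<Sum>i<l. coeff p (Suc i) * f j ^ i)" for l j
 have Gk: "spectral V (G l) *v b \<in> seq_span N kry l" for l
 proof (induction l)
  case 0
  have "spectral V (G 0) *v b = V *v 0\<^sub>v N"
   unfolding spectral_mult_vec[OF V b] by (rule arg_cong[where f = "\<lambda>x. V *v x"]) (auto simp: G_def)
  also have "\<dots> = 0\<^sub>v N" by (rule mult_zero_vec[OF orth_matD(1)[OF V]])
  finally show ?case using seq_span_zero[of 0 kry N] by simp
 next
  case (Suc l)
  have "spectral V (G (Suc l)) *v b = spectral V (G l) *v b + coeff p (Suc l) *s kry l"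
   unfolding kryf lin[symmetric] by (rule arg_cong[where f = "\<lambda>g. spectral V g *v b"]) (simp add: G_def fun_eq_iff)
  moreover have "spectral V (G l) *v b \<in> seq_span N kry (Suc l)"
   using Suc seq_span_mono[of "Suc l" kry N l] kry_carrier by auto
  moreover have "kry l \<in> seq_span N kry (Suc l)" by (rule seq_span_gen) (use kry_carrier in auto)
  ultimately show ?case using seq_span_add[of "Suc l" kry N] seq_span_smult[of "Suc l" kry N] kry_carrier by simp
 qed
 have pG: "poly p (f j) = 1 + f j * G (2 * k) j" for j
 proof -
  have "poly p (f j) = (\<Sum>i\<le>degree p. coeff p i * f j ^ i)" by (rule poly_altdef)
  also have "\<dots> = (\<Sum>i\<le>2 * k. coeff p i * f j ^ i)"
   by (rule sum.mono_neutral_left) (use p(1) in \<open>auto simp: coeff_eq_0\<close>)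
  also have "\<dots> = coeff p 0 * f j ^ 0 + (\<Sum>i<2 * k. coeff p (Suc i) * f j ^ Suc i)"
   by (rule sum.atMost_shift)
  also have "coeff p 0 = 1" using p(2) by (simp add: poly_0_coeff_0)
  finally show ?thesis by (simp add: G_def sum_distrib_left algebra_simps)
 qed
 define x where "x = (- 1) *s (spectral V (G (2 * k)) *v b)"
 have x: "x \<in> seq_span N kry (2 * k)" unfolding x_def by (rule seq_span_smult[OF kry_carrier Gk])
 have gc: "spectral V (G (2 * k)) *v b \<in> carrier_vec N"
  by (rule mult_mat_vec_carrier[OF spectral_carrier[OF V] b])
 have res: "M *v x - b = (- 1) *s (spectral V (\<lambda>j. poly p (f j)) *v b)"
 proof -
  have "M *v x = (- 1) *s (M *v (spectral V (G (2 * k)) *v b))"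
   unfolding x_def by (rule mult_mat_vec[OF Mc(1) gc])
  also have "M *v (spectral V (G (2 * k)) *v b) = spectral V (\<lambda>j. f j * G (2 * k) j) *v b"
   unfolding spectral_mult[OF V, symmetric] Mf[symmetric]
   by (rule assoc_mult_mat_vec[OF Mc(1) spectral_carrier[OF V] b, symmetric])
  finally have m: "M *v x = (- 1) *s (spectral V (\<lambda>j. f j * G (2 * k) j) *v b)" .
  have "spectral V (\<lambda>j. poly p (f j)) *v b = b + 1 *s (spectral V (\<lambda>j. f j * G (2 * k) j) *v b)"
   using lin[of "\<lambda>_. 1" 1 "\<lambda>j. f j * G (2 * k) j"] spectral_one[OF V] b by (simp add: pG)
  then show ?thesis
   unfolding m using vec_neg_minus[OF mult_mat_vec_carrier[OF spectral_carrier[OF V] b] b, of "\<lambda>j. f j * G (2 * k) j"]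
   by simp
 qed
 have "vnorm (M *v y (2 * k) - b) \<le> vnorm (M *v x - b)" by (rule y_minimal[OF x])
 also have "\<dots> = vnorm (spectral V (\<lambda>j. poly p (f j)) *v b)" unfolding res by (simp add: vnorm_smult)
 also have "\<dots> \<le> 2 * exp (- real k * a / c) * vnorm b"
 proof (rule power2_le_imp_le)
  let ?m = "2 * exp (- real k * a / c)"
  have V': "V *v w \<in> carrier_vec N" if "w \<in> carrier_vec N" for w using orth_matD[OF V] that by simp
  define w where "w = vec N (\<lambda>i. poly p (f i) * (V\<^sup>T *v b) $ i)"
  have wc: "w \<in> carrier_vec N" by (simp add: w_def)
  have "(vnorm (spectral V (\<lambda>j. poly p (f j)) *v b))\<^sup>2 = (V *v w) \<bullet> (V *v w)"
   unfolding spectral_mult_vec[OF V b] vnorm_power2 w_def ..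
  also have "\<dots> = w \<bullet> w"
   using orth_mat_isometry[OF V V'[OF wc]] orth_mat_cancel_vec(2)[OF V wc] by simp
  also have "\<dots> = (\<Sum>i<N. (poly p (f i))\<^sup>2 * ((V\<^sup>T *v b) $ i)\<^sup>2)"
   by (simp add: w_def scalar_prod_def lessThan_atLeast0 power2_eq_square algebra_simps)
  also have "\<dots> \<le> (\<Sum>i<N. ?m\<^sup>2 * ((V\<^sup>T *v b) $ i)\<^sup>2)"
  proof (rule sum_mono)
   fix i assume "i \<in> {..<N}"
   then have "\<bar>poly p (f i)\<bar> \<le> ?m" using p(3) fb by auto
   then have "(poly p (f i))\<^sup>2 \<le> ?m\<^sup>2" by (metis abs_ge_zero power2_abs power_mono)
   then show "(poly p (f i))\<^sup>2 * ((V\<^sup>T *v b) $ i)\<^sup>2 \<le> ?m\<^sup>2 * ((V\<^sup>T *v b) $ i)\<^sup>2" by (rule mult_right_mono) simp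
  qed
  also have "\<dots> = ?m\<^sup>2 * (vnorm b)\<^sup>2"
   by (simp add: sum_distrib_left[symmetric] orth_mat_sum_squares[OF V b] vnorm_power2)
  finally show "(vnorm (spectral V (\<lambda>j. poly p (f j)) *v b))\<^sup>2 \<le> (?m * vnorm b)\<^sup>2"
   by (simp add: power_mult_distrib)
 qed simp
 finally show ?thesis .
qed

end

section \<open>Conditioning of the constraint matrix\<close>

text \<open>Cauchy-Schwarz in the form of \<open>A A\<^sup>T\<close> for \<open>w\<close> and \<open>(A A\<^sup>T)\<^sup>-\<^sup>1 w\<close>.\<close>

lemma gram_lower:
 fixes A :: "real mat"
 assumes A: "A \<in> carrier_mat m k" and pd: "A * A\<^sup>T \<in> pd_mats m" and w: "w \<in> carrier_vec m"
 shows "w \<bullet> w \<le> spec_norm (minv (A * A\<^sup>T)) * ((A\<^sup>T *v w) \<bullet> (A\<^sup>T *v w))"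
proof -
 define N where "N = A * A\<^sup>T"
 define B where "B = minv N"
 have Npd: "N \<in> pd_mats m" using pd by (simp add: N_def)
 have Nc: "N \<in> carrier_mat m m" using A by (simp add: N_def)
 note i = pd_minv[OF Npd, folded B_def]
 have Bw: "B *v w \<in> carrier_vec m" by (rule mult_mat_vec_carrier[OF i(1) w])
 have NB: "N *v (B *v w) = w" by (rule inverse_cancel_vec[OF Nc i(1) i(2) w])
 have "(w \<bullet> (N *v (B *v w)))\<^sup>2 \<le> (w \<bullet> (N *v w)) * ((B *v w) \<bullet> (N *v (B *v w)))"
  by (rule psd_Cauchy_Schwarz[OF pd_imp_psd[OF Npd] w Bw])
 then have "(w \<bullet> w)\<^sup>2 \<le> (w \<bullet> (N *v w)) * (w \<bullet> (B *v w))"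
  unfolding NB using comm_scalar_prod[OF Bw w] by simp
 also have "w \<bullet> (B *v w) \<le> spec_norm B * (w \<bullet> w)"
  using quadratic_form_le_spec_norm[OF i(1) w] by (simp add: abs_le_iff)
 finally have le: "(w \<bullet> w)\<^sup>2 \<le> (w \<bullet> (N *v w)) * (spec_norm B * (w \<bullet> w))"
  using pd_imp_psd[OF Npd] w by (simp add: psd_mats_def mult_left_mono)
 have form: "w \<bullet> (N *v w) = (A\<^sup>T *v w) \<bullet> (A\<^sup>T *v w)"
  unfolding N_def using transpose_vec_mult_scalar[OF A _ w, of "A\<^sup>T *v w"] A w by (simp add: mat_dims)
 show ?thesis
 proof (cases "w \<bullet> w = 0")
  case True
  then show ?thesis using spec_norm_nonneg scalar_prod_self_nonneg[of "A\<^sup>T *v w"] by simp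
 next
  case False
  then have p: "0 < w \<bullet> w" using scalar_prod_self_nonneg[of w] by simp
  have "(w \<bullet> w) * (w \<bullet> w) \<le> (w \<bullet> w) * (spec_norm B * (w \<bullet> (N *v w)))"
   using le by (simp add: power2_eq_square algebra_simps)
  then show ?thesis using p form by (simp add: B_def N_def)
 qed
qed

lemma vnorm_transpose_mult:
 assumes A: "A \<in> carrier_mat m k" and w: "w \<in> carrier_vec m"
 shows "vnorm (A\<^sup>T *v w) \<le> spec_norm A * vnorm w"
proof (cases "vnorm (A\<^sup>T *v w) = 0")
 case False
 let ?x = "A\<^sup>T *v w"
 have xc: "?x \<in> carrier_vec k" using A w by simp
 have "vnorm ?x * vnorm ?x = w \<bullet> (A *v ?x)"
  using transpose_vec_mult_scalar[OF A xc w] vnorm_power2[of ?x] by (simp add: power2_eq_square)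
 also have "\<dots> \<le> vnorm w * vnorm (A *v ?x)"
  using Cauchy_Schwarz_vnorm[OF w mult_mat_vec_carrier[OF A xc]] by linarith
 also have "\<dots> \<le> vnorm w * (spec_norm A * vnorm ?x)" by (rule mult_left_mono[OF vnorm_mult_le[OF A xc]]) simp
 finally have "vnorm ?x * vnorm ?x \<le> (spec_norm A * vnorm w) * vnorm ?x" by (simp add: algebra_simps)
 moreover have "0 < vnorm ?x" using False by (simp add: less_le)
 ultimately show ?thesis by simp
qed (simp add: spec_norm_nonneg)

lemma spec_norm_gram:
 assumes A: "(A :: real mat) \<in> carrier_mat m k"
 shows "(spec_norm A)\<^sup>2 \<le> spec_norm (A * A\<^sup>T)"
proof -
 let ?N = "A * A\<^sup>T"
 have Nc: "?N \<in> carrier_mat m m" using A by simp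
 have AT: "vnorm (A\<^sup>T *v w) \<le> sqrt (spec_norm ?N) * vnorm w" if w: "w \<in> carrier_vec m" for w
 proof (rule power2_le_imp_le)
  have "(vnorm (A\<^sup>T *v w))\<^sup>2 = w \<bullet> (?N *v w)"
   unfolding vnorm_power2 using transpose_vec_mult_scalar[OF A _ w, of "A\<^sup>T *v w"] A w by (simp add: mat_dims)
  also have "\<dots> \<le> spec_norm ?N * (w \<bullet> w)"
   using quadratic_form_le_spec_norm[OF Nc w] by (simp add: abs_le_iff)
  finally show "(vnorm (A\<^sup>T *v w))\<^sup>2 \<le> (sqrt (spec_norm ?N) * vnorm w)\<^sup>2"
   by (simp add: power_mult_distrib spec_norm_nonneg vnorm_power2)
 qed (simp add: spec_norm_nonneg)
 have "spec_norm A \<le> sqrt (spec_norm ?N)"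
 proof (rule spec_norm_le[OF A])
  fix x :: "real vec" assume x: "x \<in> carrier_vec k"
  have Ax: "A *v x \<in> carrier_vec m" by (rule mult_mat_vec_carrier[OF A x])
  have ATT: "A\<^sup>T \<in> carrier_mat k m" using A by simp
  have "vnorm (A *v x) * vnorm (A *v x) = (A\<^sup>T *v (A *v x)) \<bullet> x"
   using transpose_vec_mult_scalar[OF A x Ax] vnorm_power2[of "A *v x"] by (simp add: power2_eq_square)
  also have "\<dots> \<le> vnorm (A\<^sup>T *v (A *v x)) * vnorm x"
   using Cauchy_Schwarz_vnorm[OF mult_mat_vec_carrier[OF ATT Ax] x] by linarith
  also have "\<dots> \<le> sqrt (spec_norm ?N) * vnorm (A *v x) * vnorm x" by (rule mult_right_mono[OF AT[OF Ax]]) simp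
  finally have le: "vnorm (A *v x) * vnorm (A *v x) \<le> (sqrt (spec_norm ?N) * vnorm x) * vnorm (A *v x)"
   by (simp add: algebra_simps)
  show "vnorm (A *v x) \<le> sqrt (spec_norm ?N) * vnorm x"
  proof (cases "vnorm (A *v x) = 0")
   case False
   then have "0 < vnorm (A *v x)" by (simp add: less_le)
   then show ?thesis using le by simp
  qed (simp add: spec_norm_nonneg)
 qed (simp add: spec_norm_nonneg)
 then have "(spec_norm A)\<^sup>2 \<le> (sqrt (spec_norm ?N))\<^sup>2" by (rule power_mono) (rule spec_norm_nonneg)
 then show ?thesis by (simp add: spec_norm_nonneg)
qed

lemma cond_ge_1:
 assumes N: "N \<in> pd_mats m" and m: "0 < m"
 shows "1 \<le> cond N"
proof -
 have Nc: "N \<in> carrier_mat m m" using N by (simp add: pd_mats_def sym_mats_def)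
 note i = pd_minv[OF N]
 obtain x :: "real vec" where x: "x \<in> carrier_vec m" "x \<bullet> x = 1" using nonzero_vec_exists[OF m] by blast
 have Bx: "minv N *v x \<in> carrier_vec m" by (rule mult_mat_vec_carrier[OF i(1) x(1)])
 have vx: "vnorm x = 1" using x by (simp add: vnorm_def)
 have "1 = vnorm (N *v (minv N *v x))" using inverse_cancel_vec[OF Nc i(1) i(2) x(1)] vx by simp
 also have "\<dots> \<le> spec_norm N * vnorm (minv N *v x)" by (rule vnorm_mult_le[OF Nc Bx])
 also have "\<dots> \<le> spec_norm N * (spec_norm (minv N) * vnorm x)"
  by (rule mult_left_mono[OF vnorm_mult_le[OF i(1) x(1)] spec_norm_nonneg])
 finally show ?thesis by (simp add: cond_def vx)
qed

section \<open>Iteration count\<close>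

context augmented
begin

lemma ev_lower:
 assumes "\<And>x. x \<in> carrier_vec n ==> c * (x \<bullet> x) \<le> x \<bullet> (W *v x)" and i: "i < n"
 shows "c \<le> ev i"
proof -
 obtain x where x: "x \<in> carrier_vec n" "x \<bullet> x = 1" "x \<bullet> (spectral V ev *v x) = ev i"
  using spectral_eigenvalue_bound[OF V i] by blast
 then show ?thesis using assms(1)[OF x(1)] unfolding W_spectral[symmetric] by simp
qed

lemma EE_norm:
 assumes x: "x \<in> carrier_vec (tri n)"
 shows "vnorm (EE *v x) \<le> 4 * vnorm x"
proof (rule power2_le_imp_le)
 have s: "had ee (dn x) \<in> sym_mats n" by (rule had_sym[OF dn_sym]) (simp add: ee_def mult.commute)
 note dc = sym_matsD(1)[OF dn_sym[of x]]
 have ec: "0 \<le> ec i \<and> ec i \<le> 2" if "i < n" for i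
  using ev_pos[OF that] ev_bot[of i] that tau_pos by (auto simp: ec_def field_simps)
 have "(vnorm (EE *v x))\<^sup>2 = ip (had ee (dn x)) (had ee (dn x))"
  unfolding vnorm_power2 EE_mult[OF x] by (rule up_scalar_prod[OF s s])
 also have "\<dots> = ip (dn x) (had (\<lambda>i j. (ee i j)\<^sup>2) (dn x))"
  unfolding ip_eq[OF sym_matsD(1)[OF s] sym_matsD(1)[OF s]] ip_had[OF dc dc]
  using dc by (intro sum.cong refl) (simp add: power2_eq_square algebra_simps)
 also have "\<dots> \<le> 16 * ip (dn x) (dn x)"
 proof (rule ip_had_bounds(2)[OF dc])
  fix i j assume ij: "i < n" "j < n"
  have "ee i j \<le> 2 * 2" "0 \<le> ee i j"
   unfolding ee_def using ec[OF ij(1)] ec[OF ij(2)] mult_mono[of "ec i" 2 "ec j" 2] by auto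
  then have "(ee i j)\<^sup>2 \<le> 4\<^sup>2" by (intro power_mono) auto
  then show "(ee i j)\<^sup>2 \<le> 16" by simp
 qed
 also have "\<dots> = (4 * vnorm x)\<^sup>2" by (simp add: dn_norm[OF x] power_mult_distrib vnorm_power2)
 finally show "(vnorm (EE *v x))\<^sup>2 \<le> (4 * vnorm x)\<^sup>2" .
qed simp

lemma QQT_norm:
 assumes x: "x \<in> carrier_vec (tri n)"
 shows "vnorm (QQ\<^sup>T *v x) \<le> vnorm x"
proof (rule power2_le_imp_le)
 note dc = sym_matsD(1)[OF dn_sym[of x]]
 have "(vnorm (QQ\<^sup>T *v x))\<^sup>2 = ip (dn x) (had msk (dn x))"
  unfolding vnorm_power2 QQT_mult[OF x] by (rule pack_scalar_prod[OF dn_sym dn_sym])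
 also have "\<dots> \<le> 1 * ip (dn x) (dn x)" by (rule ip_had_bounds(2)[OF dc]) (simp add: msk_def)
 finally show "(vnorm (QQ\<^sup>T *v x))\<^sup>2 \<le> (vnorm x)\<^sup>2" by (simp add: dn_norm[OF x] vnorm_power2)
qed simp

lemma aug_rhs_carrier:
 assumes "b \<in> carrier_vec m" "C \<in> sym_mats n"
 shows "aug_rhs A b C W r Q Qp \<in> carrier_vec (m + d)"
proof -
 have cc: "vecS C \<in> carrier_vec (tri n)" using vecS_carrier[of C] sym_matsD[OF assms(2)] by simp
 have "A * EE *v vecS C \<in> carrier_vec m" "QQ\<^sup>T *v vecS C \<in> carrier_vec d"
  by (rule mult_mat_vec_carrier[OF mult_carrier_mat[OF A EE_carrier] cc],
    rule mult_mat_vec_carrier[OF _ cc]) (use bigQ_carrier in simp)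
 then show ?thesis unfolding aug_rhs_def using assms(1) by simp
qed

lemma vnorm_append_le: "vnorm (x @\<^sub>v y) \<le> vnorm x + vnorm y"
 by (rule power2_le_imp_le) (simp_all add: vnorm_append power2_sum)

lemma aug_rhs_norm:
 assumes b: "b \<in> carrier_vec m" and C: "C \<in> sym_mats n"
  and B: "1 \<le> B" "spec_norm A \<le> B" "vnorm b \<le> B" "vnorm (vecS C) \<le> B"
 shows "vnorm (aug_rhs A b C W r Q Qp) \<le> B + 5 * B\<^sup>2 * t\<^sup>2"
proof -
 have cc: "vecS C \<in> carrier_vec (tri n)" using vecS_carrier[of C] sym_matsD[OF C] by simp
 have ec: "EE *v vecS C \<in> carrier_vec (tri n)" by (rule mult_mat_vec_carrier[OF EE_carrier cc])
 have ac: "A *v (EE *v vecS C) \<in> carrier_vec m" by (rule mult_mat_vec_carrier[OF A ec])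
 have "vnorm (A *v (EE *v vecS C)) \<le> spec_norm A * vnorm (EE *v vecS C)" by (rule vnorm_mult_le[OF A ec])
 also have "\<dots> \<le> B * (4 * B)"
  using EE_norm[OF cc] B by (intro mult_mono) auto
 finally have n1: "vnorm (A *v (EE *v vecS C)) \<le> 4 * B\<^sup>2" by (simp add: power2_eq_square)
 have n2: "vnorm (QQ\<^sup>T *v vecS C) \<le> B\<^sup>2"
 proof -
  have "B \<le> B\<^sup>2" using mult_left_mono[of 1 B B] B(1) by (simp add: power2_eq_square)
  then show ?thesis using QQT_norm[OF cc] B(4) by linarith
 qed
 have eq: "aug_rhs A b C W r Q Qp = (b + t\<^sup>2 *s (A *v (EE *v vecS C))) @\<^sub>v (t\<^sup>2 *s (QQ\<^sup>T *v vecS C))"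
  unfolding aug_rhs_def assoc_mult_mat_vec[OF A EE_carrier cc] ..
 have "vnorm (aug_rhs A b C W r Q Qp) \<le>
   (vnorm b + t\<^sup>2 * vnorm (A *v (EE *v vecS C))) + t\<^sup>2 * vnorm (QQ\<^sup>T *v vecS C)"
  unfolding eq using vnorm_append_le[of "b + t\<^sup>2 *s (A *v (EE *v vecS C))" "t\<^sup>2 *s (QQ\<^sup>T *v vecS C)"]
   vnorm_triangle[of b m "t\<^sup>2 *s (A *v (EE *v vecS C))"] b ac by (simp add: vnorm_smult)
 also have "\<dots> \<le> (B + t\<^sup>2 * (4 * B\<^sup>2)) + t\<^sup>2 * B\<^sup>2"
  using n1 n2 B by (intro add_mono mult_left_mono) auto
 finally show ?thesis by (simp add: algebra_simps)
qed

text \<open>All spectral quantities of the quasi-definite matrix enter through \<open>l / \<tau>\<close> and \<open>\<tau> / w\<close>, where \<open>w\<close> bounds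
 \<open>W\<close> from below and \<open>l\<close> bounds it on the kernel of \<open>X\<^sup>*\<close>. As \<open>w \<le> 2 \<tau> \<le> l \<le> R w\<close>, both are at most
 multiples of \<open>R\<close>, in which \<open>\<mu>\<close> has cancelled.\<close>

lemma eigenvalue_window:
 assumes Xs: "Xs \<in> psd_mats n" and ti: "tangent_injective n A \<chi>2 Xs Us" and rk: "mrank Xs \<le> r"
  and ker: "\<And>x. x \<in> carrier_vec n ==> Xs *v x = 0\<^sub>v n ==> x \<bullet> (W *v x) \<le> l * (x \<bullet> x)"
  and low: "\<And>x. x \<in> carrier_vec n ==> w * (x \<bullet> x) \<le> x \<bullet> (W *v x)"
  and w: "0 < w" and l: "0 \<le> l" "l \<le> R * w"
  and a: "0 < a" "a \<le> 1" "\<And>w. w \<in> carrier_vec m ==> a * (w \<bullet> w) \<le> (A\<^sup>T *v w) \<bullet> (A\<^sup>T *v w)"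
  and B: "0 \<le> B" "\<And>w. w \<in> carrier_vec m ==> vnorm (A\<^sup>T *v w) \<le> B * vnorm w"
 shows "\<And>z \<theta>. z \<in> carrier_vec (m + d) ==> z \<noteq> 0\<^sub>v (m + d) ==> M *v z = \<theta> *s z ==>
   a / (36 * \<chi>2\<^sup>2 * R\<^sup>2) \<le> \<bar>\<theta>\<bar> \<and> \<bar>\<theta>\<bar> \<le> 4 * B\<^sup>2 + B + R / 2"
  and "w \<le> 2 * t" "2 * t \<le> l" "1 \<le> R"
proof -
 have Us: "Us \<in> carrier_mat n (mrank Xs)" and XsU: "Xs = Us * Us\<^sup>T" and chi: "1 \<le> \<chi>2"
  using ti by (auto simp: tangent_injective_def)
 show lt: "2 * t \<le> l" by (rule threshold_le_kernel_bound[OF Us rk XsU ker])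
 have we: "w \<le> ev i" if "i < n" for i by (rule ev_lower[OF low that])
 show wt: "w \<le> 2 * t" using we[OF rn] by (simp add: tau_ev)
 have "w \<le> R * w" using wt lt l by linarith
 then show R1: "1 \<le> R" using w by simp
 let ?s = "1 / (9 * \<chi>2\<^sup>2 * (l / t)\<^sup>2)"
 have lp: "0 < l" using lt tau_pos by linarith
 have ltR: "l / t \<le> 2 * R"
 proof -
  have "l \<le> R * (2 * t)" using l(2) wt R1 mult_left_mono[OF wt, of R] by linarith
  then show ?thesis using tau_pos by (simp add: field_simps)
 qed
 have ltp: "0 < l / t" using lp tau_pos by simp
 have s0: "0 < ?s"
  using mult_pos_pos[OF zero_less_power[of \<chi>2 2] zero_less_power[of "l / t" 2]] chi ltp by simp
 have s: "?s * (v \<bullet> v) \<le> dform v + piq (QQ *v v) / 5" if "v \<in> carrier_vec d" for v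
  by (rule coupling[OF Xs ti rk l(1) ker that])
 have sR: "1 / (36 * \<chi>2\<^sup>2 * R\<^sup>2) \<le> ?s"
 proof (rule divide_left_mono)
  have "(l / t)\<^sup>2 \<le> (2 * R)\<^sup>2" by (rule power_mono[OF ltR]) (use ltp in simp)
  then have "9 * \<chi>2\<^sup>2 * (l / t)\<^sup>2 \<le> 9 * \<chi>2\<^sup>2 * (2 * R)\<^sup>2" by (intro mult_left_mono) auto
  then show "9 * \<chi>2\<^sup>2 * (l / t)\<^sup>2 \<le> 36 * \<chi>2\<^sup>2 * R\<^sup>2" by (simp add: power_mult_distrib)
  show "0 < 36 * \<chi>2\<^sup>2 * R\<^sup>2 * (9 * \<chi>2\<^sup>2 * (l / t)\<^sup>2)" using chi R1 ltp lp tau_pos by simp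
 qed simp
 let ?c = "a / (36 * \<chi>2\<^sup>2 * R\<^sup>2)"
 have chi2: "1 \<le> \<chi>2\<^sup>2" "1 \<le> R\<^sup>2" using chi R1 by (simp_all add: one_le_power)
 have d1: "1 \<le> 36 * \<chi>2\<^sup>2 * R\<^sup>2" using mult_mono[of 1 "\<chi>2\<^sup>2" 1 "R\<^sup>2"] chi2 by simp
 have c1: "?c \<le> a" 
 proof (subst pos_divide_le_eq)
  show "0 < 36 * \<chi>2\<^sup>2 * R\<^sup>2" using d1 by linarith
  show "a \<le> a * (36 * \<chi>2\<^sup>2 * R\<^sup>2)" using mult_left_mono[OF d1, of a] a(1) by simp
 qed
 have c3: "?c \<le> ?s"
 proof -
  have "?c \<le> 1 / (36 * \<chi>2\<^sup>2 * R\<^sup>2)" using a d1 by (intro divide_right_mono) auto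
  then show ?thesis using sR by linarith
 qed
 have c2: "?c \<le> a * (w / (2 * t))\<^sup>2"
 proof -
  have "2 * t \<le> R * w" using lt l by linarith
  then have "1 / R \<le> w / (2 * t)" using R1 tau_pos by (simp add: field_simps)
  then have "(1 / R)\<^sup>2 \<le> (w / (2 * t))\<^sup>2" by (rule power_mono) (use R1 in simp)
  moreover have "1 / (36 * \<chi>2\<^sup>2 * R\<^sup>2) \<le> 1 / R\<^sup>2"
  proof (rule divide_left_mono)
   show "R\<^sup>2 \<le> 36 * \<chi>2\<^sup>2 * R\<^sup>2" using mult_right_mono[of 1 "36 * \<chi>2\<^sup>2" "R\<^sup>2"] chi2 by simp
   show "0 < 36 * \<chi>2\<^sup>2 * R\<^sup>2 * R\<^sup>2" by (intro mult_pos_pos) (use chi2 in linarith)+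
  qed simp
  ultimately have "1 / (36 * \<chi>2\<^sup>2 * R\<^sup>2) \<le> (w / (2 * t))\<^sup>2" by (simp add: power_divide)
  then have "a * (1 / (36 * \<chi>2\<^sup>2 * R\<^sup>2)) \<le> a * (w / (2 * t))\<^sup>2" by (rule mult_left_mono) (use a in simp)
  then show ?thesis by simp
 qed
 have tw: "t / w \<le> R / 2" using lt l w by (simp add: field_simps)
 show "?c \<le> \<bar>\<theta>\<bar> \<and> \<bar>\<theta>\<bar> \<le> 4 * B\<^sup>2 + B + R / 2"
  if z: "z \<in> carrier_vec (m + d)" "z \<noteq> 0\<^sub>v (m + d)" "M *v z = \<theta> *s z" for z \<theta>
 proof -
  note eb = eigenvalue_bounds[OF z a(1,3) B w we s0 s c1 c2 c3]
  show ?thesis using eb(1) eb(2) tw by linarith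
 qed
qed

end

text \<open>Numerical consequences of centering: the scaling point has its \<open>n\<close>-th eigenvalue above \<open>w\<close>,
 is below \<open>l\<close> on the kernel of \<open>X\<^sup>*\<close>, and \<open>l / w\<close> does not depend on \<open>\<mu>\<close>.\<close>

lemma centering_scalars:
 fixes \<mu> L \<delta> :: real
 assumes "0 < \<mu>" "0 \<le> L" "0 \<le> \<delta>" "\<delta> < 1"
 defines "w \<equiv> (1 - \<delta>) * \<mu> / ((1 + L) * sqrt (2 * \<mu>))" and "l \<equiv> L * \<mu> / sqrt ((1 - \<delta>) * \<mu>)"
  and "R \<equiv> 3 * (max 1 L)\<^sup>2 / (1 - \<delta>)\<^sup>2"
 shows "0 < w" "0 \<le> l" "l \<le> R * w" "l\<^sup>2 = L\<^sup>2 * \<mu> / (1 - \<delta>)" "1 / w\<^sup>2 = 2 * (1 + L)\<^sup>2 / ((1 - \<delta>)\<^sup>2 * \<mu>)"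
proof -
 define e sm se where "e = 1 - \<delta>" and "sm = sqrt \<mu>" and "se = sqrt e"
 have e: "0 < e" "e \<le> 1" using assms by (auto simp: e_def)
 have s: "0 < sm" "0 < se" "\<mu> = sm * sm" "e = se * se" using assms e by (auto simp: sm_def se_def)
 have ee: "se \<le> 1" using e by (simp add: se_def)
 have we: "w = e * sm / ((1 + L) * sqrt 2)"
 proof -
  have "w = e * \<mu> / ((1 + L) * (sqrt 2 * sm))"
   unfolding w_def e_def[symmetric] real_sqrt_mult sm_def[symmetric] ..
  also have "\<dots> = (e * sm) * sm / (((1 + L) * sqrt 2) * sm)" unfolding s(3) by (simp only: mult.assoc)
  also have "\<dots> = e * sm / ((1 + L) * sqrt 2)"
   by (rule nonzero_mult_divide_mult_cancel_right) (use s in simp)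
  finally show ?thesis .
 qed
 have le: "l = L * sm / se"
  unfolding l_def e_def[symmetric] real_sqrt_mult sm_def[symmetric] se_def[symmetric]
  using s(1,2) s(3) by (simp add: field_simps)
 show "0 < w" unfolding we using e s assms by simp
 show "0 \<le> l" unfolding le using s assms by simp
 show "l\<^sup>2 = L\<^sup>2 * \<mu> / (1 - \<delta>)"
  unfolding le e_def[symmetric] using s by (simp add: power_mult_distrib power_divide power2_eq_square)
 show "1 / w\<^sup>2 = 2 * (1 + L)\<^sup>2 / ((1 - \<delta>)\<^sup>2 * \<mu>)"
  unfolding we e_def[symmetric] using s e assms by (simp add: power_mult_distrib power_divide power2_eq_square field_simps)
 show "l \<le> R * w"
 proof -
  define Lh where "Lh = max 1 L"
  have Lh: "1 \<le> Lh" "L \<le> Lh" by (simp_all add: Lh_def)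
  have "L * (1 + L) \<le> Lh * (2 * Lh)" using Lh assms(2) by (intro mult_mono) auto
  then have "L * (1 + L) * (sqrt 2 * se) \<le> Lh * (2 * Lh) * (sqrt 2 * se)" using s by (intro mult_right_mono) auto
  also have "\<dots> \<le> Lh * (2 * Lh) * (3 / 2 * 1)"
  proof (rule mult_left_mono)
   have "sqrt 2 \<le> 3 / 2" by (rule real_le_lsqrt) (auto simp: power2_eq_square)
   then show "sqrt 2 * se \<le> 3 / 2 * 1" using ee s by (intro mult_mono) auto
  qed (use Lh in simp)
  finally have k: "L * (1 + L) * (sqrt 2 * se) \<le> 3 * Lh\<^sup>2" by (simp add: power2_eq_square)
  have "R * w = (3 * Lh\<^sup>2) * (sm / (e * ((1 + L) * sqrt 2)))"
   unfolding R_def we e_def[symmetric] Lh_def[symmetric] using e by (simp add: power2_eq_square)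
  moreover have "l = (L * (1 + L) * (sqrt 2 * se)) * (sm / (e * ((1 + L) * sqrt 2)))"
  proof -
   define k where "k = (1 + L) * sqrt 2"
   have k: "k \<noteq> 0" using assms by (simp add: k_def)
   have "(L * (1 + L) * (sqrt 2 * se)) * (sm / (e * k)) = (L * se * sm) * k / (e * k)"
   proof -
    have "L * (1 + L) * (sqrt 2 * se) * sm = (L * se * sm) * k" by (simp add: k_def algebra_simps)
    then show ?thesis by (simp only: times_divide_eq_right)
   qed
   also have "\<dots> = (L * se * sm) / e" using k by simp
   also have "\<dots> = L * sm / se" unfolding s(4) using s(2) by simp
   finally show ?thesis by (simp only: le k_def)
  qed
  moreover have "0 \<le> sm / (e * ((1 + L) * sqrt 2))" using s e assms by simp
  moreover define q where "q = sm / (e * ((1 + L) * sqrt 2))"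
  ultimately show ?thesis unfolding q_def[symmetric] using mult_right_mono[OF k, of q] by simp
 qed
qed

lemma setup_augmented:
 assumes "newton_setup n m r A b C \<mu> L \<delta> \<chi>1 \<chi>2 X S Xs Ss Us W Q Qp"
 shows "augmented n r W Q Qp m A"
proof -
 have c: "centering n \<mu> L \<delta> \<chi>1 X S Xs Ss" and W: "W = nt_scaling X S"
  using assms by (auto simp: newton_setup_def)
 have "W \<in> pd_mats n" by (rule scaling_point_bounds(1)[OF c W])
 then show ?thesis using assms by unfold_locales (auto simp: newton_setup_def)
qed

lemma setup_eigenvalues:
 assumes set: "newton_setup n m r A b C \<mu> L \<delta> \<chi>1 \<chi>2 X S Xs Ss Us W Q Qp"
  and a: "0 < a" "a \<le> 1" "\<And>w. w \<in> carrier_vec m ==> a * (w \<bullet> w) \<le> (A\<^sup>T *v w) \<bullet> (A\<^sup>T *v w)"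
  and B: "0 \<le> B" "\<And>w. w \<in> carrier_vec m ==> vnorm (A\<^sup>T *v w) \<le> B * vnorm w"
 defines "R \<equiv> 3 * (max 1 L)\<^sup>2 / (1 - \<delta>)\<^sup>2"
 shows "\<And>z \<theta>. z \<in> carrier_vec (m + eigenbasis.d n r) ==> z \<noteq> 0\<^sub>v (m + eigenbasis.d n r) ==>
   aug_mat A W r Q Qp *v z = \<theta> *s z ==>
   a / (36 * \<chi>2\<^sup>2 * R\<^sup>2) \<le> \<bar>\<theta>\<bar> \<and> \<bar>\<theta>\<bar> \<le> 4 * B\<^sup>2 + B + R / 2"
  and "(tau W r)\<^sup>2 \<le> L\<^sup>2 * \<mu> / (4 * (1 - \<delta>))" "1 / (tau W r)\<^sup>2 \<le> 8 * (1 + L)\<^sup>2 / ((1 - \<delta>)\<^sup>2 * \<mu>)"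
  "1 \<le> R" "0 < a / (36 * \<chi>2\<^sup>2 * R\<^sup>2)"
proof -
 interpret augmented n r W Q Qp m A by (rule setup_augmented[OF set])
 have c: "centering n \<mu> L \<delta> \<chi>1 X S Xs Ss" and W: "W = nt_scaling X S" and ti: "tangent_injective n A \<chi>2 Xs Us"
  and rk: "mrank Xs \<le> r"
  using set by (auto simp: newton_setup_def)
 have Xs: "Xs \<in> psd_mats n" and p: "0 < \<mu>" "0 \<le> L" "0 \<le> \<delta>" "\<delta> < 1"
  using c by (auto simp: centering_def)
 note sp = scaling_point_bounds[OF c W]
 note sc = centering_scalars[OF p]
 define w l where "w = (1 - \<delta>) * \<mu> / ((1 + L) * sqrt (2 * \<mu>))" and "l = L * \<mu> / sqrt ((1 - \<delta>) * \<mu>)"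
 note sc' = sc[folded w_def l_def R_def]
 note ew = eigenvalue_window[OF Xs ti rk sp(3)[folded l_def] sp(2)[folded w_def] sc'(1,2,3) a B]
 show "\<And>z \<theta>. z \<in> carrier_vec (m + d) ==> z \<noteq> 0\<^sub>v (m + d) ==> M *v z = \<theta> *s z ==>
   a / (36 * \<chi>2\<^sup>2 * R\<^sup>2) \<le> \<bar>\<theta>\<bar> \<and> \<bar>\<theta>\<bar> \<le> 4 * B\<^sup>2 + B + R / 2" by (rule ew(1))
 show "1 \<le> R" by (rule ew(4))
 have chi: "1 \<le> \<chi>2" using ti by (simp add: tangent_injective_def)
 show "0 < a / (36 * \<chi>2\<^sup>2 * R\<^sup>2)" using a chi ew(4) by simp
 have tl: "t \<le> l / 2" and wt: "w / 2 \<le> t" using ew(2,3) by simp_all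
 have "t\<^sup>2 \<le> (l / 2)\<^sup>2" by (rule power_mono[OF tl]) (use tau_pos in simp)
 also have "(l / 2)\<^sup>2 = L\<^sup>2 * \<mu> / (4 * (1 - \<delta>))"
  unfolding power_divide sc'(4) divide_divide_eq_left by (simp only: power2_eq_square mult.commute)
 finally show "t\<^sup>2 \<le> L\<^sup>2 * \<mu> / (4 * (1 - \<delta>))" .
 have "(w / 2)\<^sup>2 \<le> t\<^sup>2" by (rule power_mono[OF wt]) (use sc'(1) in simp)
 then have "1 / t\<^sup>2 \<le> 1 / (w / 2)\<^sup>2" using sc'(1) tau_pos by (intro divide_left_mono) auto
 also have "\<dots> = 4 * (1 / w\<^sup>2)" by (simp add: power_divide)
 finally show "1 / t\<^sup>2 \<le> 8 * (1 + L)\<^sup>2 / ((1 - \<delta>)\<^sup>2 * \<mu>)" using sc'(5) by simp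
qed

lemma setup_gram:
 assumes "newton_setup n m r A b C \<mu> L \<delta> \<chi>1 \<chi>2 X S Xs Ss Us W Q Qp"
 shows "A * A\<^sup>T \<in> pd_mats m"
  and "w \<in> carrier_vec m ==> w \<bullet> w \<le> spec_norm (minv (A * A\<^sup>T)) * ((A\<^sup>T *v w) \<bullet> (A\<^sup>T *v w))"
proof -
 have A: "A \<in> carrier_mat m (tri n)" and li: "lin_indpt_rows A" using assms by (auto simp: newton_setup_def)
 show pd: "A * A\<^sup>T \<in> pd_mats m" by (rule gram_pd(1)[OF A lin_indpt_rows_inj(1)[OF A li]])
 show "w \<in> carrier_vec m ==> w \<bullet> w \<le> spec_norm (minv (A * A\<^sup>T)) * ((A\<^sup>T *v w) \<bullet> (A\<^sup>T *v w))"
  by (rule gram_lower[OF A pd])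
qed

text \<open>Injectivity is needed without any normalisation of \<open>A\<close>; every positive lower bound for \<open>A A\<^sup>T\<close> rules
 out the eigenvalue \<open>0\<close>, and \<open>1 / (s + 1)\<close> is one that is at most \<open>1\<close>.\<close>

lemma setup_regular_system:
 assumes set: "newton_setup n m r A b C \<mu> L \<delta> \<chi>1 \<chi>2 X S Xs Ss Us W Q Qp"
 shows "regular_system (m + eigenbasis.d n r) (aug_mat A W r Q Qp) (aug_rhs A b C W r Q Qp)"
proof -
 interpret augmented n r W Q Qp m A by (rule setup_augmented[OF set])
 define s where "s = spec_norm (minv (A * A\<^sup>T))"
 have s0: "0 \<le> s" by (simp add: s_def spec_norm_nonneg)
 define a where "a = 1 / (s + 1)"
 have a: "0 < a" "a \<le> 1" using s0 by (simp_all add: a_def)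
 have as: "a * s \<le> 1" using s0 by (simp add: a_def)
 have al: "a * (w \<bullet> w) \<le> (A\<^sup>T *v w) \<bullet> (A\<^sup>T *v w)" if w: "w \<in> carrier_vec m" for w
 proof -
  have "a * (w \<bullet> w) \<le> a * (s * ((A\<^sup>T *v w) \<bullet> (A\<^sup>T *v w)))"
   using setup_gram(2)[OF set w] a by (intro mult_left_mono) (auto simp: s_def)
  also have "\<dots> = (a * s) * ((A\<^sup>T *v w) \<bullet> (A\<^sup>T *v w))" by simp
  also have "\<dots> \<le> 1 * ((A\<^sup>T *v w) \<bullet> (A\<^sup>T *v w))"
   by (rule mult_right_mono[OF as scalar_prod_self_nonneg])
  finally show ?thesis by simp
 qed
 note e = setup_eigenvalues[OF set a al spec_norm_nonneg vnorm_transpose_mult[OF A]]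
 have b: "b \<in> carrier_vec m" and C: "C \<in> sym_mats n" using set by (auto simp: newton_setup_def)
 show ?thesis
 proof
  show "M \<in> sym_mats (m + d)" by (rule M_sym)
  show "aug_rhs A b C W r Q Qp \<in> carrier_vec (m + d)" by (rule aug_rhs_carrier[OF b C])
  fix x :: "real vec" assume x: "x \<in> carrier_vec (m + d)" "M *v x = 0\<^sub>v (m + d)"
  have z0: "0 *s x = 0\<^sub>v (m + d)" by (rule eq_vecI) (use x in auto)
  show "x = 0\<^sub>v (m + d)"
  proof (rule ccontr)
   assume "x \<noteq> 0\<^sub>v (m + d)"
   from e(1)[OF _ _ x(1) this, of 0] e(5) show False using x(2) z0 by fastforce
  qed
 qed
qed

text \<open>The real-number bookkeeping: \<open>\<kappa>\<close> dominates the ratio of the eigenvalue bounds, and \<open>j\<close> counts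
 pairs of iterations.\<close>

lemma iteration_count:
 fixes \<beta> \<mu> \<epsilon> e h q :: real
 assumes p: "1 \<le> \<beta>" "0 < \<mu>" "0 < \<epsilon>" "0 < e" "e \<le> 1" "1 \<le> h" "1 \<le> \<kappa>"
 defines "c \<equiv> ln (192 * \<beta>\<^sup>2) + 1" and "\<Lambda> \<equiv> max 1 (ln (h ^ 4 / (\<mu> * \<epsilon> * e ^ 4)))"
 obtains j :: nat where "real (2 * j) \<le> 4 * \<kappa> * c * \<Lambda>"
  and "192 * \<beta>\<^sup>2 * h ^ 4 / (e ^ 3 * \<mu>) * exp (- real j / \<kappa>) \<le> \<epsilon>"
proof -
 define Y where "Y = h ^ 4 / (\<mu> * \<epsilon> * e ^ 4)"
 have Y: "0 < Y" using p by (simp add: Y_def)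
 have b1: "1 \<le> \<beta>\<^sup>2" using p by (simp add: one_le_power)
 have c: "1 \<le> c" using b1 by (simp add: c_def)
 have La: "1 \<le> \<Lambda>" "ln Y \<le> \<Lambda>" by (simp_all add: \<Lambda>_def Y_def)
 have k1: "1 \<le> \<kappa> * (c * \<Lambda>)" using mult_mono[OF p(7) mult_mono[OF c La(1)]] c La p(7) by simp
 define j where "j = nat \<lceil>\<kappa> * (c * \<Lambda>)\<rceil>"
 have j: "\<kappa> * (c * \<Lambda>) \<le> real j" "real j \<le> \<kappa> * (c * \<Lambda>) + 1"
  using k1 by (simp_all add: j_def real_nat_ceiling_ge)
 have "ln (192 * \<beta>\<^sup>2) + ln Y \<le> c * \<Lambda>"
 proof -
  have "0 \<le> ln (192 * \<beta>\<^sup>2)" using b1 by simp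
  then have "ln (192 * \<beta>\<^sup>2) \<le> ln (192 * \<beta>\<^sup>2) * \<Lambda>" using La mult_left_mono[of 1 \<Lambda>] by fastforce
  then show ?thesis using La by (simp add: c_def distrib_right)
 qed
 also have "\<dots> \<le> real j / \<kappa>" using j(1) p by (simp add: field_simps)
 finally have "exp (- real j / \<kappa>) \<le> exp (- (ln (192 * \<beta>\<^sup>2) + ln Y))" by simp
 also have "\<dots> = 1 / (192 * \<beta>\<^sup>2 * Y)"
 proof -
  have "0 < 192 * \<beta>\<^sup>2" using b1 by linarith
  then show ?thesis using Y by (simp only: exp_minus exp_add exp_ln inverse_eq_divide)
 qed
 finally have "192 * \<beta>\<^sup>2 * Y * exp (- real j / \<kappa>) \<le> 192 * \<beta>\<^sup>2 * Y * (1 / (192 * \<beta>\<^sup>2 * Y))"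
  by (rule mult_left_mono) (use Y in simp)
 then have le: "192 * \<beta>\<^sup>2 * Y * exp (- real j / \<kappa>) \<le> 1" using Y p(1) by simp
 have "h ^ 4 / (e ^ 3 * \<mu>) \<le> Y * \<epsilon>"
 proof -
  have "e ^ 4 \<le> e ^ 3" using power_decreasing[of 3 4 e] p by simp
  then have "h ^ 4 / (e ^ 3 * \<mu>) \<le> h ^ 4 / (e ^ 4 * \<mu>)" using p by (intro divide_left_mono mult_right_mono) auto
  also have "\<dots> = Y * \<epsilon>" using p by (simp add: Y_def field_simps)
  finally show ?thesis .
 qed
 then have "192 * \<beta>\<^sup>2 * exp (- real j / \<kappa>) * (h ^ 4 / (e ^ 3 * \<mu>)) \<le> 192 * \<beta>\<^sup>2 * exp (- real j / \<kappa>) * (Y * \<epsilon>)"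
  by (rule mult_left_mono) simp
 also have "\<dots> = (192 * \<beta>\<^sup>2 * Y * exp (- real j / \<kappa>)) * \<epsilon>" by simp
 also have "\<dots> \<le> 1 * \<epsilon>" by (rule mult_right_mono[OF le]) (use p in simp)
 finally have "192 * \<beta>\<^sup>2 * h ^ 4 / (e ^ 3 * \<mu>) * exp (- real j / \<kappa>) \<le> \<epsilon>" by (simp add: mult.commute mult.left_commute)
 moreover have "real (2 * j) \<le> 4 * \<kappa> * c * \<Lambda>" using j(2) k1 by (simp add: mult_ac)
 ultimately show thesis by (rule that[rotated])
qed

text \<open>The ratio of the eigenvalue bounds is \<open>6 \<beta>\<^sup>2 R \<cdot> 36 \<chi>\<^sub>2\<^sup>2 R\<^sup>2 / a\<close> with \<open>1 / a = \<beta>\<^sup>2 cond (A A\<^sup>T)\<close> and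
 \<open>R = 3 h\<^sup>2 / (1 - \<delta>)\<^sup>2\<close>, which is \<open>\<kappa>\<close>. The factor in front of the exponential is the product of
 \<open>1 / \<tau>\<^sup>2\<close>, of the norm of the right-hand side and of the constant \<open>2\<close> of the Chebyshev bound.\<close>

lemma newton_step_bound:
 fixes \<beta> :: real
 assumes set: "newton_setup n m r A b C \<mu> L \<delta> \<chi>1 \<chi>2 X S Xs Ss Us W Q Qp" and mu: "\<mu> \<le> 1"
  and be: "1 \<le> \<beta>" "1 / \<beta> \<le> spec_norm A" "spec_norm A \<le> \<beta>" "vnorm b \<le> \<beta>" "vnorm (vecS C) \<le> \<beta>"
 defines "h \<equiv> max 1 L" and "q \<equiv> cond (A * A\<^sup>T)"
 defines "\<kappa> \<equiv> 5832 * \<beta> ^ 4 * q * \<chi>2\<^sup>2 * h ^ 6 / (1 - \<delta>) ^ 6"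
 shows "newton_residual A b C W (delta_X A b C W r Q Qp (2 * j)) (delta_y A b C W r Q Qp (2 * j))
   \<le> 192 * \<beta>\<^sup>2 * h ^ 4 / ((1 - \<delta>) ^ 3 * \<mu>) * exp (- real j / \<kappa>)"
  and "1 \<le> \<kappa>" and "1 \<le> q" and "1 \<le> \<chi>1" and "1 \<le> \<chi>2"
proof -
 interpret augmented n r W Q Qp m A by (rule setup_augmented[OF set])
 interpret rs: regular_system "m + d" M "aug_rhs A b C W r Q Qp" by (rule setup_regular_system[OF set])
 have b: "b \<in> carrier_vec m" and C: "C \<in> sym_mats n" and chi: "1 \<le> \<chi>2" and W: "W = nt_scaling X S"
  and cen: "centering n \<mu> L \<delta> \<chi>1 X S Xs Ss"
  using set by (auto simp: newton_setup_def tangent_injective_def)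
 show "1 \<le> \<chi>2" by (rule chi)
 show "1 \<le> \<chi>1" by (rule scaling_point_bounds(4)[OF cen W])
 define e where "e = 1 - \<delta>"
 have e: "0 < e" "e \<le> 1" and mu0: "0 < \<mu>" and L: "0 \<le> L" using cen by (auto simp: centering_def e_def)
 have h: "1 \<le> h" "L \<le> h" by (auto simp: h_def)
 have b2: "1 \<le> \<beta>\<^sup>2" "\<beta> \<le> \<beta>\<^sup>2" using be(1) one_le_power[OF be(1), of 2] mult_left_mono[of 1 \<beta> \<beta>] by (simp_all add: power2_eq_square)
 define N where "N = A * A\<^sup>T"
 define sB where "sB = spec_norm (minv N)"
 have sB0: "0 \<le> sB" by (simp add: sB_def spec_norm_nonneg)
 have sA: "0 < spec_norm A" using be(1,2) by (smt (verit) divide_pos_pos)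
 have m0: "0 < m"
 proof (rule ccontr)
  assume "\<not> 0 < m"
  have z: "vnorm (A *v x) \<le> 0 * vnorm x" for x
   using A \<open>\<not> 0 < m\<close> by (simp add: vnorm_def scalar_prod_def)
  have "spec_norm A \<le> 0" by (rule spec_norm_le[OF A _ z]) simp
  then show False using sA by simp
 qed
 have q1: "1 \<le> q" unfolding q_def by (rule cond_ge_1[OF setup_gram(1)[OF set] m0])
 show "1 \<le> q" by (rule q1)
 have q: "sB \<le> \<beta>\<^sup>2 * q"
 proof -
  have "(1 / \<beta>)\<^sup>2 \<le> (spec_norm A)\<^sup>2" by (rule power_mono[OF be(2)]) (use be in simp)
  also have "\<dots> \<le> spec_norm N" unfolding N_def by (rule spec_norm_gram[OF A])
  finally have "1 \<le> \<beta>\<^sup>2 * spec_norm N" using be(1) by (simp add: power_divide field_simps)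
  then have "1 * sB \<le> (\<beta>\<^sup>2 * spec_norm N) * sB" by (rule mult_right_mono[OF _ sB0])
  then show ?thesis by (simp add: q_def cond_def N_def sB_def mult.assoc)
 qed
 \<comment> \<open>\<open>A A\<^sup>T\<close> has norm at least \<open>1 / \<beta>\<^sup>2\<close>, so its smallest eigenvalue is at least \<open>a\<close>\<close>
 define a where "a = 1 / (\<beta>\<^sup>2 * q)"
 have bq: "1 \<le> \<beta>\<^sup>2 * q" using mult_mono[OF b2(1) q1] by simp
 have a: "0 < a" "a \<le> 1" using bq by (simp_all add: a_def)
 have as: "a * sB \<le> 1" unfolding a_def using q bq by (simp add: field_simps)
 have al: "a * (w \<bullet> w) \<le> (A\<^sup>T *v w) \<bullet> (A\<^sup>T *v w)" if w: "w \<in> carrier_vec m" for w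
 proof -
  have "a * (w \<bullet> w) \<le> a * (sB * ((A\<^sup>T *v w) \<bullet> (A\<^sup>T *v w)))"
   using setup_gram(2)[OF set w] a by (intro mult_left_mono) (auto simp: sB_def N_def)
  also have "\<dots> = (a * sB) * ((A\<^sup>T *v w) \<bullet> (A\<^sup>T *v w))" by simp
  also have "\<dots> \<le> 1 * ((A\<^sup>T *v w) \<bullet> (A\<^sup>T *v w))"
   by (rule mult_right_mono[OF as scalar_prod_self_nonneg])
  finally show ?thesis by simp
 qed
 have Bl: "vnorm (A\<^sup>T *v w) \<le> \<beta> * vnorm w" if w: "w \<in> carrier_vec m" for w
  using vnorm_transpose_mult[OF A w] mult_right_mono[OF be(3) vnorm_nonneg[of w]] by linarith
 define R where "R = 3 * h\<^sup>2 / e\<^sup>2"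
 have b0: "0 \<le> \<beta>" using be by simp
 note ev = setup_eigenvalues[OF set a al b0 Bl, folded h_def e_def, folded R_def]
 define \<sigma> where "\<sigma> = a / (36 * \<chi>2\<^sup>2 * R\<^sup>2)"
 \<comment> \<open>\<open>4 \<beta>\<^sup>2 + \<beta> + R / 2 \<le> \<nu>\<close>, since \<open>R \<ge> 3\<close>\<close>
 define \<nu> where "\<nu> = 6 * \<beta>\<^sup>2 * R"
 have h2: "1 \<le> h\<^sup>2" using h by (simp add: one_le_power)
 have R3: "3 \<le> R"
 proof -
  have "e\<^sup>2 \<le> 1" using e by (simp add: power_le_one)
  then have "3 * e\<^sup>2 \<le> 3 * h\<^sup>2" using h2 by simp
  then show ?thesis using e by (simp add: R_def field_simps)
 qed
 have nu: "4 * \<beta>\<^sup>2 + \<beta> + R / 2 \<le> \<nu>"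
 proof -
  have "3 * \<beta>\<^sup>2 \<le> R * \<beta>\<^sup>2" "R * 1 \<le> R * \<beta>\<^sup>2" using R3 b2 by (intro mult_right_mono mult_left_mono; simp)+
  then show ?thesis using b2 unfolding \<nu>_def by (simp add: mult.commute mult.left_commute)
 qed
 have s0: "0 < \<sigma>" unfolding \<sigma>_def by (rule ev(5)) 
 have s1: "\<sigma> \<le> 1"
 proof -
  have "1 \<le> \<chi>2\<^sup>2" "1 \<le> R\<^sup>2" using chi R3 by (simp_all add: one_le_power)
  then have "1 \<le> 36 * \<chi>2\<^sup>2 * R\<^sup>2" using mult_mono[of 1 "\<chi>2\<^sup>2" 1 "R\<^sup>2"] by simp
  then show ?thesis using a unfolding \<sigma>_def by (subst pos_divide_le_eq) linarith+
 qed
 have sn: "\<sigma> < \<nu>" using nu b0 b2 R3 s1 by linarith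
 have ka: "\<nu> / \<sigma> = \<kappa>"
 proof -
  have "\<nu> / \<sigma> = 216 * \<beta> ^ 4 * q * \<chi>2\<^sup>2 * R ^ 3"
   unfolding \<nu>_def \<sigma>_def a_def using be(1) q1 chi R3 by (simp add: field_simps eval_nat_numeral)
  also have "\<dots> = \<kappa>" unfolding \<kappa>_def e_def[symmetric] R_def using e
   by (simp add: power_divide power_mult_distrib field_simps flip: power_mult)
  finally show ?thesis .
 qed
 show "1 \<le> \<kappa>" unfolding ka[symmetric] using sn s0 by simp
 define rhs where "rhs = aug_rhs A b C W r Q Qp"
 have win: "\<sigma> \<le> \<bar>\<theta>\<bar> \<and> \<bar>\<theta>\<bar> \<le> \<nu>" if "z \<in> carrier_vec (m + d)" "z \<noteq> 0\<^sub>v (m + d)" "M *v z = \<theta> *s z" for z \<theta>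
  using ev(1)[OF _ _ that] nu unfolding \<sigma>_def by fastforce
 have mc: "vnorm (M *v rs.y (2 * j) - rhs) \<le> 2 * exp (- real j * \<sigma> / \<nu>) * vnorm rhs"
  unfolding rhs_def by (rule rs.minres_convergence[OF s0 sn win])
 have ex: "exp (- real j * \<sigma> / \<nu>) = exp (- real j / \<kappa>)" using s0 unfolding ka[symmetric] by simp
 have t2: "t\<^sup>2 \<le> h\<^sup>2 / (4 * e)"
 proof -
  have "L\<^sup>2 * \<mu> \<le> h\<^sup>2 * 1" using h L mu mu0 by (intro mult_mono power_mono) auto
  then have "L\<^sup>2 * \<mu> / (4 * e) \<le> h\<^sup>2 / (4 * e)" using e by (intro divide_right_mono) auto
  then show ?thesis using ev(2) by linarith
 qed
 have rn: "vnorm rhs \<le> 3 * \<beta>\<^sup>2 * h\<^sup>2 / e"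
 proof -
  have "vnorm rhs \<le> \<beta> + 5 * \<beta>\<^sup>2 * t\<^sup>2" unfolding rhs_def by (rule aug_rhs_norm[OF b C be(1,3,4,5)])
  also have "\<dots> \<le> \<beta>\<^sup>2 * (h\<^sup>2 / e) + 5 * \<beta>\<^sup>2 * (h\<^sup>2 / (4 * e))"
  proof (rule add_mono)
   have "1 \<le> h\<^sup>2 / e" using h2 e by simp
   then have "\<beta>\<^sup>2 * 1 \<le> \<beta>\<^sup>2 * (h\<^sup>2 / e)" by (intro mult_left_mono) auto
   then show "\<beta> \<le> \<beta>\<^sup>2 * (h\<^sup>2 / e)" using b2 by linarith
   show "5 * \<beta>\<^sup>2 * t\<^sup>2 \<le> 5 * \<beta>\<^sup>2 * (h\<^sup>2 / (4 * e))" using t2 by (rule mult_left_mono) simp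
  qed
  also have "\<dots> = 9 / 4 * (\<beta>\<^sup>2 * h\<^sup>2 / e)" by (simp add: field_simps)
  also have "\<dots> \<le> 3 * (\<beta>\<^sup>2 * h\<^sup>2 / e)" by (rule mult_right_mono) (use e in auto)
  finally show ?thesis by simp
 qed
 have mt: "max 1 (1 / t\<^sup>2) \<le> 32 * h\<^sup>2 / (e\<^sup>2 * \<mu>)"
 proof -
  have "(1 + L)\<^sup>2 \<le> (2 * h)\<^sup>2" using h L by (intro power_mono) auto
  then have "8 * (1 + L)\<^sup>2 / (e\<^sup>2 * \<mu>) \<le> 32 * h\<^sup>2 / (e\<^sup>2 * \<mu>)"
   using mu0 e by (intro divide_right_mono) (auto simp: power_mult_distrib)
  moreover have "1 \<le> 32 * h\<^sup>2 / (e\<^sup>2 * \<mu>)"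
  proof -
   have "e\<^sup>2 * \<mu> \<le> 1 * 1" using e mu mu0 by (intro mult_mono) (auto simp: power_le_one)
   then show ?thesis using h2 e mu0 by (simp add: field_simps)
  qed
  ultimately show ?thesis using ev(3) by simp
 qed
 define z where "z = rs.y (2 * j)"
 have zc: "z \<in> carrier_vec (m + d)" unfolding z_def by (rule rs.y_carrier)
 have it: "aug_iterate A b C W r Q Qp (2 * j) = z"
  unfolding aug_iterate_def Let_def bigQ_dims carrier_matD(1)[OF A] z_def by (rule rs.minres_eq)
 have uv: "vec_first z m @\<^sub>v vec_last z d = z" by (rule vec_first_last_append[OF zc])
 have "newton_residual A b C W (delta_X A b C W r Q Qp (2 * j)) (delta_y A b C W r Q Qp (2 * j))
  \<le> max 1 (1 / t\<^sup>2) * vnorm (M *v z - rhs)"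
  using newton_residual_bound[OF b C, of "vec_first z m" "vec_last z d"] 
  unfolding delta_X_def delta_y_def iter_u_def iter_v_def it bigQ_dims carrier_matD(1)[OF A] dimW(1) uv rhs_def
  by simp
 also have "\<dots> \<le> (32 * h\<^sup>2 / (e\<^sup>2 * \<mu>)) * (2 * exp (- real j / \<kappa>) * (3 * \<beta>\<^sup>2 * h\<^sup>2 / e))"
 proof (rule mult_mono[OF mt])
  show "vnorm (M *v z - rhs) \<le> 2 * exp (- real j / \<kappa>) * (3 * \<beta>\<^sup>2 * h\<^sup>2 / e)"
   using mc mult_left_mono[OF rn, of "2 * exp (- real j / \<kappa>)"] unfolding ex z_def by simp
  show "0 \<le> 32 * h\<^sup>2 / (e\<^sup>2 * \<mu>)" using mu0 by simp
 qed simp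
 also have "\<dots> = 192 * \<beta>\<^sup>2 * h ^ 4 / (e ^ 3 * \<mu>) * exp (- real j / \<kappa>)"
  by (simp add: power2_eq_square power3_eq_cube power4_eq_xxxx mult_ac)
 finally show "newton_residual A b C W (delta_X A b C W r Q Qp (2 * j)) (delta_y A b C W r Q Qp (2 * j))
  \<le> 192 * \<beta>\<^sup>2 * h ^ 4 / ((1 - \<delta>) ^ 3 * \<mu>) * exp (- real j / \<kappa>)" unfolding e_def .
qed

definition iteration_constant :: "real \<Rightarrow> real" where
 "iteration_constant \<beta> = 4 * (5832 * \<beta> ^ 4) * (ln (192 * \<beta>\<^sup>2) + 1)"

lemma iteration_constant_pos:
 assumes "1 \<le> \<beta>"
 shows "0 < iteration_constant \<beta>"
proof -
 have "0 \<le> ln (192 * \<beta>\<^sup>2)" using one_le_power[OF assms, of 2] by simp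
 then have "0 < ln (192 * \<beta>\<^sup>2) + 1" by linarith
 moreover have "0 < 4 * (5832 * \<beta> ^ 4)" using assms by simp
 ultimately show ?thesis unfolding iteration_constant_def by (rule mult_pos_pos[rotated])
qed

theorem iteration_bound:
 fixes \<beta> :: real
 assumes be: "1 \<le> \<beta>" and ep: "0 < \<epsilon>"
  and set: "newton_setup n m r A b C \<mu> L \<delta> \<chi>1 \<chi>2 X S Xs Ss Us W Q Qp" and mu: "\<mu> \<le> 1"
  and bs: "1 / \<beta> \<le> spec_norm A" "spec_norm A \<le> \<beta>" "vnorm b \<le> \<beta>" "vnorm (vecS C) \<le> \<beta>"
 shows "\<exists>k::nat. real k \<le> iteration_constant \<beta> *
   (cond (A * A\<^sup>T) * max 1 L ^ 20 * (1 / (1 - \<delta>) ^ 19) * \<chi>1 ^ 2 * \<chi>2 ^ 6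
    * max 1 (ln (max 1 L ^ 4 / (\<mu> * \<epsilon> * (1 - \<delta>) ^ 4)))) \<and>
  newton_residual A b C W (delta_X A b C W r Q Qp k) (delta_y A b C W r Q Qp k) \<le> \<epsilon>"
proof -
 define c K where "c = ln (192 * \<beta>\<^sup>2) + 1" and "K = iteration_constant \<beta>"
 have c: "1 \<le> c" using one_le_power[OF be, of 2] by (simp add: c_def)
 note st = newton_step_bound[OF set mu be bs]
 define h q e \<Lambda> where "h = max 1 L" and "q = cond (A * A\<^sup>T)" and "e = 1 - \<delta>"
  and "\<Lambda> = max 1 (ln (h ^ 4 / (\<mu> * \<epsilon> * e ^ 4)))"
 define \<kappa> where "\<kappa> = 5832 * \<beta> ^ 4 * q * \<chi>2\<^sup>2 * h ^ 6 / e ^ 6"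
 note st' = st[folded h_def q_def e_def, folded \<kappa>_def]
 have e: "0 < e" "e \<le> 1" and mu0: "0 < \<mu>" using set by (auto simp: newton_setup_def centering_def e_def)
 have h: "1 \<le> h" by (simp add: h_def)
 obtain j where j: "real (2 * j) \<le> 4 * \<kappa> * c * \<Lambda>"
  "192 * \<beta>\<^sup>2 * h ^ 4 / (e ^ 3 * \<mu>) * exp (- real j / \<kappa>) \<le> \<epsilon>"
  using iteration_count[OF be mu0 ep e h st'(2)] unfolding c_def \<Lambda>_def by blast
 have La: "1 \<le> \<Lambda>" by (simp add: \<Lambda>_def)
 have "q * (\<chi>2\<^sup>2 * (h ^ 6 * (1 / e ^ 6))) \<le> q * ((\<chi>1\<^sup>2 * \<chi>2 ^ 6) * (h ^ 20 * (1 / e ^ 19)))"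
 proof (intro mult_left_mono mult_mono)
  show "\<chi>2\<^sup>2 \<le> \<chi>1\<^sup>2 * \<chi>2 ^ 6"
   using mult_mono[of 1 "\<chi>1\<^sup>2" "\<chi>2\<^sup>2" "\<chi>2 ^ 6"] st'(4,5) power_increasing[of 2 6 \<chi>2] by (simp add: one_le_power)
  show "h ^ 6 \<le> h ^ 20" using h by (intro power_increasing) auto
  show "1 / e ^ 6 \<le> 1 / e ^ 19" using e by (intro divide_left_mono power_decreasing) auto
 qed (use st'(3) e h in auto)
 then have "4 * (5832 * \<beta> ^ 4) * c * \<Lambda> * (q * (\<chi>2\<^sup>2 * (h ^ 6 * (1 / e ^ 6))))
   \<le> 4 * (5832 * \<beta> ^ 4) * c * \<Lambda> * (q * ((\<chi>1\<^sup>2 * \<chi>2 ^ 6) * (h ^ 20 * (1 / e ^ 19))))"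
  by (rule mult_left_mono) (use be c La in simp)
 moreover have "4 * \<kappa> * c * \<Lambda> = 4 * (5832 * \<beta> ^ 4) * c * \<Lambda> * (q * (\<chi>2\<^sup>2 * (h ^ 6 * (1 / e ^ 6))))"
  by (simp add: \<kappa>_def mult_ac)
 moreover have "K * (q * h ^ 20 * (1 / e ^ 19) * \<chi>1 ^ 2 * \<chi>2 ^ 6 * \<Lambda>)
   = 4 * (5832 * \<beta> ^ 4) * c * \<Lambda> * (q * ((\<chi>1\<^sup>2 * \<chi>2 ^ 6) * (h ^ 20 * (1 / e ^ 19))))"
  by (simp add: K_def iteration_constant_def c_def mult_ac)
 ultimately have "real (2 * j) \<le> K * (q * h ^ 20 * (1 / e ^ 19) * \<chi>1 ^ 2 * \<chi>2 ^ 6 * \<Lambda>)"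
  using j(1) by linarith
 then show ?thesis
  using order.trans[OF st'(1)[of j] j(2)]
  unfolding h_def[symmetric] q_def[symmetric] e_def[symmetric] \<Lambda>_def K_def by blast
qed

section \<open>Register programs on blocks\<close>

datatype arith = Plus | Minus | Times | Over

fun arith_instr :: "arith \<Rightarrow> nat \<Rightarrow> nat \<Rightarrow> nat \<Rightarrow> instr" where
 "arith_instr Plus = Add"
| "arith_instr Minus = Sub"
| "arith_instr Times = Mul"
| "arith_instr Over = Div"

fun arith_val :: "arith \<Rightarrow> real \<Rightarrow> real \<Rightarrow> real" where
 "arith_val Plus x y = x + y"
| "arith_val Minus x y = x - y"
| "arith_val Times x y = x * y"
| "arith_val Over x y = x / y"

lemma arith_step: "step n A (arith_instr a d s t) R = R(d := arith_val a (R s) (R t))"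
 by (cases a) auto

lemma arith_cost: "instr_time tA tAT (arith_instr a d s t) = 1" "instr_regs n m (arith_instr a d s t) = {d, s, t}"
 by (cases a; simp)+

text \<open>An intermediate level between vectors and registers: operations on blocks, each computing a whole
 block, with address functions that may permute, transpose or mask their sources.\<close>

datatype bop =
  Fill nat nat real
 | Bin arith nat nat "nat \<Rightarrow> nat \<times> nat" "nat \<Rightarrow> nat \<times> nat"
 | Dot nat nat nat "nat \<Rightarrow> nat \<Rightarrow> nat \<times> nat" "nat \<Rightarrow> nat \<Rightarrow> nat \<times> nat"
 | CallA nat nat
 | CallAT nat nat

type_synonym blocks = "nat \<Rightarrow> nat \<Rightarrow> real"

definition bget :: "blocks \<Rightarrow> nat \<times> nat \<Rightarrow> real" where "bget \<sigma> x = \<sigma> (fst x) (snd x)"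

definition bput :: "nat \<Rightarrow> nat \<Rightarrow> (nat \<Rightarrow> real) \<Rightarrow> blocks \<Rightarrow> blocks" where
 "bput d N h \<sigma> = \<sigma>(d := (\<lambda>p. if p < N then h p else \<sigma> d p))"

text \<open>The symmetric matrix that a call of \<open>X \<mapsto> A vecS X\<close> reads: entry \<open>(max i j, min i j)\<close> of the column-wise
 stored array.\<close>

definition read_sym :: "nat \<Rightarrow> (nat \<Rightarrow> real) \<Rightarrow> real mat" where
 "read_sym n g = mat n n (\<lambda>(i, j). g (min i j * n + max i j))"

fun bstep :: "nat \<Rightarrow> real mat \<Rightarrow> bop \<Rightarrow> blocks \<Rightarrow> blocks" where
 "bstep n A (Fill d N a) \<sigma> = bput d N (\<lambda>p. a) \<sigma>"
| "bstep n A (Bin a d N f g) \<sigma> = bput d N (\<lambda>p. arith_val a (bget \<sigma> (f p)) (bget \<sigma> (g p))) \<sigma>"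
| "bstep n A (Dot d N L f g) \<sigma> = bput d N (\<lambda>p. \<Sum>l<L. bget \<sigma> (f p l) * bget \<sigma> (g p l)) \<sigma>"
| "bstep n A (CallA d s) \<sigma> = bput d (dim_row A) (\<lambda>p. (A *v vecS (read_sym n (\<sigma> s))) $ p) \<sigma>"
| "bstep n A (CallAT d s) \<sigma> = bput d (dim_col A) (\<lambda>p. (A\<^sup>T *v vec (dim_row A) (\<sigma> s)) $ p) \<sigma>"

text \<open>Blocks 0 to 3 are the four parts of the input, block 4 holds the accumulator of scalar products
 and is invisible at the level of blocks, the others are work space.\<close>

definition bsize :: "nat \<Rightarrow> nat \<Rightarrow> nat \<Rightarrow> nat" where
 "bsize n m i = (if i = 0 \<or> i = 3 then n * n else if i = 1 then n else if i = 2 then m else n * n + m)"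

definition base :: "nat \<Rightarrow> nat \<Rightarrow> nat \<Rightarrow> nat" where
 "base n m i = (if i = 0 then 0 else if i = 1 then n * n else if i = 2 then n * n + n
  else if i = 3 then n * n + n + m else 2 * (n * n) + n + m + (i - 4) * (n * n + m))"

definition addr :: "nat \<Rightarrow> nat \<Rightarrow> nat \<times> nat \<Rightarrow> nat" where "addr n m x = base n m (fst x) + snd x"

lemma base_mono: "i < j ==> base n m i + bsize n m i \<le> base n m j"
proof -
 assume ij: "i < j"
 consider "i < 4" | "4 \<le> i" by linarith
 then show ?thesis
 proof cases
  case 1
  then have "i = 0 \<or> i = 1 \<or> i = 2 \<or> i = 3" by auto
  then show ?thesis using ij by (auto simp: base_def bsize_def)
 next
  case 2
  have "(i - 4) * (n * n + m) + (n * n + m) = Suc (i - 4) * (n * n + m)" by simp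
  also have "\<dots> \<le> (j - 4) * (n * n + m)" by (rule mult_right_mono) (use ij 2 in auto)
  finally show ?thesis using ij 2 by (simp add: base_def bsize_def)
 qed
qed

lemma addr_eq_iff:
 assumes "snd x < bsize n m (fst x)" "snd y < bsize n m (fst y)"
 shows "addr n m x = addr n m y \<longleftrightarrow> x = y"
proof (cases "fst x = fst y")
 case True
 then show ?thesis by (auto simp: addr_def prod_eq_iff)
next
 case False
 then have "fst x < fst y \<or> fst y < fst x" by linarith
 then have "addr n m x \<noteq> addr n m y"
  using base_mono[of "fst x" "fst y" n m] base_mono[of "fst y" "fst x" n m] assms by (auto simp: addr_def)
 then show ?thesis using False by auto
qed

fun compile :: "nat \<Rightarrow> nat \<Rightarrow> bop \<Rightarrow> instr list" where
 "compile n m (Fill d N a) = map (\<lambda>p. Const (addr n m (d, p)) a) [0..<N]"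
| "compile n m (Bin a d N f g) =
  map (\<lambda>p. arith_instr a (addr n m (d, p)) (addr n m (f p)) (addr n m (g p))) [0..<N]"
| "compile n m (Dot d N L f g) = concat (map (\<lambda>p. Const (addr n m (d, p)) 0 #
  concat (map (\<lambda>l. [Mul (addr n m (4, 0)) (addr n m (f p l)) (addr n m (g p l)),
   Add (addr n m (d, p)) (addr n m (d, p)) (addr n m (4, 0))]) [0..<L])) [0..<N])"
| "compile n m (CallA d s) = [ApplyA (base n m d) (base n m s)]"
| "compile n m (CallAT d s) = [ApplyAT (base n m d) (base n m s)]"

definition readable :: "nat \<Rightarrow> nat \<Rightarrow> nat \<times> nat \<Rightarrow> bool" where
 "readable n m x \<longleftrightarrow> fst x \<noteq> 4 \<and> fst x < 32 \<and> snd x < bsize n m (fst x)"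

definition cheap :: "nat \<Rightarrow> nat \<Rightarrow> nat \<Rightarrow> bool" where
 "cheap n N L \<longleftrightarrow> N * (2 * L + 1) \<le> 9 * n ^ 3"

text \<open>Side conditions under which an operation on blocks is compiled correctly, and stays within
 $O(n^3)$ instructions and the first 32 blocks.\<close>

fun admissible :: "nat \<Rightarrow> nat \<Rightarrow> bop \<Rightarrow> bool" where
 "admissible n m (Fill d N a) \<longleftrightarrow> d \<noteq> 4 \<and> d < 32 \<and> N \<le> bsize n m d \<and> cheap n N 0"
| "admissible n m (Bin a d N f g) \<longleftrightarrow> d \<noteq> 4 \<and> d < 32 \<and> N \<le> bsize n m d \<and> cheap n N 0 \<and>
  (\<forall>p<N. readable n m (f p) \<and> (fst (f p) = d \<longrightarrow> snd (f p) = p) \<and>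
      readable n m (g p) \<and> (fst (g p) = d \<longrightarrow> snd (g p) = p))"
| "admissible n m (Dot d N L f g) \<longleftrightarrow> d \<noteq> 4 \<and> d < 32 \<and> N \<le> bsize n m d \<and> cheap n N L \<and>
  (\<forall>p<N. \<forall>l<L. readable n m (f p l) \<and> fst (f p l) \<noteq> d \<and> readable n m (g p l) \<and> fst (g p l) \<noteq> d)"
| "admissible n m (CallA d s) \<longleftrightarrow> d \<noteq> 4 \<and> d < 32 \<and> s \<noteq> 4 \<and> s < 32 \<and> s \<noteq> d \<and> m \<le> bsize n m d \<and> n * n \<le> bsize n m s"
| "admissible n m (CallAT d s) \<longleftrightarrow> d \<noteq> 4 \<and> d < 32 \<and> s \<noteq> 4 \<and> s < 32 \<and> s \<noteq> d \<and> tri n \<le> bsize n m d \<and> m \<le> bsize n m s"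

definition represents :: "nat \<Rightarrow> nat \<Rightarrow> regs \<Rightarrow> blocks \<Rightarrow> bool" where
 "represents n m R \<sigma> \<longleftrightarrow> (\<forall>x. fst x \<noteq> 4 \<and> snd x < bsize n m (fst x) \<longrightarrow> R (addr n m x) = bget \<sigma> x)"

lemma representsD: "represents n m R \<sigma> ==> readable n m x ==> R (addr n m x) = bget \<sigma> x"
 unfolding represents_def readable_def by blast

lemma represents_write:
 assumes "represents n m R \<sigma>" "d \<noteq> 4" "p < bsize n m d"
 shows "represents n m (R(addr n m (d, p) := v)) (\<sigma>(d := (\<sigma> d)(p := v)))"
 using assms addr_eq_iff[of _ n m "(d, p)"] by (auto simp: represents_def bget_def)

lemma represents_tmp:
 assumes "represents n m R \<sigma>" "0 < n"
 shows "represents n m (R(addr n m (4, 0) := v)) \<sigma>"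
 using assms addr_eq_iff[of _ n m "(4, 0)"] by (fastforce simp: represents_def bsize_def)

text \<open>An elementwise operation may be executed entry by entry if the value for entry \<open>p\<close> does not
 depend on the entries below \<open>p\<close> that have been overwritten.\<close>

lemma represents_pointwise:
 assumes R: "represents n m R \<sigma>"
  and c: "\<And>R \<tau> p. p < N ==> represents n m R \<tau> ==>
    represents n m (fold (step n A) (c p) R) (\<tau>(d := (\<tau> d)(p := e \<tau> p)))"
  and indep: "\<And>\<tau> p. p < N ==> (\<And>i q. i \<noteq> d \<or> p \<le> q ==> \<tau> i q = \<sigma> i q) ==> e \<tau> p = e \<sigma> p"
 shows "represents n m (fold (step n A) (concat (map c [0..<N])) R) (bput d N (e \<sigma>) \<sigma>)"
proof -
 have "K \<le> N ==> represents n m (fold (step n A) (concat (map c [0..<K])) R) (bput d K (e \<sigma>) \<sigma>)" for K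
 proof (induction K)
  case 0
  then show ?case using R by (simp add: bput_def)
 next
  case (Suc K)
  let ?t = "bput d K (e \<sigma>) \<sigma>"
  have "represents n m (fold (step n A) (concat (map c [0..<Suc K])) R) (?t(d := (?t d)(K := e ?t K)))"
   using c[of K, OF _ Suc.IH] Suc.prems by simp
  moreover have "e ?t K = e \<sigma> K" by (rule indep) (use Suc.prems in \<open>auto simp: bput_def\<close>)
  moreover have "?t(d := (?t d)(K := e \<sigma> K)) = bput d (Suc K) (e \<sigma>) \<sigma>"
   by (auto simp: bput_def fun_eq_iff less_Suc_eq)
  ultimately show ?case by simp
 qed
 then show ?thesis by simp
qed

lemma concat_single: "concat (map (\<lambda>p. [c p]) xs) = map c xs"
 by (induction xs) auto

text \<open>The accumulator lives in block 4, which the invariant does not mention, so only the target entry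
 changes at the level of blocks.\<close>

lemma dot_loop:
 assumes R: "represents n m R \<sigma>" and n: "0 < n" and d: "d \<noteq> 4" "p < bsize n m d"
  and fg: "\<And>l. l < L ==> readable n m (f l) \<and> fst (f l) \<noteq> d \<and> readable n m (g l) \<and> fst (g l) \<noteq> d"
 shows "represents n m (fold (step n A) (Const (addr n m (d, p)) 0 #
  concat (map (\<lambda>l. [Mul (addr n m (4, 0)) (addr n m (f l)) (addr n m (g l)),
   Add (addr n m (d, p)) (addr n m (d, p)) (addr n m (4, 0))]) [0..<L])) R)
  (\<sigma>(d := (\<sigma> d)(p := \<Sum>l<L. bget \<sigma> (f l) * bget \<sigma> (g l))))"
 using fg
proof (induction L)
 case 0
 then show ?case using represents_write[OF R d, of 0] by (simp add: fun_upd_def)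
next
 case (Suc L)
 define s where "s = (\<Sum>l<L. bget \<sigma> (f l) * bget \<sigma> (g l))"
 define \<tau> where "\<tau> = \<sigma>(d := (\<sigma> d)(p := s))"
 define S where "S = fold (step n A) (Const (addr n m (d, p)) 0 #
  concat (map (\<lambda>l. [Mul (addr n m (4, 0)) (addr n m (f l)) (addr n m (g l)),
   Add (addr n m (d, p)) (addr n m (d, p)) (addr n m (4, 0))]) [0..<L])) R"
 have IH: "represents n m S \<tau>" unfolding S_def \<tau>_def s_def by (rule Suc.IH) (use Suc.prems in auto)
 define v where "v = S (addr n m (f L)) * S (addr n m (g L))"
 have v: "v = bget \<sigma> (f L) * bget \<sigma> (g L)"
  unfolding v_def using representsD[OF IH, of "f L"] representsD[OF IH, of "g L"] Suc.prems[of L]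
  by (simp add: bget_def \<tau>_def)
 have S2: "represents n m (S(addr n m (4, 0) := v)) \<tau>" by (rule represents_tmp[OF IH n])
 have ne: "addr n m (d, p) \<noteq> addr n m (4, 0)"
  using addr_eq_iff[of "(d, p)" n m "(4, 0)"] d n by (simp add: bsize_def)
 have "(S(addr n m (4, 0) := v)) (addr n m (d, p)) = bget \<tau> (d, p)"
  using S2 d unfolding represents_def by simp
 then have "S (addr n m (d, p)) = s" using ne by (simp add: bget_def \<tau>_def)
 then have "fold (step n A) (Const (addr n m (d, p)) 0 #
  concat (map (\<lambda>l. [Mul (addr n m (4, 0)) (addr n m (f l)) (addr n m (g l)),
   Add (addr n m (d, p)) (addr n m (d, p)) (addr n m (4, 0))]) [0..<Suc L])) R =
  (S(addr n m (4, 0) := v))(addr n m (d, p) := s + v)"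
  using ne by (simp add: S_def v_def)
 moreover have "represents n m ((S(addr n m (4, 0) := v))(addr n m (d, p) := s + v)) (\<tau>(d := (\<tau> d)(p := s + v)))"
  by (rule represents_write[OF S2 d])
 moreover have "\<tau>(d := (\<tau> d)(p := s + v)) =
   \<sigma>(d := (\<sigma> d)(p := \<Sum>l<Suc L. bget \<sigma> (f l) * bget \<sigma> (g l)))"
  by (simp add: \<tau>_def s_def v fun_eq_iff)
 ultimately show ?case by (simp only:)
qed

lemma represents_store:
 assumes R: "represents n m R \<sigma>" and d: "d \<noteq> 4" and x: "dim_vec x \<le> bsize n m d"
 shows "represents n m (store (base n m d) x R) (bput d (dim_vec x) (\<lambda>p. x $ p) \<sigma>)"
 unfolding represents_def
proof (intro allI impI)
 fix y :: "nat \<times> nat" assume y: "fst y \<noteq> 4 \<and> snd y < bsize n m (fst y)"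
 show "store (base n m d) x R (addr n m y) = bget (bput d (dim_vec x) (\<lambda>p. x $ p) \<sigma>) y"
 proof (cases "fst y = d \<and> snd y < dim_vec x")
  case True
  then show ?thesis by (simp add: store_def addr_def bget_def bput_def)
 next
  case False
  have "\<not> (base n m d \<le> addr n m y \<and> addr n m y < base n m d + dim_vec x)"
  proof (cases "fst y = d")
   case True
   then show ?thesis using False by (simp add: addr_def)
  next
   case ne: False
   then have "fst y < d \<or> d < fst y" by linarith
   then show ?thesis using base_mono[of "fst y" d n m] base_mono[of d "fst y" n m] y x by (auto simp: addr_def)
  qed
  then have "store (base n m d) x R (addr n m y) = R (addr n m y)" by (auto simp: store_def)
  also have "\<dots> = bget \<sigma> y" using R y unfolding represents_def by blast
  finally show ?thesis using False by (auto simp: bget_def bput_def)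
 qed
qed

lemma compile_correct:
 assumes R: "represents n m R \<sigma>" and n: "0 < n" and A: "A \<in> carrier_mat m (tri n)" and ok: "admissible n m op"
 shows "represents n m (fold (step n A) (compile n m op) R) (bstep n A op \<sigma>)"
proof (cases op)
 case (Fill d N a)
 have "represents n m (fold (step n A) (concat (map (\<lambda>p. [Const (addr n m (d, p)) a]) [0..<N])) R)
   (bput d N ((\<lambda>\<tau> p. a) \<sigma>) \<sigma>)"
  by (rule represents_pointwise[OF R]) (use ok Fill represents_write in auto)
 then show ?thesis by (simp add: concat_single Fill)
next
 case (Bin a d N f g)
 let ?e = "\<lambda>\<tau> p. arith_val a (bget \<tau> (f p)) (bget \<tau> (g p))"
 have "represents n m (fold (step n A) (concat (map (\<lambda>p.
   [arith_instr a (addr n m (d, p)) (addr n m (f p)) (addr n m (g p))]) [0..<N])) R) (bput d N (?e \<sigma>) \<sigma>)"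
 proof (rule represents_pointwise[OF R])
  fix S \<tau> p assume p: "p < N" and S: "represents n m S \<tau>"
  have "S (addr n m (f p)) = bget \<tau> (f p)" "S (addr n m (g p)) = bget \<tau> (g p)"
   using representsD[OF S] ok p by (auto simp: Bin)
  then show "represents n m (fold (step n A) [arith_instr a (addr n m (d, p)) (addr n m (f p)) (addr n m (g p))] S)
    (\<tau>(d := (\<tau> d)(p := ?e \<tau> p)))"
   using represents_write[OF S, of d p] ok p by (simp add: Bin arith_step)
 next
  fix \<tau> p assume p: "p < N" and eq: "\<And>i q. i \<noteq> d \<or> p \<le> q ==> \<tau> i q = \<sigma> i q"
  have "bget \<tau> (f p) = bget \<sigma> (f p)" "bget \<tau> (g p) = bget \<sigma> (g p)"
   unfolding bget_def by (rule eq; use ok p in \<open>auto simp: Bin\<close>)+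
  then show "?e \<tau> p = ?e \<sigma> p" by simp
 qed
 then show ?thesis by (simp add: concat_single Bin)
next
 case (Dot d N L f g)
 let ?e = "\<lambda>\<tau> p. \<Sum>l<L. bget \<tau> (f p l) * bget \<tau> (g p l)"
 have "represents n m (fold (step n A) (compile n m op) R) (bput d N (?e \<sigma>) \<sigma>)"
  unfolding Dot compile.simps
 proof (rule represents_pointwise[OF R])
  fix S \<tau> p assume p: "p < N" and S: "represents n m S \<tau>"
  show "represents n m (fold (step n A) (Const (addr n m (d, p)) 0 #
  concat (map (\<lambda>l. [Mul (addr n m (4, 0)) (addr n m (f p l)) (addr n m (g p l)),
   Add (addr n m (d, p)) (addr n m (d, p)) (addr n m (4, 0))]) [0..<L])) S)
  (\<tau>(d := (\<tau> d)(p := ?e \<tau> p)))"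
   by (rule dot_loop[OF S n]) (use ok p in \<open>auto simp: Dot\<close>)
 next
  fix \<tau> p assume p: "p < N" and eq: "\<And>i q. i \<noteq> d \<or> p \<le> q ==> \<tau> i q = \<sigma> i q"
  show "?e \<tau> p = ?e \<sigma> p"
   unfolding bget_def by (intro sum.cong refl arg_cong2[of _ _ _ _ "(*)"]; rule eq; use ok p in \<open>auto simp: Dot\<close>)
 qed
 then show ?thesis by (simp add: Dot)
next
 case (CallA d s)
 have "mat n n (\<lambda>(i, j). R (base n m s + min i j * n + max i j)) = read_sym n (\<sigma> s)"
 proof (rule eq_matI)
  fix i j assume "i < dim_row (read_sym n (\<sigma> s))" "j < dim_col (read_sym n (\<sigma> s))"
  then have ij: "i < n" "j < n" by (simp_all add: read_sym_def)
  have "min i j * n + max i j < n * n"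
  proof -
   have "min i j * n + max i j < Suc (min i j) * n" using ij by simp
   also have "\<dots> \<le> n * n" by (rule mult_right_mono) (use ij in auto)
   finally show ?thesis .
  qed
  then have "R (addr n m (s, min i j * n + max i j)) = bget \<sigma> (s, min i j * n + max i j)"
   by (intro representsD[OF R]) (use ok in \<open>auto simp: CallA readable_def\<close>)
  then show "mat n n (\<lambda>(i, j). R (base n m s + min i j * n + max i j)) $$ (i, j) = read_sym n (\<sigma> s) $$ (i, j)"
   using ij by (simp add: read_sym_def addr_def bget_def add.assoc)
 qed (simp_all add: read_sym_def)
 then show ?thesis
  using represents_store[OF R, of d "A *v vecS (read_sym n (\<sigma> s))"] ok A by (simp add: CallA)
next
 case (CallAT d s)
 have "vec (dim_row A) (\<lambda>i. R (base n m s + i)) = vec (dim_row A) (\<sigma> s)"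
 proof (rule eq_vecI)
  fix i assume "i < dim_vec (vec (dim_row A) (\<sigma> s))"
  then have i: "i < m" using A by simp
  then have "R (addr n m (s, i)) = bget \<sigma> (s, i)"
   by (intro representsD[OF R]) (use ok in \<open>auto simp: CallAT readable_def\<close>)
  then show "vec (dim_row A) (\<lambda>i. R (base n m s + i)) $ i = vec (dim_row A) (\<sigma> s) $ i"
   using i A by (simp add: addr_def bget_def)
 qed simp
 then show ?thesis
  using represents_store[OF R, of d "A\<^sup>T *v vec (dim_row A) (\<sigma> s)"] ok A by (simp add: CallAT)
qed

lemma compile_list_correct:
 assumes "represents n m R \<sigma>" "0 < n" "A \<in> carrier_mat m (tri n)" "\<forall>op \<in> set ops. admissible n m op"
 shows "represents n m (fold (step n A) (concat (map (compile n m) ops)) R) (fold (bstep n A) ops \<sigma>)"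
 using assms
proof (induction ops arbitrary: R \<sigma>)
 case (Cons op ops)
 show ?case using Cons.IH[OF compile_correct[OF Cons.prems(1-3), of op]] Cons.prems by simp
qed simp

lemma run_time_append: "run_time tA tAT (xs @ ys) = run_time tA tAT xs + run_time tA tAT ys"
 by (simp add: run_time_def)

lemma run_time_unit: "(\<And>x. x \<in> set xs ==> instr_time tA tAT x = 1) ==> run_time tA tAT xs = length xs"
 by (induction xs) (auto simp: run_time_def)

lemma compile_time:
 assumes ok: "admissible n m op"
 shows "run_time tA tAT (compile n m op) \<le> 9 * n ^ 3 + tA + tAT"
proof (cases op)
 case (Dot d N L f g)
 have "run_time tA tAT (compile n m op) = length (compile n m op)"
  by (rule run_time_unit) (auto simp: Dot)
 also have "\<dots> = N * (2 * L + 1)"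
  by (simp add: Dot length_concat comp_def sum_list_triv mult.commute)
 finally show ?thesis using ok by (simp add: Dot cheap_def)
qed (use ok in \<open>auto simp: run_time_def comp_def arith_cost sum_list_triv cheap_def\<close>)

lemma compile_list_time:
 assumes "\<forall>op \<in> set ops. admissible n m op"
 shows "run_time tA tAT (concat (map (compile n m) ops)) \<le> length ops * (9 * n ^ 3 + tA + tAT)"
 using assms
proof (induction ops)
 case (Cons op ops)
 then show ?case using compile_time[of n m op tA tAT] by (simp add: run_time_append)
qed (simp add: run_time_def)

lemma addr_bound: "fst x < 32 ==> snd x < bsize n m (fst x) ==> addr n m x < base n m 32"
 using base_mono[of "fst x" 32 n m] by (simp add: addr_def)

lemma compile_regs:
 assumes ok: "admissible n m op" and n: "0 < n" and x: "x \<in> set (compile n m op)"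
 shows "instr_regs n m x \<subseteq> {..<base n m 32}"
proof -
 have rd: "addr n m y < base n m 32" if "readable n m y" for y
  using addr_bound that by (simp add: readable_def)
 have tmp: "addr n m (4, 0) < base n m 32" using addr_bound[of "(4, 0)" n m] n by (simp add: bsize_def)
 show ?thesis
 proof (cases op)
  case (Fill d N a)
  then show ?thesis using x ok addr_bound[of "(d, _)" n m] by auto
 next
  case (Bin a d N f g)
  then have "addr n m (f p) < base n m 32" "addr n m (g p) < base n m 32" if "p < N" for p
   using that ok rd by simp_all
  then show ?thesis using Bin x ok addr_bound[of "(d, _)" n m] by (auto simp: arith_cost)
 next
  case (Dot d N L f g)
  then have "addr n m (f p l) < base n m 32" "addr n m (g p l) < base n m 32" if "p < N" "l < L" for p l
   using that ok rd by simp_all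
  then show ?thesis using Dot x ok addr_bound[of "(d, _)" n m] tmp by auto
 next
  case (CallA d s)
  then show ?thesis using x ok base_mono[of d 32 n m] base_mono[of s 32 n m] by auto
 next
  case (CallAT d s)
  then show ?thesis using x ok base_mono[of d 32 n m] base_mono[of s 32 n m] by auto
 qed
qed

lemma fold_copy:
 assumes "\<And>p. p < N ==> N \<le> f p" "N \<le> z"
 shows "fold (step n A) (map (\<lambda>p. Add p (f p) z) [0..<N]) R = (\<lambda>x. if x < N then R (f x) + R z else R x)"
proof -
 have "K \<le> N ==> fold (step n A) (map (\<lambda>p. Add p (f p) z) [0..<K]) R = (\<lambda>x. if x < K then R (f x) + R z else R x)" for K
 proof (induction K)
  case (Suc K)
  then show ?case using assms(1)[of K] assms(2) by (auto simp: fun_eq_iff less_Suc_eq)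
 qed simp
 then show ?thesis by simp
qed

section \<open>The augmented system in eigenbasis coordinates\<close>

context augmented
begin

text \<open>Instead of a packed vector the program stores its full \<open>n \<times> n\<close> coordinate matrix. The change of
 representation is linear and isometric, so inner products and the recurrence carry over unchanged.\<close>

definition emb :: "real vec \<Rightarrow> real vec" where
 "emb z = vec_first z m @\<^sub>v colvec (unpack (vec_last z d))"

lemma split_vec:
 assumes "z \<in> carrier_vec (m + d)"
 shows "vec_first z m \<in> carrier_vec m" "vec_last z d \<in> carrier_vec d" "vec_first z m @\<^sub>v vec_last z d = z"
 using assms vec_first_last_append by auto

lemma emb_carrier: "emb z \<in> carrier_vec (m + n * n)" "dim_vec (emb z) = m + n * n"
 unfolding emb_def by (simp_all add: carrier_dim_vec)

lemma emb_linear: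
 assumes x: "x \<in> carrier_vec (m + d)" and y: "y \<in> carrier_vec (m + d)"
 shows "emb (x + y) = emb x + emb y" and "emb (c *s x) = c *s emb x" and "emb (x - y) = emb x - emb y"
proof -
 have dims: "dim_vec x = m + d" "dim_vec y = m + d" using x y by auto
 have l: "vec_last (x + y) d = vec_last x d + vec_last y d" "vec_last (c *s x) d = c *s vec_last x d"
   "vec_last (x - y) d = vec_last x d - vec_last y d"
  by (rule eq_vecI; simp add: vec_last_def dims)+
 note u = unpack_linear[OF split_vec(2)[OF x] split_vec(2)[OF y]]
 have b: "p mod n < n \<and> p div n < n" if "p < n * n" for p using div_mod_bound[OF that] by simp
 have s: "p - m < n * n" if "p < m + n * n" "\<not> p < m" for p using that by linarith
 note simps = emb_def l u dims index_append_vec vec_first_index colvec_def b s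
 show "emb (x + y) = emb x + emb y" by (rule eq_vecI) (auto simp: simps)
 show "emb (c *s x) = c *s emb x" by (rule eq_vecI) (auto simp: simps)
 show "emb (x - y) = emb x - emb y" by (rule eq_vecI) (auto simp: simps)
qed

lemma emb_zero: "emb (0\<^sub>v (m + d)) = 0\<^sub>v (m + n * n)"
proof -
 have z: "0\<^sub>v (m + d) = (0 :: real) *s 0\<^sub>v (m + d)" by (rule eq_vecI) auto
 have "emb (0\<^sub>v (m + d)) = 0 *s emb (0\<^sub>v (m + d))"
  using emb_linear(2)[of "0\<^sub>v (m + d)" "0\<^sub>v (m + d)" 0] z by simp
 also have "\<dots> = 0\<^sub>v (m + n * n)" by (rule eq_vecI) (use emb_carrier(2) in auto)
 finally show ?thesis .
qed

lemma emb_isometry: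
 assumes x: "x \<in> carrier_vec (m + d)" and y: "y \<in> carrier_vec (m + d)"
 shows "emb x \<bullet> emb y = x \<bullet> y"
proof -
 note sx = split_vec[OF x] and sy = split_vec[OF y]
 have cc: "colvec (unpack v) \<in> carrier_vec (n * n)" for v by (simp add: carrier_dim_vec)
 have "emb x \<bullet> emb y = vec_first x m \<bullet> vec_first y m + vec_last x d \<bullet> vec_last y d"
  unfolding emb_def scalar_prod_append[OF sx(1) cc sy(1) cc] using unpack_scalar_prod[OF sx(2) sy(2)] by (simp add: ip_def)
 also have "\<dots> = (vec_first x m @\<^sub>v vec_last x d) \<bullet> (vec_first y m @\<^sub>v vec_last y d)"
  by (rule scalar_prod_append[OF sx(1,2) sy(1,2), symmetric])
 finally show ?thesis unfolding sx(3) sy(3) .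
qed

lemma emb_append:
 assumes "u \<in> carrier_vec m" "v \<in> carrier_vec d"
 shows "emb (u @\<^sub>v v) = u @\<^sub>v colvec (unpack v)"
proof -
 have "vec_first (u @\<^sub>v v) m = u" "vec_last (u @\<^sub>v v) d = v"
  using assms by (auto simp: vec_first_def vec_last_def intro!: eq_vecI)
 then show ?thesis by (simp add: emb_def)
qed

lemma up_linear:
 assumes S: "S \<in> sym_mats n" and T: "T \<in> sym_mats n"
 shows "up S + up T = up (S + T)"
proof -
 note Sc = sym_matsD(1)[OF S] and Tc = sym_matsD(1)[OF T]
 have "V * (S + T) * V\<^sup>T = V * S * V\<^sup>T + V * T * V\<^sup>T"
  using VD(1) Sc Tc by (simp add: mat_dims mult_add_dim add_mult_dim)
 then show ?thesis unfolding up_def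
  using vecS_add[of "V * S * V\<^sup>T" n "V * T * V\<^sup>T"] sym_matsD(1)[OF conj_V_sym[OF S]] sym_matsD(1)[OF conj_V_sym[OF T]] by simp
qed

lemma sym_add: "S \<in> sym_mats n ==> T \<in> sym_mats n ==> S + T \<in> sym_mats n"
 unfolding sym_mats_def by (auto simp: transpose_add[of _ n n])

text \<open>In eigenbasis coordinates the matrix-vector product costs two congruences by \<open>V\<close>, elementwise
 products and one call each of the two constraint maps.\<close>

lemma emb_M:
 assumes u: "u \<in> carrier_vec m" and v: "v \<in> carrier_vec d"
 defines "T \<equiv> V\<^sup>T * smat n (A\<^sup>T *v u) * V" and "Z \<equiv> unpack v"
 shows "emb (M *v (u @\<^sub>v v)) = (A *v vecS (V * (had ee T + Z) * V\<^sup>T)) @\<^sub>v colvec (had msk T - had dd Z)"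
proof -
 have au: "A\<^sup>T *v u \<in> carrier_vec (tri n)" by (rule mult_mat_vec_carrier[OF AT u])
 have Td: "T = dn (A\<^sup>T *v u)" by (simp add: T_def dn_def)
 have T: "T \<in> sym_mats n" unfolding Td by (rule dn_sym)
 have Z: "Z \<in> sym_mats n" unfolding Z_def by (rule unpack_sym)
 have eT: "had ee T \<in> sym_mats n" by (rule had_sym[OF T]) (simp add: ee_def mult.commute)
 have dZ: "had dd Z \<in> sym_mats n" by (rule had_sym[OF Z]) (rule dd_sym)
 have c1: "EE *v (A\<^sup>T *v u) = up (had ee T)" unfolding EE_mult[OF au] Td ..
 have c2: "QQ *v v = up Z" unfolding bigQ_up[OF v] Z_def ..
 have top: "A *v (EE *v (A\<^sup>T *v u)) + A *v (QQ *v v) = A *v vecS (V * (had ee T + Z) * V\<^sup>T)"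
  unfolding c1 c2 mult_add_distrib_mat_vec[OF A up_carrier up_carrier, symmetric] up_linear[OF eT Z] unfolding up_def ..
 have bot: "QQ\<^sup>T *v (A\<^sup>T *v u) - t\<^sup>2 *s (bigSigma W r *v v) = pack T - pack (had dd Z)"
  unfolding QQT_mult[OF au] D_mult[OF v] Td Z_def ..
 have mdZ: "had msk (had dd Z) = had dd Z"
 proof (rule eq_matI)
  fix i j assume "i < dim_row (had dd Z)" "j < dim_col (had dd Z)"
  then have ij: "i < n" "j < n" by (simp_all add: Z_def)
  then show "had msk (had dd Z) $$ (i, j) = had dd Z $$ (i, j)"
   using unpack_bot[of i j v] by (auto simp: Z_def msk_def)
 qed auto
 have unb: "unpack (pack T - pack (had dd Z)) = had msk T - had dd Z"
  unfolding unpack_linear(3)[OF pack_carrier pack_carrier] unpack_pack[OF T] unpack_pack[OF dZ] mdZ ..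
 have "A *v vecS (V * (had ee T + Z) * V\<^sup>T) \<in> carrier_vec m"
  using mult_mat_vec_carrier[OF A up_carrier, of "had ee T + Z"] by (simp add: up_def)
 moreover have "pack T - pack (had dd Z) \<in> carrier_vec d" using pack_carrier by simp
 ultimately show ?thesis unfolding M_mult[OF u v] top bot by (simp add: emb_append unb)
qed

lemma emb_aug_rhs:
 assumes b: "b \<in> carrier_vec m" and C: "C \<in> sym_mats n"
 defines "T \<equiv> t\<^sup>2 \<cdot>\<^sub>m (V\<^sup>T * C * V)"
 shows "emb (aug_rhs A b C W r Q Qp) = (b + A *v vecS (V * had ee T * V\<^sup>T)) @\<^sub>v colvec (had msk T)"
proof -
 have cc: "vecS C \<in> carrier_vec (tri n)" using vecS_carrier[of C] sym_matsD[OF C] by simp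
 have tc: "t\<^sup>2 *s vecS C \<in> carrier_vec (tri n)" using cc by simp
 have sc: "smat n (t\<^sup>2 *s vecS C) = t\<^sup>2 \<cdot>\<^sub>m C"
 proof -
  have "smat n (t\<^sup>2 *s vecS C) = t\<^sup>2 \<cdot>\<^sub>m smat n (vecS C)"
   by (rule eq_matI) (use carrier_vecD[OF cc] tri_pos(1) in \<open>auto simp: smat_def\<close>)
  then show ?thesis using smat_vecS[OF C] by simp
 qed
 have Td: "T = dn (t\<^sup>2 *s vecS C)"
  unfolding T_def dn_def sc using VD(1) sym_matsD(1)[OF C]
  by (simp add: mat_dims mult_smult_dim smult_mult_dim)
 have T: "T \<in> sym_mats n" unfolding Td by (rule dn_sym)
 have "t\<^sup>2 *s ((A * EE) *v vecS C) = A *v (EE *v (t\<^sup>2 *s vecS C))"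
  unfolding assoc_mult_mat_vec[OF A EE_carrier cc] mult_mat_vec[OF EE_carrier cc]
   mult_mat_vec[OF A mult_mat_vec_carrier[OF EE_carrier cc]] ..
 also have "\<dots> = A *v vecS (V * had ee T * V\<^sup>T)" unfolding EE_mult[OF tc] Td[symmetric] unfolding up_def ..
 finally have top: "t\<^sup>2 *s ((A * EE) *v vecS C) = A *v vecS (V * had ee T * V\<^sup>T)" .
 have QT: "QQ\<^sup>T \<in> carrier_mat d (tri n)" using bigQ_carrier by simp
 have bot: "t\<^sup>2 *s (QQ\<^sup>T *v vecS C) = pack T"
  unfolding mult_mat_vec[OF QT cc, symmetric] QQT_mult[OF tc] Td ..
 have "A *v vecS (V * had ee T * V\<^sup>T) \<in> carrier_vec m"
  using mult_mat_vec_carrier[OF A up_carrier, of "had ee T"] by (simp add: up_def)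
 then show ?thesis unfolding aug_rhs_def top bot using b pack_carrier
  by (simp add: emb_append unpack_pack[OF T])
qed

lemma recovered_step:
 assumes u: "u \<in> carrier_vec m" and v: "v \<in> carrier_vec d" and C: "C \<in> sym_mats n"
 defines "T \<equiv> V\<^sup>T * smat n (A\<^sup>T *v u) * V - t\<^sup>2 \<cdot>\<^sub>m (V\<^sup>T * C * V)"
 shows "matS n (EE *v (A\<^sup>T *v u - t\<^sup>2 *s vecS C) + QQ *v v) = V * (had ee T + unpack v) * V\<^sup>T"
  and "had ee T + unpack v \<in> sym_mats n"
proof -
 have cc: "vecS C \<in> carrier_vec (tri n)" using vecS_carrier[of C] sym_matsD[OF C] by simp
 have au: "A\<^sup>T *v u \<in> carrier_vec (tri n)" by (rule mult_mat_vec_carrier[OF AT u])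
 have wc: "A\<^sup>T *v u - t\<^sup>2 *s vecS C \<in> carrier_vec (tri n)" using au cc by simp
 have sc: "smat n (A\<^sup>T *v u - t\<^sup>2 *s vecS C) = smat n (A\<^sup>T *v u) - t\<^sup>2 \<cdot>\<^sub>m C"
 proof -
  have "smat n (A\<^sup>T *v u - t\<^sup>2 *s vecS C) = smat n (A\<^sup>T *v u) - t\<^sup>2 \<cdot>\<^sub>m smat n (vecS C)"
   by (rule eq_matI) (use carrier_vecD[OF cc] carrier_vecD[OF au] tri_pos(1) in \<open>auto simp del: index_mult_mat_vec simp: smat_def right_diff_distrib diff_divide_distrib\<close>)
  then show ?thesis using smat_vecS[OF C] by simp
 qed
 have Td: "T = dn (A\<^sup>T *v u - t\<^sup>2 *s vecS C)"
  unfolding T_def dn_def sc using VD(1) sym_matsD(1)[OF C] sym_matsD(1)[OF smat_sym[of n "A\<^sup>T *v u"]]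
  by (simp add: mat_dims mult_smult_dim smult_mult_dim mult_minus_dim minus_mult_dim)
 have T: "T \<in> sym_mats n" unfolding Td by (rule dn_sym)
 have eT: "had ee T \<in> sym_mats n" by (rule had_sym[OF T]) (simp add: ee_def mult.commute)
 show s: "had ee T + unpack v \<in> sym_mats n" by (rule sym_add[OF eT unpack_sym])
 have "EE *v (A\<^sup>T *v u - t\<^sup>2 *s vecS C) + QQ *v v = up (had ee T + unpack v)"
  unfolding EE_mult[OF wc] Td[symmetric] bigQ_up[OF v] up_linear[OF eT unpack_sym] ..
 then show "matS n (EE *v (A\<^sup>T *v u - t\<^sup>2 *s vecS C) + QQ *v v) = V * (had ee T + unpack v) * V\<^sup>T"
  using smat_vecS[OF conj_V_sym[OF s]] matS_eq_smat[OF up_carrier] by (simp add: up_def)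
qed

end

section \<open>The program\<close>

text \<open>Use of the blocks: 0 eigenbasis, 1 eigenvalues, 2 and 3 the data \<open>b\<close> and \<open>C\<close>; 5 to 9 scratch, where 6 receives
 \<open>V\<^sup>T S V\<close>, 7 receives \<open>V S V\<^sup>T\<close> and 8 the results of calls; 10 and 11 the weights of \<open>E \<otimes> E\<close> and of \<open>\<tau>\<^sup>2 \<Sigma>\<close>;
 12 the coordinates of \<open>\<tau>\<^sup>2 C\<close>; 13 the right-hand side; 14, 15 and 16 the direction, its predecessor and the
 iterate; 17 and 18 the images of the direction under the matrix and its square; 19 scratch; 20, 21 and 22 the
 constants \<open>0\<close>, \<open>1\<close> and \<open>1 / sqrt 2\<close>; 23 and 24 \<open>\<tau>\<close> and \<open>\<tau>\<^sup>2\<close>; 25 to 29 the scalars of the recurrence;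
 30 the eigenvalues of \<open>E\<close>; 31 the constant \<open>2\<close>. All blocks but the input start with zeros.\<close>

definition down_ops :: "nat \<Rightarrow> nat \<Rightarrow> bop list" where
 "down_ops n s =
  [Dot 5 (n * n) n (\<lambda>p l. (s, p mod n + n * l)) (\<lambda>p l. (0, l + n * (p div n))),
   Dot 6 (n * n) n (\<lambda>p l. (0, l + n * (p mod n))) (\<lambda>p l. (5, l + n * (p div n)))]"

definition up_ops :: "nat \<Rightarrow> nat \<Rightarrow> bop list" where
 "up_ops n s =
  [Dot 5 (n * n) n (\<lambda>p l. (0, p mod n + n * l)) (\<lambda>p l. (s, l + n * (p div n))),
   Dot 7 (n * n) n (\<lambda>p l. (5, p mod n + n * l)) (\<lambda>p l. (0, p div n + n * l))]"

text \<open>Coordinates of \<open>A\<^sup>T u\<close>: unpack with the factor \<open>1 / sqrt 2\<close> off the diagonal, then conjugate.\<close>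

definition adjoint_ops :: "nat \<Rightarrow> nat \<Rightarrow> bop list" where
 "adjoint_ops n s =
  [CallAT 8 s,
   Bin Times 9 (n * n) (\<lambda>p. (8, tri_pos n (p mod n) (p div n))) (\<lambda>p. if p mod n = p div n then (21, 0) else (22, 0))]
  @ down_ops n 9"

text \<open>The symmetric matrix with packing \<open>E w + Q v\<close>, from the coordinates of \<open>w\<close> in block 6 and those of \<open>v\<close>
 after the first \<open>m\<close> entries of block \<open>s\<close>.\<close>

definition combine_ops :: "nat \<Rightarrow> nat \<Rightarrow> nat \<Rightarrow> bop list" where
 "combine_ops n m s =
  [Bin Times 9 (n * n) (\<lambda>p. (10, p)) (\<lambda>p. (6, p)), Bin Plus 9 (n * n) (\<lambda>p. (9, p)) (\<lambda>p. (s, m + p))] @ up_ops n 9"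

definition masked :: "nat \<Rightarrow> nat \<Rightarrow> nat \<Rightarrow> nat \<Rightarrow> nat \<times> nat" where
 "masked n r i q = (if q mod n < r \<or> q div n < r then (i, q) else (20, 0))"

definition apply_ops :: "nat \<Rightarrow> nat \<Rightarrow> nat \<Rightarrow> nat \<Rightarrow> nat \<Rightarrow> bop list" where
 "apply_ops n m r s d = adjoint_ops n s @ combine_ops n m s @
  [CallA 8 7,
   Bin Times 5 (n * n) (\<lambda>p. (11, p)) (\<lambda>p. (s, m + p)),
   Bin Minus d (n * n + m) (\<lambda>p. if p < m then (8, p) else masked n r 6 (p - m))
    (\<lambda>p. if p < m then (20, 0) else (5, p - m))]"

definition scalar_ops :: "nat \<Rightarrow> nat \<Rightarrow> bop list" where
 "scalar_ops n r =
  [Fill 21 1 1, Fill 22 1 (1 / sqrt 2), Fill 31 1 2,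
   Bin Over 23 1 (\<lambda>p. (1, r)) (\<lambda>p. (31, 0)),
   Bin Times 24 1 (\<lambda>p. (23, 0)) (\<lambda>p. (23, 0)),
   Bin Over 30 n (\<lambda>p. if p < r then (21, 0) else (1, p)) (\<lambda>p. if p < r then (21, 0) else (23, 0))]"

text \<open>On the lower right block the denominator \<open>sg\<close> is \<open>0\<close>, and division by zero supplies the mask.\<close>

definition weight_ops :: "nat \<Rightarrow> bop list" where
 "weight_ops n =
  [Bin Times 10 (n * n) (\<lambda>p. (30, p mod n)) (\<lambda>p. (30, p div n)),
   Bin Times 5 (n * n) (\<lambda>p. (1, p mod n)) (\<lambda>p. (1, p div n)),
   Bin Times 6 (n * n) (\<lambda>p. (24, 0)) (\<lambda>p. (10, p)),
   Bin Minus 5 (n * n) (\<lambda>p. (5, p)) (\<lambda>p. (6, p)),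
   Bin Over 11 (n * n) (\<lambda>p. (24, 0)) (\<lambda>p. (5, p))]"

definition init_ops :: "nat \<Rightarrow> nat \<Rightarrow> nat \<Rightarrow> bop list" where
 "init_ops n m r = scalar_ops n r @ weight_ops n @ down_ops n 3 @
  [Bin Times 12 (n * n) (\<lambda>p. (24, 0)) (\<lambda>p. (6, p)), Bin Times 9 (n * n) (\<lambda>p. (10, p)) (\<lambda>p. (12, p))]
  @ up_ops n 9 @
  [CallA 8 7,
   Bin Plus 13 (n * n + m) (\<lambda>p. if p < m then (2, p) else masked n r 12 (p - m))
    (\<lambda>p. if p < m then (8, p) else (20, 0)),
   Bin Plus 14 (n * n + m) (\<lambda>p. (13, p)) (\<lambda>p. (20, 0))]"

definition coefficient_ops :: "nat \<Rightarrow> bop list" where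
 "coefficient_ops s =
  [Dot 25 1 s (\<lambda>p l. (17, l)) (\<lambda>p l. (17, l)),
   Dot 27 1 s (\<lambda>p l. (18, l)) (\<lambda>p l. (17, l)),
   Bin Over 27 1 (\<lambda>p. (27, p)) (\<lambda>p. (25, 0)),
   Dot 28 1 s (\<lambda>p l. (17, l)) (\<lambda>p l. (13, l)),
   Bin Over 28 1 (\<lambda>p. (28, p)) (\<lambda>p. (25, 0)),
   Bin Over 29 1 (\<lambda>p. (25, 0)) (\<lambda>p. (26, 0))]"

definition direction_ops :: "nat \<Rightarrow> bop list" where
 "direction_ops s =
  [Bin Times 19 s (\<lambda>p. (27, 0)) (\<lambda>p. (14, p)), Bin Minus 17 s (\<lambda>p. (17, p)) (\<lambda>p. (19, p)),
   Bin Times 19 s (\<lambda>p. (29, 0)) (\<lambda>p. (15, p)), Bin Minus 17 s (\<lambda>p. (17, p)) (\<lambda>p. (19, p))]"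

definition advance_ops :: "nat \<Rightarrow> bop list" where
 "advance_ops s =
  [Bin Times 19 s (\<lambda>p. (28, 0)) (\<lambda>p. (14, p)), Bin Plus 16 s (\<lambda>p. (16, p)) (\<lambda>p. (19, p)),
   Bin Plus 15 s (\<lambda>p. (14, p)) (\<lambda>p. (20, 0)), Bin Plus 14 s (\<lambda>p. (17, p)) (\<lambda>p. (20, 0)),
   Bin Plus 26 1 (\<lambda>p. (25, 0)) (\<lambda>p. (20, 0))]"

definition update_ops :: "nat \<Rightarrow> bop list" where
 "update_ops s = coefficient_ops s @ direction_ops s @ advance_ops s"

definition iter_ops :: "nat \<Rightarrow> nat \<Rightarrow> nat \<Rightarrow> bop list" where
 "iter_ops n m r = apply_ops n m r 14 17 @ apply_ops n m r 17 18 @ update_ops (n * n + m)"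

definition final_ops :: "nat \<Rightarrow> nat \<Rightarrow> bop list" where
 "final_ops n m = adjoint_ops n 16 @ [Bin Minus 6 (n * n) (\<lambda>p. (6, p)) (\<lambda>p. (12, p))] @ combine_ops n m 16 @
  [Bin Over 8 m (\<lambda>p. (16, p)) (\<lambda>p. (24, 0))]"

definition all_ops :: "nat \<Rightarrow> nat \<Rightarrow> nat \<Rightarrow> nat \<Rightarrow> bop list" where
 "all_ops n m r k = init_ops n m r @ concat (replicate k (iter_ops n m r)) @ final_ops n m"

definition newton_program :: "nat \<Rightarrow> nat \<Rightarrow> nat \<Rightarrow> nat \<Rightarrow> instr list" where
 "newton_program n m r k = concat (map (compile n m) (all_ops n m r k)) @
  map (\<lambda>p. Add p (if p < n * n then addr n m (7, p) else addr n m (8, p - n * n)) (addr n m (20, 0))) [0..<n * n + m]"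

lemma pos_lt: "a < n ==> b < n ==> a + n * b < (n * n :: nat)"
 using colvec_index_pair(2)[OF zero_carrier_mat] by blast

lemma readable_work: "4 < i ==> i < 32 ==> readable n m (i, q) \<longleftrightarrow> q < n * n + m"
 by (simp add: readable_def bsize_def)

lemma readable_input:
 "readable n m (0, q) \<longleftrightarrow> q < n * n" "readable n m (1, q) \<longleftrightarrow> q < n"
 "readable n m (Suc 0, q) \<longleftrightarrow> q < n" "readable n m (2, q) \<longleftrightarrow> q < m" "readable n m (3, q) \<longleftrightarrow> q < n * n"
 by (simp_all add: readable_def bsize_def)

lemma bsize_work: "4 < i ==> bsize n m i = n * n + m" by (simp add: bsize_def)

lemma admissible_ops:
 assumes r: "r < n" and m: "m \<le> n * n"
 shows "\<forall>op \<in> set (init_ops n m r). admissible n m op" and "\<forall>op \<in> set (iter_ops n m r). admissible n m op"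
  and "\<forall>op \<in> set (final_ops n m). admissible n m op"
proof -
 have n: "1 \<le> n" using r by simp
 have c: "n * n \<le> n ^ 3" "n \<le> n ^ 3" "1 \<le> n ^ 3"
  using power_increasing[of 2 3 n] power_increasing[of 1 3 n] n by (simp_all add: power2_eq_square)
 have e: "n * n * (2 * n + 1) = 2 * n ^ 3 + n * n" by (simp add: power3_eq_cube algebra_simps)
 have "2 * n ^ 3 + n * n \<le> 9 * n ^ 3" using c by linarith
 then have b1: "cheap n (n * n) n" unfolding cheap_def e .
 have "2 * (a + m) + 1 \<le> 9 * b" if "a \<le> b" "1 \<le> b" "m \<le> a" for a b :: nat
 proof -
  have "2 * (a + m) \<le> 2 * (b + b)" using that by (intro mult_le_mono2) simp
  then show ?thesis using that(2) by simp
 qed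
 from this[OF c(1,3) m] have "2 * (n * n + m) + 1 \<le> 9 * n ^ 3" .
 then have b2: "cheap n (Suc 0) (n * n + m)" "cheap n (n * n + m) 0" "cheap n (n * n) 0" "cheap n m 0" "cheap n (Suc 0) 0"
  unfolding cheap_def by simp_all
 have b3: "cheap n n 0" unfolding cheap_def using c by simp
 define s where "s = n * n + m"
 have tr: "tri n \<le> s" using n mult_le_mono2[of "n + 1" "2 * n" n] unfolding tri_def s_def by linarith
 have ns: "n \<le> s" unfolding s_def using mult_le_mono1[OF n, of n] by linarith
 have s: "n * n \<le> s" "m \<le> s" "0 < s" "Suc 0 \<le> s" using ns n by (simp_all add: s_def)
 have md: "p mod n < n" "p div n < n" if "p < n * n" for p using div_mod_bound[OF that] by simp_all
 have i: "p mod n + n * l < n * n" "l + n * (p mod n) < n * n" "l + n * (p div n) < n * n" "p div n + n * l < n * n"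
  if "p < n * n" "l < n" for p l
  using pos_lt md[OF that(1)] that(2) by simp_all
 have i': "p mod n + n * l < s" "l + n * (p mod n) < s" "l + n * (p div n) < s" "p div n + n * l < s"
  if "p < n * n" "l < n" for p l
  using i[OF that] s by linarith+
 have tp: "tri_pos n (p mod n) (p div n) < s" if "p < n * n" for p
  using tri_pos(1)[of "p mod n" n "p div n"] md[OF that] tr by simp
 have md': "p mod n < s" "p div n < s" "p < s" "m + p < s" if "p < n * n" for p
  using md[OF that] ns that unfolding s_def by linarith+
 have pm: "p < s" if "p < m" for p using that s by simp
 have mk: "readable n m (masked n r i q)" "fst (masked n r i q) \<noteq> 13"
  if "4 < i" "i < 13" "q < n * n" for i q
  using that md'[OF that(3)] s by (simp_all add: masked_def readable_work s_def[symmetric])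
 have sub: "p - m < n * n" if "p < s" "\<not> p < m" for p using that by (simp add: s_def)
 have mk2: "fst (masked n r i q) = d \<longrightarrow> snd (masked n r i q) = p" if "i \<noteq> d" "d \<noteq> 20" for i q d p
  using that by (simp add: masked_def)
 note simps = readable_work readable_input bsize_work s_def[symmetric] b1 b2[folded s_def] b3 s tr
 have down: "\<forall>op \<in> set (down_ops n j). admissible n m op" if "j = 3 \<or> j = 9" for j
  using that by (elim disjE) (simp_all add: down_ops_def simps i i')
 have up: "\<forall>op \<in> set (up_ops n 9). admissible n m op"
  by (simp add: up_ops_def simps i i')
 have adj: "\<forall>op \<in> set (adjoint_ops n j). admissible n m op" if "j \<in> {14, 16, 17}" for j
 proof -
  have "4 < j" "j < 32" "j \<noteq> 8" using that by auto
  then show ?thesis using down[of 9] by (simp add: adjoint_ops_def simps tp)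
 qed
 have com: "\<forall>op \<in> set (combine_ops n m j). admissible n m op" if "j \<in> {14, 16, 17}" for j
 proof -
  have "4 < j" "j < 32" "j \<noteq> 9" using that by auto
  then show ?thesis using up by (simp add: combine_ops_def simps md')
 qed
 have app: "\<forall>op \<in> set (apply_ops n m r j k). admissible n m op" if j: "j \<in> {14, 17}" and k: "k \<in> {17, 18}" for j k
 proof -
  have j': "4 < j" "j < 32" "j \<noteq> 5" and k': "4 < k" "k < 32" "k \<noteq> 5" "k \<noteq> 6" "k \<noteq> 8" "k \<noteq> 20" using j k by auto
  have "admissible n m (Bin Minus k (n * n + m) (\<lambda>p. if p < m then (8, p) else masked n r 6 (p - m))
    (\<lambda>p. if p < m then (20, 0) else (5, p - m)))"
   unfolding admissible.simps s_def[symmetric]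
  proof (intro conjI allI impI)
   fix p assume p: "p < s"
   show "readable n m (if p < m then (8, p) else masked n r 6 (p - m))"
    using p mk(1)[OF _ _ sub[OF p]] by (simp add: simps)
   show "fst (if p < m then (8, p) else masked n r 6 (p - m)) = k ==>
     snd (if p < m then (8, p) else masked n r 6 (p - m)) = p"
    using k' mk2[of 6 k "p - m" p] by (cases "p < m") auto
   show "readable n m (if p < m then (20, 0) else (5, p - m))"
    using p s less_imp_diff_less[OF p, of m] by (simp add: simps)
   show "fst (if p < m then (20, 0) else (5, p - m)) = k ==> snd (if p < m then (20, 0) else (5, p - m)) = p"
    using k' by (cases "p < m") auto
  qed (use k' in \<open>simp_all add: simps\<close>)
  moreover have "admissible n m (CallA 8 7)" "admissible n m (Bin Times 5 (n * n) (\<lambda>p. (11, p)) (\<lambda>p. (j, m + p)))"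
   using j' by (simp_all add: simps md')
  ultimately show ?thesis using adj[of j] com[of j] j by (simp add: apply_ops_def) blast
 qed
 show "\<forall>op \<in> set (init_ops n m r). admissible n m op"
 proof -
  have "admissible n m (Bin Plus 13 (n * n + m) (\<lambda>p. if p < m then (2, p) else masked n r 12 (p - m))
    (\<lambda>p. if p < m then (8, p) else (20, 0)))"
   unfolding admissible.simps s_def[symmetric]
  proof (intro conjI allI impI)
   fix p assume p: "p < s"
   show "readable n m (if p < m then (2, p) else masked n r 12 (p - m))"
    using p mk(1)[OF _ _ sub[OF p]] by (simp add: simps)
   show "fst (if p < m then (2, p) else masked n r 12 (p - m)) = 13 ==>
     snd (if p < m then (2, p) else masked n r 12 (p - m)) = p"
    using mk2[of 12 13 "p - m" p] by (cases "p < m") auto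
   show "readable n m (if p < m then (8, p) else (20, 0))" using p s by (simp add: simps)
   show "fst (if p < m then (8, p) else (20 :: nat, 0)) = 13 ==> snd (if p < m then (8, p) else (20, 0)) = p"
    by (cases "p < m") auto
  qed (simp_all add: simps)
  moreover have "admissible n m (Bin Over 30 n (\<lambda>p. if p < r then (21, 0) else (1, p)) (\<lambda>p. if p < r then (21, 0) else (23, 0)))"
   using r ns by (simp add: simps)
  moreover have "admissible n m (Bin Over 23 1 (\<lambda>p. (1, r)) (\<lambda>p. (31, 0)))" using r by (simp add: simps)
  moreover have "admissible n m (CallA 8 7)" by (simp add: simps)
  ultimately show ?thesis using down[of 3] up unfolding init_ops_def scalar_ops_def weight_ops_def set_append ball_Un
   by (simp del: admissible.simps(2)) (simp add: simps md md')
 qed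
 show "\<forall>op \<in> set (iter_ops n m r). admissible n m op"
  using app[of 14 17] app[of 17 18] unfolding iter_ops_def set_append ball_Un
  by (simp add: update_ops_def coefficient_ops_def direction_ops_def advance_ops_def simps)
 show "\<forall>op \<in> set (final_ops n m). admissible n m op"
  using adj[of 16] com[of 16] unfolding final_ops_def set_append ball_Un by (simp add: simps md' pm)
qed

definition holds_mat :: "nat \<Rightarrow> (nat \<Rightarrow> real) \<Rightarrow> real mat \<Rightarrow> bool" where
 "holds_mat n g X \<longleftrightarrow> (\<forall>a<n. \<forall>b<n. g (a + n * b) = X $$ (a, b))"

definition holds_vec :: "(nat \<Rightarrow> real) \<Rightarrow> real vec \<Rightarrow> bool" where
 "holds_vec g x \<longleftrightarrow> (\<forall>p<dim_vec x. g p = x $ p)"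

lemma holds_matD: "holds_mat n g X ==> a < n ==> b < n ==> g (a + n * b) = X $$ (a, b)"
 by (simp add: holds_mat_def)

lemma holds_mat_pos:
 assumes "holds_mat n g X" "q < n * n"
 shows "g q = X $$ (q mod n, q div n)"
 using holds_matD[OF assms(1), of "q mod n" "q div n"] div_mod_bound[OF assms(2)] by (simp add: mult.commute)

lemma holds_vecD: "holds_vec g x ==> p < dim_vec x ==> g p = x $ p"
 by (simp add: holds_vec_def)

lemma holds_vec_dot:
 assumes "holds_vec g x" "holds_vec h y" "dim_vec x = k" "dim_vec y = k"
 shows "(\<Sum>l<k. g l * h l) = x \<bullet> y"
 using assms by (simp add: holds_vec_def scalar_prod_def lessThan_atLeast0)

lemma read_sym_holds:
 assumes g: "holds_mat n g X" and X: "X \<in> sym_mats n"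
 shows "read_sym n g = X"
proof (rule eq_matI)
 fix i j assume "i < dim_row X" "j < dim_col X"
 then have ij: "i < n" "j < n" using sym_matsD(1)[OF X] by auto
 have "g (max i j + n * min i j) = X $$ (max i j, min i j)" by (rule holds_matD[OF g]) (use ij in auto)
 then show "read_sym n g $$ (i, j) = X $$ (i, j)"
  using ij sym_index[OF X, of i j] by (auto simp: read_sym_def min_def max_def add.commute mult.commute split: if_splits)
qed (use sym_matsD(1)[OF X] in \<open>auto simp: read_sym_def\<close>)

lemma pos_mod: "a < n ==> (a + n * b) mod n = a" "a < n ==> (a + n * b) div n = (b :: nat)"
 by simp_all

lemma mult_mat_entry_sum:
 assumes "X \<in> carrier_mat k k" "Y \<in> carrier_mat k k" "a < k" "b < k"
 shows "(X * Y) $$ (a, b) = (\<Sum>l<k. X $$ (a, l) * Y $$ (l, b))"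
 using assms by (simp add: scalar_prod_def lessThan_atLeast0)

context augmented
begin

abbreviation exec :: "bop list \<Rightarrow> blocks \<Rightarrow> blocks" where "exec ops \<sigma> \<equiv> fold (bstep n A) ops \<sigma>"

lemma down_ops:
 assumes V0: "holds_mat n (\<sigma> 0) V" and S: "holds_mat n (\<sigma> s) S" "S \<in> carrier_mat n n"
 shows "holds_mat n (exec (down_ops n s) \<sigma> 6) (V\<^sup>T * S * V)"
  and "i \<noteq> 5 ==> i \<noteq> 6 ==> exec (down_ops n s) \<sigma> i = \<sigma> i"
proof -
 have Vc: "V \<in> carrier_mat n n" by (rule VD(1))
 have SV: "S * V \<in> carrier_mat n n" using S Vc by simp
 have eq: "V\<^sup>T * S * V = V\<^sup>T * (S * V)" by (rule assoc_mult_mat) (use S Vc in auto)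
 have "exec (down_ops n s) \<sigma> 6 (a + n * b) = (V\<^sup>T * S * V) $$ (a, b)" if ab: "a < n" "b < n" for a b
 proof -
  have "exec (down_ops n s) \<sigma> 6 (a + n * b) = (\<Sum>l<n. \<sigma> 0 (l + n * a) * (\<Sum>k<n. \<sigma> s (l + n * k) * \<sigma> 0 (k + n * b)))"
   using ab by (simp add: down_ops_def bput_def bget_def pos_lt pos_mod)
  also have "\<dots> = (\<Sum>l<n. V\<^sup>T $$ (a, l) * (S * V) $$ (l, b))"
   using ab Vc by (intro sum.cong refl) (simp add: mult_mat_entry_sum[OF S(2) Vc] holds_matD[OF V0] holds_matD[OF S(1)] del: index_mult_mat)
  also have "\<dots> = (V\<^sup>T * S * V) $$ (a, b)"
   unfolding eq by (rule mult_mat_entry_sum[symmetric]) (use SV Vc ab in auto)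
  finally show ?thesis .
 qed
 then show "holds_mat n (exec (down_ops n s) \<sigma> 6) (V\<^sup>T * S * V)" by (simp add: holds_mat_def)
 show "i \<noteq> 5 ==> i \<noteq> 6 ==> exec (down_ops n s) \<sigma> i = \<sigma> i" by (simp add: down_ops_def bput_def)
qed

lemma up_ops:
 assumes V0: "holds_mat n (\<sigma> 0) V" and S: "holds_mat n (\<sigma> s) S" "S \<in> carrier_mat n n"
 shows "holds_mat n (exec (up_ops n s) \<sigma> 7) (V * S * V\<^sup>T)"
  and "i \<noteq> 5 ==> i \<noteq> 7 ==> exec (up_ops n s) \<sigma> i = \<sigma> i"
proof -
 have Vc: "V \<in> carrier_mat n n" by (rule VD(1))
 have VS: "V * S \<in> carrier_mat n n" using S Vc by simp
 have "exec (up_ops n s) \<sigma> 7 (a + n * b) = (V * S * V\<^sup>T) $$ (a, b)" if ab: "a < n" "b < n" for a b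
 proof -
  have "exec (up_ops n s) \<sigma> 7 (a + n * b) = (\<Sum>l<n. (\<Sum>k<n. \<sigma> 0 (a + n * k) * \<sigma> s (k + n * l)) * \<sigma> 0 (b + n * l))"
   using ab by (simp add: up_ops_def bput_def bget_def pos_lt pos_mod)
  also have "\<dots> = (\<Sum>l<n. (V * S) $$ (a, l) * V\<^sup>T $$ (l, b))"
   using ab Vc by (intro sum.cong refl) (simp add: mult_mat_entry_sum[OF Vc S(2)] holds_matD[OF V0] holds_matD[OF S(1)] del: index_mult_mat)
  also have "\<dots> = (V * S * V\<^sup>T) $$ (a, b)"
   by (rule mult_mat_entry_sum[symmetric]) (use VS Vc ab in auto)
  finally show ?thesis .
 qed
 then show "holds_mat n (exec (up_ops n s) \<sigma> 7) (V * S * V\<^sup>T)" by (simp add: holds_mat_def)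
 show "i \<noteq> 5 ==> i \<noteq> 7 ==> exec (up_ops n s) \<sigma> i = \<sigma> i" by (simp add: up_ops_def bput_def)
qed

lemma adjoint_ops:
 assumes V0: "holds_mat n (\<sigma> 0) V" and c: "\<sigma> 21 0 = 1" "\<sigma> 22 0 = 1 / sqrt 2"
  and u: "u \<in> carrier_vec m" "\<And>p. p < m ==> \<sigma> s p = u $ p"
 shows "holds_mat n (exec (adjoint_ops n s) \<sigma> 6) (V\<^sup>T * smat n (A\<^sup>T *v u) * V)"
  and "i \<notin> {5, 6, 8, 9} ==> exec (adjoint_ops n s) \<sigma> i = \<sigma> i"
proof -
 define \<tau> where "\<tau> = exec (take 2 (adjoint_ops n s)) \<sigma>"
 have e: "exec (adjoint_ops n s) \<sigma> = exec (down_ops n 9) \<tau>" by (simp add: adjoint_ops_def \<tau>_def)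
 have fr: "\<tau> i = \<sigma> i" if "i \<noteq> 8" "i \<noteq> 9" for i using that by (simp add: \<tau>_def adjoint_ops_def bput_def)
 have uv: "vec m (\<sigma> s) = u" by (rule eq_vecI) (use u in auto)
 have dA: "dim_row A = m" "dim_col A = tri n" using A by auto
 have "\<tau> 9 (a + n * b) = smat n (A\<^sup>T *v u) $$ (a, b)" if ab: "a < n" "b < n" for a b
  using ab c tri_pos(1)[OF ab] by (simp add: \<tau>_def adjoint_ops_def bput_def bget_def pos_lt pos_mod smat_def dA uv del: index_mult_mat_vec)
 then have h9: "holds_mat n (\<tau> 9) (smat n (A\<^sup>T *v u))" by (simp add: holds_mat_def)
 have h0: "holds_mat n (\<tau> 0) V" using V0 fr by simp
 note d = down_ops[OF h0 h9 sym_matsD(1)[OF smat_sym]]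
 show "holds_mat n (exec (adjoint_ops n s) \<sigma> 6) (V\<^sup>T * smat n (A\<^sup>T *v u) * V)" unfolding e by (rule d(1))
 show "i \<notin> {5, 6, 8, 9} ==> exec (adjoint_ops n s) \<sigma> i = \<sigma> i" unfolding e using d(2) fr by simp
qed

lemma combine_ops:
 assumes V0: "holds_mat n (\<sigma> 0) V" and E: "holds_mat n (\<sigma> 10) (mat n n (\<lambda>(i, j). ee i j))"
  and T: "holds_mat n (\<sigma> 6) T" "T \<in> carrier_mat n n" and Z: "holds_mat n (\<lambda>p. \<sigma> s (m + p)) Z" "Z \<in> carrier_mat n n" "s \<noteq> 9"
 shows "holds_mat n (exec (combine_ops n m s) \<sigma> 7) (V * (had ee T + Z) * V\<^sup>T)"
  and "i \<notin> {5, 7, 9} ==> exec (combine_ops n m s) \<sigma> i = \<sigma> i"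
proof -
 define \<tau> where "\<tau> = exec (take 2 (combine_ops n m s)) \<sigma>"
 have e: "exec (combine_ops n m s) \<sigma> = exec (up_ops n 9) \<tau>" by (simp add: combine_ops_def \<tau>_def)
 have fr: "\<tau> i = \<sigma> i" if "i \<noteq> 9" for i using that by (simp add: \<tau>_def combine_ops_def bput_def)
 have "\<tau> 9 (a + n * b) = (had ee T + Z) $$ (a, b)" if ab: "a < n" "b < n" for a b
  using ab Z T holds_matD[OF E ab] holds_matD[OF T(1) ab] holds_matD[OF Z(1) ab]
  by (simp add: \<tau>_def combine_ops_def bput_def bget_def pos_lt)
 then have h9: "holds_mat n (\<tau> 9) (had ee T + Z)" by (simp add: holds_mat_def)
 have h0: "holds_mat n (\<tau> 0) V" using V0 fr by simp
 have cc: "had ee T + Z \<in> carrier_mat n n" using Z by simp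
 note d = up_ops[OF h0 h9 cc]
 show "holds_mat n (exec (combine_ops n m s) \<sigma> 7) (V * (had ee T + Z) * V\<^sup>T)" unfolding e by (rule d(1))
 show "i \<notin> {5, 7, 9} ==> exec (combine_ops n m s) \<sigma> i = \<sigma> i" unfolding e using d(2) fr by simp
qed

definition stocked :: "real mat \<Rightarrow> real vec \<Rightarrow> blocks \<Rightarrow> bool" where
 "stocked T0 b0 \<sigma> \<longleftrightarrow> holds_mat n (\<sigma> 0) V \<and> holds_mat n (\<sigma> 10) (mat n n (\<lambda>(i, j). ee i j)) \<and>
  holds_mat n (\<sigma> 11) (mat n n (\<lambda>(i, j). dd i j)) \<and> holds_mat n (\<sigma> 12) T0 \<and> holds_vec (\<sigma> 13) b0 \<and>
  \<sigma> 20 0 = 0 \<and> \<sigma> 21 0 = 1 \<and> \<sigma> 22 0 = 1 / sqrt 2 \<and> \<sigma> 24 0 = t\<^sup>2"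

lemma stocked_cong:
 assumes "stocked T0 b0 \<sigma>" "\<And>i. i \<in> {0, 10, 11, 12, 13, 20, 21, 22, 24} ==> \<tau> i = \<sigma> i"
 shows "stocked T0 b0 \<tau>"
 using assms by (simp add: stocked_def)

lemma holds_emb:
 assumes h: "holds_vec g (emb z)"
 shows "\<And>p. p < m ==> g p = vec_first z m $ p" and "holds_mat n (\<lambda>p. g (m + p)) (unpack (vec_last z d))"
proof -
 show "g p = vec_first z m $ p" if "p < m" for p
  using holds_vecD[OF h, of p] that by (simp add: emb_carrier) (simp add: emb_def)
 show "holds_mat n (\<lambda>p. g (m + p)) (unpack (vec_last z d))"
  unfolding holds_mat_def
 proof (intro allI impI)
  fix a b assume ab: "a < n" "b < n"
  have "g (m + (a + n * b)) = emb z $ (m + (a + n * b))"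
   by (rule holds_vecD[OF h]) (use pos_lt[OF ab] in \<open>simp add: emb_carrier\<close>)
  also have "\<dots> = colvec (unpack (vec_last z d)) $ (a + n * b)"
   unfolding emb_def using pos_lt[OF ab] by simp
  also have "\<dots> = unpack (vec_last z d) $$ (a, b)"
   by (rule colvec_index_pair(1)[of _ n n]) (use ab in \<open>auto intro: carrier_matI\<close>)
  finally show "g (m + (a + n * b)) = unpack (vec_last z d) $$ (a, b)" .
 qed
qed

lemma masked_get:
 assumes h: "holds_mat n (\<sigma> i) T" and T: "T \<in> carrier_mat n n" and z: "\<sigma> 20 0 = 0" and q: "q < n * n"
 shows "bget \<sigma> (masked n r i q) = colvec (had msk T) $ q"
 using holds_mat_pos[OF h q] z div_mod_bound[OF q] T q by (simp add: bget_def masked_def index_colvec msk_def)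

lemma apply_ops:
 assumes K: "stocked T0 b0 \<sigma>" and z: "z \<in> carrier_vec (m + d)" and h: "holds_vec (\<sigma> s) (emb z)"
  and s: "s \<notin> {5, 6, 7, 8, 9}" and d: "dst \<notin> {5, 6, 7, 8, 9}"
 shows "holds_vec (exec (apply_ops n m r s dst) \<sigma> dst) (emb (M *v z))"
  and "i \<notin> {5, 6, 7, 8, 9, dst} ==> exec (apply_ops n m r s dst) \<sigma> i = \<sigma> i"
proof -
 define u v Z where "u = vec_first z m" and "v = vec_last z (eigenbasis.d n r)" and "Z = unpack v"
 note sz = split_vec[OF z, folded u_def v_def]
 note he = holds_emb[OF h, folded u_def v_def, folded Z_def]
 note k = K[unfolded stocked_def]
 define T where "T = V\<^sup>T * smat n (A\<^sup>T *v u) * V"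
 have T: "T \<in> sym_mats n" using dn_sym[of "A\<^sup>T *v u"] by (simp add: T_def dn_def)
 have Z: "Z \<in> sym_mats n" unfolding Z_def by (rule unpack_sym)
 note Tc = sym_matsD(1)[OF T] and Zc = sym_matsD(1)[OF Z]
 have eT: "had ee T \<in> sym_mats n" by (rule had_sym[OF T]) (simp add: ee_def mult.commute)
 define \<sigma>1 where "\<sigma>1 = exec (adjoint_ops n s) \<sigma>"
 have h1: "holds_mat n (\<sigma>1 6) T" and f1: "\<And>i. i \<notin> {5, 6, 8, 9} ==> \<sigma>1 i = \<sigma> i"
 proof -
  have k': "holds_mat n (\<sigma> 0) V" "\<sigma> 21 0 = 1" "\<sigma> 22 0 = 1 / sqrt 2" using k by blast+
  show "holds_mat n (\<sigma>1 6) T" unfolding \<sigma>1_def T_def by (rule adjoint_ops(1)[OF k' sz(1)]) (rule he(1))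
  show "\<sigma>1 i = \<sigma> i" if "i \<notin> {5, 6, 8, 9}" for i
   unfolding \<sigma>1_def by (rule adjoint_ops(2)[OF k' sz(1) _ that]) (rule he(1))
 qed
 define \<sigma>2 where "\<sigma>2 = exec (combine_ops n m s) \<sigma>1"
 have E1: "holds_mat n (\<sigma>1 10) (mat n n (\<lambda>(i, j). ee i j))" and V1: "holds_mat n (\<sigma>1 0) V" using k f1 by simp_all
 have Z1: "holds_mat n (\<lambda>p. \<sigma>1 s (m + p)) Z" using he(2) f1[of s] s by simp
 have s9: "s \<noteq> 9" using s by simp
 note cb = combine_ops[OF V1 E1 h1 Tc Z1 Zc s9, folded \<sigma>2_def]
 note sc = cb(1) and f2 = cb(2)
 define X where "X = V * (had ee T + Z) * V\<^sup>T"
 have X: "X \<in> sym_mats n" unfolding X_def by (rule conj_V_sym[OF sym_add[OF eT Z]])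
 define y where "y = A *v vecS X"
 have y: "y \<in> carrier_vec m" unfolding y_def X_def using mult_mat_vec_carrier[OF A up_carrier, of "had ee T + Z"] by (simp add: up_def)
 have ry: "A *v vecS (read_sym n (\<sigma>2 7)) = y" unfolding read_sym_holds[OF sc[folded X_def] X] y_def ..
 define \<sigma>3 where "\<sigma>3 = exec [CallA 8 7, Bin Times 5 (n * n) (\<lambda>p. (11, p)) (\<lambda>p. (s, m + p))] \<sigma>2"
 have dA: "dim_row A = m" using A by simp
 have g8: "\<sigma>3 8 p = y $ p" if "p < m" for p using that by (simp add: \<sigma>3_def bput_def dA ry)
 have f3: "\<sigma>3 i = \<sigma>2 i" if "i \<notin> {5, 8}" for i using that by (simp add: \<sigma>3_def bput_def)
 have g5: "\<sigma>3 5 q = colvec (had dd Z) $ q" if q: "q < n * n" for q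
 proof -
  have "\<sigma>3 5 q = \<sigma> 11 q * \<sigma> s (m + q)" using q s f2 f1 by (simp add: \<sigma>3_def bput_def bget_def)
  also have "\<dots> = dd (q mod n) (q div n) * Z $$ (q mod n, q div n)"
   using holds_mat_pos[OF he(2) q] holds_mat_pos[OF conjunct1[OF conjunct2[OF conjunct2[OF k]]] q] div_mod_bound[OF q]
   by simp
  finally show ?thesis using q div_mod_bound[OF q] Zc by (simp add: index_colvec)
 qed
 have h6: "holds_mat n (\<sigma>3 6) T" and z20: "\<sigma>3 20 0 = 0" using h1 f1 f2 f3 k by simp_all
 define x where "x = y @\<^sub>v colvec (had msk T - had dd Z)"
 have e: "exec (apply_ops n m r s dst) \<sigma> = bput dst (n * n + m)
   (\<lambda>p. bget \<sigma>3 (if p < m then (8, p) else masked n r 6 (p - m)) - bget \<sigma>3 (if p < m then (20, 0) else (5, p - m))) \<sigma>3"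
  by (simp add: apply_ops_def \<sigma>3_def \<sigma>2_def \<sigma>1_def)
 have xv: "emb (M *v z) = x"
  using emb_M[OF sz(1,2)] unfolding sz(3) T_def[symmetric] Z_def[symmetric] X_def[symmetric] y_def[symmetric] x_def .
 have val: "bget \<sigma>3 (if p < m then (8, p) else masked n r 6 (p - m)) - bget \<sigma>3 (if p < m then (20, 0) else (5, p - m)) = x $ p"
  if p: "p < n * n + m" for p
 proof (cases "p < m")
  case True
  then show ?thesis using g8 z20 y by (simp add: bget_def x_def)
 next
  case False
  then have q: "p - m < n * n" using p by linarith
  have "x $ p = colvec (had msk T) $ (p - m) - colvec (had dd Z) $ (p - m)"
   using False q y Tc Zc div_mod_bound[OF q] by (simp add: x_def index_colvec)
  then show ?thesis using False g5[OF q] masked_get[OF h6 Tc z20 q] by (simp add: bget_def)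
 qed
 have dx: "dim_vec x = n * n + m" using xv emb_carrier(2)[of "M *v z"] by simp
 show "holds_vec (exec (apply_ops n m r s dst) \<sigma> dst) (emb (M *v z))"
  unfolding xv e holds_vec_def dx using val by (simp add: bput_def)
 show "i \<notin> {5, 6, 7, 8, 9, dst} ==> exec (apply_ops n m r s dst) \<sigma> i = \<sigma> i"
  unfolding e using f1 f2 f3 by (simp add: bput_def)
qed

end

text \<open>Reading a single entry after a list of operations only involves the operations that this entry depends
 on; followed backwards from the last operation, all others drop out.\<close>

definition rexec :: "nat \<Rightarrow> real mat \<Rightarrow> bop list \<Rightarrow> blocks \<Rightarrow> blocks" where
 "rexec n A ops \<sigma> = fold (bstep n A) (rev ops) \<sigma>"

lemma exec_rexec: "fold (bstep n A) ops \<sigma> = rexec n A (rev ops) \<sigma>"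
 by (simp add: rexec_def)

lemma rexec_simps:
 "rexec n A [] \<sigma> i p = \<sigma> i p"
 "rexec n A (Fill d N c # ops) \<sigma> i p = (if i = d \<and> p < N then c else rexec n A ops \<sigma> i p)"
 "rexec n A (Bin a d N f g # ops) \<sigma> i p = (if i = d \<and> p < N
  then arith_val a (rexec n A ops \<sigma> (fst (f p)) (snd (f p))) (rexec n A ops \<sigma> (fst (g p)) (snd (g p)))
  else rexec n A ops \<sigma> i p)"
 "rexec n A (Dot d N L k l # ops) \<sigma> i p = (if i = d \<and> p < N
  then (\<Sum>q<L. rexec n A ops \<sigma> (fst (k p q)) (snd (k p q)) * rexec n A ops \<sigma> (fst (l p q)) (snd (l p q)))
  else rexec n A ops \<sigma> i p)"
 by (simp_all add: rexec_def bput_def bget_def)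

fun target :: "bop \<Rightarrow> nat" where
 "target (Fill d N c) = d"
| "target (Bin a d N f g) = d"
| "target (Dot d N L f g) = d"
| "target (CallA d s) = d"
| "target (CallAT d s) = d"

lemma exec_frame: "\<forall>op \<in> set ops. target op \<noteq> i ==> fold (bstep n A) ops \<sigma> i = \<sigma> i"
proof (induction ops arbitrary: \<sigma>)
 case (Cons op ops)
 have "bstep n A op \<sigma> i = \<sigma> i" using Cons.prems by (cases op) (auto simp: bput_def)
 then show ?case using Cons by simp
qed simp

lemma transpose_smult_mat: "(c \<cdot>\<^sub>m H)\<^sup>T = c \<cdot>\<^sub>m (H :: real mat)\<^sup>T"
 by (rule eq_matI) auto

context augmented
begin

definition tracks :: "blocks \<Rightarrow> odir \<Rightarrow> bool" where
 "tracks \<sigma> s \<longleftrightarrow> od_p s \<in> carrier_vec (m + d) \<and> od_o s \<in> carrier_vec (m + d) \<and> od_y s \<in> carrier_vec (m + d) \<and>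
  holds_vec (\<sigma> 14) (emb (od_p s)) \<and> holds_vec (\<sigma> 15) (emb (od_o s)) \<and> holds_vec (\<sigma> 16) (emb (od_y s)) \<and>
  \<sigma> 26 0 = od_n s"

lemma emb_dot:
 assumes "holds_vec g (emb x)" "holds_vec h (emb y)" "x \<in> carrier_vec (m + d)" "y \<in> carrier_vec (m + d)"
 shows "(\<Sum>l<n * n + m. g l * h l) = x \<bullet> y"
 using holds_vec_dot[OF assms(1,2)] emb_isometry[OF assms(3,4)] by (simp add: emb_carrier add.commute)

lemma emb_index:
 assumes x: "x \<in> carrier_vec (m + d)" and y: "y \<in> carrier_vec (m + d)" and p: "p < n * n + m"
 shows "emb (x + c *s y) $ p = emb x $ p + c * emb y $ p" and "emb (x - c *s y) $ p = emb x $ p - c * emb y $ p"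
proof -
 have cy: "c *s y \<in> carrier_vec (m + d)" using y by simp
 show "emb (x + c *s y) $ p = emb x $ p + c * emb y $ p"
  unfolding emb_linear(1)[OF x cy] emb_linear(2)[OF y y] using p by (simp add: emb_carrier)
 show "emb (x - c *s y) $ p = emb x $ p - c * emb y $ p"
  unfolding emb_linear(3)[OF x cy] emb_linear(2)[OF y y] using p by (simp add: emb_carrier)
qed

text \<open>One pass of the loop is one step of the recurrence: both images of the direction are formed first,
 and all later reads are of blocks that still hold old values.\<close>

lemma iter_ops:
 assumes K: "stocked T0 (emb b) \<sigma>" and tr: "tracks \<sigma> s" and b: "b \<in> carrier_vec (m + d)"
 shows "stocked T0 (emb b) (exec (iter_ops n m r) \<sigma>)"
  and "tracks (exec (iter_ops n m r) \<sigma>) (od_step (\<lambda>x. M *v x) b s)"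
proof -
 define p o' y q w where "p = od_p s" and "o' = od_o s" and "y = od_y s" and "q = M *v p" and "w = M *v q"
 note t = tr[unfolded tracks_def, folded p_def o'_def y_def]
 have pc: "p \<in> carrier_vec (m + d)" and oc: "o' \<in> carrier_vec (m + d)" and yc: "y \<in> carrier_vec (m + d)" using t by blast+
 have qc: "q \<in> carrier_vec (m + d)" unfolding q_def by (rule mult_mat_vec_carrier[OF M_carrier pc])
 have wc: "w \<in> carrier_vec (m + d)" unfolding w_def by (rule mult_mat_vec_carrier[OF M_carrier qc])
 have h14: "holds_vec (\<sigma> 14) (emb p)" using t by blast
 define \<sigma>1 where "\<sigma>1 = exec (apply_ops n m r 14 17) \<sigma>"
 have h1: "holds_vec (\<sigma>1 17) (emb q)"
  unfolding \<sigma>1_def q_def by (rule apply_ops(1)[OF K pc h14]) simp_all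
 have f1: "\<sigma>1 i = \<sigma> i" if "i \<notin> {5, 6, 7, 8, 9, 17}" for i
  unfolding \<sigma>1_def by (rule apply_ops(2)[OF K pc h14 _ _ that]) simp_all
 have K1: "stocked T0 (emb b) \<sigma>1" by (rule stocked_cong[OF K]) (rule f1, auto)
 define \<sigma>2 where "\<sigma>2 = exec (apply_ops n m r 17 18) \<sigma>1"
 have h2: "holds_vec (\<sigma>2 18) (emb w)"
  unfolding \<sigma>2_def w_def by (rule apply_ops(1)[OF K1 qc h1]) simp_all
 have f2: "\<sigma>2 i = \<sigma>1 i" if "i \<notin> {5, 6, 7, 8, 9, 18}" for i
  unfolding \<sigma>2_def by (rule apply_ops(2)[OF K1 qc h1 _ _ that]) simp_all
 have g: "holds_vec (\<sigma>2 14) (emb p)" "holds_vec (\<sigma>2 15) (emb o')" "holds_vec (\<sigma>2 16) (emb y)" "holds_vec (\<sigma>2 17) (emb q)"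
  "holds_vec (\<sigma>2 13) (emb b)" "\<sigma>2 26 0 = od_n s" "\<sigma>2 20 0 = 0"
  using t h1 K unfolding stocked_def by (simp_all add: f1 f2)
 define \<rho>1 \<rho>2 \<tau> where "\<rho>1 = exec (coefficient_ops (n * n + m)) \<sigma>2" and "\<rho>2 = exec (direction_ops (n * n + m)) \<rho>1"
  and "\<tau> = exec (advance_ops (n * n + m)) \<rho>2"
 have e: "exec (iter_ops n m r) \<sigma> = \<tau>"
  by (simp add: iter_ops_def update_ops_def \<tau>_def \<rho>2_def \<rho>1_def \<sigma>2_def \<sigma>1_def)
 have r1: "\<rho>1 i = \<sigma>2 i" if "i \<notin> {25, 27, 28, 29}" for i
  unfolding \<rho>1_def by (rule exec_frame) (use that in \<open>simp add: coefficient_ops_def\<close>)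
 have r2: "\<rho>2 i = \<rho>1 i" if "i \<notin> {17, 19}" for i
  unfolding \<rho>2_def by (rule exec_frame) (use that in \<open>simp add: direction_ops_def\<close>)
 have r3: "\<tau> i = \<rho>2 i" if "i \<notin> {14, 15, 16, 19, 26}" for i
  unfolding \<tau>_def by (rule exec_frame) (use that in \<open>simp add: advance_ops_def\<close>)
 note dots = emb_dot[OF g(4,4) qc qc] emb_dot[OF h2 g(4) wc qc] emb_dot[OF g(4,5) qc b]
 define nn where "nn = q \<bullet> q"
 have K3: "stocked T0 (emb b) \<tau>"
 proof (rule stocked_cong[OF K])
  fix i :: nat assume i: "i \<in> {0, 10, 11, 12, 13, 20, 21, 22, 24}"
  have "i \<notin> {5, 6, 7, 8, 9, 17}" "i \<notin> {5, 6, 7, 8, 9, 18}" "i \<notin> {25, 27, 28, 29}" "i \<notin> {17, 19}" "i \<notin> {14, 15, 16, 19, 26}"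
   using i by auto
  then show "\<tau> i = \<sigma> i" using f1 f2 r1 r2 r3 by metis
 qed
 then show "stocked T0 (emb b) (exec (iter_ops n m r) \<sigma>)" unfolding e .
 have c: "\<rho>1 25 0 = nn" "\<rho>1 27 0 = (w \<bullet> q) / nn" "\<rho>1 28 0 = (q \<bullet> b) / nn" "\<rho>1 29 0 = nn / od_n s"
  by (simp_all add: \<rho>1_def[unfolded exec_rexec] coefficient_ops_def rexec_simps dots g(6) nn_def)
 have d17: "\<rho>2 17 j = \<sigma>2 17 j - (w \<bullet> q) / nn * \<sigma>2 14 j - nn / od_n s * \<sigma>2 15 j" if "j < n * n + m" for j
  using that by (simp add: \<rho>2_def[unfolded exec_rexec] direction_ops_def rexec_simps c r1)
 have s: "\<rho>2 14 = \<sigma>2 14" "\<rho>2 16 = \<sigma>2 16" "\<rho>2 20 0 = 0" "\<rho>2 25 0 = nn" "\<rho>2 28 0 = (q \<bullet> b) / nn"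
  using g(7) c by (simp_all add: r2 r1)
 note ev = \<tau>_def[unfolded exec_rexec] advance_ops_def rexec_simps s
 have v26: "\<tau> 26 0 = nn" by (simp add: ev)
 have v15: "\<tau> 15 j = \<sigma>2 14 j" if "j < n * n + m" for j using that by (simp add: ev)
 have v16: "\<tau> 16 j = \<sigma>2 16 j + (q \<bullet> b) / nn * \<sigma>2 14 j" if "j < n * n + m" for j
  using that by (simp add: ev)
 have v14: "\<tau> 14 j = \<sigma>2 17 j - (w \<bullet> q) / nn * \<sigma>2 14 j - nn / od_n s * \<sigma>2 15 j" if "j < n * n + m" for j
  using that by (simp add: ev d17)
 define s' where "s' = od_step (\<lambda>x. M *v x) b s"
 have s': "od_p s' = (q - ((w \<bullet> q) / nn) *s p) - (nn / od_n s) *s o'" "od_o s' = p" "od_n s' = nn"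
  "od_y s' = y + ((q \<bullet> b) / nn) *s p"
  by (simp_all add: s'_def od_step_def Let_def p_def o'_def y_def q_def w_def nn_def)
 have qp: "q - ((w \<bullet> q) / nn) *s p \<in> carrier_vec (m + d)" using qc pc by simp
 have gv: "h j = emb x $ j" if "holds_vec h (emb x)" "j < n * n + m" for h x j
  using holds_vecD[OF that(1), of j] that(2) by (simp add: emb_carrier)
 have hv: "holds_vec h (emb x)" if "\<And>j. j < n * n + m ==> h j = emb x $ j" for h x
  unfolding holds_vec_def using that by (simp add: emb_carrier add.commute)
 have "tracks \<tau> s'"
  unfolding tracks_def s'
 proof (intro conjI)
  show "(q - ((w \<bullet> q) / nn) *s p) - (nn / od_n s) *s o' \<in> carrier_vec (m + d)" "p \<in> carrier_vec (m + d)"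
   "y + ((q \<bullet> b) / nn) *s p \<in> carrier_vec (m + d)" using qp oc pc yc by simp_all
  show "holds_vec (\<tau> 14) (emb ((q - ((w \<bullet> q) / nn) *s p) - (nn / od_n s) *s o'))"
   by (rule hv) (simp add: v14 emb_index(2)[OF qp oc] emb_index(2)[OF qc pc] gv[OF g(4)] gv[OF g(1)] gv[OF g(2)])
  show "holds_vec (\<tau> 15) (emb p)" by (rule hv) (simp add: v15 gv[OF g(1)])
  show "holds_vec (\<tau> 16) (emb (y + ((q \<bullet> b) / nn) *s p))"
   by (rule hv) (simp add: v16 emb_index(1)[OF yc pc] gv[OF g(3)] gv[OF g(1)])
 qed (rule v26)
 then show "tracks (exec (iter_ops n m r) \<sigma>) (od_step (\<lambda>x. M *v x) b s)" unfolding e s'_def .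
qed

lemma init_ops:
 assumes V0: "holds_mat n (\<sigma> 0) V" and l: "\<And>i. i < n ==> \<sigma> 1 i = ev i" and bb: "\<And>i. i < m ==> \<sigma> 2 i = b $ i"
  and C0: "holds_mat n (\<sigma> 3) C" and z: "\<And>i p. 4 < i ==> \<sigma> i p = 0"
  and b: "b \<in> carrier_vec m" and C: "C \<in> sym_mats n"
 defines "rhs \<equiv> aug_rhs A b C W r Q Qp"
 shows "stocked (t\<^sup>2 \<cdot>\<^sub>m (V\<^sup>T * C * V)) (emb rhs) (exec (init_ops n m r) \<sigma>)"
  and "tracks (exec (init_ops n m r) \<sigma>) (od_init (m + d) rhs)"
proof -
 note Cc = sym_matsD(1)[OF C] and Vc = VD(1)
 define T0 where "T0 = t\<^sup>2 \<cdot>\<^sub>m (V\<^sup>T * C * V)"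
 have T0c: "T0 \<in> carrier_mat n n" using Cc Vc by (simp add: T0_def)
 have T0s: "T0 \<in> sym_mats n"
 proof -
  have "V\<^sup>T * C * V = dn (vecS C)" using smat_vecS[OF C] by (simp add: dn_def)
  then have "V\<^sup>T * C * V \<in> sym_mats n" using dn_sym by simp
  then show ?thesis unfolding T0_def sym_mats_def by (simp add: transpose_smult_mat)
 qed
 have eT: "had ee T0 \<in> sym_mats n" by (rule had_sym[OF T0s]) (simp add: ee_def mult.commute)
 define X where "X = V * had ee T0 * V\<^sup>T"
 have X: "X \<in> sym_mats n" unfolding X_def by (rule conj_V_sym[OF eT])
 have dA: "dim_row A = m" using A by simp
 have n0: "0 < n" using rn by simp
 define \<sigma>0 where "\<sigma>0 = exec (scalar_ops n r) \<sigma>"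
 have f0: "\<sigma>0 i = \<sigma> i" if "i \<notin> {21, 22, 23, 24, 30, 31}" for i
  unfolding \<sigma>0_def by (rule exec_frame) (use that in \<open>simp add: scalar_ops_def\<close>)
 note ev0 = \<sigma>0_def[unfolded exec_rexec] scalar_ops_def rexec_simps
 have t2: "\<sigma> (Suc 0) r = 2 * t" using l[OF rn] tau_ev by simp
 have c0: "\<sigma>0 24 0 = t\<^sup>2" "\<sigma>0 21 0 = 1" "\<sigma>0 22 0 = 1 / sqrt 2" by (simp_all add: ev0 t2 power2_eq_square)
 have e30: "\<sigma>0 30 i = ec i" if "i < n" for i using that l t2 by (simp add: ev0 ec_def)
 define \<sigma>1 where "\<sigma>1 = exec (weight_ops n) \<sigma>0"
 have f1': "\<sigma>1 i = \<sigma>0 i" if "i \<notin> {5, 6, 10, 11}" for i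
  unfolding \<sigma>1_def by (rule exec_frame) (use that in \<open>simp add: weight_ops_def\<close>)
 have f1: "\<sigma>1 i = \<sigma> i" if "i \<notin> {5, 6, 10, 11, 21, 22, 23, 24, 30, 31}" for i
  using that f1'[of i] f0[of i] by simp
 have s24: "\<sigma>1 24 0 = t\<^sup>2" and s21: "\<sigma>1 21 0 = 1" "\<sigma>1 22 0 = 1 / sqrt 2" using c0 f1' by simp_all
 have l0: "\<sigma>0 1 i = ev i" "\<sigma>0 (Suc 0) i = ev i" if "i < n" for i using l[OF that] f0[of 1] by simp_all
 note ev1 = \<sigma>1_def[unfolded exec_rexec] weight_ops_def rexec_simps c0 e30 l0
 have e10: "\<sigma>1 10 (i + n * j) = ee i j" if "i < n" "j < n" for i j
  using that by (simp add: ev1 pos_lt pos_mod ee_def)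
 have e11: "\<sigma>1 11 (i + n * j) = dd i j" if "i < n" "j < n" for i j
  using that by (simp add: ev1 pos_lt pos_mod dd_def sg_def ee_def)
 have V1: "holds_mat n (\<sigma>1 0) V" and C1: "holds_mat n (\<sigma>1 3) C" using V0 C0 f1 by simp_all
 define \<sigma>2 where "\<sigma>2 = exec (down_ops n 3) \<sigma>1"
 note d2 = down_ops[OF V1 C1 Cc, folded \<sigma>2_def]
 define \<sigma>3 where "\<sigma>3 = exec [Bin Times 12 (n * n) (\<lambda>p. (24, 0)) (\<lambda>p. (6, p)), Bin Times 9 (n * n) (\<lambda>p. (10, p)) (\<lambda>p. (12, p))] \<sigma>2"
 note ev3 = \<sigma>3_def[unfolded exec_rexec] rexec_simps
 have f3: "\<sigma>3 i = \<sigma>2 i" if "i \<noteq> 12" "i \<noteq> 9" for i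
 proof
  fix p show "\<sigma>3 i p = \<sigma>2 i p" using that by (simp add: ev3)
 qed
 have e12: "\<sigma>3 12 (i + n * j) = T0 $$ (i, j)" "\<sigma>3 9 (i + n * j) = had ee T0 $$ (i, j)" if ij: "i < n" "j < n" for i j
 proof -
  have v: "\<sigma>2 6 (i + n * j) = (V\<^sup>T * C * V) $$ (i, j)" by (rule holds_matD[OF d2(1) ij])
  have w: "\<sigma>2 24 0 = t\<^sup>2" "\<sigma>2 10 (i + n * j) = ee i j" using d2(2) s24 e10[OF ij] by simp_all
  have T: "T0 $$ (i, j) = t\<^sup>2 * (V\<^sup>T * C * V) $$ (i, j)"
   unfolding T0_def by (rule index_smult_mat) (use ij Vc in auto)
  show "\<sigma>3 12 (i + n * j) = T0 $$ (i, j)" unfolding T using ij v w by (simp add: ev3 pos_lt)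
  show "\<sigma>3 9 (i + n * j) = had ee T0 $$ (i, j)" using ij v w T T0c by (simp add: ev3 pos_lt)
 qed
 have V3: "holds_mat n (\<sigma>3 0) V" using V1 d2(2) f3 by simp
 have h9: "holds_mat n (\<sigma>3 9) (had ee T0)" and h12: "holds_mat n (\<sigma>3 12) T0" using e12 by (simp_all add: holds_mat_def)
 define \<sigma>4 where "\<sigma>4 = exec (up_ops n 9) \<sigma>3"
 note u4 = up_ops[OF V3 h9 sym_matsD(1)[OF eT], folded \<sigma>4_def X_def]
 define y where "y = A *v vecS X"
 have y: "y \<in> carrier_vec m" unfolding y_def X_def using mult_mat_vec_carrier[OF A up_carrier, of "had ee T0"] by (simp add: up_def)
 define \<sigma>5 where "\<sigma>5 = bstep n A (CallA 8 7) \<sigma>4"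
 have f5: "\<sigma>5 i = \<sigma>4 i" if "i \<noteq> 8" for i using that by (simp add: \<sigma>5_def bput_def)
 have v5: "\<sigma>5 8 p = y $ p" if "p < m" for p
  using that by (simp add: \<sigma>5_def bput_def dA read_sym_holds[OF u4(1) X] y_def)
 define \<tau> where "\<tau> = exec (init_ops n m r) \<sigma>"
 have e: "\<tau> = exec [Bin Plus 13 (n * n + m) (\<lambda>p. if p < m then (2, p) else masked n r 12 (p - m))
    (\<lambda>p. if p < m then (8, p) else (20, 0)), Bin Plus 14 (n * n + m) (\<lambda>p. (13, p)) (\<lambda>p. (20, 0))] \<sigma>5"
  by (simp add: \<tau>_def \<sigma>5_def \<sigma>4_def \<sigma>3_def \<sigma>2_def \<sigma>1_def \<sigma>0_def init_ops_def)
 note ev6 = e[unfolded exec_rexec] rexec_simps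
 have f6: "\<tau> i = \<sigma>5 i" if "i \<noteq> 13" "i \<noteq> 14" for i
 proof
  fix p show "\<tau> i p = \<sigma>5 i p" using that by (simp add: ev6)
 qed
 have f: "\<tau> i = \<sigma>1 i" if "i \<notin> {5, 6, 7, 8, 9, 12, 13, 14}" for i using that f6 f5 u4(2) f3 d2(2) by simp
 have z5: "\<sigma>5 20 0 = 0" using f5 u4(2) f3 d2(2) f1 z by simp
 have h512: "holds_mat n (\<sigma>5 12) T0" using h12 f5 u4(2) by simp
 have b5: "\<sigma>5 2 p = b $ p" if "p < m" for p using bb[OF that] f5 u4(2) f3 d2(2) f1 by simp
 have rv: "emb rhs = (b + y) @\<^sub>v colvec (had msk T0)"
  using emb_aug_rhs[OF b C] unfolding rhs_def T0_def y_def X_def .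
 have v13: "\<tau> 13 p = emb rhs $ p" if p: "p < n * n + m" for p
 proof (cases "p < m")
  case True
  then show ?thesis using p b5 v5 b y by (simp add: ev6 rv)
 next
  case False
  then have q: "p - m < n * n" using p by linarith
  have "emb rhs $ p = colvec (had msk T0) $ (p - m)" unfolding rv using False q b y T0c by simp
  also have "\<dots> = bget \<sigma>5 (masked n r 12 (p - m))" by (rule masked_get[where T = T0, symmetric]) (use h512 T0c z5 q in auto)
  finally show ?thesis using p False z5 by (simp add: ev6 bget_def)
 qed
 have v14: "\<tau> 14 p = \<tau> 13 p" if "p < n * n + m" for p using that z5 by (simp add: ev6)
 have h13: "holds_vec (\<tau> 13) (emb rhs)" "holds_vec (\<tau> 14) (emb rhs)"
  unfolding holds_vec_def using v13 v14 by (simp_all add: emb_carrier add.commute)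
 have "stocked T0 (emb rhs) \<tau>"
  unfolding stocked_def
 proof (intro conjI)
  show "holds_mat n (\<tau> 0) V" using V1 f by simp
  show "holds_mat n (\<tau> 10) (mat n n (\<lambda>(i, j). ee i j))" "holds_mat n (\<tau> 11) (mat n n (\<lambda>(i, j). dd i j))"
   using e10 e11 f by (simp_all add: holds_mat_def)
  show "holds_mat n (\<tau> 12) T0" using h512 f6 by simp
  show "\<tau> 20 0 = 0" using f f1 z by simp
 qed (use h13 f s21 s24 in simp_all)
 then show "stocked (t\<^sup>2 \<cdot>\<^sub>m (V\<^sup>T * C * V)) (emb rhs) (exec (init_ops n m r) \<sigma>)" unfolding \<tau>_def T0_def .
 have z0: "holds_vec (\<sigma> 15) (emb (0\<^sub>v (m + d)))" "holds_vec (\<sigma> 16) (emb (0\<^sub>v (m + d)))"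
  unfolding emb_zero holds_vec_def using z by auto
 have "rhs \<in> carrier_vec (m + d)" unfolding rhs_def by (rule aug_rhs_carrier[OF b C])
 then show "tracks (exec (init_ops n m r) \<sigma>) (od_init (m + d) rhs)"
  unfolding \<tau>_def[symmetric] tracks_def od_init_def using h13 z0 f f1 z by simp
qed

lemma loop_ops:
 assumes "stocked T0 (emb b) \<sigma>" "tracks \<sigma> (od_init (m + d) b)" and b: "b \<in> carrier_vec (m + d)"
 shows "stocked T0 (emb b) (exec (concat (replicate k (iter_ops n m r))) \<sigma>)"
  and "tracks (exec (concat (replicate k (iter_ops n m r))) \<sigma>) (od_state (m + d) (\<lambda>x. M *v x) b k)"
proof -
 have "stocked T0 (emb b) (exec (concat (replicate k (iter_ops n m r))) \<sigma>) \<and>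
  tracks (exec (concat (replicate k (iter_ops n m r))) \<sigma>) (od_state (m + d) (\<lambda>x. M *v x) b k)"
 proof (induction k)
  case 0
  then show ?case using assms by (simp add: od_state_def)
 next
  case (Suc k)
  have e: "exec (concat (replicate (Suc k) (iter_ops n m r))) \<sigma> =
    exec (iter_ops n m r) (exec (concat (replicate k (iter_ops n m r))) \<sigma>)"
   unfolding replicate_append_same[symmetric] replicate_Suc by simp
  have o: "od_state (m + d) (\<lambda>x. M *v x) b (Suc k) = od_step (\<lambda>x. M *v x) b (od_state (m + d) (\<lambda>x. M *v x) b k)"
   by (simp add: od_state_def)
  show ?case unfolding e o using iter_ops[OF conjunct1[OF Suc] conjunct2[OF Suc] b] by blast
 qed
 then show "stocked T0 (emb b) (exec (concat (replicate k (iter_ops n m r))) \<sigma>)"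
  and "tracks (exec (concat (replicate k (iter_ops n m r))) \<sigma>) (od_state (m + d) (\<lambda>x. M *v x) b k)" by blast+
qed

lemma final_ops:
 assumes K: "stocked (t\<^sup>2 \<cdot>\<^sub>m (V\<^sup>T * C * V)) b0 \<sigma>" and z: "z \<in> carrier_vec (m + d)" and h: "holds_vec (\<sigma> 16) (emb z)"
  and C: "C \<in> sym_mats n"
 defines "u \<equiv> vec_first z m" and "v \<equiv> vec_last z d"
 shows "holds_mat n (exec (final_ops n m) \<sigma> 7) (matS n (EE *v (A\<^sup>T *v u - t\<^sup>2 *s vecS C) + QQ *v v))"
  and "p < m ==> exec (final_ops n m) \<sigma> 8 p = u $ p / t\<^sup>2" and "exec (final_ops n m) \<sigma> 20 0 = 0"
proof -
 note sz = split_vec[OF z, folded u_def v_def]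
 note he = holds_emb[OF h, folded u_def v_def]
 note k = K[unfolded stocked_def]
 note Cc = sym_matsD(1)[OF C] and Vc = VD(1)
 define T1 T0 where "T1 = V\<^sup>T * smat n (A\<^sup>T *v u) * V" and "T0 = t\<^sup>2 \<cdot>\<^sub>m (V\<^sup>T * C * V)"
 have T1c: "T1 \<in> carrier_mat n n" and T0c: "T0 \<in> carrier_mat n n"
  using Vc Cc sym_matsD(1)[OF dn_sym[of "A\<^sup>T *v u"]] by (simp_all add: T1_def T0_def dn_def)
 define T where "T = T1 - T0"
 have Tc: "T \<in> carrier_mat n n" unfolding T_def by (rule minus_carrier_mat[OF T0c])
 have k': "holds_mat n (\<sigma> 0) V" "\<sigma> 21 0 = 1" "\<sigma> 22 0 = 1 / sqrt 2" using k by blast+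
 have k12: "holds_mat n (\<sigma> 12) T0" and k10: "holds_mat n (\<sigma> 10) (mat n n (\<lambda>(i, j). ee i j))" using k by (simp_all add: T0_def)
 define \<sigma>1 where "\<sigma>1 = exec (adjoint_ops n 16) \<sigma>"
 have h1: "holds_mat n (\<sigma>1 6) T1" unfolding \<sigma>1_def T1_def by (rule adjoint_ops(1)[OF k' sz(1)]) (rule he(1))
 have f1: "\<sigma>1 i = \<sigma> i" if "i \<notin> {5, 6, 8, 9}" for i
  unfolding \<sigma>1_def by (rule adjoint_ops(2)[OF k' sz(1) _ that]) (rule he(1))
 define \<sigma>2 where "\<sigma>2 = bstep n A (Bin Minus 6 (n * n) (\<lambda>p. (6, p)) (\<lambda>p. (12, p))) \<sigma>1"
 have f2: "\<sigma>2 i = \<sigma>1 i" if "i \<noteq> 6" for i using that by (simp add: \<sigma>2_def bput_def)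
 have "\<sigma>2 6 (i + n * j) = T $$ (i, j)" if ij: "i < n" "j < n" for i j
  using ij holds_matD[OF h1 ij] holds_matD[OF k12 ij] f1[of 12] T1c T0c by (simp add: \<sigma>2_def bput_def bget_def pos_lt T_def)
 then have h2: "holds_mat n (\<sigma>2 6) T" by (simp add: holds_mat_def)
 have V2: "holds_mat n (\<sigma>2 0) V" "holds_mat n (\<sigma>2 10) (mat n n (\<lambda>(i, j). ee i j))" using k' k10 f1 f2 by simp_all
 have Z2: "holds_mat n (\<lambda>p. \<sigma>2 16 (m + p)) (unpack v)" using he(2) f1 f2 by simp
 define \<sigma>3 where "\<sigma>3 = exec (combine_ops n m 16) \<sigma>2"
 have n16: "(16::nat) \<noteq> 9" by simp
 note c3 = combine_ops[OF V2 h2 Tc Z2 sym_matsD(1)[OF unpack_sym] n16, folded \<sigma>3_def]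
 have e: "exec (final_ops n m) \<sigma> = bput 8 m (\<lambda>p. bget \<sigma>3 (16, p) / bget \<sigma>3 (24, 0)) \<sigma>3"
  by (simp add: final_ops_def \<sigma>3_def \<sigma>2_def \<sigma>1_def)
 have x: "matS n (EE *v (A\<^sup>T *v u - t\<^sup>2 *s vecS C) + QQ *v v) = V * (had ee T + unpack v) * V\<^sup>T"
  unfolding recovered_step(1)[OF sz(1,2) C] T_def T1_def T0_def ..
 show "holds_mat n (exec (final_ops n m) \<sigma> 7) (matS n (EE *v (A\<^sup>T *v u - t\<^sup>2 *s vecS C) + QQ *v v))"
  unfolding x e using c3(1) by (simp add: bput_def)
 have s3: "\<sigma>3 16 = \<sigma> 16" "\<sigma>3 24 = \<sigma> 24" "\<sigma>3 20 = \<sigma> 20" using c3(2) f2 f1 by simp_all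
 show "p < m ==> exec (final_ops n m) \<sigma> 8 p = u $ p / t\<^sup>2"
  unfolding e using he(1) k s3 by (simp add: bput_def bget_def)
 show "exec (final_ops n m) \<sigma> 20 0 = 0" unfolding e using k s3 by (simp add: bput_def)
qed

end

lemma concat_replicate_set: "op \<in> set (concat (replicate k xs)) ==> op \<in> set xs"
 by (induction k) auto

lemma admissible_all_ops:
 assumes "r < n" "m \<le> n * n"
 shows "\<forall>op \<in> set (all_ops n m r k). admissible n m op"
 using admissible_ops[OF assms] concat_replicate_set[of _ k "iter_ops n m r"]
 unfolding all_ops_def set_append ball_Un by blast

lemma tri_le: "tri n \<le> n * n"
proof -
 have "n * (n + 1) \<le> 2 * (n * n)" by (cases n) auto
 then show ?thesis unfolding tri_def by linarith
qed

lemma alg_input_entries: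
 fixes W :: "real mat"
 assumes V: "hcat Q Qp \<in> carrier_mat n n" and b: "b \<in> carrier_vec m" and C: "C \<in> carrier_mat n n"
 defines "R \<equiv> store 0 (alg_input n W Q Qp b C) (\<lambda>_. 0)"
 shows "dim_vec (alg_input n W Q Qp b C) = 2 * (n * n) + n + m"
  and "p < n * n ==> R (addr n m (0, p)) = colvec (hcat Q Qp) $ p"
  and "p < n ==> R (addr n m (1, p)) = lam W (p + 1)"
  and "p < m ==> R (addr n m (2, p)) = b $ p"
  and "p < n * n ==> R (addr n m (3, p)) = colvec C $ p"
  and "4 < i ==> R (addr n m (i, p)) = 0"
proof -
 have dv: "dim_row (hcat Q Qp) = n" "dim_col (hcat Q Qp) = n" "dim_row C = n" "dim_col C = n" "dim_vec b = m" using V b C by auto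
 show len: "dim_vec (alg_input n W Q Qp b C) = 2 * (n * n) + n + m" by (simp add: alg_input_def dv)
 note s = R_def store_def len addr_def base_def
 have i: "alg_input n W Q Qp b C = colvec (hcat Q Qp) @\<^sub>v vec n (\<lambda>i. lam W (i + 1)) @\<^sub>v b @\<^sub>v colvec C"
  by (simp add: alg_input_def)
 show "p < n * n ==> R (addr n m (0, p)) = colvec (hcat Q Qp) $ p" by (simp add: s) (simp add: i dv)
 show "p < n ==> R (addr n m (1, p)) = lam W (p + 1)" by (simp add: s) (simp add: i dv)
 show "p < m ==> R (addr n m (2, p)) = b $ p" by (simp add: s) (simp add: i dv)
 show "p < n * n ==> R (addr n m (3, p)) = colvec C $ p" by (simp add: s) (simp add: i dv)
 show "4 < i ==> R (addr n m (i, p)) = 0" by (simp add: s)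
qed

context augmented
begin

lemma newton_program_correct:
 assumes rs: "regular_system (m + d) M (aug_rhs A b C W r Q Qp)" and b: "b \<in> carrier_vec m" and C: "C \<in> sym_mats n"
 shows "run n A (newton_program n m r k) (alg_input n W Q Qp b C) (n * n + m)
  = alg_output (delta_X A b C W r Q Qp k) (delta_y A b C W r Q Qp k)"
proof -
 interpret rs: regular_system "m + d" M "aug_rhs A b C W r Q Qp" by (rule rs)
 have mn: "m \<le> n * n" using m_le tri_le[of n] by linarith
 have n0: "0 < n" using rn by simp
 note Cc = sym_matsD(1)[OF C]
 have Vh: "hcat Q Qp \<in> carrier_mat n n" using VD(1) by (simp add: V_def)
 define R0 where "R0 = store 0 (alg_input n W Q Qp b C) (\<lambda>_. 0)"
 define \<sigma>0 where "\<sigma>0 i p = R0 (addr n m (i, p))" for i p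
 note inp = alg_input_entries[OF Vh b Cc, where W = W, folded R0_def]
 have rep0: "represents n m R0 \<sigma>0" by (simp add: represents_def \<sigma>0_def bget_def)
 have hC: "holds_mat n (\<sigma>0 3) C" and hV: "holds_mat n (\<sigma>0 0) V"
  unfolding holds_mat_def \<sigma>0_def using inp(2,5) pos_lt colvec_index_pair(1)[OF Cc] colvec_index_pair(1)[OF Vh]
  by (simp_all add: V_def)
 have l0: "\<sigma>0 1 i = ev i" if "i < n" for i using inp(3)[OF that] by (simp add: \<sigma>0_def ev_def)
 have b0: "\<sigma>0 2 i = b $ i" if "i < m" for i using inp(4)[OF that] by (simp add: \<sigma>0_def)
 have z0: "\<sigma>0 i p = 0" if "4 < i" for i p using inp(6)[OF that] by (simp add: \<sigma>0_def)
 define \<sigma>1 where "\<sigma>1 = exec (init_ops n m r) \<sigma>0"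
 have i1: "stocked (t\<^sup>2 \<cdot>\<^sub>m (V\<^sup>T * C * V)) (emb (aug_rhs A b C W r Q Qp)) \<sigma>1"
  "tracks \<sigma>1 (od_init (m + d) (aug_rhs A b C W r Q Qp))"
  unfolding \<sigma>1_def by (rule init_ops[OF hV _ _ hC _ b C]; rule l0 b0 z0; assumption)+
 define \<sigma>2 where "\<sigma>2 = exec (concat (replicate k (iter_ops n m r))) \<sigma>1"
 note i2 = loop_ops[OF i1 aug_rhs_carrier[OF b C], of k, folded \<sigma>2_def]
 define z where "z = rs.y k"
 have zy: "od_y (od_state (m + d) (\<lambda>x. M *v x) (aug_rhs A b C W r Q Qp) k) = z" by (simp add: z_def rs.y_def)
 have zc: "z \<in> carrier_vec (m + d)" and hz: "holds_vec (\<sigma>2 16) (emb z)" using i2(2) zy by (simp_all add: tracks_def)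
 define \<sigma>3 where "\<sigma>3 = exec (final_ops n m) \<sigma>2"
 note i3 = final_ops[OF i2(1) zc hz C, folded \<sigma>3_def]
 have it: "aug_iterate A b C W r Q Qp k = z"
  unfolding aug_iterate_def Let_def bigQ_dims carrier_matD(1)[OF A] z_def by (rule rs.minres_eq)
 define dX dy where "dX = delta_X A b C W r Q Qp k" and "dy = delta_y A b C W r Q Qp k"
 have dX: "dX = matS n (EE *v (A\<^sup>T *v vec_first z m - t\<^sup>2 *s vecS C) + QQ *v vec_last z d)"
  unfolding dX_def delta_X_def iter_u_def iter_v_def it bigQ_dims carrier_matD(1)[OF A] dimW(1) ..
 have dy: "dy = (1 / t\<^sup>2) *s vec_first z m"
  unfolding dy_def delta_y_def iter_u_def it carrier_matD(1)[OF A] ..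
 have dXc: "dX \<in> carrier_mat n n"
  unfolding dX recovered_step(1)[OF split_vec(1,2)[OF zc] C]
  by (rule sym_matsD(1)[OF conj_V_sym[OF recovered_step(2)[OF split_vec(1,2)[OF zc] C]]])
 have h7: "holds_mat n (\<sigma>3 7) dX" unfolding dX by (rule i3(1))
 have all: "exec (all_ops n m r k) \<sigma>0 = \<sigma>3" by (simp add: all_ops_def \<sigma>3_def \<sigma>2_def \<sigma>1_def)
 define R3 where "R3 = fold (step n A) (concat (map (compile n m) (all_ops n m r k))) R0"
 have rep3: "represents n m R3 \<sigma>3"
  unfolding R3_def all[symmetric] by (rule compile_list_correct[OF rep0 n0 A admissible_all_ops[OF rn mn]])
 have r3: "R3 (addr n m (i, p)) = \<sigma>3 i p" if "i \<in> {7, 8, 20}" "p < n * n + m" for i p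
  using representsD[OF rep3, of "(i, p)"] that by (auto simp: bget_def readable_def bsize_def)
 have out: "fold (step n A) (newton_program n m r k) R0 = (\<lambda>x. if x < n * n + m then
   R3 (if x < n * n then addr n m (7, x) else addr n m (8, x - n * n)) + R3 (addr n m (20, 0)) else R3 x)"
  unfolding newton_program_def fold_append comp_apply R3_def[symmetric]
  by (rule fold_copy) (simp_all add: addr_def base_def)
 have z20: "R3 (addr n m (20, 0)) = 0" using r3[of 20 0] i3(3) n0 by simp
 show ?thesis
  unfolding run_def alg_output_def dX_def[symmetric] dy_def[symmetric] R0_def[symmetric]
 proof (rule eq_vecI)
  have ddy: "dim_vec dy = m" by (simp add: dy)
  show dims: "dim_vec (vec (n * n + m) (fold (step n A) (newton_program n m r k) R0)) = dim_vec (colvec dX @\<^sub>v dy)"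
   using dXc ddy by simp
  fix p assume "p < dim_vec (colvec dX @\<^sub>v dy)"
  then have p: "p < n * n + m" using dims by simp
  show "vec (n * n + m) (fold (step n A) (newton_program n m r k) R0) $ p = (colvec dX @\<^sub>v dy) $ p"
  proof (cases "p < n * n")
   case True
   have "fold (step n A) (newton_program n m r k) R0 p = \<sigma>3 7 p" unfolding out using True p r3[of 7 p] z20 by simp
   also have "\<dots> = colvec dX $ p" using holds_mat_pos[OF h7 True] True dXc by (simp add: index_colvec)
   finally show ?thesis using p True dXc by simp
  next
   case False
   then have q: "p - n * n < m" using p by linarith
   have "fold (step n A) (newton_program n m r k) R0 p = \<sigma>3 8 (p - n * n)"
    unfolding out using False p q r3[of 8 "p - n * n"] z20 by simp
   also have "\<dots> = dy $ (p - n * n)" using i3(2)[OF q] q by (simp add: dy)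
   finally show ?thesis using p q False ddy carrier_matD[OF dXc] by simp
  qed
 qed
qed

end

text \<open>The number of block operations does not depend on the dimensions, so each operation may be charged
 its worst case $O(n^3)$ plus one call.\<close>

definition iter_len :: nat where "iter_len = length (iter_ops 0 0 0)"
definition frame_len :: nat where "frame_len = length (init_ops 0 0 0) + length (final_ops 0 0)"

lemma length_all_ops: "length (all_ops n m r k) = frame_len + k * iter_len"
proof -
 have "length (iter_ops n m r) = iter_len" "length (init_ops n m r) + length (final_ops n m) = frame_len"
  by (simp_all add: iter_len_def frame_len_def iter_ops_def init_ops_def final_ops_def apply_ops_def combine_ops_def
   adjoint_ops_def update_ops_def coefficient_ops_def direction_ops_def advance_ops_def scalar_ops_def weight_ops_def
   up_ops_def down_ops_def)
 then show ?thesis by (simp add: all_ops_def length_concat sum_list_replicate)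
qed

lemma newton_program_time:
 assumes r: "r < n" and m: "m \<le> n * n" and k: "1 \<le> k"
 shows "run_time tA tAT (newton_program n m r k) \<le> (frame_len + iter_len + 2) * k * (9 * n ^ 3 + tA + tAT)"
proof -
 define U where "U = 9 * n ^ 3 + tA + tAT"
 have n1: "1 \<le> n" using r by simp
 have nn: "n * n \<le> n ^ 3" using power_increasing[of 2 3 n] n1 by (simp add: power2_eq_square)
 have copy: "run_time tA tAT (map (\<lambda>p. Add p (f p) x) [0..<N]) = N" for f :: "nat \<Rightarrow> nat" and x N
  by (subst run_time_unit) auto
 have "run_time tA tAT (newton_program n m r k) \<le> length (all_ops n m r k) * U + (n * n + m)"
  unfolding newton_program_def run_time_append copy U_def
  using compile_list_time[OF admissible_all_ops[OF r m, of k], of tA tAT] by simp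
 also have "\<dots> \<le> (frame_len + k * iter_len) * U + 2 * U"
  unfolding length_all_ops using nn m by (simp add: U_def)
 also have "\<dots> = (frame_len + k * iter_len + 2) * U" by (simp add: algebra_simps)
 also have "\<dots> \<le> ((frame_len + iter_len + 2) * k) * U"
 proof (rule mult_right_mono)
  have "(frame_len + 2) * 1 \<le> (frame_len + 2) * k" by (rule mult_le_mono2[OF k])
  then show "frame_len + k * iter_len + 2 \<le> (frame_len + iter_len + 2) * k" by (simp add: algebra_simps)
 qed simp
 finally show ?thesis by (simp add: U_def)
qed

lemma newton_program_regs:
 assumes r: "r < n" and m: "m \<le> n * n"
 shows "(\<Union>ins \<in> set (newton_program n m r k). instr_regs n m ins) \<subseteq> {..<base n m 32}"
proof
 fix x assume "x \<in> (\<Union>ins \<in> set (newton_program n m r k). instr_regs n m ins)"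
 then obtain ins where i: "ins \<in> set (newton_program n m r k)" "x \<in> instr_regs n m ins" by blast
 have n: "0 < n" using r by simp
 consider op where "op \<in> set (all_ops n m r k)" "ins \<in> set (compile n m op)"
  | p where "p < n * n + m" "ins = Add p (if p < n * n then addr n m (7, p) else addr n m (8, p - n * n)) (addr n m (20, 0))"
  using i(1) unfolding newton_program_def by auto
 then show "x \<in> {..<base n m 32}"
 proof cases
  case 1
  then show ?thesis using compile_regs[OF _ n 1(2)] admissible_all_ops[OF r m, of k] i(2) by blast
 next
  case 2
  have "instr_regs n m ins \<subseteq> {..<base n m 32}"
   using 2(1) addr_bound[of "(7, p)" n m] addr_bound[of "(8, p - n * n)" n m] addr_bound[of "(20, 0)" n m] n
   unfolding 2(2) by (auto simp: bsize_def base_def)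
  then show ?thesis using i(2) by blast
 qed
qed

lemma newton_program_storage:
 assumes r: "r < n" and m: "m \<le> n * n"
 shows "run_storage n m sA sAT (newton_program n m r k) (2 * (n * n) + n + m) (n * n + m) \<le> 60 * (n * n) + max sA sAT"
proof -
 have n: "n \<le> n * n" by (cases n) auto
 have "{..<2 * (n * n) + n + m} \<union> {..<n * n + m} \<union> (\<Union>ins \<in> set (newton_program n m r k). instr_regs n m ins) \<subseteq> {..<base n m 32}"
  using newton_program_regs[OF r m] by (auto simp: base_def)
 then have "card ({..<2 * (n * n) + n + m} \<union> {..<n * n + m} \<union> (\<Union>ins \<in> set (newton_program n m r k). instr_regs n m ins))
   \<le> card {..<base n m 32}" by (rule card_mono[rotated]) simp
 also have "card {..<base n m 32} = 2 * (n * n) + n + m + 28 * (n * n + m)" by (simp add: base_def)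
 also have "\<dots> = 30 * (n * n) + n + 29 * m" by simp
 also have "\<dots> \<le> 30 * (n * n) + n * n + 29 * (n * n)" by (intro add_mono mult_le_mono2 n m order_refl)
 also have "\<dots> = 60 * (n * n)" by simp
 finally show ?thesis by (simp add: run_storage_def)
qed

definition program_constant :: "real \<Rightarrow> real" where
 "program_constant c = real (frame_len + iter_len + 2) * (9 + 2 * \<bar>c\<bar>) + 60"

lemma program_constant_pos: "0 < program_constant c"
 unfolding program_constant_def by (rule add_nonneg_pos) simp_all

theorem newton_program_bounds:
 fixes c :: real and k tA tAT sA sAT :: nat
 assumes set: "newton_setup n m r A b C \<mu> L \<delta> \<chi>1 \<chi>2 X S Xs Ss Us W Q Qp" and k: "1 \<le> k"
  and ct: "real tA \<le> c * real n ^ 3" "real tAT \<le> c * real n ^ 3" "real sA \<le> c * real n ^ 2" "real sAT \<le> c * real n ^ 2"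
 shows "run n A (newton_program n m r k) (alg_input n W Q Qp b C) (n * n + m)
   = alg_output (delta_X A b C W r Q Qp k) (delta_y A b C W r Q Qp k)"
  and "real (run_time tA tAT (newton_program n m r k)) \<le> program_constant c * (real n ^ 3 * real k)"
  and "real (run_storage n m sA sAT (newton_program n m r k) (dim_vec (alg_input n W Q Qp b C)) (n * n + m))
   \<le> program_constant c * real n ^ 2"
proof -
 define F K where "F = real (frame_len + iter_len + 2)" and "K = program_constant c"
 have F: "1 \<le> F" by (simp add: F_def)
 have K: "K = F * (9 + 2 * \<bar>c\<bar>) + 60" by (simp add: K_def F_def program_constant_def)
 interpret augmented n r W Q Qp m A by (rule setup_augmented[OF set])
 have b: "b \<in> carrier_vec m" and C: "C \<in> sym_mats n" using set by (auto simp: newton_setup_def)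
 have mn: "m \<le> n * n" using m_le tri_le[of n] by linarith
 have cc: "c * x \<le> \<bar>c\<bar> * x" if "0 \<le> x" for x by (rule mult_right_mono) (use that in auto)
 show "run n A (newton_program n m r k) (alg_input n W Q Qp b C) (n * n + m)
   = alg_output (delta_X A b C W r Q Qp k) (delta_y A b C W r Q Qp k)"
  by (rule newton_program_correct[OF setup_regular_system[OF set] b C])
 have "real (run_time tA tAT (newton_program n m r k)) \<le> real ((frame_len + iter_len + 2) * k * (9 * n ^ 3 + tA + tAT))"
  using newton_program_time[OF rn mn k, of tA tAT] by (simp only: of_nat_le_iff)
 also have "\<dots> = F * real k * (9 * real n ^ 3 + real tA + real tAT)" by (simp add: F_def distrib_right distrib_left)
 also have "\<dots> \<le> F * real k * ((9 + 2 * \<bar>c\<bar>) * real n ^ 3)"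
 proof (rule mult_left_mono)
  have "9 * real n ^ 3 + real tA + real tAT \<le> 9 * real n ^ 3 + \<bar>c\<bar> * real n ^ 3 + \<bar>c\<bar> * real n ^ 3"
   using ct(1,2) cc[of "real n ^ 3"] by simp
  then show "9 * real n ^ 3 + real tA + real tAT \<le> (9 + 2 * \<bar>c\<bar>) * real n ^ 3" by (simp add: algebra_simps)
 qed (use F in simp)
 also have "\<dots> = F * (9 + 2 * \<bar>c\<bar>) * (real n ^ 3 * real k)" by simp
 also have "\<dots> \<le> K * (real n ^ 3 * real k)" by (rule mult_right_mono) (simp_all add: K)
 finally show "real (run_time tA tAT (newton_program n m r k)) \<le> program_constant c * (real n ^ 3 * real k)" unfolding K_def .
 have Vh: "hcat Q Qp \<in> carrier_mat n n" using VD(1) by (simp add: V_def)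
 have "real (run_storage n m sA sAT (newton_program n m r k) (dim_vec (alg_input n W Q Qp b C)) (n * n + m))
   \<le> real (60 * (n * n) + max sA sAT)"
  unfolding alg_input_entries(1)[OF Vh b sym_matsD(1)[OF C]] of_nat_le_iff by (rule newton_program_storage[OF rn mn])
 also have "\<dots> \<le> (60 + \<bar>c\<bar>) * real n ^ 2"
  using ct(3,4) cc[of "real n ^ 2"] by (simp add: power2_eq_square algebra_simps max_def)
 also have "\<dots> \<le> K * real n ^ 2"
 proof (rule mult_right_mono)
  have "1 * \<bar>c\<bar> \<le> F * (9 + 2 * \<bar>c\<bar>)" using F by (intro mult_mono) auto
  then show "60 + \<bar>c\<bar> \<le> K" by (simp add: K)
 qed simp
 finally show "real (run_storage n m sA sAT (newton_program n m r k) (dim_vec (alg_input n W Q Qp b C)) (n * n + m))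
   \<le> program_constant c * real n ^ 2" unfolding K_def .
qed

theorem corollary3p4:
  shows
    "(\<forall>\<beta>\<ge>(1::real). \<exists>K>(0::real).
        \<forall>n m r A b C \<mu> L \<delta> \<chi>1 \<chi>2 X S Xs Ss Us W Q Qp. \<forall>\<epsilon>>(0::real).
          newton_setup n m r A b C \<mu> L \<delta> \<chi>1 \<chi>2 X S Xs Ss Us W Q Qp \<and> \<mu> \<le> 1 \<and>
          1 / \<beta> \<le> spec_norm A \<and> spec_norm A \<le> \<beta> \<and> vnorm b \<le> \<beta> \<and> vnorm (vecS C) \<le> \<beta>
          \<longrightarrow> (\<exists>k::nat.
                real k \<le> K * (cond (A * A\<^sup>T) * max 1 L ^ 20 * (1 / (1 - \<delta>) ^ 19) * \<chi>1 ^ 2 * \<chi>2 ^ 6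
                            * max 1 (ln (max 1 L ^ 4 / (\<mu> * \<epsilon> * (1 - \<delta>) ^ 4)))) \<and>
                newton_residual A b C W
                  (delta_X A b C W r Q Qp k) (delta_y A b C W r Q Qp k) \<le> \<epsilon>))
     \<and>
     (\<exists>alg :: nat \<Rightarrow> nat \<Rightarrow> nat \<Rightarrow> nat \<Rightarrow> instr list. \<forall>c::real. \<exists>K>(0::real).
        \<forall>n m r A b C \<mu> L \<delta> \<chi>1 \<chi>2 X S Xs Ss Us W Q Qp. \<forall>k\<ge>(1::nat). \<forall>tA tAT sA sAT :: nat.
          newton_setup n m r A b C \<mu> L \<delta> \<chi>1 \<chi>2 X S Xs Ss Us W Q Qp \<and>
          real tA \<le> c * real n ^ 3 \<and> real tAT \<le> c * real n ^ 3 \<and>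
          real sA \<le> c * real n ^ 2 \<and> real sAT \<le> c * real n ^ 2
          \<longrightarrow> run n A (alg n m r k) (alg_input n W Q Qp b C) (n * n + m)
                = alg_output (delta_X A b C W r Q Qp k) (delta_y A b C W r Q Qp k) \<and>
              real (run_time tA tAT (alg n m r k)) \<le> K * (real n ^ 3 * real k) \<and>
              real (run_storage n m sA sAT (alg n m r k)
                     (dim_vec (alg_input n W Q Qp b C)) (n * n + m)) \<le> K * real n ^ 2)"
proof (rule conjI, goal_cases)
  case 1
  show ?case
  proof (intro allI impI, goal_cases)
    case (1 \<beta>)
    show ?case
      by (rule exI[of _ "iteration_constant \<beta>"], intro conjI allI impI)
        (rule iteration_constant_pos[OF 1] | elim conjE, rule iteration_bound[OF 1]; assumption)+
  qed
next
  case 2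
  show ?case
  proof (rule exI[of _ newton_program], rule allI, goal_cases)
    case (1 c)
    show ?case
      by (rule exI[of _ "program_constant c"], intro conjI allI impI)
        (rule program_constant_pos | elim conjE, rule newton_program_bounds; assumption)+
  qed
qed

end
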